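(* Let $X$ be a $0$-definable (in a structure $M$) approximate subring of a ring, $R:=\langle X\rangle$, and $\bar R:=\langle\bar X\rangle$. Then $X$ has a definable locally compact model. More precisely, the quotient map $h\colon R\to\bar R/\bar R^{00}_M$ is the universal definable locally compact model of $X$, and $$U:=\{a/\bar R^{00}_M : a+\bar R^{00}_M\subseteq 4\bar X+\bar X\cdot 4\bar X\}$$ is an open neighborhood of $0/\bar R^{00}_M$ such that $h^{-1}[U]\subseteq 4X+X\cdot 4X$.
   Context: Rings need not be commutative or unital. For subsets $B,C$ of a ring, $B+C=\{b+c\}$, $B\cdot C=BC=\{bc\}$ (the set of products), and $4B:=B+B+B+B$. A subset $X$ of a ring is additively symmetric if $0\in X$ and $-X=X$. $\langle X\rangle$ is the subring generated by $X$. An approximate subring is an additively symmetric subset $X$ of a ring such that $XX\cup(X+X)\subseteq F+X$ for some finite $F\subseteq\langle X\rangle$. Put $X_0:=X$ and $X_{n+1}:=X_nX_n+(X_n+X_n)$; then $\langle X\rangle=\bigcup_n X_n$. $X$ is $0$-definable in a first-order structure $M$ (in a language $\mathcal L$) if all $X_n$, and the restrictions of $+$ and $\cdot$ to each $X_n\times X_n$, are definable in $M$ without parameters. $\mathfrak C\succ M$ is a monster model: $\kappa$-saturated and strongly $\kappa$-homogeneous for a strong limit cardinal $\kappa>|\mathcal L|+|M|$. "Small" and "bounded" mean of cardinality $<\kappa$. $\bar X$, $\bar X_n$ are the interpretations of $X$, $X_n$ in $\mathfrak C$, and $\bar R=\bigcup_n\bar X_n$ is the ring generated by $\bar X$ (with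 operations interpreted in $\mathfrak C$). A set is $A$-type-definable if it is the set of realizations in $\mathfrak C$ of a set of formulas over $A$, and type-definable if it is so over some small $A\subseteq\mathfrak C$ (the empty set is allowed). $\bar R^{00}_M$ is the smallest $M$-type-definable two-sided ideal of $\bar R$ of bounded index (its existence is implicit in the claim). $a/I$ denotes the coset $a+I$. For a type-definable two-sided ideal $I$ of bounded index, $\bar R/I$ carries the logic topology: $F\subseteq\bar R/I$ is closed iff $\pi^{-1}[F]\cap\bar X_m$ is type-definable for every $m\in\omega$, where $\pi\colon\bar R\to\bar R/I$ is the quotient map; this makes $\bar R/I$ a locally compact topological ring. The quotient map $R\to\bar R/I$ is the restriction of $\pi$ to $R$. Locally compact spaces are Hausdorff by definition. A definable locally compact model of $X$ (also: of $R$) is a ring homomorphism $f\colon R\to S$ into a locally compact (topological) ring $S$ such that: $f[X]$ is relatively compact in $S$; there are a neighborhood $U$ of $0$ in $S$ and $m<\omega$ with $f^{-1}[U]\subseteq X_m$; and $f$ is definable, i.e. for every open $U\subseteq S$ and compact $C\subseteq S$ with $C\subseteq U$ there is a definable (in $M$, with parameters) subset $Y$ of $R$ with $f^{-1}[C]\subseteq Y\subseteq f^{-1}[U]$. Such a model $h\colon R\to T$ is universal if for any definable locally compact model $f\colon R\to S$ of $X$ there is a unique continuous homomorphism $g\colon T\to S$ with $f=g\circ h$. *)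

theory Defs
  imports "HOL-Algebra.QuotRing" "HOL-Analysis.Analysis"
begin

section \<open>First-order logic\<close>

text \<open>A language is a set of function symbols and a set of relation symbols, each paired with its
  arity; constants are function symbols of arity 0.\<close>

record ('f, 'p) language =
  fsyms :: "('f \<times> nat) set"
  rsyms :: "('p \<times> nat) set"

datatype 'f fo_term = FVar nat | FApp 'f "'f fo_term list"

datatype ('f, 'p) fo_form =
    FEq "'f fo_term" "'f fo_term"
  | FRel 'p "'f fo_term list"
  | FNeg "('f, 'p) fo_form"
  | FAnd "('f, 'p) fo_form" "('f, 'p) fo_form"
  | FEx nat "('f, 'p) fo_form"

primrec term_in :: "('f, 'p) language \<Rightarrow> 'f fo_term \<Rightarrow> bool" where
  "term_in L (FVar i) \<longleftrightarrow> True"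
| "term_in L (FApp f ts) \<longleftrightarrow> (f, length ts) \<in> fsyms L \<and> list_all (term_in L) ts"

primrec form_in :: "('f, 'p) language \<Rightarrow> ('f, 'p) fo_form \<Rightarrow> bool" where
  "form_in L (FEq s t) \<longleftrightarrow> term_in L s \<and> term_in L t"
| "form_in L (FRel p ts) \<longleftrightarrow> (p, length ts) \<in> rsyms L \<and> list_all (term_in L) ts"
| "form_in L (FNeg \<phi>) \<longleftrightarrow> form_in L \<phi>"
| "form_in L (FAnd \<phi> \<psi>) \<longleftrightarrow> form_in L \<phi> \<and> form_in L \<psi>"
| "form_in L (FEx i \<phi>) \<longleftrightarrow> form_in L \<phi>"

definition formulas :: "('f, 'p) language \<Rightarrow> ('f, 'p) fo_form set" where
  "formulas L = {\<phi>. form_in L \<phi>}"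

primrec fv_term :: "'f fo_term \<Rightarrow> nat set" where
  "fv_term (FVar i) = {i}"
| "fv_term (FApp f ts) = \<Union> (set (map fv_term ts))"

primrec fv :: "('f, 'p) fo_form \<Rightarrow> nat set" where
  "fv (FEq s t) = fv_term s \<union> fv_term t"
| "fv (FRel p ts) = \<Union> (set (map fv_term ts))"
| "fv (FNeg \<phi>) = fv \<phi>"
| "fv (FAnd \<phi> \<psi>) = fv \<phi> \<union> fv \<psi>"
| "fv (FEx i \<phi>) = fv \<phi> - {i}"

record ('f, 'p, 'a) struct =
  universe :: "'a set"
  fun_of :: "'f \<Rightarrow> 'a list \<Rightarrow> 'a"
  rel_of :: "'p \<Rightarrow> 'a list \<Rightarrow> bool"

definition is_struct :: "('f, 'p) language \<Rightarrow> ('f, 'p, 'a) struct \<Rightarrow> bool" where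
  "is_struct L M \<longleftrightarrow> universe M \<noteq> {} \<and>
     (\<forall>f xs. (f, length xs) \<in> fsyms L \<and> set xs \<subseteq> universe M \<longrightarrow> fun_of M f xs \<in> universe M)"

primrec eval_term :: "('f, 'p, 'a) struct \<Rightarrow> (nat \<Rightarrow> 'a) \<Rightarrow> 'f fo_term \<Rightarrow> 'a" where
  "eval_term M e (FVar i) = e i"
| "eval_term M e (FApp f ts) = fun_of M f (map (eval_term M e) ts)"

primrec sat :: "('f, 'p, 'a) struct \<Rightarrow> (nat \<Rightarrow> 'a) \<Rightarrow> ('f, 'p) fo_form \<Rightarrow> bool" where
  "sat M e (FEq s t) \<longleftrightarrow> eval_term M e s = eval_term M e t"
| "sat M e (FRel p ts) \<longleftrightarrow> rel_of M p (map (eval_term M e) ts)"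
| "sat M e (FNeg \<phi>) \<longleftrightarrow> \<not> sat M e \<phi>"
| "sat M e (FAnd \<phi> \<psi>) \<longleftrightarrow> sat M e \<phi> \<and> sat M e \<psi>"
| "sat M e (FEx i \<phi>) \<longleftrightarrow> (\<exists>a\<in>universe M. sat M (e(i := a)) \<phi>)"

definition elem_substruct ::
    "('f, 'p) language \<Rightarrow> ('f, 'p, 'a) struct \<Rightarrow> ('f, 'p, 'a) struct \<Rightarrow> bool" where
  "elem_substruct L M N \<longleftrightarrow> is_struct L M \<and> is_struct L N \<and> universe M \<subseteq> universe N \<and>
     (\<forall>f xs. (f, length xs) \<in> fsyms L \<and> set xs \<subseteq> universe M \<longrightarrow> fun_of M f xs = fun_of N f xs) \<and>
     (\<forall>p xs. (p, length xs) \<in> rsyms L \<and> set xs \<subseteq> universe M \<longrightarrow> rel_of M p xs = rel_of N p xs) \<and>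
     (\<forall>\<phi>\<in>formulas L. \<forall>e. range e \<subseteq> universe M \<longrightarrow> sat M e \<phi> = sat N e \<phi>)"

section \<open>Definable and type-definable sets\<close>

text \<open>Elements of the \<open>k\<close>-th Cartesian power are lists of length \<open>k\<close>. A formula over \<open>A\<close> in \<open>k\<close> free
  variables is a pair \<open>(\<phi>, ps)\<close>: the variables below \<open>k\<close> are the free ones, and the following
  \<open>length ps\<close> variables are replaced by the parameters \<open>ps\<close>.\<close>

definition tuples :: "nat \<Rightarrow> 'a set \<Rightarrow> 'a list set" where
  "tuples k A = {xs. length xs = k \<and> set xs \<subseteq> A}"

definition formulas_over ::
    "('f, 'p) language \<Rightarrow> nat \<Rightarrow> 'a set \<Rightarrow> (('f, 'p) fo_form \<times> 'a list) set" where
  "formulas_over L k A =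
     {(\<phi>, ps). \<phi> \<in> formulas L \<and> set ps \<subseteq> A \<and> fv \<phi> \<subseteq> {..<k + length ps}}"

definition realizations ::
    "('f, 'p, 'a) struct \<Rightarrow> nat \<Rightarrow> (('f, 'p) fo_form \<times> 'a list) set \<Rightarrow> 'a list set" where
  "realizations M k \<Sigma> =
     {xs \<in> tuples k (universe M). \<forall>(\<phi>, ps)\<in>\<Sigma>. sat M (\<lambda>i. (xs @ ps) ! i) \<phi>}"

definition definable_over ::
    "('f, 'p) language \<Rightarrow> ('f, 'p, 'a) struct \<Rightarrow> nat \<Rightarrow> 'a set \<Rightarrow> 'a list set \<Rightarrow> bool" where
  "definable_over L M k A D \<longleftrightarrow> (\<exists>\<phi>\<in>formulas_over L k A. D = realizations M k {\<phi>})"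

definition type_definable_over ::
    "('f, 'p) language \<Rightarrow> ('f, 'p, 'a) struct \<Rightarrow> nat \<Rightarrow> 'a set \<Rightarrow> 'a list set \<Rightarrow> bool" where
  "type_definable_over L M k A D \<longleftrightarrow> (\<exists>\<Sigma>\<subseteq>formulas_over L k A. D = realizations M k \<Sigma>)"

text \<open>The interpretation in the elementary extension \<open>C\<close> of a \<open>0\<close>-definable set \<open>D\<close> of \<open>M\<close>; by
  elementarity it does not depend on the formula that defines \<open>D\<close>.\<close>

definition interp_in :: "('f, 'p) language \<Rightarrow> ('f, 'p, 'a) struct \<Rightarrow> ('f, 'p, 'a) struct \<Rightarrow>
    nat \<Rightarrow> 'a list set \<Rightarrow> 'a list set" where
  "interp_in L M C k D = (THE D'. \<exists>\<phi>\<in>formulas_over L k {}.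
     D = realizations M k {\<phi>} \<and> D' = realizations C k {\<phi>})"

section \<open>Monster models\<close>

context includes cardinal_syntax
begin

definition strong_limit :: "'k rel \<Rightarrow> bool" where
  "strong_limit \<kappa> \<longleftrightarrow> Card_order \<kappa> \<and> cinfinite \<kappa> \<and>
     (\<forall>B\<subseteq>Field \<kappa>. |B| <o \<kappa> \<longrightarrow> |Pow B| <o \<kappa>)"

definition saturated :: "('f, 'p) language \<Rightarrow> 'k rel \<Rightarrow> ('f, 'p, 'a) struct \<Rightarrow> bool" where
  "saturated L \<kappa> C \<longleftrightarrow> (\<forall>A k. \<forall>\<Sigma>\<subseteq>formulas_over L k A.
     A \<subseteq> universe C \<and> |A| <o \<kappa> \<and> (\<forall>\<Sigma>0\<subseteq>\<Sigma>. finite \<Sigma>0 \<longrightarrow> realizations C k \<Sigma>0 \<noteq> {}) \<longrightarrow>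
     realizations C k \<Sigma> \<noteq> {})"

definition elem_map_on ::
    "('f, 'p) language \<Rightarrow> ('f, 'p, 'a) struct \<Rightarrow> 'a set \<Rightarrow> ('a \<Rightarrow> 'a) \<Rightarrow> bool" where
  "elem_map_on L C A f \<longleftrightarrow> f ` A \<subseteq> universe C \<and>
     (\<forall>\<phi>\<in>formulas L. \<forall>e. e ` fv \<phi> \<subseteq> A \<longrightarrow> sat C e \<phi> = sat C (f \<circ> e) \<phi>)"

definition automorphism ::
    "('f, 'p) language \<Rightarrow> ('f, 'p, 'a) struct \<Rightarrow> ('a \<Rightarrow> 'a) \<Rightarrow> bool" where
  "automorphism L C \<sigma> \<longleftrightarrow> bij_betw \<sigma> (universe C) (universe C) \<and>
     (\<forall>f xs. (f, length xs) \<in> fsyms L \<and> set xs \<subseteq> universe C \<longrightarrow>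
        \<sigma> (fun_of C f xs) = fun_of C f (map \<sigma> xs)) \<and>
     (\<forall>p xs. (p, length xs) \<in> rsyms L \<and> set xs \<subseteq> universe C \<longrightarrow>
        rel_of C p xs = rel_of C p (map \<sigma> xs))"

definition strongly_homogeneous ::
    "('f, 'p) language \<Rightarrow> 'k rel \<Rightarrow> ('f, 'p, 'a) struct \<Rightarrow> bool" where
  "strongly_homogeneous L \<kappa> C \<longleftrightarrow> (\<forall>A\<subseteq>universe C. \<forall>f. |A| <o \<kappa> \<and> elem_map_on L C A f \<longrightarrow>
     (\<exists>\<sigma>. automorphism L C \<sigma> \<and> (\<forall>a\<in>A. \<sigma> a = f a)))"

text \<open>As usual in model theory, the cardinality of a language is the number of its formulas; in
  particular it is infinite.\<close>

definition monster_model :: "('f, 'p) language \<Rightarrow> ('f, 'p, 'a) struct \<Rightarrow> 'k rel \<Rightarrow>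
    ('f, 'p, 'a) struct \<Rightarrow> bool" where
  "monster_model L M \<kappa> C \<longleftrightarrow> elem_substruct L M C \<and>
     strong_limit \<kappa> \<and> |formulas L| +c |universe M| <o \<kappa> \<and>
     saturated L \<kappa> C \<and> strongly_homogeneous L \<kappa> C"

definition type_definable :: "('f, 'p) language \<Rightarrow> 'k rel \<Rightarrow> ('f, 'p, 'a) struct \<Rightarrow> nat \<Rightarrow>
    'a list set \<Rightarrow> bool" where
  "type_definable L \<kappa> C k D \<longleftrightarrow>
     (\<exists>A\<subseteq>universe C. |A| <o \<kappa> \<and> type_definable_over L C k A D)"

end

section \<open>Rings that need not be unital or commutative\<close>

text \<open>These reuse the records and the coset constructions of \<open>HOL-Algebra\<close>; the field \<open>one\<close> of a
  ring record is never constrained.\<close>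

locale rng = abelian_group R for R (structure) +
  assumes rng_m_closed: "\<lbrakk>x \<in> carrier R; y \<in> carrier R\<rbrakk> \<Longrightarrow> x \<otimes> y \<in> carrier R"
    and rng_m_assoc: "\<lbrakk>x \<in> carrier R; y \<in> carrier R; z \<in> carrier R\<rbrakk> \<Longrightarrow>
      (x \<otimes> y) \<otimes> z = x \<otimes> (y \<otimes> z)"
    and rng_l_distr: "\<lbrakk>x \<in> carrier R; y \<in> carrier R; z \<in> carrier R\<rbrakk> \<Longrightarrow>
      (x \<oplus> y) \<otimes> z = x \<otimes> z \<oplus> y \<otimes> z"
    and rng_r_distr: "\<lbrakk>x \<in> carrier R; y \<in> carrier R; z \<in> carrier R\<rbrakk> \<Longrightarrow>
      z \<otimes> (x \<oplus> y) = z \<otimes> x \<oplus> z \<otimes> y"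

definition rng_hom :: "('a, 'm) ring_scheme \<Rightarrow> ('b, 'n) ring_scheme \<Rightarrow> ('a \<Rightarrow> 'b) set" where
  "rng_hom R S = {f \<in> carrier R \<rightarrow> carrier S. \<forall>x\<in>carrier R. \<forall>y\<in>carrier R.
     f (x \<oplus>\<^bsub>R\<^esub> y) = f x \<oplus>\<^bsub>S\<^esub> f y \<and> f (x \<otimes>\<^bsub>R\<^esub> y) = f x \<otimes>\<^bsub>S\<^esub> f y}"

definition two_sided_ideal :: "'a set \<Rightarrow> ('a, 'm) ring_scheme \<Rightarrow> bool" where
  "two_sided_ideal I R \<longleftrightarrow> additive_subgroup I R \<and>
     (\<forall>a\<in>I. \<forall>x\<in>carrier R. x \<otimes>\<^bsub>R\<^esub> a \<in> I \<and> a \<otimes>\<^bsub>R\<^esub> x \<in> I)"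

definition subrng :: "'a set \<Rightarrow> ('a, 'm) ring_scheme \<Rightarrow> bool" where
  "subrng H R \<longleftrightarrow> additive_subgroup H R \<and> (\<forall>x\<in>H. \<forall>y\<in>H. x \<otimes>\<^bsub>R\<^esub> y \<in> H)"

definition generated_subrng :: "('a, 'm) ring_scheme \<Rightarrow> 'a set \<Rightarrow> 'a set" where
  "generated_subrng R X = \<Inter> {H. subrng H R \<and> X \<subseteq> H}"

definition additively_symmetric :: "('a, 'm) ring_scheme \<Rightarrow> 'a set \<Rightarrow> bool" where
  "additively_symmetric R X \<longleftrightarrow> X \<subseteq> carrier R \<and> \<zero>\<^bsub>R\<^esub> \<in> X \<and> (\<lambda>x. \<ominus>\<^bsub>R\<^esub> x) ` X = X"

definition approximate_subring :: "('a, 'm) ring_scheme \<Rightarrow> 'a set \<Rightarrow> bool" where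
  "approximate_subring R X \<longleftrightarrow> additively_symmetric R X \<and>
     (\<exists>F. finite F \<and> F \<subseteq> generated_subrng R X \<and>
        (X <#>\<^bsub>R\<^esub> X) \<union> (X <+>\<^bsub>R\<^esub> X) \<subseteq> F <+>\<^bsub>R\<^esub> X)"

text \<open>For additively symmetric \<open>X\<close> these sets increase to the subring generated by \<open>X\<close>.\<close>

primrec level :: "('a, 'm) ring_scheme \<Rightarrow> 'a set \<Rightarrow> nat \<Rightarrow> 'a set" where
  "level R X 0 = X"
| "level R X (Suc n) =
     (level R X n <#>\<^bsub>R\<^esub> level R X n) <+>\<^bsub>R\<^esub> (level R X n <+>\<^bsub>R\<^esub> level R X n)"

definition four :: "('a, 'm) ring_scheme \<Rightarrow> 'a set \<Rightarrow> 'a set" where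
  "four R X = X <+>\<^bsub>R\<^esub> X <+>\<^bsub>R\<^esub> X <+>\<^bsub>R\<^esub> X"

definition four_plus_mult_four :: "('a, 'm) ring_scheme \<Rightarrow> 'a set \<Rightarrow> 'a set" where
  "four_plus_mult_four R X = four R X <+>\<^bsub>R\<^esub> (X <#>\<^bsub>R\<^esub> four R X)"

section \<open>Definable approximate subrings and their interpretation in the monster model\<close>

text \<open>A subset of the \<open>k\<close>-th power of \<open>M\<close> is a set of lists, so the ambient ring has elements of
  type \<open>'a list\<close>; nothing is assumed of its elements outside of the subring generated by \<open>X\<close>.
  Graphs of binary operations are sets of concatenated triples of \<open>k\<close>-tuples.\<close>

definition add_graph :: "('a list, 'm) ring_scheme \<Rightarrow> 'a list set \<Rightarrow> 'a list set" where
  "add_graph R Y = (\<lambda>(x, y). x @ y @ (x \<oplus>\<^bsub>R\<^esub> y)) ` (Y \<times> Y)"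

definition mult_graph :: "('a list, 'm) ring_scheme \<Rightarrow> 'a list set \<Rightarrow> 'a list set" where
  "mult_graph R Y = (\<lambda>(x, y). x @ y @ (x \<otimes>\<^bsub>R\<^esub> y)) ` (Y \<times> Y)"

definition zero_definable :: "('f, 'p) language \<Rightarrow> ('f, 'p, 'a) struct \<Rightarrow> nat \<Rightarrow>
    ('a list, 'm) ring_scheme \<Rightarrow> 'a list set \<Rightarrow> bool" where
  "zero_definable L M k R X \<longleftrightarrow> (\<forall>n.
     definable_over L M k {} (level R X n) \<and>
     definable_over L M (3 * k) {} (add_graph R (level R X n)) \<and>
     definable_over L M (3 * k) {} (mult_graph R (level R X n)))"

definition level_bar :: "('f, 'p) language \<Rightarrow> ('f, 'p, 'a) struct \<Rightarrow> ('f, 'p, 'a) struct \<Rightarrow>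
    nat \<Rightarrow> ('a list, 'm) ring_scheme \<Rightarrow> 'a list set \<Rightarrow> nat \<Rightarrow> 'a list set" where
  "level_bar L M C k R X n = interp_in L M C k (level R X n)"

definition ring_bar :: "('f, 'p) language \<Rightarrow> ('f, 'p, 'a) struct \<Rightarrow> ('f, 'p, 'a) struct \<Rightarrow>
    nat \<Rightarrow> ('a list, 'm) ring_scheme \<Rightarrow> 'a list set \<Rightarrow> 'a list ring" where
  "ring_bar L M C k R X =
     \<lparr>partial_object.carrier = (\<Union>n. level_bar L M C k R X n),
      monoid.mult = (\<lambda>x y. THE z. \<exists>n. x @ y @ z \<in> interp_in L M C (3 * k) (mult_graph R (level R X n))),
      monoid.one = undefined,
      ring.zero = \<zero>\<^bsub>R\<^esub>,
      ring.add = (\<lambda>x y. THE z. \<exists>n. x @ y @ z \<in> interp_in L M C (3 * k) (add_graph R (level R X n)))\<rparr>"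

section \<open>The ideal \<open>00\<close> and the logic topology\<close>

context includes cardinal_syntax
begin

definition bounded_index :: "'k rel \<Rightarrow> ('a, 'm) ring_scheme \<Rightarrow> 'a set \<Rightarrow> bool" where
  "bounded_index \<kappa> R I \<longleftrightarrow> |a_rcosets\<^bsub>R\<^esub> I| <o \<kappa>"

end

text \<open>In the next two definitions \<open>S\<close> is a ring whose elements are \<open>k\<close>-tuples of \<open>C\<close>.\<close>

definition is_tdef_bounded_ideal :: "('f, 'p) language \<Rightarrow> ('f, 'p, 'a) struct \<Rightarrow> 'k rel \<Rightarrow>
    ('f, 'p, 'a) struct \<Rightarrow> nat \<Rightarrow> ('a list, 'm) ring_scheme \<Rightarrow> 'a list set \<Rightarrow> bool" where
  "is_tdef_bounded_ideal L M \<kappa> C k S I \<longleftrightarrow>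
     two_sided_ideal I S \<and> type_definable_over L C k (universe M) I \<and> bounded_index \<kappa> S I"

text \<open>This is the smallest such ideal as soon as it is itself such an ideal.\<close>

definition ideal00 :: "('f, 'p) language \<Rightarrow> ('f, 'p, 'a) struct \<Rightarrow> 'k rel \<Rightarrow>
    ('f, 'p, 'a) struct \<Rightarrow> nat \<Rightarrow> ('a list, 'm) ring_scheme \<Rightarrow> 'a list set" where
  "ideal00 L M \<kappa> C k S = \<Inter> {I. is_tdef_bounded_ideal L M \<kappa> C k S I}"

text \<open>\<open>S\<close> is filtered by the sets \<open>Y m\<close>; the complements of the sets \<open>V\<close> below are the closed
  sets.\<close>

definition logic_topology :: "('f, 'p) language \<Rightarrow> 'k rel \<Rightarrow> ('f, 'p, 'a) struct \<Rightarrow> nat \<Rightarrow>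
    (nat \<Rightarrow> 'a list set) \<Rightarrow> ('a list, 'm) ring_scheme \<Rightarrow> 'a list set \<Rightarrow> 'a list set topology" where
  "logic_topology L \<kappa> C k Y S I = topology (\<lambda>V. V \<subseteq> carrier (S Quot I) \<and>
     (\<forall>m. type_definable L \<kappa> C k
        ({a \<in> carrier S. I +>\<^bsub>S\<^esub> a \<in> carrier (S Quot I) - V} \<inter> Y m)))"

section \<open>Definable locally compact models\<close>

definition locally_compact_ring :: "('s, 'm) ring_scheme \<Rightarrow> 's topology \<Rightarrow> bool" where
  "locally_compact_ring S \<tau> \<longleftrightarrow> rng S \<and> topspace \<tau> = carrier S \<and>
     continuous_map (prod_topology \<tau> \<tau>) \<tau> (\<lambda>(x, y). x \<oplus>\<^bsub>S\<^esub> y) \<and>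
     continuous_map \<tau> \<tau> (\<lambda>x. \<ominus>\<^bsub>S\<^esub> x) \<and>
     continuous_map (prod_topology \<tau> \<tau>) \<tau> (\<lambda>(x, y). x \<otimes>\<^bsub>S\<^esub> y) \<and>
     Hausdorff_space \<tau> \<and> locally_compact_space \<tau>"

text \<open>Here \<open>A\<close> is the ambient ring and \<open>R\<close> the subring generated by \<open>X\<close>.\<close>

definition definable_lc_model :: "('f, 'p) language \<Rightarrow> ('f, 'p, 'a) struct \<Rightarrow> nat \<Rightarrow>
    ('a list, 'm) ring_scheme \<Rightarrow> 'a list set \<Rightarrow>
    ('s, 'n) ring_scheme \<Rightarrow> 's topology \<Rightarrow> ('a list \<Rightarrow> 's) \<Rightarrow> bool" where
  "definable_lc_model L M k A X S \<tau> f \<longleftrightarrow>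
     (let R = generated_subrng A X in
      locally_compact_ring S \<tau> \<and>
      f \<in> rng_hom (A\<lparr>carrier := R\<rparr>) S \<and>
      compactin \<tau> (\<tau> closure_of (f ` X)) \<and>
      (\<exists>U V m. openin \<tau> V \<and> \<zero>\<^bsub>S\<^esub> \<in> V \<and> V \<subseteq> U \<and> U \<subseteq> carrier S \<and>
         {a \<in> R. f a \<in> U} \<subseteq> level A X m) \<and>
      (\<forall>U K. openin \<tau> U \<and> compactin \<tau> K \<and> K \<subseteq> U \<longrightarrow>
         (\<exists>Y\<subseteq>R. definable_over L M k (universe M) Y \<and>
            {a \<in> R. f a \<in> K} \<subseteq> Y \<and> Y \<subseteq> {a \<in> R. f a \<in> U})))"

text \<open>Universality with respect to the models in rings over the type \<open>'s\<close>, which is arbitrary.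
  Maps on \<open>T\<close> are made unique as functions by requiring them to be extensional.\<close>

definition universal_definable_lc_model :: "'s itself \<Rightarrow> ('f, 'p) language \<Rightarrow>
    ('f, 'p, 'a) struct \<Rightarrow> nat \<Rightarrow> ('a list, 'm) ring_scheme \<Rightarrow> 'a list set \<Rightarrow>
    't ring \<Rightarrow> 't topology \<Rightarrow> ('a list \<Rightarrow> 't) \<Rightarrow> bool" where
  "universal_definable_lc_model ty L M k A X T \<tau> h \<longleftrightarrow>
     definable_lc_model L M k A X T \<tau> h \<and>
     (\<forall>(S :: 's ring) \<sigma> f. definable_lc_model L M k A X S \<sigma> f \<longrightarrow>
        (\<exists>!g. g \<in> extensional (carrier T) \<and> g \<in> rng_hom T S \<and> continuous_map \<tau> \<sigma> g \<and>
           (\<forall>a\<in>generated_subrng A X. f a = g (h a))))"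

end

theory Submission
  imports Defs "HOL-Real_Asymp.Real_Asymp" "HOL-Library.Nat_Bijection"
begin

text \<open>
  The theorem has an additive and a multiplicative half, and both are reduced to statements about
  sets that are definable over \<open>M\<close>.

  Additively, let \<open>H\<close> be the smallest subgroup of \<open>(Rbar, +)\<close> that is type-definable over \<open>M\<close> and has
  bounded index. The point is that \<open>H \<subseteq> 4 Xbar\<close>. By compactness this needs a sequence
  of \<open>M\<close>-definable symmetric generic sets \<open>S 0 = Xbar, S 1, ...\<close> with \<open>8 S (i+1) \<subseteq> 4 S i\<close>
  (\<open>ex_base_chain\<close>). Such sets come from the argument of Massicot and Wagner, in
  which an invariant measure measures the sets \<open>B \<inter> (g + B)\<close>. No definable measure is available, so
  the measure is replaced by two families of inequalities: a function \<open>\<phi>\<close> is at most \<open>r\<close> if some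
  \<open>n\<close> translates of \<open>\<phi>\<close> are dominated by \<open>r n\<close> translates of the indicator of \<open>X\<close> (\<open>up\<close>), and at
  least \<open>r\<close> if the opposite holds (\<open>lo\<close>). Averaging over boxes in the abelian group
  makes these bounds translation invariant and additive, and the polynomial growth of boxes makes
  them consistent (\<open>lo_le_up\<close>). For a bounded number of translates the inequality is first-order,
  hence the set of \<open>g\<close> such that \<open>B \<inter> (g + B)\<close> is not small is definable. If \<open>B\<close> is chosen such that
  \<open>B + X\<close> is almost as large as \<open>lo\<close>-bounds permit, then eight elements of this set add up to an
  element of \<open>4 X\<close> (\<open>ex_good_kernel\<close>).

  Multiplicatively, \<open>J = H + Rbar H\<close> (the set of all \<open>h + r h'\<close>) is an ideal. The elements of
  \<open>R\<close> map \<open>H\<close> into itself, since the preimage of \<open>H\<close> under the multiplication by such an element is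
  type-definable over \<open>M\<close> of bounded index. Hence a coheir of the type of \<open>(r', h')\<close> over \<open>M\<close> can be
  realized by \<open>(y, z)\<close> with \<open>y w \<in> H\<close> for given \<open>w \<in> H\<close>. A coheir sequence of such pairs and the
  pigeonhole principle give in addition \<open>x \<in> H\<close> with \<open>r (z - x) \<in> H\<close> and \<open>y x \<in> H\<close>
  (\<open>pair_in_fiber\<close>), and then \<open>r h + r' h'\<close> equals \<open>(r + y) (h + z - x)\<close> up to \<open>H\<close> (\<open>RH_add\<close>). So
  \<open>J\<close> is closed under addition. As \<open>Rbar = R + Xbar\<close>, even \<open>J = H + Xbar H\<close>, which is
  type-definable and contained in \<open>4 Xbar + Xbar (4 Xbar)\<close>. Every bounded type-definable ideal contains
  \<open>H\<close> and therefore \<open>J\<close>.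

  The logic topology on \<open>Rbar / J\<close> has the cosets \<open>a + D\<close>, for \<open>D \<supseteq> J\<close> definable over \<open>M\<close>, as a base of
  neighbourhoods (\<open>opn_iff\<close>), and \<open>R\<close> is dense in it. So continuity, local compactness and definability of the
  quotient map are consequences of saturation. Given any model \<open>f : R \<rightarrow> S\<close>,
  the definable sets that contain the preimage of a neighbourhood of \<open>0\<close> intersect in a
  type-definable ideal of bounded index, which contains \<open>J\<close> (\<open>J_sub_\<E>\<close>). This is the uniform continuity of \<open>f\<close> with
  respect to the topology that \<open>Rbar / J\<close> induces on \<open>R\<close>, so \<open>f\<close> extends to \<open>Rbar / J\<close> by
  limits, which exist because \<open>f\<close> maps every level into a compact set.
\<close>

section \<open>Convolutions with finite families\<close>

context abelian_group
begin

text \<open>A list \<open>E\<close> acts on functions as the measure that counts its entries; repeated entries count repeatedly,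
  so that comparing two lists amounts to comparing measures with rational weights.\<close>

definition conv :: "'a list => ('a => real) => 'a => real" where
 "conv E \<phi> u = (\<Sum>e\<leftarrow>E. \<phi> (u \<oplus> e))"

definition list_sum :: "'a list => 'a list => 'a list" where
 "list_sum E F = concat (map (%e. map (%f. e \<oplus> f) F) E)"

lemma conv_Nil [simp]: "conv [] \<phi> u = 0"
 by (simp add: conv_def)

lemma conv_Cons [simp]: "conv (e # E) \<phi> u = \<phi> (u \<oplus> e) + conv E \<phi> u"
 by (simp add: conv_def)

lemma conv_append [simp]: "conv (E @ F) \<phi> u = conv E \<phi> u + conv F \<phi> u"
 by (simp add: conv_def)

lemma list_sum_Nil [simp]: "list_sum [] F = []"
 by (simp add: list_sum_def)

lemma list_sum_Cons [simp]: "list_sum (e # E) F = map (%f. e \<oplus> f) F @ list_sum E F"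
 by (simp add: list_sum_def)

lemma length_list_sum [simp]: "length (list_sum E F) = length E * length F"
 by (induction E) auto

lemma set_list_sum: "set (list_sum E F) = (%(e, f). e \<oplus> f) ` (set E \<times> set F)"
 by (induction E) auto

lemma set_list_sum_carrier:
 "set E <= carrier G ==> set F <= carrier G ==> set (list_sum E F) <= carrier G"
 by (auto simp: set_list_sum)

lemma list_sum_eq_Nil [simp]: "list_sum E F = [] \<longleftrightarrow> E = [] \<or> F = []"
 by (metis length_0_conv length_list_sum mult_eq_0_iff)

lemma conv_translate:
 assumes "set E <= carrier G" "u \<in> carrier G" "e \<in> carrier G"
 shows "conv (map (%f. e \<oplus> f) E) \<phi> u = conv E \<phi> (u \<oplus> e)"
 using assms by (induction E) (auto simp: a_assoc)

lemma conv_list_sum: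
 assumes "set E <= carrier G" "set F <= carrier G" "u \<in> carrier G"
 shows "conv (list_sum E F) \<phi> u = conv E (conv F \<phi>) u"
 using assms by (induction E) (auto simp: conv_translate)

lemma conv_add: "conv E (%u. \<phi> u + \<psi> u) u = conv E \<phi> u + conv E \<psi> u"
 by (induction E) auto

lemma conv_commute:
 assumes "set E <= carrier G" "set F <= carrier G" "u \<in> carrier G"
 shows "conv E (conv F \<phi>) u = conv F (conv E \<phi>) u"
 using assms
proof (induction E)
 case Nil
 then show ?case by (simp add: conv_def)
next
 case (Cons e E)
 have "conv F (conv (e # E) \<phi>) u = conv F (%w. \<phi> (w \<oplus> e)) u + conv F (conv E \<phi>) u"
  by (simp add: conv_Cons[abs_def] conv_add)
 also have "conv F (%w. \<phi> (w \<oplus> e)) u = conv F \<phi> (u \<oplus> e)"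
  unfolding conv_def using Cons.prems
  by (intro arg_cong[where f = sum_list] map_cong) (auto intro!: arg_cong[where f = \<phi>] simp: a_ac)
 finally show ?case using Cons by simp
qed

lemma conv_mono:
 assumes "set E <= carrier G" "u \<in> carrier G" "!!w. w \<in> carrier G ==> \<phi> w <= \<psi> w"
 shows "conv E \<phi> u <= conv E \<psi> u"
 using assms by (induction E) (auto intro: add_mono)

lemma conv_nonneg:
 assumes "set E <= carrier G" "u \<in> carrier G" "!!w. w \<in> carrier G ==> 0 <= \<phi> w"
 shows "0 <= conv E \<phi> u"
 using assms by (induction E) auto

lemma conv_cong:
 assumes "set E <= carrier G" "u \<in> carrier G" "!!w. w \<in> carrier G ==> \<phi> w = \<psi> w"
 shows "conv E \<phi> u = conv E \<psi> u"
 using assms by (induction E) auto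

primrec list_pow :: "'a list => nat => 'a list" where
 "list_pow E 0 = [\<zero>]"
| "list_pow E (Suc n) = list_sum E (list_pow E n)"

lemma length_list_pow [simp]: "length (list_pow E n) = length E ^ n"
 by (induction n) auto

lemma set_list_pow_carrier: "set E <= carrier G ==> set (list_pow E n) <= carrier G"
 by (induction n) (use set_list_sum_carrier in auto)

text \<open>The sums of elements of a finite set with \<open>n\<close> summands all lie in a box whose size is polynomial in
  \<open>n\<close>. Here commutativity of addition enters the comparison of lists.\<close>

primrec small_combs :: "nat => 'a list => 'a set" where
 "small_combs n [] = {\<zero>}"
| "small_combs n (e # E) = (%(c, x). add_pow G (c::nat) e \<oplus> x) ` ({..n} \<times> small_combs n E)"

lemma finite_small_combs: "finite (small_combs n E)"
 by (induction E) auto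

lemma card_small_combs: "card (small_combs n E) <= (n + 1) ^ length E"
proof (induction E)
 case (Cons e E)
 have "card (small_combs n (e # E)) <= card ({..n} \<times> small_combs n E)"
  unfolding small_combs.simps by (intro card_image_le) (simp add: finite_small_combs)
 also have "\<dots> = (n + 1) * card (small_combs n E)"
  by (simp add: card_cartesian_product)
 also have "\<dots> <= (n + 1) * (n + 1) ^ length E"
  using Cons by (intro mult_le_mono2)
 finally show ?case by simp
qed auto

lemma small_combs_carrier: "set E <= carrier G ==> small_combs n E <= carrier G"
 by (induction E) auto

lemma small_combs_mono: "small_combs n E <= small_combs (Suc n) E"
 by (induction E) force+

lemma small_combs_step:
 assumes "set E <= carrier G" "e \<in> set E" "x \<in> small_combs n E"
 shows "e \<oplus> x \<in> small_combs (Suc n) E"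
 using assms
proof (induction E arbitrary: x)
 case (Cons d E)
 then obtain c y where x: "x = add_pow G (c::nat) d \<oplus> y" "c <= n" "y \<in> small_combs n E" by auto
 have y: "y \<in> carrier G" using x Cons.prems small_combs_carrier[of E n] by auto
 show ?case
 proof (cases "e = d")
  case True
  have "e \<oplus> x = add_pow G (Suc c) d \<oplus> y"
   using True x y Cons.prems by (simp add: a_ac)
  moreover have "y \<in> small_combs (Suc n) E" using x small_combs_mono by blast
  ultimately show ?thesis using x by force
 next
  case False
  then have e: "e \<in> set E" using Cons.prems by auto
  have "e \<oplus> x = add_pow G c d \<oplus> (e \<oplus> y)"
   using e x y Cons.prems by (auto simp: a_ac)
  moreover have "e \<oplus> y \<in> small_combs (Suc n) E" using Cons.IH[of y] e x Cons.prems by auto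
  ultimately show ?thesis using x by force
 qed
qed auto

lemma zero_in_small_combs: "set E <= carrier G ==> \<zero> \<in> small_combs n E"
proof (induction E)
 case (Cons d E)
 have "\<zero> = add_pow G (0::nat) d \<oplus> \<zero>" by simp
 then show ?case using Cons by force
qed auto

lemma set_list_pow_subset: "set E <= carrier G ==> set (list_pow E n) <= small_combs n E"
proof (induction n)
 case (Suc n)
 then show ?case by (auto simp: set_list_sum intro: small_combs_step)
qed (auto simp: zero_in_small_combs)

text \<open>Taking powers removes polynomial factors: this upgrades a bound that holds up to such a factor to the
  sharp one.\<close>

lemma exponential_beats_polynomial:
 fixes a b d :: nat
 assumes "!!n. a ^ n <= (n + 1) ^ d * b ^ n"
 shows "a <= b"
proof (rule ccontr)
 assume "\<not> a <= b"
 then have ab: "b < a" by simp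
 define q where "q = real b / real a"
 have q: "0 <= q" "q < 1" using ab by (auto simp: q_def)
 have le: "1 <= real (n + 1) ^ d * q ^ n" for n
 proof -
  have "real a ^ n <= real (n + 1) ^ d * real b ^ n"
   using assms[of n] by (metis (mono_tags) of_nat_le_iff of_nat_mult of_nat_power)
  then show ?thesis using ab by (simp add: q_def power_divide field_simps)
 qed
 have "(%n. real (n + 1) ^ d * q ^ n) \<longlonglongrightarrow> 0"
 proof (cases "q = 0")
  case True
  have "eventually (%n. real (n + 1) ^ d * q ^ n = 0) sequentially"
   using eventually_gt_at_top[of 0] by eventually_elim (simp add: True)
  then show ?thesis by (rule tendsto_eventually)
 next
  case False
  define l where "l = - ln q"
  have l: "0 < l" using q False by (simp add: l_def)
  have "(%n. (real n * l) ^ d / exp (real n * l)) \<longlonglongrightarrow> 0"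
   by (rule filterlim_compose[OF tendsto_power_div_exp_0]) (use l in real_asymp)
  then have "(%n. inverse (l ^ d) * ((real n * l) ^ d / exp (real n * l))) \<longlonglongrightarrow> inverse (l ^ d) * 0"
   by (rule tendsto_mult_left)
  moreover have "exp (real n * l) = inverse (q ^ n)" for n
   using q False by (simp add: l_def exp_minus exp_of_nat_mult)
  ultimately have "(%n. real n ^ d * q ^ n) \<longlonglongrightarrow> 0"
   using l by (simp add: power_mult_distrib field_simps)
  then have "(%n. real (Suc n) ^ d * q ^ Suc n) \<longlonglongrightarrow> 0"
   by (rule LIMSEQ_Suc)
  then have "(%n. inverse q * (real (Suc n) ^ d * q ^ Suc n)) \<longlonglongrightarrow> inverse q * 0"
   by (rule tendsto_mult_left)
  then show ?thesis using False by (simp add: field_simps)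
 qed
 then have "1 <= (0::real)" by (rule LIMSEQ_le_const) (use le in auto)
 then show False by simp
qed

lemma conv_indicator_le: "conv E (indicator X) u <= real (length E)"
 by (induction E) (auto simp: indicator_def)

text \<open>Iterating the hypothesis \<open>n\<close> times, the convolution of the indicator of \<open>X\<close> with the \<open>n\<close>-th
  power of \<open>E\<close> is dominated by that of \<open>E'\<close>. Summing over the negatives of the small combinations,
  where the mass of the left-hand side lies, bounds \<open>|E|^n\<close> by a polynomial times \<open>|E'|^n\<close>.\<close>

lemma conv_le_imp_length_le:
 assumes X: "\<zero> \<in> X" and E: "set E <= carrier G" and E': "set E' <= carrier G"
  and le: "!!u. u \<in> carrier G ==> conv E (indicator X) u <= conv E' (indicator X) u"
 shows "length E <= length E'"
proof (rule exponential_beats_polynomial)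
 fix n
 have pow: "conv (list_pow E n) (indicator X) u <= conv (list_pow E' n) (indicator X) u"
  if "u \<in> carrier G" for u n
  using that
 proof (induction n arbitrary: u)
  case (Suc n)
  have "conv (list_pow E (Suc n)) (indicator X) u = conv E (conv (list_pow E n) (indicator X)) u"
   using Suc.prems E by (simp add: conv_list_sum set_list_pow_carrier)
  also have "\<dots> <= conv E (conv (list_pow E' n) (indicator X)) u"
   using Suc E by (intro conv_mono) auto
  also have "\<dots> = conv (list_pow E' n) (conv E (indicator X)) u"
   using Suc.prems E E' by (intro conv_commute) (auto dest: set_list_pow_carrier[THEN subsetD])
  also have "\<dots> <= conv (list_pow E' n) (conv E' (indicator X)) u"
   using Suc.prems E' le by (intro conv_mono set_list_pow_carrier) auto
  also have "\<dots> = conv E' (conv (list_pow E' n) (indicator X)) u"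
   using Suc.prems E' by (intro conv_commute) (auto dest: set_list_pow_carrier[THEN subsetD])
  also have "\<dots> = conv (list_pow E' (Suc n)) (indicator X) u"
   using Suc.prems E' by (simp add: conv_list_sum set_list_pow_carrier)
  finally show ?case .
 qed auto
 let ?W = "list_pow E n"
 have fin: "finite (set ?W)" by simp
 have W: "set ?W <= carrier G" using E by (rule set_list_pow_carrier)
 have ne: "length E ^ n <= (n + 1) ^ length E * length E' ^ n" if "x \<in> set ?W"
  "!!y. y \<in> set ?W ==> count_list ?W y <= count_list ?W x" for x
 proof -
  have x: "x \<in> carrier G" using W that by auto
  have "length E ^ n = (\<Sum>y\<in>set ?W. count_list ?W y)"
   by (simp add: sum_count_set)
  also have "\<dots> <= card (set ?W) * count_list ?W x"
   using sum_bounded_above[of "set ?W" "count_list ?W"] that by auto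
  also have "card (set ?W) <= (n + 1) ^ length E"
   using set_list_pow_subset[OF E] card_small_combs[of n E] finite_small_combs
   by (meson card_mono le_trans)
  finally have 1: "length E ^ n <= (n + 1) ^ length E * count_list ?W x" by simp
  have "real (count_list ws x) <= conv ws (indicator X) (\<ominus> x)" if "set ws <= carrier G" for ws
   using that X x by (induction ws) (auto simp: l_neg indicator_def)
  then have "real (count_list ?W x) <= conv ?W (indicator X) (\<ominus> x)" using W by simp
  also have "\<dots> <= conv (list_pow E' n) (indicator X) (\<ominus> x)" using pow x by simp
  also have "\<dots> <= real (length (list_pow E' n))"
   by (rule conv_indicator_le)
  finally have "count_list ?W x <= length E' ^ n" by (simp add: of_nat_power[symmetric] del: of_nat_power)
  then show ?thesis using 1 by (meson le_trans mult_le_mono2)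
 qed
 show "length E ^ n <= (n + 1) ^ length E * length E' ^ n"
 proof (cases "set ?W = {}")
  case True
  then have "length E ^ n = 0" by (metis length_list_pow list.size(3) set_empty)
  then show ?thesis by simp
 next
  case False
  let ?m = "Max (count_list ?W ` set ?W)"
  have "?m \<in> count_list ?W ` set ?W" using fin False by (intro Max_in) auto
  then obtain x where "x \<in> set ?W" "count_list ?W x = ?m" by auto
  moreover have "count_list ?W y <= ?m" if "y \<in> set ?W" for y using that by (intro Max_ge) auto
  ultimately show ?thesis using ne[of x] by auto
 qed
qed

end

section \<open>Weighted coverings in an approximate group\<close>

lemmas (in abelian_group) ag_simprules
 [algebra ring "zero G" "add G" "a_inv G" "a_minus G" "monoid.one G" "monoid.mult G"] =
 a_closed zero_closed a_inv_closed minus_closed a_assoc l_zero l_neg a_comm minus_eq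
 r_zero r_neg r_neg2 r_neg1 minus_add minus_minus minus_zero a_lcomm

text \<open>The levels \<open>L\<close> bound the translations that occur in an inequality, so that its validity
  is expressed by one formula.\<close>

locale approx_group = abelian_group G for G (structure) +
 fixes X :: "'a set" and Fs :: "'a list" and L :: "nat => 'a set"
 assumes X_sub: "X <= carrier G"
  and zero_X: "\<zero> \<in> X"
  and neg_X: "x \<in> X ==> \<ominus> x \<in> X"
  and Fs_sub: "set Fs <= carrier G"
  and cover_X: "[|x \<in> X; y \<in> X|] ==> \<exists>f\<in>set Fs. \<exists>z\<in>X. x \<oplus> y = f \<oplus> z"
  and L_sub: "L n <= carrier G"
  and L_Suc: "L n <= L (Suc n)"
  and L_add: "[|x \<in> L n; y \<in> L n|] ==> x \<oplus> y \<in> L (Suc n)"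
  and L_neg: "x \<in> L n ==> \<ominus> x \<in> L n"
  and L_zero: "\<zero> \<in> L n"
  and L_exhaust: "carrier G <= (\<Union>n. L n)"
  and X_L: "\<exists>n. X <= L n"
begin

lemma X_closed [simp]: "x \<in> X ==> x \<in> carrier G"
 using X_sub by auto

lemma L_mono: "m <= n ==> L m <= L n"
 by (induction rule: dec_induct) (use L_Suc in auto)

lemma finite_in_level: "finite F ==> F <= carrier G ==> \<exists>n. F <= L n"
proof (induction rule: finite_induct)
 case (insert x F)
 then obtain m n where "F <= L m" "x \<in> L n" using L_exhaust by auto
 then have "insert x F <= L (max m n)" using L_mono[of m "max m n"] L_mono[of n "max m n"] by auto
 then show ?case by blast
qed auto

text \<open>This bounds the size of \<open>\<phi>\<close> from above by \<open>r\<close> times the size of \<open>X\<close>. All translations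
  are counted and bounded by the index \<open>i\<close>: for fixed \<open>i\<close> the relation is first-order.\<close>

definition up :: "nat => ('a => real) => real => bool" where
 "up i \<phi> r \<longleftrightarrow> (\<exists>E E'. E \<noteq> [] & length E <= i & length E' <= i & set E <= L i & set E' <= L i \<and>
   real (length E') <= r * real (length E) \<and>
   (\<forall>u\<in>carrier G. conv E \<phi> u <= conv E' (indicator X) u))"

text \<open>The lower bound dual to \<open>up\<close>. It is only used to choose a set that is nearly
  optimal, so the number of translations is not recorded.\<close>

definition lo :: "('a => real) => real => bool" where
 "lo \<phi> r \<longleftrightarrow> (\<exists>E E'. E \<noteq> [] & set E <= carrier G & set E' <= carrier G \<and>
   r * real (length E) <= real (length E') \<and>
   (\<forall>u\<in>carrier G. conv E' (indicator X) u <= conv E \<phi> u))"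

lemma conv_shift:
 assumes "set E <= carrier G" "u \<in> carrier G" "g \<in> carrier G"
 shows "conv E (%w. \<phi> (w \<oplus> g)) u = conv E \<phi> (u \<oplus> g)"
 using assms by (induction E) (auto intro!: arg_cong[where f = \<phi>] simp: a_ac)

lemma up_level:
 assumes "up i \<phi> r" "i <= j" shows "up j \<phi> r"
 using assms L_mono[of i j] unfolding up_def by (meson dual_order.trans)

lemma up_mono:
 assumes "up i \<psi> r" "!!u. u \<in> carrier G ==> \<phi> u <= \<psi> u" "r <= r'"
 shows "up i \<phi> r'"
proof -
 obtain E E' where E: "E \<noteq> []" "length E <= i" "length E' <= i" "set E <= L i" "set E' <= L i"
  "real (length E') <= r * real (length E)"
  "\<forall>u\<in>carrier G. conv E \<psi> u <= conv E' (indicator X) u"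
  using assms(1) unfolding up_def by blast
 have "conv E \<phi> u <= conv E' (indicator X) u" if "u \<in> carrier G" for u
  using conv_mono[of E u \<phi> \<psi>] E(4,7) L_sub assms(2) that by (meson order_trans)
 moreover have "real (length E') <= r' * real (length E)"
  using E(6) assms(3) by (meson mult_right_mono of_nat_0_le_iff order_trans)
 ultimately show ?thesis unfolding up_def using E by blast
qed

lemma list_sum_level:
 assumes "set E <= L i" "set F <= L j"
 shows "set (list_sum E F) <= L (Suc (max i j))"
 using assms L_mono[of i "max i j"] L_mono[of j "max i j"] by (auto simp: set_list_sum intro!: L_add)

lemma up_add:
 "\<exists>k. \<forall>\<phi> \<psi> r s. up i \<phi> r --> up j \<psi> s --> up k (%u. \<phi> u + \<psi> u) (r + s)"
proof (intro exI allI impI)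
 fix \<phi> \<psi> r s
 assume "up i \<phi> r" "up j \<psi> s"
 then obtain E E' F F' where
  E: "E \<noteq> []" "length E <= i" "length E' <= i" "set E <= L i" "set E' <= L i"
   "real (length E') <= r * real (length E)"
   "\<forall>u\<in>carrier G. conv E \<phi> u <= conv E' (indicator X) u" and
  F: "F \<noteq> []" "length F <= j" "length F' <= j" "set F <= L j" "set F' <= L j"
   "real (length F') <= s * real (length F)"
   "\<forall>u\<in>carrier G. conv F \<psi> u <= conv F' (indicator X) u"
  unfolding up_def by (elim exE conjE) (rule that)
 have sub: "set E <= carrier G" "set E' <= carrier G" "set F <= carrier G" "set F' <= carrier G"
  using E F L_sub by blast+
 let ?k = "Suc (max i j) + 2 * (i * j)"
 have le: "length E * length F <= i * j" "length E' * length F <= i * j" "length E * length F' <= i * j"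
  using E F by (auto intro: mult_le_mono)
 show "up ?k (%u. \<phi> u + \<psi> u) (r + s)"
  unfolding up_def
 proof (rule exI[of _ "list_sum E F"], rule exI[of _ "list_sum E' F @ list_sum E F'"], intro conjI ballI)
  show "list_sum E F \<noteq> []" using E F by simp
  show "length (list_sum E F) <= ?k" using le by auto
  show "length (list_sum E' F @ list_sum E F') <= ?k" using le by auto
  have "set (list_sum E F) <= L (Suc (max i j))" "set (list_sum E' F @ list_sum E F') <= L (Suc (max i j))"
   using list_sum_level E F by auto
  then have *: "set (list_sum E F) <= L ?k" "set (list_sum E' F @ list_sum E F') <= L ?k"
   using L_mono[of "Suc (max i j)" ?k] by auto
  show "set (list_sum E F) <= L ?k" by (rule *)
  show "set (list_sum E' F @ list_sum E F') <= L ?k" by (rule *)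
  show "real (length (list_sum E' F @ list_sum E F')) <= (r + s) * real (length (list_sum E F))"
   using mult_right_mono[OF E(6), of "real (length F)"] mult_left_mono[OF F(6), of "real (length E)"]
   by (simp add: algebra_simps)
  fix u assume u: "u \<in> carrier G"
  have "conv (list_sum E F) (%u. \<phi> u + \<psi> u) u = conv F (conv E \<phi>) u + conv E (conv F \<psi>) u"
   using u sub by (simp add: conv_add conv_list_sum conv_commute[of F E])
  also have "\<dots> <= conv F (conv E' (indicator X)) u + conv E (conv F' (indicator X)) u"
   using u sub E F by (intro add_mono conv_mono) auto
  also have "\<dots> = conv (list_sum E' F @ list_sum E F') (indicator X) u"
   using u sub by (simp add: conv_list_sum conv_commute[of F E'])
  finally show "conv (list_sum E F) (%u. \<phi> u + \<psi> u) u
   <= conv (list_sum E' F @ list_sum E F') (indicator X) u" .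
 qed
qed

lemma up_zero: "up (Suc 0) (%u. 0) 0"
 unfolding up_def by (intro exI[of _ "[\<zero>]"] exI[of _ "[]"]) (auto simp: L_zero)

lemma up_sum:
 "\<exists>k. \<forall>\<phi>. (\<forall>p<n. up i (\<phi> p) r) --> up k (%u. \<Sum>p<n. \<phi> p u) (real n * r)"
proof (induction n)
 case 0
 then show ?case using up_zero by auto
next
 case (Suc n)
 then obtain k where k: "!!\<phi>. (\<forall>p<n. up i (\<phi> p) r) ==> up k (%u. \<Sum>p<n. \<phi> p u) (real n * r)" by blast
 obtain k' where k': "!!\<phi> \<psi> r s. up k \<phi> r ==> up i \<psi> s ==> up k' (%u. \<phi> u + \<psi> u) (r + s)"
  using up_add[of k i] by blast
 have "up k' (%u. \<Sum>p<Suc n. \<phi> p u) (real (Suc n) * r)" if "\<forall>p<Suc n. up i (\<phi> p) r" for \<phi>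
  using k'[OF k, of \<phi> "\<phi> n" r] that by (simp add: algebra_simps)
 then show ?case by blast
qed

lemma up_translate:
 assumes "up i \<phi> s" "g \<in> L j"
 shows "up (Suc (max i j)) (%u. \<phi> (u \<oplus> g)) s"
proof -
 obtain E E' where E: "E \<noteq> []" "length E <= i" "length E' <= i" "set E <= L i" "set E' <= L i"
  "real (length E') <= s * real (length E)"
  "\<forall>u\<in>carrier G. conv E \<phi> u <= conv E' (indicator X) u"
  using assms(1) unfolding up_def by blast
 have sub: "set E <= carrier G" "set E' <= carrier G" "g \<in> carrier G"
  using E L_sub assms by blast+
 have "conv E (%u. \<phi> (u \<oplus> g)) u <= conv (list_sum [g] E') (indicator X) u" if u: "u \<in> carrier G" for u
 proof -
  have "conv E (%u. \<phi> (u \<oplus> g)) u = conv E \<phi> (u \<oplus> g)"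
   using conv_shift sub u by simp
  also have "\<dots> <= conv E' (indicator X) (u \<oplus> g)" using E sub u by auto
  finally show ?thesis using sub u by (simp add: conv_translate)
 qed
 moreover have "set (list_sum [g] E') <= L (Suc (max i j))"
  using list_sum_level[of "[g]" j E' i] assms E by (simp add: max.commute)
 moreover have "set E <= L (Suc (max i j))" using E L_mono[of i "Suc (max i j)"] by (meson dual_order.trans le_SucI max.cobounded1)
 ultimately show ?thesis unfolding up_def
  using E by (intro exI[of _ E] exI[of _ "list_sum [g] E'"]) auto
qed

lemma up_double:
 "\<exists>k. \<forall>A. A <= X <+>\<^bsub>G\<^esub> X --> up k (indicator A) (real (length Fs))"
proof -
 obtain n where n: "set Fs <= L n" using finite_in_level Fs_sub by blast
 have "up (Suc n + length Fs) (indicator A) (real (length Fs))" if A: "A <= X <+>\<^bsub>G\<^esub> X" for A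
  unfolding up_def
 proof (rule exI[of _ "[\<zero>]"], rule exI[of _ "map (a_inv G) Fs"], intro conjI ballI)
  show "set [\<zero>] <= L (Suc n + length Fs)" using L_zero by simp
  show "set (map (a_inv G) Fs) <= L (Suc n + length Fs)"
   using n L_neg L_mono[of n "Suc n + length Fs"] by auto
  fix u assume u: "u \<in> carrier G"
  show "conv [\<zero>] (indicator A) u <= conv (map (a_inv G) Fs) (indicator X) u"
  proof (cases "u \<in> A")
   case True
   then obtain x y where "x \<in> X" "y \<in> X" "u = x \<oplus> y" using A by (auto simp: set_add_def')
   then obtain f z where f: "f \<in> set Fs" "z \<in> X" "u = f \<oplus> z" using cover_X by metis
   then have fc: "f \<in> carrier G" using Fs_sub by auto
   have zc: "z \<in> carrier G" using f by simp
   have "u \<oplus> \<ominus> f = z" unfolding f(3) using fc zc by algebra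
   have gen: "1 <= conv (map (a_inv G) Fs') (indicator X) u"
    if "f \<in> set Fs'" "set Fs' <= carrier G" for Fs'
    using that
   proof (induction Fs')
    case (Cons h Fs')
    have "0 <= conv (map (a_inv G) Fs') (indicat_real X) u"
     using Cons.prems u by (intro conv_nonneg) auto
    then show ?case
     using Cons f(2) \<open>u \<oplus> \<ominus> f = z\<close> by (cases "f = h") (auto intro: order_trans)
   qed auto
   show ?thesis using gen[of Fs] f Fs_sub u True by simp
  next
   case False
   then have "conv [\<zero>] (indicator A) u = 0" using u by simp
   then show ?thesis using Fs_sub u by (simp only:) (rule conv_nonneg, auto)
  qed
 qed auto
 then show ?thesis by blast
qed

lemma lo_mono:
 assumes "lo \<phi> r" "!!u. u \<in> carrier G ==> \<phi> u <= \<psi> u"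
 shows "lo \<psi> r"
proof -
 obtain E E' where E: "E \<noteq> []" "set E <= carrier G" "set E' <= carrier G"
   "r * real (length E) <= real (length E')"
   "\<forall>u\<in>carrier G. conv E' (indicator X) u <= conv E \<phi> u" using assms(1) unfolding lo_def by blast
 moreover have "conv E \<phi> u <= conv E \<psi> u" if "u \<in> carrier G" for u
  using E assms(2) that by (intro conv_mono) auto
 ultimately show ?thesis unfolding lo_def by (meson order_trans)
qed

lemma lo_add:
 assumes "lo \<phi> r" "lo \<psi> s"
 shows "lo (%u. \<phi> u + \<psi> u) (r + s)"
proof -
 obtain E E' F F' where
  E: "E \<noteq> []" "set E <= carrier G" "set E' <= carrier G"
   "r * real (length E) <= real (length E')"
   "\<forall>u\<in>carrier G. conv E' (indicator X) u <= conv E \<phi> u" and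
  F: "F \<noteq> []" "set F <= carrier G" "set F' <= carrier G"
   "s * real (length F) <= real (length F')"
   "\<forall>u\<in>carrier G. conv F' (indicator X) u <= conv F \<psi> u"
  using assms unfolding lo_def by (elim exE conjE) (rule that)
 show ?thesis unfolding lo_def
 proof (rule exI[of _ "list_sum E F"], rule exI[of _ "list_sum E' F @ list_sum E F'"], intro conjI ballI)
  show "list_sum E F \<noteq> []" using E F by simp
  show "set (list_sum E F) <= carrier G" using E F by (intro set_list_sum_carrier)
  show "set (list_sum E' F @ list_sum E F') <= carrier G"
   using E F set_list_sum_carrier[of E' F] set_list_sum_carrier[of E F'] by auto
  show "(r + s) * real (length (list_sum E F)) <= real (length (list_sum E' F @ list_sum E F'))"
   using mult_right_mono[OF E(4), of "real (length F)"] mult_left_mono[OF F(4), of "real (length E)"]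
   by (simp add: algebra_simps)
  fix u assume u: "u \<in> carrier G"
  have "conv (list_sum E' F @ list_sum E F') (indicator X) u
    = conv F (conv E' (indicator X)) u + conv E (conv F' (indicator X)) u"
   using u E F by (simp add: conv_list_sum conv_commute[of F E'])
  also have "\<dots> <= conv F (conv E \<phi>) u + conv E (conv F \<psi>) u"
   using u E F by (intro add_mono conv_mono) auto
  also have "\<dots> = conv (list_sum E F) (%u. \<phi> u + \<psi> u) u"
   using u E F by (simp add: conv_add conv_list_sum conv_commute[of F E])
  finally show "conv (list_sum E' F @ list_sum E F') (indicator X) u \<le>
   conv (list_sum E F) (%u. \<phi> u + \<psi> u) u" .
 qed
qed

lemma lo_zero: "lo (%u. 0) 0"
 unfolding lo_def by (intro exI[of _ "[\<zero>]"] exI[of _ "[]"]) auto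

lemma lo_translate:
 assumes "lo \<phi> r" "g \<in> carrier G"
 shows "lo (%u. \<phi> (u \<oplus> g)) r"
proof -
 obtain E E' where E: "E \<noteq> []" "set E <= carrier G" "set E' <= carrier G"
   "r * real (length E) <= real (length E')"
   "\<forall>u\<in>carrier G. conv E' (indicator X) u <= conv E \<phi> u" using assms(1) unfolding lo_def by blast
 have "conv (map (%e. g \<oplus> e) E') (indicator X) u <= conv E (%u. \<phi> (u \<oplus> g)) u"
  if u: "u \<in> carrier G" for u
  using E assms u by (simp add: conv_translate conv_shift)
 then show ?thesis unfolding lo_def
  using E assms by (intro exI[of _ E] exI[of _ "map (%e. g \<oplus> e) E'"]) auto
qed

lemma lo_conv:
 assumes "lo (conv gs \<phi>) r" "gs \<noteq> []" "set gs <= carrier G"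
 shows "lo \<phi> (r / real (length gs))"
proof -
 obtain E E' where E: "E \<noteq> []" "set E <= carrier G" "set E' <= carrier G"
   "r * real (length E) <= real (length E')"
   "\<forall>u\<in>carrier G. conv E' (indicator X) u <= conv E (conv gs \<phi>) u" using assms(1) unfolding lo_def by blast
 show ?thesis unfolding lo_def
  using E assms set_list_sum_carrier[of E gs]
  by (intro exI[of _ "list_sum E gs"] exI[of _ "E'"]) (auto simp: conv_list_sum field_simps)
qed

lemma lo_one:
 assumes "b \<in> carrier G" "!!x. x \<in> X ==> b \<oplus> x \<in> Y"
 shows "lo (indicator Y) 1"
 unfolding lo_def
 using assms
 by (intro exI[of _ "[b]"] exI[of _ "[\<zero>]"]) (auto simp: indicator_def a_comm)

text \<open>This replaces the existence of an invariant measure: combining the two inequalities by convolution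
  compares two lists acting on the indicator of \<open>X\<close>, and so their lengths.\<close>

lemma lo_le_up:
 assumes "lo \<phi> r" "up i \<phi> s"
 shows "r <= s"
proof -
 obtain E E' where
  E: "E \<noteq> []" "set E <= L i" "set E' <= L i"
   "real (length E') <= s * real (length E)"
   "\<forall>u\<in>carrier G. conv E \<phi> u <= conv E' (indicator X) u"
  using assms(2) unfolding up_def by blast
 obtain F F' where F: "F \<noteq> []" "set F <= carrier G" "set F' <= carrier G"
   "r * real (length F) <= real (length F')"
   "\<forall>u\<in>carrier G. conv F' (indicator X) u <= conv F \<phi> u"
  using assms(1) unfolding lo_def by blast
 have sub: "set E <= carrier G" "set E' <= carrier G"
  using E L_sub by blast+
 have "conv (list_sum E F') (indicator X) u <= conv (list_sum F E') (indicator X) u"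
  if u: "u \<in> carrier G" for u
 proof -
  have "conv (list_sum E F') (indicator X) u = conv E (conv F' (indicator X)) u"
   using sub F u by (simp add: conv_list_sum)
  also have "\<dots> <= conv E (conv F \<phi>) u" using sub F u by (intro conv_mono) auto
  also have "\<dots> = conv F (conv E \<phi>) u" using sub F u by (intro conv_commute) auto
  also have "\<dots> <= conv F (conv E' (indicator X)) u" using F E u by (intro conv_mono) auto
  finally show ?thesis using sub F u by (simp add: conv_list_sum)
 qed
 then have "length (list_sum E F') <= length (list_sum F E')"
  by (intro conv_le_imp_length_le[OF zero_X] set_list_sum_carrier) (use sub F in auto)
 then have "real (length E) * real (length F') <= real (length F) * real (length E')"
  by (simp flip: of_nat_mult)
 also have "\<dots> <= real (length F) * (s * real (length E))" using E by (intro mult_left_mono) auto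
 finally have "real (length F') <= real (length F) * s" using E by (simp add: field_simps)
 then have "r * real (length F) <= s * real (length F)" using F(4) by (metis mult.commute order_trans)
 then show ?thesis using F by simp
qed

text \<open>The boxes \<open>[a, b)^N\<close> in the directions \<open>gs\<close> are Foelner sets: translation by a direction moves the box
  \<open>[1, n)^N\<close> into \<open>[0, n)^N\<close>, and the sizes of the two differ by a factor close to \<open>1\<close>.\<close>

primrec box :: "nat => nat => 'a list => 'a list" where
 "box a b [] = [\<zero>]"
| "box a b (g # gs) = list_sum (map (%c. add_pow G c g) [a..<b]) (box a b gs)"

lemma length_box [simp]: "length (box a b gs) = (b - a) ^ length gs"
 by (induction gs) auto

lemma box_carrier: "set gs <= carrier G ==> set (box a b gs) <= carrier G"
 by (induction gs) (auto dest: set_list_sum_carrier simp: set_list_sum)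

lemma multiple_level: "g \<in> L j ==> add_pow G (c::nat) g \<in> L (j + c)"
proof (induction c)
 case (Suc c)
 have "g \<in> L (j + c)" using Suc L_mono[of j "j + c"] by auto
 then show ?case using Suc L_add[of "add_pow G c g" "j + c" g] by simp
qed (simp add: L_zero)

lemma box_level: "set gs <= L j ==> set (box a b gs) <= L (j + b + length gs)"
proof (induction gs)
 case (Cons g gs)
 have "set (map (%c. add_pow G c g) [a..<b]) <= L (j + b + length gs)"
 proof
  fix x assume "x \<in> set (map (%c. add_pow G c g) [a..<b])"
  then obtain c where "x = add_pow G c g" "c < b" by auto
  then show "x \<in> L (j + b + length gs)"
   using multiple_level[of g j c] Cons.prems L_mono[of "j + c" "j + b + length gs"] by auto
 qed
 then show ?case using list_sum_level[of _ "j + b + length gs" _ "j + b + length gs"] Cons by simp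
qed (simp add: L_zero)

lemma sum_list_drop_le:
 fixes f :: "nat => real"
 assumes "!!c. 0 <= f c"
 shows "(\<Sum>c\<leftarrow>[1..<n]. f c) <= (\<Sum>c\<leftarrow>[0..<n]. f c)"
  and "(\<Sum>c\<leftarrow>[1..<n]. f c) <= (\<Sum>c\<leftarrow>[0..<n]. f (Suc c))"
proof -
 have *: "(\<Sum>c\<leftarrow>[a..<b]. g c) = sum g {a..<b}" for a b and g :: "nat => real"
  by (simp add: sum_list_distinct_conv_sum_set)
 show "(\<Sum>c\<leftarrow>[1..<n]. f c) <= (\<Sum>c\<leftarrow>[0..<n]. f c)"
  unfolding * by (intro sum_mono2) (auto simp: assms)
 have "sum f {1..<n} <= sum f {1..<Suc n}" by (intro sum_mono2) (auto simp: assms)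
 also have "\<dots> = (\<Sum>c\<in>{0..<n}. f (Suc c))" unfolding One_nat_def by (rule sum.shift_bounds_Suc_ivl)
 finally show "(\<Sum>c\<leftarrow>[1..<n]. f c) <= (\<Sum>c\<leftarrow>[0..<n]. f (Suc c))" unfolding * .
qed

lemma conv_multiples_mono:
 assumes "g \<in> carrier G" "u \<in> carrier G" "!!w. w \<in> carrier G ==> 0 <= \<phi> w"
 shows "conv (map (%c. add_pow G c g) [1..<n]) \<phi> u <= conv (map (%c. add_pow G c g) [0..<n]) \<phi> u"
  and "conv (map (%c. add_pow G c g) [1..<n]) \<phi> u
      <= conv (map (%c. add_pow G c g) [0..<n]) (%w. \<phi> (w \<oplus> g)) u"
proof -
 show "conv (map (%c. add_pow G c g) [1..<n]) \<phi> u <= conv (map (%c. add_pow G c g) [0..<n]) \<phi> u"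
  using sum_list_drop_le(1)[of "%c. \<phi> (u \<oplus> add_pow G c g)" n] assms
  by (simp add: conv_def o_def del: upt_Suc)
 show "conv (map (%c. add_pow G c g) [1..<n]) \<phi> u
      <= conv (map (%c. add_pow G c g) [0..<n]) (%w. \<phi> (w \<oplus> g)) u"
  using sum_list_drop_le(2)[of "%c. \<phi> (u \<oplus> add_pow G c g)" n] assms
  by (simp add: conv_def o_def a_assoc del: upt_Suc)
qed

lemma conv_box_mono:
 assumes "set gs <= carrier G" "u \<in> carrier G" "!!w. w \<in> carrier G ==> 0 <= \<phi> w"
 shows "conv (box 1 n gs) \<phi> u <= conv (box 0 n gs) \<phi> u"
 using assms(1,2)
proof (induction gs arbitrary: u)
 case (Cons g gs)
 let ?I = "%a. map (%c. add_pow G c g) [a..<n]"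
 have I: "set (?I a) <= carrier G" for a using Cons.prems by auto
 have B: "set (box a n gs) <= carrier G" for a using Cons.prems by (intro box_carrier) auto
 have "conv (box 1 n (g # gs)) \<phi> u = conv (?I 1) (conv (box 1 n gs) \<phi>) u"
  using I B Cons.prems by (simp add: conv_list_sum)
 also have "\<dots> <= conv (?I 0) (conv (box 1 n gs) \<phi>) u"
  using Cons.prems B assms(3) by (intro conv_multiples_mono conv_nonneg) auto
 also have "\<dots> <= conv (?I 0) (conv (box 0 n gs) \<phi>) u"
  using Cons I by (intro conv_mono) auto
 also have "\<dots> = conv (box 0 n (g # gs)) \<phi> u"
  using I B Cons.prems by (simp add: conv_list_sum)
 finally show ?case .
qed auto

lemma conv_box_translate:
 assumes "set gs <= carrier G" "u \<in> carrier G" "!!w. w \<in> carrier G ==> 0 <= \<phi> w" "h \<in> set gs"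
 shows "conv (box 1 n gs) \<phi> u <= conv (box 0 n gs) (%w. \<phi> (w \<oplus> h)) u"
 using assms(1,2,4)
proof (induction gs arbitrary: u)
 case (Cons g gs)
 let ?I = "%a. map (%c. add_pow G c g) [a..<n]"
 have I: "set (?I a) <= carrier G" for a using Cons.prems by auto
 have B: "set (box a n gs) <= carrier G" for a using Cons.prems by (intro box_carrier) auto
 have h: "h \<in> carrier G" using Cons.prems by auto
 have 1: "conv (box 1 n (g # gs)) \<phi> u = conv (?I 1) (conv (box 1 n gs) \<phi>) u"
  using I B Cons.prems by (simp add: conv_list_sum)
 have 2: "conv (box 0 n (g # gs)) (%w. \<phi> (w \<oplus> h)) u = conv (?I 0) (conv (box 0 n gs) (%w. \<phi> (w \<oplus> h))) u"
  using I B Cons.prems by (simp add: conv_list_sum)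
 show ?case
 proof (cases "h = g")
  case True
  have "conv (?I 1) (conv (box 1 n gs) \<phi>) u <= conv (?I 1) (conv (box 0 n gs) \<phi>) u"
   using Cons.prems I assms(3) by (intro conv_mono conv_box_mono) auto
  also have "\<dots> <= conv (?I 0) (%w. conv (box 0 n gs) \<phi> (w \<oplus> g)) u"
   using Cons.prems B assms(3) by (intro conv_multiples_mono conv_nonneg) auto
  also have "\<dots> = conv (?I 0) (conv (box 0 n gs) (%w. \<phi> (w \<oplus> h))) u"
   using Cons.prems I B True by (intro conv_cong) (auto simp: conv_shift)
  finally show ?thesis unfolding 1 2 .
 next
  case False
  have "conv (?I 1) (conv (box 1 n gs) \<phi>) u <= conv (?I 0) (conv (box 1 n gs) \<phi>) u"
   using Cons.prems B assms(3) by (intro conv_multiples_mono conv_nonneg) auto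
  also have "\<dots> <= conv (?I 0) (conv (box 0 n gs) (%w. \<phi> (w \<oplus> h))) u"
   using Cons False I by (intro conv_mono) auto
  finally show ?thesis unfolding 1 2 .
 qed
qed auto

lemma conv_scale: "conv E (%w. c * \<phi> w) u = c * conv E \<phi> u"
 by (induction E) (auto simp: algebra_simps)

lemma conv_replicate: "conv (concat (replicate N E)) \<phi> u = real N * conv E \<phi> u"
 by (induction N) (auto simp: algebra_simps)

lemma length_concat_replicate: "length (concat (replicate N E)) = N * length E"
 by (induction N) auto

text \<open>If the sum of \<open>N\<close> translates of \<open>\<phi>\<close> is small, then so is \<open>\<phi>\<close>, by averaging over a box in the directions
  of the translations.\<close>

lemma up_box:
 assumes "\<delta> > 0" "N > 0"
 shows "\<exists>k. \<forall>gs \<phi> r. length gs = N --> set gs <= L j --> (\<forall>w\<in>carrier G. 0 <= \<phi> w) -->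
   up i (conv gs \<phi>) r --> up k \<phi> (r * (1 + \<delta>) / real N)"
proof -
 have "(%n. (real n / (real n - 1)) ^ N) \<longlonglongrightarrow> 1 ^ N"
  by (intro tendsto_power) real_asymp
 then have "eventually (%n. (real n / (real n - 1)) ^ N < 1 + \<delta>) sequentially"
  using assms by (intro order_tendstoD(2)) auto
 then obtain n where n: "n > 1" "(real n / (real n - 1)) ^ N < 1 + \<delta>"
  using eventually_gt_at_top[of 1] by (metis (no_types, lifting) eventually_conj eventually_happens'
    sequentially_bot)
 have nN: "real (n ^ N) <= (1 + \<delta>) * real ((n - 1) ^ N)"
  using n by (simp add: power_divide field_simps of_nat_diff)
 let ?k = "Suc (max i (j + n + N)) + N * i * n ^ N + i * n ^ N"
 show ?thesis
 proof (intro exI[of _ ?k] allI impI)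
  fix gs \<phi> r
  assume gs: "length gs = N" "set gs <= L j" and nonneg: "\<forall>w\<in>carrier G. 0 <= \<phi> w"
   and "up i (conv gs \<phi>) r"
  then obtain E E' where E: "E \<noteq> []" "length E <= i" "length E' <= i" "set E <= L i" "set E' <= L i"
   "real (length E') <= r * real (length E)"
   "\<forall>u\<in>carrier G. conv E (conv gs \<phi>) u <= conv E' (indicator X) u"
   unfolding up_def by blast
  have sub: "set E <= carrier G" "set E' <= carrier G" "set gs <= carrier G"
   using E gs L_sub by blast+
  note bc = box_carrier[OF sub(3)]
  let ?D = "list_sum E (box 1 n gs)" and ?D' = "list_sum E' (box 0 n gs)"
  have "0 <= r * real (length E)" using E(6) by (meson of_nat_0_le_iff order_trans)
  then have r: "0 <= r" using E(1) by (simp add: zero_le_mult_iff)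
  show "up ?k \<phi> (r * (1 + \<delta>) / real N)"
   unfolding up_def
  proof (rule exI[of _ "concat (replicate N ?D)"], rule exI[of _ ?D'], intro conjI ballI)
   have "box 1 n gs \<noteq> []"
   proof
    assume "box 1 n gs = []"
    then have "length (box 1 n gs) = 0" by simp
    then show False using n by simp
   qed
   then have "?D \<noteq> []" using E by simp
   then show "concat (replicate N ?D) \<noteq> []" using assms(2) by auto
   have "(n - 1) ^ N <= n ^ N" by (intro power_mono) auto
   then have "N * (length E * (n - 1) ^ N) <= N * (i * n ^ N)"
    using E by (intro mult_le_mono2 mult_le_mono) auto
   then show "length (concat (replicate N ?D)) <= ?k"
    using gs by (simp only: length_concat_replicate length_list_sum length_box mult.assoc)
   have "length E' * n ^ N <= i * n ^ N" using E by (intro mult_le_mono) auto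
   then show "length ?D' <= ?k" using gs by (simp only: length_list_sum length_box) (simp only: diff_zero)
   have "set ?D <= L (Suc (max i (j + n + N)))" "set ?D' <= L (Suc (max i (j + n + N)))"
    using list_sum_level[OF E(4) box_level[OF gs(2)]] list_sum_level[OF E(5) box_level[OF gs(2)]] gs
    by auto
   then have *: "set (concat (replicate N ?D)) <= L ?k" "set ?D' <= L ?k"
    using L_mono[of "Suc (max i (j + n + N))" ?k] by (auto split: if_splits simp del: max.bounded_iff intro!: le_SucI trans_le_add1)
   show "set (concat (replicate N ?D)) <= L ?k" by (rule *)
   show "set ?D' <= L ?k" by (rule *)
   have "real (length E') * real (n ^ N) <= (r * real (length E)) * ((1 + \<delta>) * real ((n - 1) ^ N))"
    using E(6) nN r by (intro mult_mono) auto
   then show "real (length ?D') <= r * (1 + \<delta>) / real N * real (length (concat (replicate N ?D)))"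
    using assms gs by (simp add: length_concat_replicate ac_simps)
   fix u assume u: "u \<in> carrier G"
   have core: "real N * conv (box 1 n gs) \<phi> w <= conv (box 0 n gs) (conv gs \<phi>) w"
    if w: "w \<in> carrier G" for w
   proof -
    have "real (length hs) * conv (box 1 n gs) \<phi> w <= conv (box 0 n gs) (conv hs \<phi>) w"
     if "set hs <= set gs" for hs
     using that
    proof (induction hs)
     case Nil
     have "0 <= conv (box 0 n gs) (conv [] \<phi>) w" using bc w by (intro conv_nonneg) (auto simp: nonneg)
     then show ?case by (simp only: list.size of_nat_0 mult_zero_left)
    next
     case (Cons h hs)
     have "conv (box 1 n gs) \<phi> w <= conv (box 0 n gs) (%w. \<phi> (w \<oplus> h)) w"
      using Cons.prems sub w nonneg by (intro conv_box_translate) auto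
     then show ?case using Cons
      by (simp add: conv_Cons[abs_def] conv_add algebra_simps)
    qed
    then show ?thesis using gs by blast
   qed
   have "conv (concat (replicate N ?D)) \<phi> u = conv E (%w. real N * conv (box 1 n gs) \<phi> w) u"
    using sub bc u by (simp add: conv_replicate conv_list_sum conv_scale)
   also have "\<dots> <= conv E (conv (box 0 n gs) (conv gs \<phi>)) u"
    using sub core u by (intro conv_mono) auto
   also have "\<dots> = conv (box 0 n gs) (conv E (conv gs \<phi>)) u"
    using sub bc u by (intro conv_commute) auto
   also have "\<dots> <= conv (box 0 n gs) (conv E' (indicator X)) u"
    using bc E u by (intro conv_mono) auto
   also have "\<dots> = conv ?D' (indicator X) u"
    using sub bc u by (simp add: conv_list_sum conv_commute[of "box 0 n gs"])
   finally show "conv (concat (replicate N ?D)) \<phi> u <= conv ?D' (indicator X) u" .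
  qed
 qed
qed

end

section \<open>Generic symmetric sets with small sums\<close>

context approx_group
begin

lemma neg_zero [simp]: "\<ominus> \<zero> = \<zero>"
 using r_neg[of \<zero>] by simp

definition self_overlap :: "'a set => 'a => 'a set" where
 "self_overlap B g = {x \<in> B. x \<ominus> g \<in> B}"

text \<open>Among many translates of a set that is not small, inside a double of \<open>X\<close>, two have to overlap
  substantially. Otherwise inclusion-exclusion makes their union too large. Both orders of the pair are allowed for,
  since the bound on the overlap is not symmetric at a fixed level.\<close>

lemma generic_stabilizer:
 assumes t: "t > 0"
 shows "\<exists>(N::nat) s. s > 0 & (\<forall>i. \<exists>k. \<forall>B. B <= X --> \<not> up k (indicator B) t -->
  \<not> (\<exists>g. (\<forall>a<N. g a \<in> X) & (\<forall>a<N. \<forall>b<N. a < b -->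
    up i (indicator (self_overlap B (g b \<ominus> g a))) s \<or>
    up i (indicator (self_overlap B (g a \<ominus> g b))) s)))"
proof -
 define K where "K = real (length Fs)"
 have "Fs \<noteq> []" using cover_X[OF zero_X zero_X] by auto
 then have K: "K > 0" by (simp add: K_def)
 obtain N :: nat where N: "N > 0" "3 * K / t < real N"
  by (metis K divide_pos_pos gr0I less_eq_real_def mult_pos_pos not_less of_nat_0 reals_Archimedean2 t
    zero_less_numeral)
 define s where "s = K / (real N * real N)"
 have s: "s > 0" using K N by (simp add: s_def)
 obtain j where j: "X <= L j" using X_L by blast
 show ?thesis
 proof (rule exI[of _ N], rule exI[of _ s], intro conjI allI)
  fix i
  define i' where "i' = Suc (max i j) + 1"
  obtain k1 where k1: "!!A. A <= X <+>\<^bsub>G\<^esub> X ==> up k1 (indicator A) K"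
   using up_double unfolding K_def by blast
  obtain k2 where k2: "!!\<phi>. (\<forall>p<N. up i' (\<phi> p) s) ==> up k2 (%u. \<Sum>p<N. \<phi> p u) (real N * s)"
   using up_sum by blast
  obtain k3 where k3: "!!\<phi>. (\<forall>p<N. up k2 (\<phi> p) (real N * s)) ==>
    up k3 (%u. \<Sum>p<N. \<phi> p u) (real N * (real N * s))"
   using up_sum by blast
  obtain k4 where k4: "!!\<phi> \<psi> r s. up k1 \<phi> r ==> up k3 \<psi> s ==> up k4 (%u. \<phi> u + \<psi> u) (r + s)"
   using up_add by blast
  obtain k where k: "!!gs \<phi> r. length gs = N ==> set gs <= L j ==> (\<forall>w\<in>carrier G. 0 <= \<phi> w) ==>
   up k4 (conv gs \<phi>) r ==> up k \<phi> (r * (1 + 1 / 2) / real N)"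
   using up_box[of "1/2" N j k4] N by auto
  show "\<exists>k. \<forall>B. B <= X --> \<not> up k (indicator B) t -->
   \<not> (\<exists>g. (\<forall>a<N. g a \<in> X) & (\<forall>a<N. \<forall>b<N. a < b -->
    up i (indicator (self_overlap B (g b \<ominus> g a))) s \<or>
    up i (indicator (self_overlap B (g a \<ominus> g b))) s))"
  proof (rule exI[of _ k], intro allI impI notI, elim exE conjE)
   fix B g
   assume B: "B <= X" and large: "\<not> up k (indicator B) t" and gX: "\<forall>a<N. g a \<in> X"
    and small: "\<forall>a<N. \<forall>b<N. a < b -->
    up i (indicator (self_overlap B (g b \<ominus> g a))) s \<or>
    up i (indicator (self_overlap B (g a \<ominus> g b))) s"
   have Bc: "x \<in> carrier G" if "x \<in> B" for x using B that by auto
   have g: "g a \<in> carrier G" if "a < N" for a using gX that by auto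
   have neg_level: "\<ominus> g a \<in> L j" if "a < N" for a by (rule L_neg) (use gX j that in auto)
   define C where "C a b = {u \<in> carrier G. u \<ominus> g a \<in> B & u \<ominus> g b \<in> B}" for a b
   define \<phi> where "\<phi> a b = (if a < b then indicat_real (C a b) else (%u. 0))" for a b
   have over: "up i' (indicator (C a b)) s"
    if ab: "a < N" "b < N" and u: "up i (indicator (self_overlap B (g b \<ominus> g a))) s" for a b
   proof -
    from ab have "\<ominus> g a \<in> L j" by (intro neg_level)
    from up_translate[OF u this]
    have "up (Suc (max i j)) (%u. indicator (self_overlap B (g b \<ominus> g a)) (u \<oplus> \<ominus> g a)) s" .
    then have "up i' (%u. indicator (self_overlap B (g b \<ominus> g a)) (u \<oplus> \<ominus> g a)) s"
     by (rule up_level) (auto simp: i'_def)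
    moreover have "indicator (C a b) u = (indicator (self_overlap B (g b \<ominus> g a)) (u \<oplus> \<ominus> g a) :: real)"
     if "u \<in> carrier G" for u
    proof -
     have "u \<oplus> \<ominus> g a \<ominus> (g b \<ominus> g a) = u \<ominus> g b" "u \<oplus> \<ominus> g a = u \<ominus> g a"
      using that g ab by algebra+
     then show ?thesis using that by (simp add: C_def self_overlap_def indicator_def)
    qed
    ultimately show ?thesis by - (erule up_mono, simp_all)
   qed
   have "up i' (\<phi> a b) s" if ab: "a < N" "b < N" for a b
   proof (cases "a < b")
    case True
    have "C b a = C a b" by (auto simp: C_def)
    moreover have "up i (indicator (self_overlap B (g b \<ominus> g a))) s \<or>
     up i (indicator (self_overlap B (g a \<ominus> g b))) s" using small ab True by blast
    ultimately have "up i' (indicator (C a b)) s" using over[of a b] over[of b a] ab by metis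
    then show ?thesis using True by (simp add: \<phi>_def)
   next
    case False
    have "up i' (%u. 0) 0" using up_zero by (rule up_level) (simp add: i'_def)
    then have "up i' (%u. 0) s" by (rule up_mono) (use s in auto)
    then show ?thesis using False by (simp add: \<phi>_def)
   qed
   then have "up k3 (%u. \<Sum>a<N. \<Sum>b<N. \<phi> a b u) (real N * (real N * s))"
    using k2 k3 by simp
   moreover define A where "A = {u \<in> carrier G. \<exists>a<N. u \<ominus> g a \<in> B}"
   have "A <= X <+>\<^bsub>G\<^esub> X"
   proof
    fix u assume "u \<in> A"
    then obtain a where a: "a < N" "u \<ominus> g a \<in> B" "u \<in> carrier G" by (auto simp: A_def)
    have "u = (u \<ominus> g a) \<oplus> g a" using a g[of a] by algebra
    then show "u \<in> X <+>\<^bsub>G\<^esub> X" using a B gX unfolding set_add_def' by blast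
   qed
   then have "up k1 (indicator A) K" by (rule k1)
   ultimately have 1: "up k4 (%u. indicator A u + (\<Sum>a<N. \<Sum>b<N. \<phi> a b u)) (K + real N * (real N * s))"
    by (intro k4)
   have count: "conv (map (%a. \<ominus> g a) [0..<N]) (indicator B) u
    <= indicator A u + (\<Sum>a<N. \<Sum>b<N. \<phi> a b u)" if u: "u \<in> carrier G" for u
   proof -
    have nn: "0 <= \<phi> a b u" for a b by (simp add: \<phi>_def)
    have eq: "conv (map (%a. \<ominus> g a) [0..<N]) (indicator B) u = (\<Sum>a<N. indicator B (u \<ominus> g a))"
     unfolding conv_def by (simp add: o_def sum_list_distinct_conv_sum_set lessThan_atLeast0 minus_eq)
    show ?thesis
    proof (cases "\<exists>a<N. u \<ominus> g a \<in> B")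
     case False
     then have "conv (map (%a. \<ominus> g a) [0..<N]) (indicator B) u = 0"
      unfolding eq by (intro sum.neutral) auto
     then show ?thesis using nn by (simp add: sum_nonneg add_nonneg_nonneg)
    next
     case True
     define c where "c = (LEAST a. a < N & u \<ominus> g a \<in> B)"
     have c: "c < N" "u \<ominus> g c \<in> B" using LeastI_ex[OF True] by (auto simp: c_def)
     have least: "c <= a" if "a < N" "u \<ominus> g a \<in> B" for a
      unfolding c_def using that by (intro Least_le) auto
     have "indicator B (u \<ominus> g a) <= \<phi> c a u" if "a < N" "a \<noteq> c" for a
      using least[of a] that c u by (auto simp: \<phi>_def C_def indicator_def)
     then have "(\<Sum>a\<in>{..<N} - {c}. indicator B (u \<ominus> g a)) <= (\<Sum>a\<in>{..<N} - {c}. \<phi> c a u)"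
      by (intro sum_mono) auto
     also have "\<dots> <= (\<Sum>b<N. \<phi> c b u)" by (intro sum_mono2) (auto simp: nn)
     also have "\<dots> <= (\<Sum>a<N. \<Sum>b<N. \<phi> a b u)"
      using c by (intro member_le_sum) (auto intro!: sum_nonneg nn)
     finally have "(\<Sum>a\<in>{..<N} - {c}. indicator B (u \<ominus> g a)) <= (\<Sum>a<N. \<Sum>b<N. \<phi> a b u)" .
     moreover have "indicator A u = (1::real)" using True u by (simp add: A_def)
     moreover have "(\<Sum>a<N. indicator B (u \<ominus> g a)) =
       indicat_real B (u \<ominus> g c) + (\<Sum>a\<in>{..<N} - {c}. indicator B (u \<ominus> g a))"
      using c by (intro sum.remove) auto
     ultimately show ?thesis unfolding eq using c by simp
    qed
   qed
   have 2: "up k4 (conv (map (%a. \<ominus> g a) [0..<N]) (indicator B)) (K + real N * (real N * s))"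
    using 1 count by (rule up_mono) auto
   have "up k (indicator B) ((K + real N * (real N * s)) * (1 + 1 / 2) / real N)"
    by (rule k[OF _ _ _ 2]) (auto simp: neg_level)
   moreover have "(K + real N * (real N * s)) * (1 + 1 / 2) / real N <= t"
   proof -
    have "real N * (real N * s) = K" using N by (simp add: s_def)
    moreover have "3 * K <= t * real N" using N t by (simp add: field_simps)
    ultimately show ?thesis using N by (simp add: field_simps)
   qed
   ultimately have "up k (indicator B) t" by - (erule up_mono, auto)
   then show False using large by simp
  qed
 qed (use s in auto)
qed

text \<open>The partial sums of \<open>gs\<close>, with the sign with which they translate the overlaps.\<close>

primrec offsets :: "'a list => 'a list" where
 "offsets [] = []"
| "offsets (s # gs) = \<zero> # map (%e. \<ominus> s \<oplus> e) (offsets gs)"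

primrec total :: "'a list => 'a" where
 "total [] = \<zero>"
| "total (s # gs) = s \<oplus> total gs"

primrec overlaps :: "'a set => 'a list => 'a => real" where
 "overlaps Y [] u = 0"
| "overlaps Y (s # gs) u = indicator (self_overlap Y s) u + overlaps Y gs (u \<ominus> s)"

lemma total_closed [simp]: "set gs <= carrier G ==> total gs \<in> carrier G"
 by (induction gs) auto

lemma offsets_carrier: "set gs <= carrier G ==> set (offsets gs) <= carrier G"
 by (induction gs) auto

lemma length_offsets [simp]: "length (offsets gs) = length gs"
 by (induction gs) auto

text \<open>A point that lies in \<open>Y\<close> and whose translate by the total does not is lost at some
  intermediate step, so it is missing from one of the overlaps.\<close>

lemma overlaps_le:
 assumes "set gs <= carrier G" "u \<in> carrier G"
 shows "overlaps Y gs u <= conv (offsets gs) (indicator Y) u"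
  and "indicator Y u + overlaps Y gs u <= conv (offsets gs) (indicator Y) u + indicator Y (u \<ominus> total gs)"
proof -
 have "overlaps Y gs u <= conv (offsets gs) (indicator Y) u \<and>
  indicator Y u + overlaps Y gs u <= conv (offsets gs) (indicator Y) u + indicator Y (u \<ominus> total gs)"
  using assms
 proof (induction gs arbitrary: u)
  case Nil
  then show ?case by (simp add: minus_eq)
 next
  case (Cons s gs)
  have s: "s \<in> carrier G" "u \<ominus> s \<in> carrier G" "set gs <= carrier G" using Cons.prems by auto
  have 1: "conv (offsets (s # gs)) (indicator Y) u = indicator Y u + conv (offsets gs) (indicator Y) (u \<ominus> s)"
   using s Cons.prems by (simp add: conv_translate offsets_carrier minus_eq)
  have 2: "(u \<ominus> s) \<ominus> total gs = u \<ominus> total (s # gs)"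
   using s Cons.prems total_closed[of gs] unfolding total.simps by algebra
  have 3: "indicator (self_overlap Y s) u <= (indicator Y u :: real)"
   "indicator (self_overlap Y s) u <= (indicator Y (u \<ominus> s) :: real)"
   by (auto simp: self_overlap_def indicator_def)
  show ?case unfolding 1 using Cons.IH[OF s(3,2)] 3 by (simp add: 2)
 qed
 then show "overlaps Y gs u <= conv (offsets gs) (indicator Y) u"
  "indicator Y u + overlaps Y gs u <= conv (offsets gs) (indicator Y) u + indicator Y (u \<ominus> total gs)"
  by auto
qed

lemma lo_overlaps:
 assumes "set gs <= carrier G" "!!s. s \<in> set gs ==> lo (indicator (self_overlap Y s)) c"
 shows "lo (overlaps Y gs) (real (length gs) * c)"
 using assms
proof (induction gs)
 case Nil
 then show ?case using lo_zero by simp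
next
 case (Cons s gs)
 have "lo (%u. overlaps Y gs (u \<oplus> \<ominus> s)) (real (length gs) * c)"
  using Cons by (intro lo_translate) auto
 then have "lo (%u. indicator (self_overlap Y s) u + overlaps Y gs (u \<oplus> \<ominus> s)) (c + real (length gs) * c)"
  using Cons by (intro lo_add) auto
 then show ?case
  by (simp add: algebra_simps minus_eq overlaps.simps[abs_def])
qed

text \<open>If the total is no difference of elements of \<open>Y\<close>, then \<open>Y\<close> and its translate are disjoint, and the second
  inequality on overlaps makes \<open>Y\<close> larger by the factor \<open>(n + 1) / n\<close> than it can be.\<close>

lemma total_in_difference_set:
 assumes gs: "set gs <= carrier G" "length gs = n" "n > 0" and Y: "Y <= carrier G"
  and Yc: "lo (indicator Y) c"
  and ov: "!!s. s \<in> set gs ==> lo (indicator (self_overlap Y s)) c"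
  and not: "\<not> lo (indicator Y) (real (n + 1) / real n * c)"
 shows "\<exists>y\<in>Y. \<exists>z\<in>Y. total gs = y \<ominus> z"
proof (rule ccontr)
 assume none: "\<not> ?thesis"
 have "lo (%u. indicator Y u + overlaps Y gs u) (c + real n * c)"
  using lo_add[OF Yc lo_overlaps[OF gs(1) ov]] gs by simp
 moreover have "indicator Y u + overlaps Y gs u <= conv (offsets gs) (indicator Y) u"
  if u: "u \<in> carrier G" for u
 proof (cases "u \<in> Y & u \<ominus> total gs \<in> Y")
  case True
  have "total gs = u \<ominus> (u \<ominus> total gs)" using u gs(1) total_closed[of gs] by algebra
  then show ?thesis using True none by blast
 next
  case False
  then show ?thesis using overlaps_le[OF gs(1) u, of Y] by (auto simp: indicator_def split: if_splits)
 qed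
 ultimately have "lo (conv (offsets gs) (indicator Y)) (c + real n * c)"
  by - (erule lo_mono, simp)
 then have "lo (indicator Y) ((c + real n * c) / real (length (offsets gs)))"
  by (rule lo_conv) (use gs offsets_carrier[OF gs(1)] in \<open>auto simp flip: length_greater_0_conv\<close>)
 then have "lo (indicator Y) ((c + real n * c) / real n)" by (simp add: gs)
 moreover have "(c + real n * c) / real n = real (n + 1) / real n * c" by (simp add: field_simps)
 ultimately show False using not by simp
qed

text \<open>Eight summands allow for differences of two sums of four: a good kernel is a set one step
  down in a chain of sets shrinking to a subgroup.\<close>

definition good_kernel :: "'a set => bool" where
 "good_kernel S \<longleftrightarrow> S <= carrier G & \<zero> \<in> S & (\<forall>g\<in>S. \<ominus> g \<in> S) \<and>
   (\<forall>gs. length gs = 8 --> set gs <= S -->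
    (\<exists>a\<in>X. \<exists>b\<in>X. \<exists>c\<in>X. \<exists>d\<in>X. total gs = a \<oplus> b \<oplus> (c \<oplus> d))) \<and>
   (\<exists>F. finite F & F <= X & (\<forall>x\<in>X. \<exists>f\<in>F. x \<ominus> f \<in> S))"

text \<open>The elements \<open>g\<close> for which the overlap of \<open>B\<close> with its translate by \<open>g\<close> is not small.\<close>

definition stab :: "nat => real => 'a set => 'a set" where
 "stab i s B = {g \<in> carrier G. \<not> up i (indicator (self_overlap B g)) s \<and>
   \<not> up i (indicator (self_overlap B (\<ominus> g))) s}"

lemma self_overlap_zero: "B <= carrier G ==> self_overlap B \<zero> = B"
 by (auto simp: self_overlap_def minus_eq)

lemma finite_cover_of_no_separated:
 fixes N :: nat
 assumes "!!g. \<forall>a<N. g a \<in> X ==> \<exists>a<N. \<exists>b<N. a < b & g b \<ominus> g a \<in> S"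
 shows "\<exists>F. finite F & F <= X & (\<forall>x\<in>X. \<exists>f\<in>F. x \<ominus> f \<in> S)"
proof (rule ccontr)
 assume none: "\<not> ?thesis"
 have "\<exists>g. (\<forall>a<n. g a \<in> X) & (\<forall>a<n. \<forall>b<n. a < b --> g b \<ominus> g a \<notin> S)" for n :: nat
 proof (induction n)
  case (Suc n)
  then obtain g where g: "\<forall>a<n. g a \<in> X" "\<forall>a<n. \<forall>b<n. a < b --> g b \<ominus> g a \<notin> S" by blast
  have "finite (g ` {..<n})" "g ` {..<n} <= X" using g by auto
  then have "\<not> (\<forall>x\<in>X. \<exists>f\<in>g ` {..<n}. x \<ominus> f \<in> S)"
   using none by (elim contrapos_nn) (rule exI[of _ "g ` {..<n}"], simp)
  then obtain x where x: "x \<in> X" "\<forall>f\<in>g ` {..<n}. x \<ominus> f \<notin> S" by auto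
  have "(\<forall>a<Suc n. (g(n := x)) a \<in> X) \<and>
    (\<forall>a<Suc n. \<forall>b<Suc n. a < b --> (g(n := x)) b \<ominus> (g(n := x)) a \<notin> S)"
   using g x by (auto simp: less_Suc_eq)
  then show ?case by (rule exI[of _ "g(n := x)"])
 qed auto
 from this[of N] obtain g where g: "\<forall>a<N. g a \<in> X" "\<forall>a<N. \<forall>b<N. a < b --> g b \<ominus> g a \<notin> S"
  by (elim exE conjE)
 from assms[OF g(1)] g(2) show False by blast
qed

text \<open>Induction on \<open>l\<close>, that is, on the room left for \<open>B + X\<close> to be large. Either the elements of
  the stabilizer of \<open>B\<close> qualify, by the bound on totals applied to \<open>B + X\<close>; or some overlap \<open>B \<inter> (g + B)\<close> satisfies a
  stronger bound and takes the role of \<open>B\<close>. The factor \<open>9 / 8\<close> is \<open>(n + 1) / n\<close> for eight summands.\<close>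

theorem good_kernel_step:
 fixes DD :: "'a set set"
 assumes inter: "!!B g. B \<in> DD ==> B <= X ==> g \<in> carrier G ==> self_overlap B g \<in> DD"
  and stab: "!!B i s. B \<in> DD ==> B <= X ==> i > 0 ==> s > 0 ==> stab i s B \<in> DD"
 shows "t > 0 ==> \<exists>i. \<forall>B. B \<in> DD --> B <= X --> \<not> up i (indicator B) t -->
   \<not> lo (indicator (B <+>\<^bsub>G\<^esub> X)) ((9 / 8) ^ l) --> (\<exists>S\<in>DD. good_kernel S)"
proof (induction l arbitrary: t)
 case 0
 have "lo (indicator (B <+>\<^bsub>G\<^esub> X)) 1" if "B <= X" "\<not> up 1 (indicator B) t" for B
 proof -
  have "B \<noteq> {}"
  proof
   assume "B = {}"
   moreover have "up 1 (indicator {}) t"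
    using up_zero \<open>t > 0\<close> by (intro up_mono[OF up_zero[folded One_nat_def]]) auto
   ultimately show False using that by simp
  qed
  then obtain b where b: "b \<in> B" by auto
  show ?thesis by (rule lo_one[of b]) (use b that in \<open>auto simp: set_add_def'\<close>)
 qed
 then show ?case by (intro exI[of _ 1]) auto
next
 case (Suc l)
 obtain N :: nat and s where s: "s > 0" and gen: "!!i. \<exists>k. \<forall>B. B <= X --> \<not> up k (indicator B) t -->
  \<not> (\<exists>g. (\<forall>a<N. g a \<in> X) & (\<forall>a<N. \<forall>b<N. a < b -->
    up i (indicator (self_overlap B (g b \<ominus> g a))) s \<or>
    up i (indicator (self_overlap B (g a \<ominus> g b))) s))"
  using generic_stabilizer[OF \<open>t > 0\<close>] by (elim exE conjE) (rule that, assumption, erule spec)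
 obtain i0 where i0: "!!B. B \<in> DD ==> B <= X ==> \<not> up i0 (indicator B) s ==>
   \<not> lo (indicator (B <+>\<^bsub>G\<^esub> X)) ((9 / 8) ^ l) ==> \<exists>S\<in>DD. good_kernel S"
  using Suc.IH[OF s] by blast
 define i where "i = Suc i0"
 have "i0 <= i" by (simp add: i_def)
 then have i: "!!B. B \<in> DD ==> B <= X ==> \<not> up i (indicator B) s ==>
   \<not> lo (indicator (B <+>\<^bsub>G\<^esub> X)) ((9 / 8) ^ l) ==> \<exists>S\<in>DD. good_kernel S"
  using i0 up_level by blast
 obtain k where raw: "\<forall>B. B <= X --> \<not> up k (indicator B) t -->
  \<not> (\<exists>g. (\<forall>a<N. g a \<in> X) & (\<forall>a<N. \<forall>b<N. a < b -->
    up i (indicator (self_overlap B (g b \<ominus> g a))) s \<or>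
    up i (indicator (self_overlap B (g a \<ominus> g b))) s))"
  using gen[of i] by (elim exE)
 have k: "\<exists>a<N. \<exists>b<N. a < b & \<not> up i (indicator (self_overlap B (g b \<ominus> g a))) s \<and>
    \<not> up i (indicator (self_overlap B (g a \<ominus> g b))) s"
  if B: "B <= X" "\<not> up k (indicator B) t" and g: "\<forall>a<N. g a \<in> X" for B g
 proof (rule ccontr)
  assume "\<not> ?thesis"
  then have "(\<forall>a<N. g a \<in> X) & (\<forall>a<N. \<forall>b<N. a < b -->
    up i (indicator (self_overlap B (g b \<ominus> g a))) s \<or>
    up i (indicator (self_overlap B (g a \<ominus> g b))) s)" using g by blast
  then show False using raw[rule_format, OF B] by (elim notE) (rule exI[of _ g])
 qed
 show ?case
 proof (rule exI[of _ "k + i"], intro allI impI)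
  fix B
  assume B: "B \<in> DD" "B <= X" "\<not> up (k + i) (indicator B) t"
   and notlo: "\<not> lo (indicator (B <+>\<^bsub>G\<^esub> X)) ((9 / 8) ^ Suc l)"
  have large: "\<not> up k (indicator B) t" using B(3) up_level by (meson le_add1)
  define S where "S = stab i s B"
  define Y where "Y = B <+>\<^bsub>G\<^esub> X"
  have Yc: "Y <= carrier G" using B(2) by (auto simp: Y_def set_add_def')
  show "\<exists>S\<in>DD. good_kernel S"
  proof (cases "\<exists>g\<in>S. \<not> lo (indicator (self_overlap B g <+>\<^bsub>G\<^esub> X)) ((9 / 8) ^ l)")
   case True
   then obtain g where g: "g \<in> S" "\<not> lo (indicator (self_overlap B g <+>\<^bsub>G\<^esub> X)) ((9 / 8) ^ l)" by blast
   then have "g \<in> carrier G" "\<not> up i (indicator (self_overlap B g)) s" by (auto simp: S_def stab_def)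
   moreover have "self_overlap B g <= X" using B by (auto simp: self_overlap_def)
   ultimately show ?thesis using i[OF inter] B g by blast
  next
   case False
   then have lo: "lo (indicator (self_overlap B g <+>\<^bsub>G\<^esub> X)) ((9 / 8) ^ l)" if "g \<in> S" for g
    using that by blast
   have ovl: "lo (indicator (self_overlap Y g)) ((9 / 8) ^ l)" if g: "g \<in> S" for g
   proof (rule lo_mono[OF lo[OF g]])
    fix u assume "u \<in> carrier G"
    have "self_overlap B g <+>\<^bsub>G\<^esub> X <= self_overlap Y g"
    proof
     fix w assume "w \<in> self_overlap B g <+>\<^bsub>G\<^esub> X"
     then obtain b x where w: "b \<in> B" "b \<ominus> g \<in> B" "x \<in> X" "w = b \<oplus> x"
      by (auto simp: self_overlap_def set_add_def')
     then have cc: "b \<in> carrier G" "x \<in> carrier G" "g \<in> carrier G"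
      using B g by (auto simp: S_def stab_def)
     have "w \<ominus> g = (b \<ominus> g) \<oplus> x" unfolding w using cc by algebra
     then show "w \<in> self_overlap Y g" using w by (auto simp: self_overlap_def Y_def set_add_def')
    qed
    then show "indicator (self_overlap B g <+>\<^bsub>G\<^esub> X) u <= (indicator (self_overlap Y g) u :: real)"
     by (auto simp: indicator_def)
   qed
   have ex0: "\<exists>a<N. \<exists>b<N. a < b & g b \<ominus> g a \<in> S" if g: "\<forall>a<N. g a \<in> X" for g
   proof -
    obtain a b where ab: "a < N" "b < N" "a < b"
     "\<not> up i (indicator (self_overlap B (g b \<ominus> g a))) s"
     "\<not> up i (indicator (self_overlap B (g a \<ominus> g b))) s"
     using k[OF B(2) large g] by blast
    have "\<ominus> (g b \<ominus> g a) = g a \<ominus> g b"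
     using g ab X_closed[of "g a"] X_closed[of "g b"] by (simp add: minus_eq minus_add a_comm)
    then have "g b \<ominus> g a \<in> S" using ab g by (auto simp: S_def stab_def)
    then show ?thesis using ab by blast
   qed
   have zS: "\<zero> \<in> S"
   proof -
    obtain a b where "a < N" "b < N"
     "\<not> up i (indicator (self_overlap B (\<zero> \<ominus> \<zero>))) s"
     using k[OF B(2) large, of "%_. \<zero>"] zero_X by blast
    then show ?thesis by (auto simp: S_def stab_def minus_eq)
   qed
   have "self_overlap Y \<zero> = Y" by (rule self_overlap_zero[OF Yc])
   then have Ylo: "lo (indicator Y) ((9 / 8) ^ l)" using ovl[OF zS] by simp
   have "good_kernel S"
    unfolding good_kernel_def
   proof (intro conjI allI impI ballI)
    show "S <= carrier G" by (auto simp: S_def stab_def)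
    show "\<zero> \<in> S" by (rule zS)
    show "\<ominus> g \<in> S" if "g \<in> S" for g using that by (auto simp: S_def stab_def)
    show "\<exists>F. finite F & F <= X & (\<forall>x\<in>X. \<exists>f\<in>F. x \<ominus> f \<in> S)"
     using ex0 by (rule finite_cover_of_no_separated)
    fix gs :: "'a list" assume gs: "length gs = 8" "set gs <= S"
    have gsc: "set gs <= carrier G" using gs by (auto simp: S_def stab_def)
    have "\<exists>y\<in>Y. \<exists>z\<in>Y. total gs = y \<ominus> z"
    proof (rule total_in_difference_set[OF gsc gs(1) _ Yc Ylo])
     show "lo (indicator (self_overlap Y s)) ((9 / 8) ^ l)" if "s \<in> set gs" for s
      using ovl that gs by auto
     show "\<not> lo (indicator Y) (real (8 + 1) / real 8 * (9 / 8) ^ l)"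
      using notlo by (simp add: Y_def)
    qed auto
    then obtain b x c z where yz: "b \<in> B" "x \<in> X" "c \<in> B" "z \<in> X"
      "total gs = (b \<oplus> x) \<ominus> (c \<oplus> z)" by (auto simp: Y_def set_add_def')
    then have X': "b \<in> X" "x \<in> X" "c \<in> X" "z \<in> X" using B by auto
    have "total gs = b \<oplus> x \<oplus> (\<ominus> c \<oplus> \<ominus> z)"
     unfolding yz(5) using X'[THEN X_closed] by algebra
    then show "\<exists>a\<in>X. \<exists>b\<in>X. \<exists>c\<in>X. \<exists>d\<in>X. total gs = a \<oplus> b \<oplus> (c \<oplus> d)"
     using X' neg_X by blast
   qed
   then show ?thesis using stab[OF B(1,2) _ s, of i] by (auto simp: S_def i_def)
  qed
 qed
qed

theorem ex_good_kernel:
 fixes DD :: "'a set set"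
 assumes inter: "!!B g. B \<in> DD ==> B <= X ==> g \<in> carrier G ==> self_overlap B g \<in> DD"
  and stab: "!!B i s. B \<in> DD ==> B <= X ==> i > 0 ==> s > 0 ==> stab i s B \<in> DD"
  and X: "X \<in> DD"
 shows "\<exists>S\<in>DD. good_kernel S"
proof -
 obtain l where l: "real (length Fs) < (9 / 8) ^ l"
  using real_arch_pow[of "9/8" "real (length Fs)"] by auto
 obtain i where i: "!!B. B \<in> DD ==> B <= X ==> \<not> up i (indicator B) (1 / 2) ==>
   \<not> lo (indicator (B <+>\<^bsub>G\<^esub> X)) ((9 / 8) ^ l) ==> \<exists>S\<in>DD. good_kernel S"
  using good_kernel_step[OF inter stab, of "1/2" l] by auto
 have "lo (indicator X) 1" by (rule lo_one[of \<zero>]) auto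
 then have "\<not> up i (indicator X) (1 / 2)" using lo_le_up by force
 moreover obtain k where "up k (indicator (X <+>\<^bsub>G\<^esub> X)) (real (length Fs))" using up_double by blast
 then have "\<not> lo (indicator (X <+>\<^bsub>G\<^esub> X)) ((9 / 8) ^ l)" using lo_le_up l by force
 ultimately show ?thesis using i X by blast
qed

end

section \<open>Definable relations between tuples\<close>

lemma eval_term_cong: "(!!n. n \<in> fv_term t ==> e n = e' n) ==> eval_term N e t = eval_term N e' t"
proof (induction t)
 case (FApp f ts)
 have "map (eval_term N e) ts = map (eval_term N e') ts"
  using FApp by (intro map_cong) auto
 then show ?case by (simp only: eval_term.simps)
qed auto

lemma sat_cong: "(!!n. n \<in> fv \<phi> ==> e n = e' n) ==> sat N e \<phi> = sat N e' \<phi>"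
proof (induction \<phi> arbitrary: e e')
 case (FEq s t)
 then show ?case using eval_term_cong[of s e e' N] eval_term_cong[of t e e' N] by auto
next
 case (FRel p ts)
 have "map (eval_term N e) ts = map (eval_term N e') ts"
  using FRel by (intro map_cong eval_term_cong) auto
 then show ?case by (simp only: sat.simps)
next
 case (FNeg \<phi>)
 then show ?case by (metis fv.simps(3) sat.simps(3))
next
 case (FAnd \<phi> \<psi>)
 have "sat N e \<phi> = sat N e' \<phi>" "sat N e \<psi> = sat N e' \<psi>"
  using FAnd.prems by (auto intro!: FAnd.IH)
 then show ?case by simp
next
 case (FEx i \<phi>)
 have "sat N (e(i := a)) \<phi> = sat N (e'(i := a)) \<phi>" for a
  using FEx.prems by (intro FEx.IH) auto
 then show ?case by simp
qed

lemma finite_fv_term: "finite (fv_term t)"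
 by (induction t) auto

lemma finite_fv: "finite (fv \<phi>)"
 by (induction \<phi>) (auto simp: finite_fv_term)

primrec rename_term :: "(nat => nat) => 'f fo_term => 'f fo_term" where
 "rename_term \<rho> (FVar i) = FVar (\<rho> i)"
| "rename_term \<rho> (FApp f ts) = FApp f (map (rename_term \<rho>) ts)"

lemma term_in_rename: "term_in L (rename_term \<rho> t) = term_in L t"
 by (induction t) (auto simp: list_all_iff)

lemma fv_rename_term: "fv_term (rename_term \<rho> t) = \<rho> ` fv_term t"
 by (induction t) auto

lemma eval_rename_term: "eval_term N e (rename_term \<rho> t) = eval_term N (%i. e (\<rho> i)) t"
proof (induction t)
 case (FApp f ts)
 then have "map (eval_term N e \<circ> rename_term \<rho>) ts = map (eval_term N (%i. e (\<rho> i))) ts"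
  by (intro map_cong) (auto simp: o_def)
 then show ?case by (simp only: rename_term.simps eval_term.simps map_map)
qed auto

lemma rename_formula:
 "form_in L \<phi> ==> \<exists>\<psi>. form_in L \<psi> & fv \<psi> <= \<rho> ` fv \<phi> \<and>
   (\<forall>(N :: ('f, 'p, 'a) struct) e. sat N e \<psi> = sat N (%i. e (\<rho> i)) \<phi>)"
proof (induction \<phi> arbitrary: \<rho>)
 case (FEq s t)
 then show ?case
  by (intro exI[of _ "FEq (rename_term \<rho> s) (rename_term \<rho> t)"])
   (auto simp: term_in_rename fv_rename_term eval_rename_term)
next
 case (FRel p ts)
 have "map (eval_term N e \<circ> rename_term \<rho>) ts = map (eval_term N (%i. e (\<rho> i))) ts"
  for N :: "('f, 'p, 'a) struct" and e
  by (intro map_cong) (auto simp: eval_rename_term)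
 then have "sat N e (FRel p (map (rename_term \<rho>) ts)) = sat N (%i. e (\<rho> i)) (FRel p ts)"
  for N :: "('f, 'p, 'a) struct" and e
  by (simp only: sat.simps map_map)
 moreover have "form_in L (FRel p (map (rename_term \<rho>) ts))"
  "fv (FRel p (map (rename_term \<rho>) ts)) <= \<rho> ` fv (FRel p ts)"
  using FRel by (auto simp: term_in_rename fv_rename_term list_all_iff)
 ultimately show ?case by blast
next
 case (FNeg \<phi>)
 then obtain \<psi> where "form_in L \<psi>" "fv \<psi> <= \<rho> ` fv \<phi>"
  "\<forall>(N :: ('f, 'p, 'a) struct) e. sat N e \<psi> = sat N (%i. e (\<rho> i)) \<phi>" by fastforce
 then show ?case by (intro exI[of _ "FNeg \<psi>"]) auto
next
 case (FAnd \<phi> \<phi>')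
 obtain \<psi> where \<psi>: "form_in L \<psi>" "fv \<psi> <= \<rho> ` fv \<phi>"
  "\<forall>(N :: ('f, 'p, 'a) struct) e. sat N e \<psi> = sat N (%i. e (\<rho> i)) \<phi>"
  using FAnd.IH(1)[of \<rho>] FAnd.prems by auto
 obtain \<psi>' where "form_in L \<psi>'" "fv \<psi>' <= \<rho> ` fv \<phi>'"
  "\<forall>(N :: ('f, 'p, 'a) struct) e. sat N e \<psi>' = sat N (%i. e (\<rho> i)) \<phi>'"
  using FAnd.IH(2)[of \<rho>] FAnd.prems by auto
 with \<psi> show ?case by (intro exI[of _ "FAnd \<psi> \<psi>'"]) auto
next
 case (FEx i \<phi>)
 obtain n where n: "n \<notin> \<rho> ` fv \<phi>"
  using finite_fv[of \<phi>] ex_new_if_finite[of "\<rho> ` fv \<phi>"] infinite_UNIV_nat by blast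
 obtain \<psi> where \<psi>: "form_in L \<psi>" "fv \<psi> <= \<rho>(i := n) ` fv \<phi>"
  "\<forall>(N :: ('f, 'p, 'a) struct) e. sat N e \<psi> = sat N (%j. e ((\<rho>(i := n)) j)) \<phi>"
  using FEx.IH[of "\<rho>(i := n)"] FEx.prems by auto
 have "sat N (e(n := a)) \<psi> = sat N ((%i. e (\<rho> i))(i := a)) \<phi>" for N :: "('f, 'p, 'a) struct" and e a
  unfolding \<psi>(3)[rule_format] using n by (intro sat_cong) auto
 moreover have "fv \<psi> - {n} <= \<rho> ` (fv \<phi> - {i})" using \<psi>(2) by auto
 ultimately show ?case using \<psi>(1) by (intro exI[of _ "FEx n \<psi>"]) auto
qed

lemma sat_exists_many:
 "sat N e (foldr FEx ns \<phi>) \<longleftrightarrow>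
   (\<exists>e'. (\<forall>m. m \<notin> set ns --> e' m = e m) & (\<forall>m\<in>set ns. e' m \<in> universe N) & sat N e' \<phi>)"
proof (induction ns arbitrary: e)
 case Nil
 have "e' = e" if "\<forall>m. e' m = e m" for e' using that by auto
 then show ?case by auto
next
 case (Cons n ns)
 show ?case
 proof
  assume "sat N e (foldr FEx (n # ns) \<phi>)"
  then obtain a where "a \<in> universe N" "sat N (e(n := a)) (foldr FEx ns \<phi>)" by auto
  then obtain e' where e': "\<forall>m. m \<notin> set ns --> e' m = (e(n := a)) m" "\<forall>m\<in>set ns. e' m \<in> universe N"
   "sat N e' \<phi>" unfolding Cons by blast
  then have "e' n \<in> universe N" using \<open>a \<in> universe N\<close> by (cases "n \<in> set ns") auto
  then show "\<exists>e'. (\<forall>m. m \<notin> set (n # ns) --> e' m = e m) & (\<forall>m\<in>set (n # ns). e' m \<in> universe N) & sat N e' \<phi>"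
   using e' by (intro exI[of _ e']) auto
 next
  assume "\<exists>e'. (\<forall>m. m \<notin> set (n # ns) --> e' m = e m) & (\<forall>m\<in>set (n # ns). e' m \<in> universe N) & sat N e' \<phi>"
  then obtain e' where e': "\<forall>m. m \<notin> set (n # ns) --> e' m = e m"
   "\<forall>m\<in>set (n # ns). e' m \<in> universe N" "sat N e' \<phi>" by blast
  then have "sat N (e(n := e' n)) (foldr FEx ns \<phi>)"
   unfolding Cons by (intro exI[of _ e']) auto
  then show "sat N e (foldr FEx (n # ns) \<phi>)" using e' by auto
 qed
qed

lemma form_in_exists_many: "form_in L (foldr FEx ns \<phi>) = form_in L \<phi>"
 by (induction ns) auto

definition FTrue :: "('f, 'p) fo_form" where "FTrue = FEq (FVar 0) (FVar 0)"

lemma sat_conj_many: "sat N e (foldr FAnd \<phi>s FTrue) \<longleftrightarrow> (\<forall>\<phi>\<in>set \<phi>s. sat N e \<phi>)"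
 by (induction \<phi>s) (auto simp: FTrue_def)

lemma form_in_conj_many: "form_in L (foldr FAnd \<phi>s FTrue) \<longleftrightarrow> (\<forall>\<phi>\<in>set \<phi>s. form_in L \<phi>)"
 by (induction \<phi>s) (auto simp: FTrue_def)

lemma length_concat_map:
 "(!!i. i < n ==> length (v i) = k) ==> length (concat (map v [0..<n])) = n * k"
 by (induction n) auto

lemma nth_concat_map:
 assumes "!!i. i < n ==> length (v i) = k" "m < n * k"
 shows "concat (map v [0..<n]) ! m = v (m div k) ! (m mod k)"
 using assms
proof (induction n)
 case (Suc n)
 have len: "length (concat (map v [0..<n])) = n * k"
  using Suc.prems(1) by (intro length_concat_map) auto
 show ?case
 proof (cases "m < n * k")
  case True
  then show ?thesis using Suc by (simp add: nth_append len)
 next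
  case False
  define r where "r = m - n * k"
  have r: "m = n * k + r" "r < k" using False Suc.prems(2) by (auto simp: r_def)
  then have "m div k = n" "m mod k = r" by auto
  then show ?thesis using False by (simp add: nth_append len r_def)
 qed
qed auto

locale monster =
 fixes L :: "('f, 'p) language" and M C :: "('f, 'p, 'a) struct" and \<kappa> :: "'k rel" and k :: nat
 assumes monster: "monster_model L M \<kappa> C"
begin

context includes cardinal_syntax begin

lemma elem_substruct: "elem_substruct L M C"
 using monster by (simp add: monster_model_def)

lemma M_sub_C: "universe M <= universe C"
 using elem_substruct by (simp add: elem_substruct_def)

lemma M_nonempty: "universe M \<noteq> {}"
 using elem_substruct by (simp add: elem_substruct_def is_struct_def)

lemma elementary: "form_in L \<phi> ==> (!!n. e n \<in> universe M) ==> sat M e \<phi> = sat C e \<phi>"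
 using elem_substruct unfolding elem_substruct_def formulas_def by (simp add: image_subset_iff)

lemma elementary_fv:
 assumes "form_in L \<phi>" "!!n. n \<in> fv \<phi> ==> e n \<in> universe M"
 shows "sat M e \<phi> = sat C e \<phi>"
proof -
 obtain d where d: "d \<in> universe M" using M_nonempty by auto
 let ?e = "%n. if n \<in> fv \<phi> then e n else d"
 have "sat M e \<phi> = sat M ?e \<phi>" by (rule sat_cong) auto
 also have "\<dots> = sat C ?e \<phi>" using assms d by (intro elementary) auto
 also have "\<dots> = sat C e \<phi>" by (rule sat_cong) auto
 finally show ?thesis .
qed

definition T :: "'a list set" where "T = tuples k (universe C)"
definition T0 :: "'a list set" where "T0 = tuples k (universe M)"

lemma T0_sub_T: "T0 <= T"
 using M_sub_C by (auto simp: T_def T0_def tuples_def)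

lemma T0_nonempty: "\<exists>m. m \<in> T0"
proof -
 obtain d where "d \<in> universe M" using M_nonempty by auto
 then have "replicate k d \<in> T0" by (auto simp: T0_def tuples_def)
 then show ?thesis by blast
qed

text \<open>Tuples are stored in the variables by a pairing function: coordinate \<open>j\<close> of the tuple \<open>v i\<close> is variable \<open>(i, j)\<close>. All variables
  with \<open>j \<ge> k\<close> are free for parameters.\<close>

definition env :: "(nat => 'a) => (nat => 'a list) => nat => 'a" where
 "env p v n = (case prod_decode n of (i, j) => if j < k then v i ! j else p n)"

lemma env_encode: "env p v (prod_encode (i, j)) = (if j < k then v i ! j else p (prod_encode (i, j)))"
 by (simp add: env_def)

text \<open>Relations between tuples that are definable over \<open>M\<close>, where finitely many of the variables \<open>v i\<close> occur. The closure
  properties below spare all further work with formulas.\<close>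

definition dfn :: "((nat => 'a list) => bool) => bool" where
 "dfn Q \<longleftrightarrow> (\<exists>\<phi> p. form_in L \<phi> & range p <= universe M \<and>
   (\<forall>v. (\<forall>i. v i \<in> T) --> Q v = sat C (env p v) \<phi>))"

lemma dfnI:
 assumes "form_in L \<phi>" "!!n. p n \<in> universe M"
  "!!v. (!!i. v i \<in> T) ==> Q v = sat C (%i. env p v (\<rho> i)) \<phi>"
 shows "dfn Q"
 using assms rename_formula[OF assms(1), of \<rho>] unfolding dfn_def by (metis image_subset_iff)

lemma dfnE:
 assumes "dfn Q"
 obtains \<phi> p where "form_in L \<phi>" "!!n. p n \<in> universe M"
  "!!v. (!!i. v i \<in> T) ==> Q v = sat C (env p v) \<phi>"
 using assms unfolding dfn_def by (metis rangeI subsetD)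

lemma dfn_cong:
 assumes "dfn P" "!!v. (!!i. v i \<in> T) ==> P v = Q v"
 shows "dfn Q"
 using assms unfolding dfn_def by metis

lemma dfn_not:
 assumes "dfn P" shows "dfn (%v. \<not> P v)"
proof -
 obtain \<phi> p where "form_in L \<phi>" "!!n. p n \<in> universe M"
  "!!v. (!!i. v i \<in> T) ==> P v = sat C (env p v) \<phi>" using dfnE[OF assms] by metis
 then show ?thesis by (intro dfnI[of "FNeg \<phi>" p _ "%i. i"]) auto
qed

lemma dfn_and:
 assumes "dfn P" "dfn Q" shows "dfn (%v. P v & Q v)"
proof -
 obtain \<phi>1 p1 where 1: "form_in L \<phi>1" "!!n. p1 n \<in> universe M"
  "!!v. (!!i. v i \<in> T) ==> P v = sat C (env p1 v) \<phi>1" using dfnE[OF assms(1)] by metis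
 obtain \<phi>2 p2 where 2: "form_in L \<phi>2" "!!n. p2 n \<in> universe M"
  "!!v. (!!i. v i \<in> T) ==> Q v = sat C (env p2 v) \<phi>2" using dfnE[OF assms(2)] by metis
 define \<rho> where "\<rho> b n = (case prod_decode n of (i, j) =>
   if j < k then n else prod_encode (i, k + (2 * (j - k) + b)))" for b n :: nat
 define p where "p n = (case prod_decode n of (i, j) =>
   if even (j - k) then p1 (prod_encode (i, k + (j - k) div 2))
   else p2 (prod_encode (i, k + (j - k) div 2)))" for n
 have e1: "env p v (\<rho> 0 n) = env p1 v n" for v n
 proof -
  obtain i j where "n = prod_encode (i, j)" by (metis prod_decode_inverse surj_pair)
  then show ?thesis by (auto simp: \<rho>_def p_def env_def)
 qed
 have e2: "env p v (\<rho> 1 n) = env p2 v n" for v n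
 proof -
  obtain i j where "n = prod_encode (i, j)" by (metis prod_decode_inverse surj_pair)
  then show ?thesis by (auto simp: \<rho>_def p_def env_def)
 qed
 obtain \<psi>1 where \<psi>1: "form_in L \<psi>1" "!!e. sat C e \<psi>1 = sat C (%i. e (\<rho> 0 i)) \<phi>1"
  using rename_formula[OF 1(1), of "\<rho> 0"] by blast
 obtain \<psi>2 where \<psi>2: "form_in L \<psi>2" "!!e. sat C e \<psi>2 = sat C (%i. e (\<rho> 1 i)) \<phi>2"
  using rename_formula[OF 2(1), of "\<rho> 1"] by blast
 have "(%i. env p v (\<rho> 0 i)) = env p1 v" "(%i. env p v (\<rho> 1 i)) = env p2 v" for v
  by (auto simp: e1 e2[unfolded One_nat_def])
 then show ?thesis
  using 1 2 \<psi>1 \<psi>2 by (intro dfnI[of "FAnd \<psi>1 \<psi>2" p _ "%i. i"]) (auto simp: p_def split: prod.splits)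
qed

lemma dfn_subst:
 assumes "dfn P" shows "dfn (%v. P (%i. v (\<sigma> i)))"
proof -
 obtain \<phi> p where \<phi>: "form_in L \<phi>" "!!n. p n \<in> universe M"
  "!!v. (!!i. v i \<in> T) ==> P v = sat C (env p v) \<phi>" using dfnE[OF assms] by metis
 let ?\<rho> = "%n. case prod_decode n of (i, j) => if j < k then prod_encode (\<sigma> i, j) else n"
 have "env p (%i. v (\<sigma> i)) = (%i. env p v (?\<rho> i))" for v
  by (rule ext) (auto simp: env_def split: prod.splits)
 then show ?thesis using \<phi> by (intro dfnI[of \<phi> p _ ?\<rho>]) auto
qed

lemma dfn_ex_case:
 assumes "dfn P" shows "dfn (%v. \<exists>x\<in>T. P (case_nat x v))"
proof -
 obtain \<phi> p where \<phi>: "form_in L \<phi>" "!!n. p n \<in> universe M"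
  "!!v. (!!i. v i \<in> T) ==> P v = sat C (env p v) \<phi>" using dfnE[OF assms] by metis
 define \<rho> where "\<rho> n = (case prod_decode n of (i, j) =>
   if j < k then (case i of 0 => prod_encode (0, k + j) | Suc i' => prod_encode (i', j))
   else prod_encode (Suc i, j))" for n
 define p' where "p' n = (case prod_decode n of (i, j) => p (prod_encode (i - 1, j)))" for n
 obtain \<psi> where \<psi>: "form_in L \<psi>" "!!e. sat C e \<psi> = sat C (%i. e (\<rho> i)) \<phi>"
  using rename_formula[OF \<phi>(1), of \<rho>] by blast
 define ns where "ns = map (%j. prod_encode (0, k + j)) [0..<k]"
 show ?thesis
 proof (rule dfnI[of "foldr FEx ns \<psi>" p' _ "%i. i"])
  show "form_in L (foldr FEx ns \<psi>)" using \<psi> by (simp add: form_in_exists_many)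
  show "p' n \<in> universe M" for n by (auto simp: p'_def \<phi> split: prod.splits)
  fix v :: "nat => 'a list" assume v: "!!i. v i \<in> T"
  have key: "(%i. e' (\<rho> i)) = env p (case_nat x v)"
   if e': "\<forall>m. m \<notin> set ns --> e' m = env p' v m" and x: "!!j. j < k ==> e' (prod_encode (0, k + j)) = x ! j" for e' x
  proof
   fix n
   obtain i j where n: "n = prod_encode (i, j)" by (metis prod_decode_inverse surj_pair)
   have ns: "prod_encode (a, b) \<in> set ns \<longleftrightarrow> a = 0 & k <= b & b < 2 * k" for a b
    by (auto simp: ns_def image_iff intro!: bexI[of _ "b - k"])
   show "e' (\<rho> n) = env p (case_nat x v) n"
    using x e' by (auto simp: n \<rho>_def env_encode ns p'_def split: nat.splits)
  qed
  show "(\<exists>x\<in>T. P (case_nat x v)) = sat C (env p' v) (foldr FEx ns \<psi>)"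
  proof
   assume "\<exists>x\<in>T. P (case_nat x v)"
   then obtain x where x: "x \<in> T" "P (case_nat x v)" by blast
   define e' where "e' m = (if m \<in> set ns then x ! (snd (prod_decode m) - k) else env p' v m)" for m
   have "(%i. e' (\<rho> i)) = env p (case_nat x v)" by (rule key) (auto simp: e'_def ns_def)
   moreover have "case_nat x v i \<in> T" for i using x v by (cases i) auto
   ultimately have "sat C e' \<psi>" using x \<phi>(3) \<psi>(2) by metis
   moreover have "e' m \<in> universe C" if "m \<in> set ns" for m
    using that x(1) by (auto simp: e'_def ns_def T_def tuples_def)
   ultimately show "sat C (env p' v) (foldr FEx ns \<psi>)"
    unfolding sat_exists_many by (intro exI[of _ e']) (auto simp: e'_def)
  next
   assume "sat C (env p' v) (foldr FEx ns \<psi>)"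
   then obtain e' where e': "\<forall>m. m \<notin> set ns --> e' m = env p' v m" "\<forall>m\<in>set ns. e' m \<in> universe C"
    "sat C e' \<psi>" unfolding sat_exists_many by auto
   define x where "x = map (%j. e' (prod_encode (0, k + j))) [0..<k]"
   have "(%i. e' (\<rho> i)) = env p (case_nat x v)" by (rule key[OF e'(1)]) (simp add: x_def)
   moreover have x: "x \<in> T" using e'(2) by (auto simp: x_def T_def tuples_def ns_def)
   moreover have "case_nat x v i \<in> T" for i using x v by (cases i) auto
   ultimately have "P (case_nat x v)" using e'(3) \<phi>(3) \<psi>(2) by metis
   then show "\<exists>x\<in>T. P (case_nat x v)" using x by blast
  qed
 qed
qed

lemma dfn_ex:
 assumes "dfn (%v. P (v 0) (%i. v (Suc i)))"
 shows "dfn (%v. \<exists>x\<in>T. P x v)"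
 using dfn_ex_case[OF assms] by simp

lemma T_eq_iff: "x \<in> T ==> y \<in> T ==> x = y \<longleftrightarrow> (\<forall>j<k. x ! j = y ! j)"
 by (auto simp: T_def tuples_def intro: nth_equalityI)

lemma dfn_eq: "dfn (%v. v i = v i')"
proof -
 obtain d where d: "d \<in> universe M" using M_nonempty by auto
 show ?thesis
  by (rule dfnI[of "foldr FAnd (map (%j. FEq (FVar (prod_encode (i, j))) (FVar (prod_encode (i', j)))) [0..<k]) FTrue"
     "%_. d" _ "%i. i"])
   (auto simp: form_in_conj_many sat_conj_many d env_encode T_eq_iff)
qed

lemma dfn_const:
 assumes "m \<in> T0" shows "dfn (%v. v i = m)"
proof -
 obtain d where d: "d \<in> universe M" using M_nonempty by auto
 let ?p = "%n. case prod_decode n of (i, j) => if j - k < k then m ! (j - k) else d"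
 have "m \<in> T" using assms T0_sub_T by auto
 then show ?thesis
  by (intro dfnI[of "foldr FAnd (map (%j. FEq (FVar (prod_encode (i, j))) (FVar (prod_encode (i, k + j)))) [0..<k]) FTrue"
     ?p _ "%i. i"])
   (use assms in \<open>auto simp: form_in_conj_many sat_conj_many d env_encode T_eq_iff T0_def tuples_def split: prod.splits\<close>)
qed

lemma dfn_formula:
 assumes "form_in L \<phi>" "fv \<phi> <= {..<n * k + length ps}" "set ps <= universe M"
 shows "dfn (%v. sat C (%i. (concat (map v [0..<n]) @ ps) ! i) \<phi>)"
proof -
 obtain d where d: "d \<in> universe M" using M_nonempty by auto
 define p where "p m = (case prod_decode m of (i, j) => if j - k < length ps then ps ! (j - k) else d)" for m
 define \<rho> where "\<rho> m = (if m < n * k then prod_encode (m div k, m mod k)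
   else prod_encode (0, k + (m - n * k)))" for m
 show ?thesis
 proof (rule dfnI[OF assms(1), of p _ \<rho>])
  show "p m \<in> universe M" for m
   using assms(3) d nth_mem by (auto simp: p_def split: prod.splits)
  fix v :: "nat => 'a list" assume v: "!!i. v i \<in> T"
  have len: "length (v i) = k" for i using v by (auto simp: T_def tuples_def)
  have lenc: "length (concat (map v [0..<n])) = n * k"
   by (rule length_concat_map) (simp add: len)
  show "sat C (%i. (concat (map v [0..<n]) @ ps) ! i) \<phi> = sat C (%i. env p v (\<rho> i)) \<phi>"
  proof (rule sat_cong)
   fix m assume "m \<in> fv \<phi>"
   then have m: "m < n * k + length ps" using assms(2) by auto
   show "(concat (map v [0..<n]) @ ps) ! m = (%i. env p v (\<rho> i)) m"
   proof (cases "m < n * k")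
    case True
    then have "m mod k < k" by (cases k) auto
    then show ?thesis using True nth_concat_map[of n v k m] len
     by (simp add: nth_append lenc \<rho>_def env_encode)
   next
    case False
    then obtain r where "m = n * k + r" by (metis le_Suc_ex not_less)
    then show ?thesis using m by (simp add: nth_append lenc \<rho>_def env_encode p_def)
   qed
  qed
 qed
qed

lemma formula_of_dfn:
 assumes "dfn Q" "!!i. w i \<in> T"
 shows "\<exists>\<psi> ps. (\<psi>, ps) \<in> formulas_over L (n * k) (universe M \<union> (\<Union>i. set (w i))) \<and>
  (\<forall>xs\<in>tuples (n * k) (universe C). sat C (%i. (xs @ ps) ! i) \<psi> \<longleftrightarrow>
    Q (%i. if i < n then take k (drop (i * k) xs) else w i))"
proof -
 obtain \<phi> p where \<phi>: "form_in L \<phi>" "!!n. p n \<in> universe M"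
  "!!v. (!!i. v i \<in> T) ==> Q v = sat C (env p v) \<phi>" using dfnE[OF assms(1)] by metis
 obtain N where N: "fv \<phi> <= {..<N}"
  using finite_fv[of \<phi>] by (meson finite_nat_iff_bounded)
 define \<rho> where "\<rho> m = (case prod_decode m of (i, j) => if j < k & i < n then i * k + j else n * k + m)" for m
 define ps where "ps = map (env p w) [0..<N]"
 obtain \<psi> where \<psi>: "form_in L \<psi>" "fv \<psi> <= \<rho> ` fv \<phi>" "!!e. sat C e \<psi> = sat C (%i. e (\<rho> i)) \<phi>"
  using rename_formula[OF \<phi>(1), of \<rho>] by blast
 have len: "length (w i) = k" for i using assms(2) by (auto simp: T_def tuples_def)
 have small: "i * k + j < n * k" if "i < n" "j < k" for i j
 proof -
  have "i * k + j < Suc i * k" using that by simp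
  also have "\<dots> <= n * k" using that by (intro mult_le_mono1) auto
  finally show ?thesis .
 qed
 have "fv \<psi> <= {..<n * k + length ps}"
 proof
  fix m assume "m \<in> fv \<psi>"
  then obtain m' where "m' \<in> fv \<phi>" "m = \<rho> m'" using \<psi> by auto
  then show "m \<in> {..<n * k + length ps}" using N small
   by (cases "prod_decode m'") (auto simp: \<rho>_def ps_def intro: trans_less_add1)
 qed
 moreover have "set ps <= universe M \<union> (\<Union>i. set (w i))"
 proof
  fix x assume "x \<in> set ps"
  then obtain m where m: "x = env p w m" by (auto simp: ps_def)
  obtain i j where ij: "m = prod_encode (i, j)" by (metis prod_decode_inverse surj_pair)
  have "w i ! j \<in> set (w i)" if "j < k" using that len by simp
  then show "x \<in> universe M \<union> (\<Union>i. set (w i))" using \<phi>(2) by (auto simp: m ij env_encode)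
 qed
 ultimately have "(\<psi>, ps) \<in> formulas_over L (n * k) (universe M \<union> (\<Union>i. set (w i)))"
  using \<psi>(1) by (auto simp: formulas_over_def formulas_def)
 moreover have "sat C (%i. (xs @ ps) ! i) \<psi> \<longleftrightarrow>
    Q (%i. if i < n then take k (drop (i * k) xs) else w i)" if xs: "xs \<in> tuples (n * k) (universe C)" for xs
 proof -
  let ?v = "%i. if i < n then take k (drop (i * k) xs) else w i"
  have lx: "length xs = n * k" using xs by (auto simp: tuples_def)
  have tk: "take k (drop (i * k) xs) \<in> T" if "i < n" for i
  proof -
   have "i * k + k <= n * k" using that by (metis Suc_leI add.commute mult_Suc mult_le_mono1)
   then show ?thesis using xs by (auto simp: T_def tuples_def dest!: in_set_takeD in_set_dropD)
  qed
  then have v: "?v i \<in> T" for i using assms(2) by auto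
  have "sat C (%i. (xs @ ps) ! i) \<psi> = sat C (env p ?v) \<phi>"
   unfolding \<psi>(3)
  proof (rule sat_cong)
   fix m assume "m \<in> fv \<phi>"
   then have m: "m < N" using N by auto
   obtain i j where ij: "m = prod_encode (i, j)" by (metis prod_decode_inverse surj_pair)
   show "(%i. (xs @ ps) ! (\<rho> i)) m = env p ?v m"
    using m small[of i j] lx by (auto simp: ij \<rho>_def nth_append env_encode ps_def)
  qed
  then show ?thesis using \<phi>(3) v by simp
 qed
 ultimately show ?thesis by blast
qed

text \<open>The witnesses that already lie in \<open>M\<close> are kept, which makes them available as parameters.\<close>

lemma tarski_vaught:
 assumes "dfn Q" "!!i. v i \<in> T" "Q v"
 shows "\<exists>w. (\<forall>i. w i \<in> T0) & Q w & (\<forall>i. v i \<in> T0 --> w i = v i)"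
proof -
 obtain \<phi> p where \<phi>: "form_in L \<phi>" "!!n. p n \<in> universe M"
  "!!v. (!!i. v i \<in> T) ==> Q v = sat C (env p v) \<phi>" using dfnE[OF assms(1)] by metis
 obtain d where d: "d \<in> universe M" using M_nonempty by auto
 obtain ns where ns: "set ns = {n \<in> fv \<phi>. env p v n \<notin> universe M}"
  using finite_list[of "{n \<in> fv \<phi>. env p v n \<notin> universe M}"] finite_fv[of \<phi>] by auto
 define e where "e n = (if env p v n \<in> universe M then env p v n else d)" for n
 have univ: "env p v n \<in> universe C" for n
  using assms(2) \<phi>(2) M_sub_C
  by (auto simp: env_def T_def tuples_def split: prod.splits) (metis nth_mem subsetD)
 have "sat C (env p v) \<phi>" using \<phi>(3)[of v] assms by simp
 then have "sat C e (foldr FEx ns \<phi>)"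
  unfolding sat_exists_many
  by (intro exI[of _ "%n. if n \<in> fv \<phi> then env p v n else e n"])
   (auto simp: ns e_def univ M_sub_C[THEN subsetD] d intro: sat_cong[THEN iffD1, rotated])
 then have "sat M e (foldr FEx ns \<phi>)"
  using \<phi>(1) d by (subst elementary) (auto simp: form_in_exists_many e_def)
 then obtain e' where e': "\<forall>m. m \<notin> set ns --> e' m = e m" "\<forall>m\<in>set ns. e' m \<in> universe M" "sat M e' \<phi>"
  unfolding sat_exists_many by blast
 have e'M: "e' n \<in> universe M" for n using e' d by (cases "n \<in> set ns") (auto simp: e_def)
 define w where "w i = map (%j. e' (prod_encode (i, j))) [0..<k]" for i
 have w: "w i \<in> T0" for i using e'M by (auto simp: w_def T0_def tuples_def)
 then have wT: "w i \<in> T" for i using T0_sub_T by auto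
 have "sat C e' \<phi>" using e' \<phi>(1) e'M elementary by blast
 moreover have "sat C e' \<phi> = sat C (env p w) \<phi>"
 proof (rule sat_cong)
  fix m assume "m \<in> fv \<phi>"
  obtain i j where ij: "m = prod_encode (i, j)" by (metis prod_decode_inverse surj_pair)
  show "e' m = env p w m"
  proof (cases "j < k")
   case True then show ?thesis by (simp add: ij env_encode w_def)
  next
   case False
   then have "env p v m = p m" by (simp add: ij env_encode)
   then have "m \<notin> set ns" "e m = p m" using \<phi>(2) by (auto simp: ns e_def)
   then show ?thesis using e'(1) False by (simp add: ij env_encode)
  qed
 qed
 ultimately have "Q w" using \<phi>(3) wT by simp
 moreover have "w i = v i" if "v i \<in> T0" for i
 proof (rule nth_equalityI)
  have v: "length (v i) = k" "set (v i) <= universe M" using that by (auto simp: T0_def tuples_def)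
  then show "length (w i) = length (v i)" by (simp add: w_def)
  fix j assume "j < length (w i)"
  then have j: "j < k" by (simp add: w_def)
  then have "v i ! j \<in> universe M" using v by auto
  then have "prod_encode (i, j) \<notin> set ns" "e (prod_encode (i, j)) = v i ! j"
   using j by (auto simp: ns env_encode e_def)
  then show "w i ! j = v i ! j" using e'(1) j by (simp add: w_def)
 qed
 ultimately show ?thesis using w by blast
qed

definition small :: "'b set => bool" where
 "small B \<longleftrightarrow> |B| <o \<kappa>"

lemma kappa: "Card_order \<kappa>" "cinfinite \<kappa>" "\<not> finite (Field \<kappa>)"
 using monster by (auto simp: monster_model_def strong_limit_def cinfinite_def)

lemma small_formulas: "small (formulas L)" and small_universe: "small (universe M)"
proof -
 have *: "|formulas L| +c |universe M| <o \<kappa>" using monster by (simp add: monster_model_def)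
 show "small (formulas L)"
  unfolding small_def by (rule ordLeq_ordLess_trans[OF ordLeq_csum1[OF card_of_Card_order] *])
 show "small (universe M)"
  unfolding small_def by (rule ordLeq_ordLess_trans[OF ordLeq_csum2[OF card_of_Card_order] *])
qed

lemma small_subset: "small B ==> A <= B ==> small A"
 unfolding small_def by (meson card_of_mono1 ordLeq_ordLess_trans)

lemma small_image: "small B ==> small (f ` B)"
 unfolding small_def by (meson card_of_image ordLeq_ordLess_trans)

lemma small_Un: "small A ==> small B ==> small (A \<union> B)"
 unfolding small_def using card_of_Un_ordLess_infinite_Field kappa by blast

lemma small_nat: "small (UNIV :: nat set)"
proof -
 let ?f = "%n. FEq (FVar n) (FVar n) :: ('f, 'p) fo_form"
 have "inj ?f" by (auto simp: inj_def)
 moreover have "range ?f <= formulas L" by (auto simp: formulas_def)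
 ultimately have "|UNIV :: nat set| \<le>o |formulas L|" by (meson card_of_ordLeq)
 then show ?thesis using small_formulas unfolding small_def by (rule ordLeq_ordLess_trans)
qed

lemma small_Times:
 assumes "small A" "small B" shows "small (A \<times> B)"
proof -
 let ?E = "(A <+> B) <+> (UNIV :: nat set)"
 have "small ?E"
  using assms small_nat kappa card_of_Plus_ordLess_infinite_Field unfolding small_def by metis
 moreover have "infinite ?E" by (simp add: finite_Plus_iff)
 then have "|?E \<times> ?E| =o |?E|" by (rule card_of_Times_same_infinite)
 moreover have "|A \<times> B| \<le>o |?E \<times> ?E|"
  by (rule card_of_ordLeqI[of "%(a, b). (Inl (Inl a), Inl (Inr b))"]) (auto simp: inj_on_def)
 ultimately show ?thesis unfolding small_def
  by (meson ordLeq_ordLess_trans ordIso_ordLess_trans)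
qed

lemma small_countable: "countable A ==> small A"
proof -
 assume "countable A"
 then obtain f :: "'b => nat" where "inj_on f A" by (auto simp: countable_def)
 then have "|A| \<le>o |UNIV :: nat set|" by (meson card_of_ordLeq subset_UNIV)
 then show ?thesis using small_nat unfolding small_def by (rule ordLeq_ordLess_trans)
qed

lemma small_Pow: "small B ==> small (Pow B)"
proof -
 assume B: "small B"
 then have "|B| \<le>o \<kappa>" unfolding small_def by (rule ordLess_imp_ordLeq)
 then have "|B| \<le>o |Field \<kappa>|"
  using card_of_Field_ordIso[OF kappa(1)] ordIso_symmetric ordLeq_ordIso_trans by blast
 then obtain f where f: "inj_on f B" "f ` B <= Field \<kappa>" by (meson card_of_ordLeq)
 have "|f ` B| <o \<kappa>" using small_image[OF B, of f] by (simp add: small_def)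
 then have "|Pow (f ` B)| <o \<kappa>" using monster f(2) by (auto simp: monster_model_def strong_limit_def)
 moreover have "|Pow B| \<le>o |Pow (f ` B)|"
  using f(1) by (intro card_of_ordLeqI[of "image f"]) (auto intro: inj_on_image_Pow)
 ultimately show ?thesis unfolding small_def by (rule ordLeq_ordLess_trans[rotated])
qed

lemma small_lists:
 assumes "small B" shows "small (lists B)"
proof -
 let ?f = "%xs. {(i, x). i < length xs & xs ! i = x}"
 have "xs = ys" if eq: "?f xs = ?f ys" for xs ys :: "'b list"
 proof (rule nth_equalityI)
  have *: "i < length xs & xs ! i = x \<longleftrightarrow> i < length ys & ys ! i = x" for i x
   using eq by (auto simp: set_eq_iff)
  then have "i < length xs \<longleftrightarrow> i < length ys" for i by blast
  then show "length xs = length ys" by (metis linorder_neqE_nat order_less_irrefl)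
  show "xs ! i = ys ! i" if "i < length xs" for i using * that by blast
 qed
 then have "inj_on ?f (lists B)" by (rule inj_onI)
 moreover have "?f ` lists B <= Pow (UNIV \<times> B)" by auto
 ultimately have "|lists B| \<le>o |Pow ((UNIV :: nat set) \<times> B)|" by (meson card_of_ordLeq)
 moreover have "small (Pow ((UNIV :: nat set) \<times> B))"
  by (intro small_Pow small_Times small_nat assms)
 ultimately show ?thesis unfolding small_def by (rule ordLeq_ordLess_trans)
qed

theorem saturation:
 assumes A: "A <= T" "small A"
  and S: "!!Q w. (Q, w) \<in> S ==> dfn Q & (\<forall>i. w i \<in> A)"
  and fin: "!!S'. finite S' ==> S' <= S ==>
   \<exists>x. (\<forall>i. x i \<in> T) & (\<forall>(Q, w)\<in>S'. Q (%i. if i < n then x i else w i))"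
 shows "\<exists>x. (\<forall>i. x i \<in> T) & (\<forall>(Q, w)\<in>S. Q (%i. if i < n then x i else w i))"
proof -
 obtain d where d: "d \<in> T0" using T0_nonempty by auto
 define A' where "A' = universe M \<union> (\<Union>a\<in>A. set a)"
 have "(\<Union>a\<in>A. set a) <= (%(a, j). a ! j) ` (A \<times> (UNIV :: nat set))"
  by (force simp: in_set_conv_nth)
 then have "small (\<Union>a\<in>A. set a)"
  by (rule small_subset[OF small_image[OF small_Times[OF A(2) small_nat]]])
 then have A': "|A'| <o \<kappa>" "A' <= universe C"
  using small_Un[OF small_universe] M_sub_C A(1) unfolding A'_def small_def
  by (auto simp: T_def tuples_def)
 have "\<exists>q. q \<in> formulas_over L (n * k) A' \<and>
   (\<forall>xs\<in>tuples (n * k) (universe C). sat C (%i. (xs @ snd q) ! i) (fst q) \<longleftrightarrow>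
     fst s (%i. if i < n then take k (drop (i * k) xs) else snd s i))" if "s \<in> S" for s
 proof -
  obtain Q w where s: "s = (Q, w)" by (cases s)
  then have Q: "dfn Q" "!!i. w i \<in> T" "!!i. w i \<in> A" using S that A by auto
  obtain \<psi> ps where \<psi>: "(\<psi>, ps) \<in> formulas_over L (n * k) (universe M \<union> (\<Union>i. set (w i)))"
   "\<forall>xs\<in>tuples (n * k) (universe C). sat C (%i. (xs @ ps) ! i) \<psi> \<longleftrightarrow>
    Q (%i. if i < n then take k (drop (i * k) xs) else w i)" using formula_of_dfn[of Q w n] Q(1,2) by blast
  have "universe M \<union> (\<Union>i. set (w i)) <= A'" using Q(3) by (auto simp: A'_def)
  then have "(\<psi>, ps) \<in> formulas_over L (n * k) A'" using \<psi>(1) unfolding formulas_over_def by blast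
  then show ?thesis using \<psi>(2) unfolding s
   by (intro exI[of _ "(\<psi>, ps)"] conjI) (simp_all only: fst_conv snd_conv)
 qed
 then have "\<forall>s\<in>S. \<exists>q. q \<in> formulas_over L (n * k) A' \<and>
   (\<forall>xs\<in>tuples (n * k) (universe C). sat C (%i. (xs @ snd q) ! i) (fst q) \<longleftrightarrow>
     fst s (%i. if i < n then take k (drop (i * k) xs) else snd s i))" by (intro ballI)
 from bchoice[OF this] obtain q where q0: "\<forall>s\<in>S. q s \<in> formulas_over L (n * k) A' \<and>
   (\<forall>xs\<in>tuples (n * k) (universe C). sat C (%i. (xs @ snd (q s)) ! i) (fst (q s)) \<longleftrightarrow>
     fst s (%i. if i < n then take k (drop (i * k) xs) else snd s i))" by (elim exE)
 then have q: "!!s. s \<in> S ==> q s \<in> formulas_over L (n * k) A'"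
  "!!s xs. s \<in> S ==> xs \<in> tuples (n * k) (universe C) ==> sat C (%i. (xs @ snd (q s)) ! i) (fst (q s)) \<longleftrightarrow>
     fst s (%i. if i < n then take k (drop (i * k) xs) else snd s i)"
  by (auto simp only: bspec[OF q0])
 have real: "xs \<in> realizations C (n * k) (q ` S') \<longleftrightarrow> xs \<in> tuples (n * k) (universe C) \<and>
   (\<forall>(Q, w)\<in>S'. Q (%i. if i < n then take k (drop (i * k) xs) else w i))" if "S' <= S" for S' xs
 proof -
  have "(\<forall>r\<in>q ` S'. sat C (%i. (xs @ snd r) ! i) (fst r)) \<longleftrightarrow>
    (\<forall>s\<in>S'. fst s (%i. if i < n then take k (drop (i * k) xs) else snd s i))"
   if "xs \<in> tuples (n * k) (universe C)"
   using q(2)[OF subsetD[OF \<open>S' <= S\<close>] that] by simp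
  then show ?thesis unfolding realizations_def by (auto simp: case_prod_beta)
 qed
 have tk: "take k (drop (i * k) xs) \<in> T" if "xs \<in> tuples (n * k) (universe C)" "i < n" for xs i
 proof -
  have "i * k + k <= n * k" using that by (metis Suc_leI add.commute mult_Suc mult_le_mono1)
  then show ?thesis using that by (auto simp: T_def tuples_def dest!: in_set_takeD in_set_dropD)
 qed
 have "realizations C (n * k) (q ` S) \<noteq> {}"
 proof -
  have "realizations C (n * k) \<Sigma>0 \<noteq> {}" if \<Sigma>0: "\<Sigma>0 <= q ` S" "finite \<Sigma>0" for \<Sigma>0
  proof -
   obtain S' where S': "S' <= S" "finite S'" "\<Sigma>0 = q ` S'"
    using \<Sigma>0 by (meson finite_subset_image)
   obtain x where x: "\<forall>i. x i \<in> T" "\<forall>(Q, w)\<in>S'. Q (%i. if i < n then x i else w i)"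
    using fin[OF S'(2,1)] by blast
   define xs where "xs = concat (map x [0..<n])"
   have len: "length (x i) = k" for i using x by (auto simp: T_def tuples_def)
   have lx: "length xs = n * k" unfolding xs_def by (rule length_concat_map) (simp add: len)
   have xs: "xs \<in> tuples (n * k) (universe C)"
    using x lx by (auto simp: tuples_def xs_def T_def)
   have "take k (drop (i * k) xs) = x i" if "i < n" for i
   proof (rule nth_equalityI)
    have ik: "i * k + k <= n * k" using that by (metis Suc_leI add.commute mult_Suc mult_le_mono1)
    then show "length (take k (drop (i * k) xs)) = length (x i)" using lx len by simp
    fix j assume "j < length (take k (drop (i * k) xs))"
    then have j: "j < k" by simp
    then have "xs ! (i * k + j) = x ((i * k + j) div k) ! ((i * k + j) mod k)"
     unfolding xs_def using ik len by (intro nth_concat_map) auto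
    moreover have "i * k <= length xs" using ik lx by linarith
    ultimately show "take k (drop (i * k) xs) ! j = x i ! j" using j by simp
   qed
   then have "(%i. if i < n then take k (drop (i * k) xs) else w i) = (%i. if i < n then x i else w i)" for w
    by auto
   then have "xs \<in> realizations C (n * k) (q ` S')" unfolding real[OF S'(1)] using xs x(2) by simp
   then show ?thesis using S' by blast
  qed
  moreover have "q ` S <= formulas_over L (n * k) A'" using q(1) by auto
  moreover have "saturated L \<kappa> C" using monster by (simp add: monster_model_def)
  ultimately show ?thesis using A' unfolding saturated_def by blast
 qed
 then obtain xs where xs: "xs \<in> tuples (n * k) (universe C)"
   "\<forall>(Q, w)\<in>S. Q (%i. if i < n then take k (drop (i * k) xs) else w i)"
  using real[of S] by auto
 define x where "x i = (if i < n then take k (drop (i * k) xs) else d)" for i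
 have "(%i. if i < n then take k (drop (i * k) xs) else w i) = (%i. if i < n then x i else w i)" for w
  by (auto simp: x_def)
 moreover have "x i \<in> T" for i using tk xs d T0_sub_T by (auto simp: x_def)
 ultimately show ?thesis using xs(2) by (intro exI[of _ x]) auto
qed

end

end

section \<open>Definable and type-definable sets of tuples\<close>

context monster
begin

lemma dfn_or: "dfn P ==> dfn Q ==> dfn (%v. P v \<or> Q v)"
 using dfn_not[OF dfn_and[OF dfn_not dfn_not]] by simp

lemma dfn_imp:
 assumes "dfn P" "dfn Q" shows "dfn (%v. P v --> Q v)"
 by (rule dfn_cong[OF dfn_or[OF dfn_not[OF assms(1)] assms(2)]]) blast

lemma dfn_all:
 assumes "dfn (%v. P (v 0) (%i. v (Suc i)))" shows "dfn (%v. \<forall>x\<in>T. P x v)"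
proof -
 have "dfn (%v. \<exists>x\<in>T. \<not> P x v)" using dfn_not[OF assms] by (rule dfn_ex)
 from dfn_not[OF this] show ?thesis by (rule dfn_cong) blast
qed

lemma dfn_True: "dfn (%v. True)"
 by (rule dfn_cong[OF dfn_eq[of 0 0]]) simp

lemma dfn_closed: "dfn (%v. b)"
 using dfn_True dfn_not[OF dfn_True] by (cases b) auto

lemma dfn_conj_many: fixes n :: nat shows "(!!i. i < n ==> dfn (P i)) ==> dfn (%v. \<forall>i<n. P i v)"
proof (induction n)
 case (Suc n)
 have "dfn (%v. (\<forall>i<n. P i v) & P n v)"
  by (rule dfn_and) (use Suc in auto)
 then show ?case by (rule dfn_cong) (auto simp: less_Suc_eq)
qed (simp add: dfn_True)

definition dset :: "'a list set => bool" where
 "dset D \<longleftrightarrow> D <= T & dfn (%v. v 0 \<in> D)"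

lemma dset_sub: "dset D ==> D <= T"
 by (simp add: dset_def)

lemma dset_mem: "dset D ==> dfn (%v. v i \<in> D)"
 using dfn_subst[of "%v. v 0 \<in> D" "%_. i"] by (simp add: dset_def)

lemma dset_collect:
 assumes "dfn (%v. P (v 0))" shows "dset {x \<in> T. P x}"
proof -
 have "dfn (%v. v 0 \<in> {x \<in> T. P x})" by (rule dfn_cong[OF assms]) simp
 then show ?thesis by (simp add: dset_def)
qed

lemma dsetI:
 assumes "dfn (%v. P (v 0))" "!!x. x \<in> D \<longleftrightarrow> x \<in> T & P x" shows "dset D"
proof -
 have "D = {x \<in> T. P x}" using assms(2) by auto
 then show ?thesis using dset_collect[OF assms(1)] by simp
qed

lemma dset_T: "dset T"
 by (rule dsetI[of "%_. True"]) (auto simp: dfn_True)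

lemma dset_empty: "dset {}"
 by (rule dsetI[of "%_. False"]) (auto simp: dfn_closed)

lemma dset_Int: "dset D ==> dset E ==> dset (D \<inter> E)"
 by (rule dsetI[of "%x. x \<in> D & x \<in> E"]) (auto intro!: dfn_and dset_mem dest: dset_sub)

lemma dset_Un: "dset D ==> dset E ==> dset (D \<union> E)"
 by (rule dsetI[of "%x. x \<in> D \<or> x \<in> E"]) (auto intro!: dfn_or dset_mem dest: dset_sub)

lemma dset_compl: "dset D ==> dset (T - D)"
 by (rule dsetI[of "%x. x \<notin> D"]) (auto intro!: dfn_not dset_mem)

lemma dset_Diff: "dset D ==> dset E ==> dset (D - E)"
 by (rule dsetI[of "%x. x \<in> D & x \<notin> E"]) (auto intro!: dfn_and dfn_not dset_mem dest: dset_sub)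

lemma dset_Inter: "finite \<D> ==> (!!D. D \<in> \<D> ==> dset D) ==> dset (T \<inter> \<Inter>\<D>)"
proof (induction \<D> rule: finite_induct)
 case (insert D \<D>)
 have "dset (D \<inter> (T \<inter> \<Inter>\<D>))" by (rule dset_Int) (use insert in auto)
 then show ?case by (simp add: Int_left_commute)
qed (simp add: dset_T)

lemma dset_Union: "finite \<D> ==> (!!D. D \<in> \<D> ==> dset D) ==> dset (\<Union>\<D>)"
 by (induction \<D> rule: finite_induct) (auto intro: dset_empty dset_Un)

lemma transfer:
 assumes "dfn Q" "!!v. (!!i. v i \<in> T0) ==> Q v" "!!i. v i \<in> T"
 shows "Q v"
 using tarski_vaught[OF dfn_not[OF assms(1)], of v] assms(2,3) by blast

lemma transfer1:
 assumes "dfn (%v. P (v 0))" "!!x. x \<in> T0 ==> P x" "x \<in> T" shows "P x"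
 using transfer[OF assms(1), of "%_. x"] assms by blast

lemma transfer2:
 assumes "dfn (%v. P (v 0) (v 1))" "!!x y. x \<in> T0 ==> y \<in> T0 ==> P x y" "x \<in> T" "y \<in> T" shows "P x y"
 using transfer[OF assms(1), of "%i. if i = 0 then x else y"] assms by auto

lemma transfer3:
 assumes "dfn (%v. P (v 0) (v 1) (v 2))" "!!x y z. x \<in> T0 ==> y \<in> T0 ==> z \<in> T0 ==> P x y z"
  "x \<in> T" "y \<in> T" "z \<in> T" shows "P x y z"
 using transfer[OF assms(1), of "%i. if i = 0 then x else if i = 1 then y else z"] assms by auto

lemma dset_meets_T0:
 assumes "dset D" "x \<in> D" shows "\<exists>y\<in>T0. y \<in> D"
 using tarski_vaught[OF dset_mem[OF assms(1), of 0], of "%_. x"] assms dset_sub by blast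

lemma dset_eqI: "dset D ==> dset E ==> D \<inter> T0 <= E ==> D <= E"
 using dset_meets_T0[OF dset_Diff[of D E]] by blast

lemma formula_of_dset:
 assumes "dset D"
 shows "\<exists>q\<in>formulas_over L k (universe M). D = realizations C k {q} & D \<inter> T0 = realizations M k {q}"
proof -
 obtain m where m: "m \<in> T0" using T0_nonempty by auto
 then have mM: "set m <= universe M" by (auto simp: T0_def tuples_def)
 obtain \<psi> ps where q: "(\<psi>, ps) \<in> formulas_over L (1 * k) (universe M \<union> (\<Union>i::nat. set m))"
  "\<forall>xs\<in>tuples (1 * k) (universe C). sat C (%i. (xs @ ps) ! i) \<psi> \<longleftrightarrow>
    (%v. v 0 \<in> D) (%i. if i < 1 then take k (drop (i * k) xs) else m)"
  using formula_of_dfn[of "%v. v 0 \<in> D" "%_. m" 1] assms m T0_sub_T unfolding dset_def by blast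
 have "universe M \<union> (\<Union>i::nat. set m) = universe M" using mM by auto
 then have q1: "(\<psi>, ps) \<in> formulas_over L k (universe M)" using q(1) by simp
 then have psi: "form_in L \<psi>" "set ps <= universe M" "fv \<psi> <= {..<k + length ps}"
  by (auto simp: formulas_over_def formulas_def)
 have sat: "sat C (%i. (xs @ ps) ! i) \<psi> \<longleftrightarrow> xs \<in> D" if "xs \<in> T" for xs
  using q(2) that by (simp add: T_def tuples_def)
 have satM: "sat M (%i. (xs @ ps) ! i) \<psi> \<longleftrightarrow> sat C (%i. (xs @ ps) ! i) \<psi>" if "xs \<in> T0" for xs
 proof (rule elementary_fv[OF psi(1)])
  fix n assume "n \<in> fv \<psi>"
  then have "n < length (xs @ ps)" using psi(3) that by (auto simp: T0_def tuples_def)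
  then have "(xs @ ps) ! n \<in> set (xs @ ps)" by (rule nth_mem)
  then show "(xs @ ps) ! n \<in> universe M" using psi(2) that by (auto simp: T0_def tuples_def)
 qed
 show ?thesis
 proof (rule bexI[OF _ q1], rule conjI)
  show "D = realizations C k {(\<psi>, ps)}"
   using sat dset_sub[OF assms] by (auto simp: realizations_def T_def[symmetric])
  show "D \<inter> T0 = realizations M k {(\<psi>, ps)}"
   using sat satM T0_sub_T by (auto simp: realizations_def T0_def[symmetric])
 qed
qed

lemma dset_of_formula:
 assumes "q \<in> formulas_over L k (universe M)"
 shows "dset (realizations C k {q})"
proof -
 obtain \<psi> ps where q: "q = (\<psi>, ps)" by (cases q)
 then have "form_in L \<psi>" "set ps <= universe M" "fv \<psi> <= {..<1 * k + length ps}"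
  using assms by (auto simp: formulas_over_def formulas_def)
 then have "dfn (%v. sat C (%i. (concat (map v [0..<1]) @ ps) ! i) \<psi>)" by (intro dfn_formula)
 then have "dfn (%v. sat C (%i. (v 0 @ ps) ! i) \<psi>)" by simp
 then show ?thesis
  by (rule dsetI) (auto simp: realizations_def q T_def)
qed

lemma definable_dset: "dset D ==> definable_over L M k (universe M) (D \<inter> T0)"
 using formula_of_dset unfolding definable_over_def by blast

lemma dset_of_definable:
 assumes "definable_over L M k (universe M) Y"
 shows "\<exists>D. dset D & D \<inter> T0 = Y"
proof -
 obtain q where q: "q \<in> formulas_over L k (universe M)" "Y = realizations M k {q}"
  using assms by (auto simp: definable_over_def)
 obtain \<psi> ps where q': "q = (\<psi>, ps)" by (cases q)
 then have psi: "form_in L \<psi>" "set ps <= universe M" "fv \<psi> <= {..<k + length ps}"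
  using q by (auto simp: formulas_over_def formulas_def)
 have "sat M (%i. (xs @ ps) ! i) \<psi> \<longleftrightarrow> sat C (%i. (xs @ ps) ! i) \<psi>" if "xs \<in> T0" for xs
 proof (rule elementary_fv[OF psi(1)])
  fix n assume "n \<in> fv \<psi>"
  then have "n < length (xs @ ps)" using psi(3) that by (auto simp: T0_def tuples_def)
  then have "(xs @ ps) ! n \<in> set (xs @ ps)" by (rule nth_mem)
  then show "(xs @ ps) ! n \<in> universe M" using psi(2) that by (auto simp: T0_def tuples_def)
 qed
 then have "realizations C k {q} \<inter> T0 = Y"
  using T0_sub_T by (auto simp: realizations_def q(2) q' T0_def[symmetric] T_def[symmetric])
 then show ?thesis using dset_of_formula[OF q(1)] by blast
qed

definition tdef :: "'a list set => bool" where
 "tdef P \<longleftrightarrow> (\<exists>\<S>. (\<forall>D\<in>\<S>. dset D) & P = T \<inter> \<Inter>\<S>)"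

lemma realizations_eq_Inter: "realizations C k \<Sigma> = T \<inter> (\<Inter>q\<in>\<Sigma>. realizations C k {q})"
 by (auto simp: realizations_def T_def)

lemma tdef_iff: "type_definable_over L C k (universe M) P \<longleftrightarrow> tdef P"
proof
 assume "type_definable_over L C k (universe M) P"
 then obtain \<Sigma> where \<Sigma>: "\<Sigma> <= formulas_over L k (universe M)" "P = realizations C k \<Sigma>"
  by (auto simp: type_definable_over_def)
 then show "tdef P" unfolding tdef_def
  by (intro exI[of _ "(%q. realizations C k {q}) ` \<Sigma>"]) (auto simp: realizations_eq_Inter[of \<Sigma>] intro: dset_of_formula)
next
 assume "tdef P"
 then obtain \<S> where S: "!!D. D \<in> \<S> ==> dset D" "P = T \<inter> \<Inter>\<S>" by (auto simp: tdef_def)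
 have "\<forall>D\<in>\<S>. \<exists>q. q \<in> formulas_over L k (universe M) & D = realizations C k {q}"
  using formula_of_dset S(1) by blast
 from bchoice[OF this] obtain q where q: "\<forall>D\<in>\<S>. q D \<in> formulas_over L k (universe M) & D = realizations C k {q D}" by blast
 have "P = realizations C k (q ` \<S>)"
  unfolding realizations_eq_Inter[of "q ` \<S>"] S(2) using q by auto
 then show "type_definable_over L C k (universe M) P"
  unfolding type_definable_over_def using q by (intro exI[of _ "q ` \<S>"]) auto
qed

lemma tdef_imp_type_definable: "tdef P ==> type_definable L \<kappa> C k P"
 using tdef_iff M_sub_C small_universe unfolding type_definable_def small_def by blast

definition tequiv :: "'a list => 'a list => bool" where
 "tequiv a b \<longleftrightarrow> a \<in> T & b \<in> T & (\<forall>D. dset D --> a \<in> D \<longleftrightarrow> b \<in> D)"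

lemma tequivI:
 assumes "a \<in> T" "b \<in> T" "!!D. dset D ==> b \<in> D ==> a \<in> D" shows "tequiv a b"
 using assms dset_compl unfolding tequiv_def by blast

text \<open>By compactness over the parameters: if \<open>a \<notin> P\<close>, then no realization of the type of \<open>a\<close> over \<open>M\<close> lies in \<open>P\<close>, and
  finitely many formulas over \<open>M\<close> show this.\<close>

theorem tdef_of_invariant:
 assumes P: "type_definable L \<kappa> C k P" and inv: "!!a b. a \<in> P ==> tequiv a b ==> b \<in> P"
 shows "tdef P"
proof -
 obtain B \<Sigma> where B: "B <= universe C" "small B" "\<Sigma> <= formulas_over L k B" "P = realizations C k \<Sigma>"
  using P by (auto simp: type_definable_def type_definable_over_def small_def)
 have PT: "P <= T" by (auto simp: B(4) realizations_def T_def)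
 define \<S> where "\<S> = {D. dset D & P <= D}"
 have "b \<in> P" if b: "b \<in> T" "\<forall>D\<in>\<S>. b \<in> D" for b
 proof -
  define \<Theta> where "\<Theta> = {q \<in> formulas_over L k (universe M). b \<in> realizations C k {q}}"
  have "realizations C k \<Sigma>0 \<noteq> {}" if \<Sigma>0: "\<Sigma>0 <= \<Sigma> \<union> \<Theta>" "finite \<Sigma>0" for \<Sigma>0
  proof
   assume empty: "realizations C k \<Sigma>0 = {}"
   define D where "D = realizations C k (\<Sigma>0 \<inter> \<Theta>)"
   have D: "dset D" unfolding D_def realizations_eq_Inter[of "\<Sigma>0 \<inter> \<Theta>"]
    by (rule dset_Inter) (use \<Sigma>0 dset_of_formula in \<open>auto simp: \<Theta>_def\<close>)
   have "P \<inter> D <= realizations C k \<Sigma>0"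
    using \<Sigma>0 unfolding B(4) D_def realizations_def by blast
   then have "P <= T - D" using empty PT by auto
   then have "T - D \<in> \<S>" using dset_compl[OF D] by (auto simp: \<S>_def)
   then have "b \<notin> D" using b by auto
   moreover have "b \<in> D" unfolding D_def realizations_eq_Inter[of "\<Sigma>0 \<inter> \<Theta>"]
    using b by (auto simp: \<Theta>_def)
   ultimately show False by simp
  qed
  moreover have "\<Sigma> \<union> \<Theta> <= formulas_over L k (B \<union> universe M)"
   using B(3) by (auto simp: \<Theta>_def formulas_over_def)
  moreover have "small (B \<union> universe M)" by (intro small_Un B small_universe)
  moreover have "saturated L \<kappa> C" using monster by (simp add: monster_model_def)
  ultimately have "realizations C k (\<Sigma> \<union> \<Theta>) \<noteq> {}"
   using B(1) M_sub_C unfolding saturated_def small_def by (meson Un_least)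
  then obtain a where a: "a \<in> realizations C k (\<Sigma> \<union> \<Theta>)" by blast
  then have aP: "a \<in> P" by (auto simp: B(4) realizations_def)
  have "tequiv a b"
  proof (rule tequivI)
   show "a \<in> T" "b \<in> T" using aP PT b by auto
   fix D assume D: "dset D" "b \<in> D"
   obtain q where q: "q \<in> formulas_over L k (universe M)" "D = realizations C k {q}"
    using formula_of_dset[OF D(1)] by blast
   then have "q \<in> \<Theta>" using D by (simp add: \<Theta>_def)
   then show "a \<in> D" using a unfolding q(2) by (auto simp: realizations_def)
  qed
  then show ?thesis using inv aP by blast
 qed
 then have "P = T \<inter> \<Inter>\<S>" using PT by (auto simp: \<S>_def)
 then show ?thesis unfolding tdef_def by (intro exI[of _ \<S>]) (auto simp: \<S>_def)
qed

lemma compactness: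
 assumes w: "!!i. w i \<in> T" and Q: "!!Q. Q \<in> \<Q> ==> dfn Q"
  and ne: "\<Q> \<noteq> {}"
  and dir: "!!P Q. P \<in> \<Q> ==> Q \<in> \<Q> ==> \<exists>R\<in>\<Q>. \<forall>v. (\<forall>i. v i \<in> T) --> R v --> P v & Q v"
  and sat: "!!Q. Q \<in> \<Q> ==> \<exists>x. (\<forall>i. x i \<in> T) & Q (%i. if i < n then x i else w i)"
 shows "\<exists>x. (\<forall>i. x i \<in> T) & (\<forall>Q\<in>\<Q>. Q (%i. if i < n then x i else w i))"
proof -
 have bound: "\<exists>R\<in>\<Q>. \<forall>v. (\<forall>i. v i \<in> T) --> R v --> (\<forall>Q\<in>\<Q>'. Q v)" if "finite \<Q>'" "\<Q>' <= \<Q>" for \<Q>'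
  using that
 proof (induction \<Q>' rule: finite_induct)
  case empty
  then show ?case using ne by auto
 next
  case (insert P \<Q>')
  then obtain R where R: "R \<in> \<Q>" "\<forall>v. (\<forall>i. v i \<in> T) --> R v --> (\<forall>Q\<in>\<Q>'. Q v)" by auto
  obtain R' where R': "R' \<in> \<Q>" "\<forall>v. (\<forall>i. v i \<in> T) --> R' v --> P v & R v"
   using dir[of P R] insert.prems R(1) by auto
  show ?case by (rule bexI[OF _ R'(1)]) (use R R' in auto)
 qed
 have "\<exists>x. (\<forall>i. x i \<in> T) & (\<forall>(Q, w)\<in>(%Q. (Q, w)) ` \<Q>. Q (%i. if i < n then x i else w i))"
 proof (rule saturation[of "range w"])
  show "range w <= T" using w by auto
  show "small (range w)" by (intro small_countable) auto
  show "dfn Q & (\<forall>i. w' i \<in> range w)" if "(Q, w') \<in> (%Q. (Q, w)) ` \<Q>" for Q w' using that Q by auto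
  fix S' assume S': "finite S'" "S' <= (%Q. (Q, w)) ` \<Q>"
  then have "finite (fst ` S')" "fst ` S' <= \<Q>" by auto
  from bound[OF this] obtain R where R: "R \<in> \<Q>" "\<forall>v. (\<forall>i. v i \<in> T) --> R v --> (\<forall>Q\<in>fst ` S'. Q v)" by blast
  obtain x where x: "\<forall>i. x i \<in> T" "R (%i. if i < n then x i else w i)" using sat[OF R(1)] by blast
  then have "\<forall>Q\<in>fst ` S'. Q (%i. if i < n then x i else w i)" using R(2) w by simp
  then have "\<forall>(Q, w)\<in>S'. Q (%i. if i < n then x i else w i)" using S'(2) by fastforce
  then show "\<exists>x. (\<forall>i. x i \<in> T) & (\<forall>(Q, w)\<in>S'. Q (%i. if i < n then x i else w i))" using x(1) by blast
 qed
 then show ?thesis by auto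
qed

text \<open>Filter bases of definable sets stand for partial types that are closed under conjunction.\<close>

definition fbase :: "'a list set set => bool" where
 "fbase \<S> \<longleftrightarrow> \<S> \<noteq> {} & (\<forall>D\<in>\<S>. dset D) & (\<forall>D\<in>\<S>. \<forall>E\<in>\<S>. \<exists>F\<in>\<S>. F <= D \<inter> E)"

lemma fbase_single: "dset D ==> fbase {D}"
 by (auto simp: fbase_def)

lemma compactness3:
 assumes S: "fbase \<S>1" "fbase \<S>2" "fbase \<S>3" and w: "!!i. w i \<in> T"
  and Q: "dfn (%v. Q (v 0) (v 1) (v 2) (%i. v (Suc (Suc (Suc i)))))"
  and all: "!!x y z. x \<in> \<Inter>\<S>1 ==> y \<in> \<Inter>\<S>2 ==> z \<in> \<Inter>\<S>3 ==> x \<in> T ==> y \<in> T ==> z \<in> T ==> Q x y z w"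
 shows "\<exists>D\<in>\<S>1. \<exists>E\<in>\<S>2. \<exists>F\<in>\<S>3. \<forall>x\<in>D. \<forall>y\<in>E. \<forall>z\<in>F. Q x y z w"
proof (rule ccontr)
 assume none: "\<not> ?thesis"
 define P where "P D E F v \<longleftrightarrow> ((v 0 \<in> D & v 1 \<in> E) & v 2 \<in> F) \<and>
  \<not> Q (v 0) (v 1) (v 2) (%i. v (Suc (Suc (Suc i))))" for D E F and v :: "nat => 'a list"
 define \<Q> where "\<Q> = {P D E F | D E F. D \<in> \<S>1 & E \<in> \<S>2 & F \<in> \<S>3}"
 define w' where "w' i = w (i - 3)" for i
 have Tm: "x \<in> T" if "x \<in> D" "D \<in> \<S>1 \<or> D \<in> \<S>2 \<or> D \<in> \<S>3" for x D
  using that S dset_sub unfolding fbase_def by blast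
 have "\<exists>x. (\<forall>i. x i \<in> T) & (\<forall>Q\<in>\<Q>. Q (%i. if i < 3 then x i else w' i))"
 proof (rule compactness)
  show "w' i \<in> T" for i using w by (simp add: w'_def)
  show "dfn R" if "R \<in> \<Q>" for R
   using that S unfolding \<Q>_def P_def fbase_def
   by (auto intro!: dfn_and dfn_not dset_mem Q[unfolded One_nat_def])
  show "\<Q> \<noteq> {}" using S unfolding \<Q>_def fbase_def by blast
  show "\<exists>R\<in>\<Q>. \<forall>v. (\<forall>i. v i \<in> T) --> R v --> R1 v & R2 v" if R: "R1 \<in> \<Q>" "R2 \<in> \<Q>" for R1 R2
  proof -
   obtain D1 E1 F1 where 1: "R1 = P D1 E1 F1" "D1 \<in> \<S>1" "E1 \<in> \<S>2" "F1 \<in> \<S>3" using R unfolding \<Q>_def by blast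
   obtain D2 E2 F2 where 2: "R2 = P D2 E2 F2" "D2 \<in> \<S>1" "E2 \<in> \<S>2" "F2 \<in> \<S>3" using R unfolding \<Q>_def by blast
   obtain D where D: "D \<in> \<S>1" "D <= D1 \<inter> D2" using S(1) 1 2 unfolding fbase_def by blast
   obtain E where E: "E \<in> \<S>2" "E <= E1 \<inter> E2" using S(2) 1 2 unfolding fbase_def by blast
   obtain F where F: "F \<in> \<S>3" "F <= F1 \<inter> F2" using S(3) 1 2 unfolding fbase_def by blast
   have "P D E F \<in> \<Q>" using D E F unfolding \<Q>_def by blast
   moreover have "P D E F v --> P D1 E1 F1 v & P D2 E2 F2 v" for v
    using D E F unfolding P_def by blast
   ultimately show ?thesis unfolding 1 2 by blast
  qed
  show "\<exists>x. (\<forall>i. x i \<in> T) & R (%i. if i < 3 then x i else w' i)" if R: "R \<in> \<Q>" for R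
  proof -
   obtain D E F where 1: "R = P D E F" "D \<in> \<S>1" "E \<in> \<S>2" "F \<in> \<S>3" using R unfolding \<Q>_def by blast
   then obtain x y z where xyz: "x \<in> D" "y \<in> E" "z \<in> F" "\<not> Q x y z w" using none by blast
   let ?x = "%i::nat. if i = 0 then x else if i = 1 then y else z"
   have "\<forall>i. ?x i \<in> T" using xyz 1 Tm by auto
   moreover have "R (%i. if i < 3 then ?x i else w' i)"
    unfolding 1 P_def using xyz by (simp add: w'_def)
   ultimately show ?thesis by (intro exI[of _ ?x] conjI)
  qed
 qed
 then obtain x where x: "\<forall>i. x i \<in> T" "\<forall>R\<in>\<Q>. R (%i. if i < 3 then x i else w' i)" by blast
 have P: "P D E F (%i. if i < 3 then x i else w' i)" if "D \<in> \<S>1" "E \<in> \<S>2" "F \<in> \<S>3" for D E F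
  using x(2) that unfolding \<Q>_def by blast
 obtain D E F where DEF: "D \<in> \<S>1" "E \<in> \<S>2" "F \<in> \<S>3" using S unfolding fbase_def by blast
 have "x 0 \<in> \<Inter>\<S>1" using P[OF _ DEF(2,3)] unfolding P_def by auto
 moreover have "x 1 \<in> \<Inter>\<S>2" using P[OF DEF(1) _ DEF(3)] unfolding P_def by auto
 moreover have "x 2 \<in> \<Inter>\<S>3" using P[OF DEF(1,2)] unfolding P_def by auto
 ultimately have "Q (x 0) (x 1) (x 2) w" using all x(1) by blast
 moreover have "\<not> Q (x 0) (x 1) (x 2) w" using P[OF DEF] unfolding P_def by (simp add: w'_def)
 ultimately show False by simp
qed

lemma compactness2:
 assumes S: "fbase \<S>1" "fbase \<S>2" and w: "!!i. w i \<in> T"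
  and Q: "dfn (%v. Q (v 0) (v 1) (%i. v (Suc (Suc i))))"
  and all: "!!x y. x \<in> \<Inter>\<S>1 ==> y \<in> \<Inter>\<S>2 ==> x \<in> T ==> y \<in> T ==> Q x y w"
 shows "\<exists>D\<in>\<S>1. \<exists>E\<in>\<S>2. \<forall>x\<in>D. \<forall>y\<in>E. Q x y w"
proof -
 obtain m where m: "m \<in> T" using T0_nonempty T0_sub_T by auto
 have "dfn (%v. Q (v 0) (v 1) (%i. v (Suc (Suc (Suc i)))))"
  using dfn_subst[OF Q, of "%i. if i < 2 then i else Suc i"] by simp
 then have "\<exists>D\<in>\<S>1. \<exists>E\<in>\<S>2. \<exists>F\<in>{T}. \<forall>x\<in>D. \<forall>y\<in>E. \<forall>z\<in>F. Q x y w"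
  by (rule compactness3[OF S fbase_single[OF dset_T] w]) (rule all)
 then show ?thesis using m by blast
qed

lemma compactness1:
 assumes S: "fbase \<S>" and w: "!!i. w i \<in> T"
  and Q: "dfn (%v. Q (v 0) (%i. v (Suc i)))"
  and all: "!!x. x \<in> \<Inter>\<S> ==> x \<in> T ==> Q x w"
 shows "\<exists>D\<in>\<S>. \<forall>x\<in>D. Q x w"
proof -
 obtain m where m: "m \<in> T" using T0_nonempty T0_sub_T by auto
 have "dfn (%v. Q (v 0) (%i. v (Suc (Suc i))))"
  using dfn_subst[OF Q, of "%i. if i < 1 then i else Suc i"] by simp
 then have "\<exists>D\<in>\<S>. \<exists>E\<in>{T}. \<forall>x\<in>D. \<forall>y\<in>E. Q x w"
  by (rule compactness2[OF S fbase_single[OF dset_T] w]) (rule all)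
 then show ?thesis using m by blast
qed

lemma tdef_fbase:
 assumes "tdef P"
 shows "fbase {D. dset D & P <= D}" "\<Inter>{D. dset D & P <= D} = P"
proof -
 obtain \<S> where S: "\<forall>D\<in>\<S>. dset D" "P = T \<inter> \<Inter>\<S>" using assms by (auto simp: tdef_def)
 show "\<Inter>{D. dset D & P <= D} = P" using S dset_T by auto
 show "fbase {D. dset D & P <= D}"
  unfolding fbase_def
 proof (intro conjI ballI)
  have "T \<in> {D. dset D & P <= D}" using dset_T S(2) by simp
  then show "{D. dset D & P <= D} \<noteq> {}" by (rule ex_in_conv[THEN iffD1, OF exI])
  show "dset D" if "D \<in> {D. dset D & P <= D}" for D using that by simp
  show "\<exists>F\<in>{D. dset D & P <= D}. F <= D \<inter> E"
   if "D \<in> {D. dset D & P <= D}" "E \<in> {D. dset D & P <= D}" for D E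
   by (rule bexI[of _ "D \<inter> E"]) (use that dset_Int in auto)
 qed
qed

lemma tdef_Inter: "(!!P. P \<in> \<P> ==> tdef P) ==> tdef (T \<inter> \<Inter>\<P>)"
proof -
 assume P: "!!P. P \<in> \<P> ==> tdef P"
 have "T \<inter> \<Inter>\<P> = T \<inter> \<Inter>{D. dset D & (\<exists>P\<in>\<P>. P <= D)}" (is "_ = ?R")
 proof
  show "?R <= T \<inter> \<Inter>\<P>"
  proof
   fix x assume x: "x \<in> ?R"
   have "x \<in> P" if "P \<in> \<P>" for P
    using tdef_fbase(2)[OF P[OF that]] x that by blast
   then show "x \<in> T \<inter> \<Inter>\<P>" using x by blast
  qed
 qed blast
 moreover have "\<forall>D\<in>{D. dset D & (\<exists>P\<in>\<P>. P <= D)}. dset D" by simp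
 ultimately show ?thesis unfolding tdef_def by (intro exI conjI)
qed

lemma tdef_sub: "tdef P ==> P <= T"
 by (auto simp: tdef_def)

lemma tdef_Int: "tdef P ==> tdef Q ==> tdef (P \<inter> Q)"
 using tdef_Inter[of "{P, Q}"] tdef_sub[of P] by (auto simp: Int_absorb1 Int_assoc[symmetric])

lemma finite_subcover:
 assumes A: "A <= T" "small A" and D: "dset D"
  and Q: "dfn (%v. Q (v 0) (v 1))"
  and cov: "!!x. x \<in> D ==> \<exists>a\<in>A. Q x a"
 shows "\<exists>F. finite F & F <= A & (\<forall>x\<in>D. \<exists>a\<in>F. Q x a)"
proof (rule ccontr)
 assume none: "\<not> ?thesis"
 obtain m where m: "m \<in> T" using T0_nonempty T0_sub_T by auto
 let ?P = "%v :: nat => 'a list. v 0 \<in> D & \<not> Q (v 0) (v 1)"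
 have dP: "dfn ?P" by (rule dfn_and[OF dset_mem[OF D] dfn_not[OF Q]])
 have none': "\<exists>x\<in>D. \<forall>a\<in>F. \<not> Q x a" if "finite F" "F <= A" for F
 proof (rule ccontr)
  assume "\<not> ?thesis"
  then have "finite F & F <= A & (\<forall>x\<in>D. \<exists>a\<in>F. Q x a)" using that by simp
  then show False using none by (elim notE) (rule exI[of _ F])
 qed
 have ne: "A \<noteq> {}"
 proof
  assume "A = {}"
  then have "D = {}" using cov by auto
  then show False using none'[of "{}"] by simp
 qed
 have "\<exists>x. (\<forall>i. x i \<in> T) & (\<forall>(P, w)\<in>(%a. (?P, %_ :: nat. a)) ` A. P (%i. if i < 1 then x i else w i))"
 proof (rule saturation[OF A])
  show "dfn P & (\<forall>i. w i \<in> A)" if "(P, w) \<in> (%a. (?P, %_ :: nat. a)) ` A" for P w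
   using that dP by auto
  fix S' assume S': "finite S'" "S' <= (%a. (?P, %_ :: nat. a)) ` A"
  then obtain F where F: "F <= A" "finite F" "S' = (%a. (?P, %_ :: nat. a)) ` F" by (meson finite_subset_image)
  obtain x where "x \<in> D" "\<forall>a\<in>F. \<not> Q x a" using none'[OF F(2,1)] by (elim bexE)
  then show "\<exists>x. (\<forall>i. x i \<in> T) & (\<forall>(P, w)\<in>S'. P (%i. if i < 1 then x i else w i))"
   using dset_sub[OF D] unfolding F(3) by (intro exI[of _ "%_. x"]) auto
 qed
 then show False using cov ne by auto
qed

lemma small_dsets: "small {D. dset D}"
proof -
 have "formulas_over L k (universe M) <= formulas L \<times> lists (universe M)"
  by (auto simp: formulas_over_def)
 then have "small (formulas_over L k (universe M))"
  by (rule small_subset[OF small_Times[OF small_formulas small_lists[OF small_universe]]])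
 then have "small ((%q. realizations C k {q}) ` formulas_over L k (universe M))" by (rule small_image)
 moreover have "{D. dset D} <= (%q. realizations C k {q}) ` formulas_over L k (universe M)"
  using formula_of_dset by blast
 ultimately show ?thesis by (rule small_subset)
qed

lemma elementary_realization:
 assumes "form_in L \<phi>" "fv \<phi> <= {..<n}" "xs \<in> tuples n (universe C)" "sat C (%i. xs ! i) \<phi>"
 shows "\<exists>xs\<in>tuples n (universe M). sat M (%i. xs ! i) \<phi>"
proof -
 obtain d where d: "d \<in> universe M" using M_nonempty by auto
 let ?ex = "foldr FEx [0..<n] \<phi>"
 have "sat C (%_. d) ?ex" unfolding sat_exists_many
 proof (intro exI[of _ "%i. if i < n then xs ! i else d"] conjI)
  show "\<forall>m\<in>set [0..<n]. (if m < n then xs ! m else d) \<in> universe C"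
   using assms(3) by (auto simp: tuples_def)
  show "sat C (%i. if i < n then xs ! i else d) \<phi>"
   using assms(2) by (intro sat_cong[THEN iffD1, OF _ assms(4)]) auto
 qed auto
 then have "sat M (%_. d) ?ex" using assms(1) d by (subst elementary) (auto simp: form_in_exists_many)
 then obtain e where e: "\<forall>m\<in>set [0..<n]. e m \<in> universe M" "sat M e \<phi>"
  unfolding sat_exists_many by blast
 have "sat M (%i. map e [0..<n] ! i) \<phi>"
  using assms(2) by (intro sat_cong[THEN iffD1, OF _ e(2)]) auto
 moreover have "map e [0..<n] \<in> tuples n (universe M)" using e(1) by (auto simp: tuples_def)
 ultimately show ?thesis by blast
qed

lemma interp_eq:
 assumes \<phi>: "(\<phi>, [] :: 'a list) \<in> formulas_over L n {}"
 shows "interp_in L M C n (realizations M n {(\<phi>, [])}) = realizations C n {(\<phi>, [])}"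
 unfolding interp_in_def
proof (rule the_equality)
 show "\<exists>\<psi>\<in>formulas_over L n {}. realizations M n {(\<phi>, [])} = realizations M n {\<psi>} \<and>
   realizations C n {(\<phi>, [])} = realizations C n {\<psi>}" by (rule bexI[OF _ \<phi>]) simp
 fix D assume "\<exists>\<psi>\<in>formulas_over L n {}. realizations M n {(\<phi>, [])} = realizations M n {\<psi>} \<and>
   D = realizations C n {\<psi>}"
 then obtain q where q: "q \<in> formulas_over L n {}" "realizations M n {(\<phi>, [])} = realizations M n {q}"
  "D = realizations C n {q}" by blast
 obtain \<psi> where \<psi>: "q = (\<psi>, [])" using q(1) by (auto simp: formulas_over_def)
 have sub: "realizations C n {(\<alpha>, [])} <= realizations C n {(\<beta>, [])}"
  if "(\<alpha>, []) \<in> formulas_over L n {}" "(\<beta>, []) \<in> formulas_over L n {}"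
   "realizations M n {(\<alpha>, [])} <= realizations M n {(\<beta>, [])}" for \<alpha> \<beta>
 proof (rule ccontr)
  assume "\<not> ?thesis"
  then obtain xs where xs: "xs \<in> tuples n (universe C)" "sat C (%i. xs ! i) (FAnd \<alpha> (FNeg \<beta>))"
   by (auto simp: realizations_def)
  have "form_in L (FAnd \<alpha> (FNeg \<beta>))" "fv (FAnd \<alpha> (FNeg \<beta>)) <= {..<n}"
   using that by (auto simp: formulas_over_def formulas_def)
  from elementary_realization[OF this xs] obtain ys where
   "ys \<in> tuples n (universe M)" "sat M (%i. ys ! i) (FAnd \<alpha> (FNeg \<beta>))" by blast
  then show False using that(3) by (auto simp: realizations_def)
 qed
 show "D = realizations C n {(\<phi>, [])}"
  unfolding q(3) \<psi> by (intro equalityI sub) (use \<phi> q \<psi> in auto)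
qed

lemma interp_dset:
 assumes "definable_over L M k {} D"
 shows "dset (interp_in L M C k D)" "interp_in L M C k D \<inter> T0 = D"
proof -
 obtain q where q: "q \<in> formulas_over L k {}" "D = realizations M k {q}"
  using assms by (auto simp: definable_over_def)
 obtain \<phi> where \<phi>: "q = (\<phi>, [])" using q(1) by (auto simp: formulas_over_def)
 have eq: "interp_in L M C k D = realizations C k {q}" unfolding q(2) \<phi> by (rule interp_eq) (use q \<phi> in simp)
 have q': "q \<in> formulas_over L k (universe M)" using q(1) by (auto simp: formulas_over_def)
 show "dset (interp_in L M C k D)" unfolding eq using q' by (rule dset_of_formula)
 have "form_in L \<phi>" "fv \<phi> <= {..<k}" using q(1) \<phi> by (auto simp: formulas_over_def formulas_def)
 then have sat: "sat M (%i. xs ! i) \<phi> = sat C (%i. xs ! i) \<phi>" if xs: "xs \<in> T0" for xs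
 proof (intro elementary_fv)
  fix n assume "n \<in> fv \<phi>"
  then have "n < length xs" using \<open>fv \<phi> <= {..<k}\<close> xs by (auto simp: T0_def tuples_def)
  then have "xs ! n \<in> set xs" by (rule nth_mem)
  then show "xs ! n \<in> universe M" using xs by (auto simp: T0_def tuples_def)
 qed
 have "realizations C k {q} \<inter> T0 = realizations M k {q}"
  using sat T0_sub_T by (auto simp: realizations_def \<phi> T_def[symmetric] T0_def[symmetric])
 then show "interp_in L M C k D \<inter> T0 = D" using eq q(2) by simp
qed

text \<open>Concatenations of tuples turn a definable set of \<open>3 k\<close>-tuples into a relation between three \<open>k\<close>-tuples.\<close>

lemma interp_relation:
 assumes "definable_over L M (3 * k) {} D"
 shows "dfn (%v. v 0 @ v 1 @ v 2 \<in> interp_in L M C (3 * k) D)"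
  and "!!x y z. x \<in> T0 ==> y \<in> T0 ==> z \<in> T0 ==> x @ y @ z \<in> interp_in L M C (3 * k) D \<longleftrightarrow> x @ y @ z \<in> D"
proof -
 obtain q where q: "q \<in> formulas_over L (3 * k) {}" "D = realizations M (3 * k) {q}"
  using assms by (auto simp: definable_over_def)
 obtain \<phi> where \<phi>: "q = (\<phi>, [])" using q(1) by (auto simp: formulas_over_def)
 have eq: "interp_in L M C (3 * k) D = realizations C (3 * k) {q}" unfolding q(2) \<phi> by (rule interp_eq) (use q \<phi> in simp)
 have form: "form_in L \<phi>" "fv \<phi> <= {..<3 * k}" using q(1) \<phi> by (auto simp: formulas_over_def formulas_def)
 have "dfn (%v. sat C (%i. (concat (map v [0..<3]) @ []) ! i) \<phi>)"
  using form by (intro dfn_formula) auto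
 then have "dfn (%v. sat C (%i. (v 0 @ v 1 @ v 2) ! i) \<phi>)" by (simp add: numeral_3_eq_3 numeral_2_eq_2)
 then show "dfn (%v. v 0 @ v 1 @ v 2 \<in> interp_in L M C (3 * k) D)"
  by (rule dfn_cong) (auto simp: eq realizations_def \<phi> T_def tuples_def)
 fix x y z assume xyz: "x \<in> T0" "y \<in> T0" "z \<in> T0"
 then have 1: "x @ y @ z \<in> tuples (3 * k) (universe M)" by (auto simp: T0_def tuples_def)
 then have 2: "x @ y @ z \<in> tuples (3 * k) (universe C)" using M_sub_C by (auto simp: tuples_def)
 have "(x @ y @ z) ! n \<in> universe M" if "n < 3 * k" for n
  using 1 that unfolding tuples_def by (metis (mono_tags, lifting) mem_Collect_eq nth_mem subsetD)
 then have "sat M (%i. (x @ y @ z) ! i) \<phi> = sat C (%i. (x @ y @ z) ! i) \<phi>"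
  using form by (intro elementary_fv) auto
 then show "x @ y @ z \<in> interp_in L M C (3 * k) D \<longleftrightarrow> x @ y @ z \<in> D"
 proof -
  have "x @ y @ z \<in> realizations C (3 * k) {q} \<longleftrightarrow> x @ y @ z \<in> realizations M (3 * k) {q}"
   using 1 2 \<open>sat M _ \<phi> = sat C _ \<phi>\<close> by (simp add: realizations_def \<phi>)
  then show ?thesis using eq q(2) by simp
 qed
qed

end

section \<open>Levels of a definable approximate subring\<close>

context abelian_group begin

lemma add_subgroupI:
 assumes "H <= carrier G" "\<zero> \<in> H" "!!x y. x \<in> H ==> y \<in> H ==> x \<oplus> y \<in> H" "!!x. x \<in> H ==> \<ominus> x \<in> H"
 shows "additive_subgroup H G"
 unfolding additive_subgroup_def subgroup_def using assms by (auto simp: a_inv_def)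

lemma add_subgroupD:
 assumes "additive_subgroup H G"
 shows "H <= carrier G" "\<zero> \<in> H" "!!x y. x \<in> H ==> y \<in> H ==> x \<oplus> y \<in> H" "!!x. x \<in> H ==> \<ominus> x \<in> H"
 using assms unfolding additive_subgroup_def subgroup_def by (auto simp: a_inv_def)

end

context rng begin

lemma rng_r_null: "x \<in> carrier R ==> x \<otimes> \<zero> = \<zero>"
proof -
 assume x: "x \<in> carrier R"
 then have c: "x \<otimes> \<zero> \<in> carrier R" by (simp add: rng_m_closed)
 have "x \<otimes> \<zero> \<oplus> x \<otimes> \<zero> = x \<otimes> \<zero> \<oplus> \<zero>"
  using x c rng_r_distr[of \<zero> \<zero> x] by simp
 then show ?thesis using c by simp
qed

lemma rng_l_null: "x \<in> carrier R ==> \<zero> \<otimes> x = \<zero>"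
proof -
 assume x: "x \<in> carrier R"
 then have c: "\<zero> \<otimes> x \<in> carrier R" by (simp add: rng_m_closed)
 have "\<zero> \<otimes> x \<oplus> \<zero> \<otimes> x = \<zero> \<otimes> x \<oplus> \<zero>"
  using x c rng_l_distr[of \<zero> \<zero> x] by simp
 then show ?thesis using c by simp
qed

lemma rng_l_minus: "x \<in> carrier R ==> y \<in> carrier R ==> \<ominus> x \<otimes> y = \<ominus> (x \<otimes> y)"
 using rng_l_distr[of "\<ominus> x" x y]
 by (intro minus_equality[symmetric]) (simp_all add: rng_m_closed l_neg rng_l_null)

lemma rng_r_minus: "x \<in> carrier R ==> y \<in> carrier R ==> x \<otimes> \<ominus> y = \<ominus> (x \<otimes> y)"
 using rng_r_distr[of "\<ominus> y" y x]
 by (intro minus_equality[symmetric]) (simp_all add: rng_m_closed l_neg rng_r_null)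

lemmas rng_simprules
 [algebra ring "zero R" "add R" "a_inv R" "a_minus R" "monoid.one R" "monoid.mult R"] =
 a_closed zero_closed a_inv_closed minus_closed a_assoc l_zero l_neg a_comm minus_eq
 r_zero r_neg r_neg2 r_neg1 minus_add minus_minus minus_zero a_lcomm
 rng_m_closed rng_m_assoc rng_l_distr rng_r_distr rng_l_null rng_r_null rng_l_minus rng_r_minus

end

lemma set_add_iff: "z \<in> H <+>\<^bsub>G\<^esub> K \<longleftrightarrow> (\<exists>x\<in>H. \<exists>y\<in>K. z = x \<oplus>\<^bsub>G\<^esub> y)"
 by (auto simp: set_add_def')

lemma set_mult_iff: "z \<in> H <#>\<^bsub>G\<^esub> K \<longleftrightarrow> (\<exists>x\<in>H. \<exists>y\<in>K. z = x \<otimes>\<^bsub>G\<^esub> y)"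
 by (auto simp: set_mult_def)

locale def_ring = monster L M C \<kappa> k
 for L :: "('f, 'p) language" and M C :: "('f, 'p, 'a) struct" and \<kappa> :: "'k rel" and k +
 fixes A :: "'a list ring" and X :: "'a list set"
 assumes rng_A: "rng A" and approx: "approximate_subring A X" and zdef: "zero_definable L M k A X"
begin

abbreviation add_A (infixl "[+A]" 65) where "x [+A] y \<equiv> x \<oplus>\<^bsub>A\<^esub> y"
abbreviation mult_A (infixl "[*A]" 70) where "x [*A] y \<equiv> x \<otimes>\<^bsub>A\<^esub> y"

sublocale A: rng A by (rule rng_A)

abbreviation lev where "lev n \<equiv> level A X n"

lemma X_props: "X <= carrier A" "\<zero>\<^bsub>A\<^esub> \<in> X" "!!x. x \<in> X ==> \<ominus>\<^bsub>A\<^esub> x \<in> X"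
 using approx by (auto simp: approximate_subring_def additively_symmetric_def)

lemma lev_Suc_iff: "z \<in> lev (Suc n) \<longleftrightarrow>
  (\<exists>a\<in>lev n. \<exists>b\<in>lev n. \<exists>c\<in>lev n. \<exists>d\<in>lev n. z = a [*A] b [+A] (c [+A] d))"
 by (simp add: set_add_iff Bex_def set_mult_iff) blast

lemma lev_carrier: "lev n <= carrier A"
proof (induction n)
 case (Suc n)
 show ?case
 proof
  fix z assume "z \<in> lev (Suc n)"
  then show "z \<in> carrier A" unfolding lev_Suc_iff using Suc by (auto simp: A.rng_m_closed subset_iff)
 qed
qed (simp add: X_props)

lemma lev_zero: "\<zero>\<^bsub>A\<^esub> \<in> lev n"
proof (induction n)
 case (Suc n)
 have "\<zero>\<^bsub>A\<^esub> = \<zero>\<^bsub>A\<^esub> [*A] \<zero>\<^bsub>A\<^esub> [+A] (\<zero>\<^bsub>A\<^esub> [+A] \<zero>\<^bsub>A\<^esub>)" by (simp add: A.rng_l_null)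
 then show ?case unfolding lev_Suc_iff using Suc by blast
qed (simp add: X_props)

lemma lev_add: "x \<in> lev n ==> y \<in> lev n ==> x [+A] y \<in> lev (Suc n)"
proof -
 assume xy: "x \<in> lev n" "y \<in> lev n"
 then have "x [+A] y = \<zero>\<^bsub>A\<^esub> [*A] \<zero>\<^bsub>A\<^esub> [+A] (x [+A] y)"
  using lev_carrier[of n] by (auto simp: A.rng_l_null subset_iff)
 then show ?thesis unfolding lev_Suc_iff using xy lev_zero[of n] by blast
qed

lemma lev_mult: "x \<in> lev n ==> y \<in> lev n ==> x [*A] y \<in> lev (Suc n)"
proof -
 assume xy: "x \<in> lev n" "y \<in> lev n"
 then have "x [*A] y = x [*A] y [+A] (\<zero>\<^bsub>A\<^esub> [+A] \<zero>\<^bsub>A\<^esub>)"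
  using lev_carrier[of n] by (auto simp: A.rng_m_closed subset_iff)
 then show ?thesis unfolding lev_Suc_iff using xy lev_zero[of n] by blast
qed

lemma lev_Suc: "lev n <= lev (Suc n)"
proof
 fix x assume x: "x \<in> lev n"
 then have "x \<in> carrier A" using lev_carrier by auto
 then show "x \<in> lev (Suc n)" using lev_add[OF x lev_zero] by (simp only: A.r_zero)
qed

lemma lev_neg: "x \<in> lev n ==> \<ominus>\<^bsub>A\<^esub> x \<in> lev n"
proof (induction n arbitrary: x)
 case (Suc n)
 then obtain a b c d where x: "a \<in> lev n" "b \<in> lev n" "c \<in> lev n" "d \<in> lev n"
  "x = a [*A] b [+A] (c [+A] d)" unfolding lev_Suc_iff by blast
 then have "a \<in> carrier A" "b \<in> carrier A" "c \<in> carrier A" "d \<in> carrier A" using lev_carrier by auto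
 then have "\<ominus>\<^bsub>A\<^esub> x = (\<ominus>\<^bsub>A\<^esub> a) [*A] b [+A] (\<ominus>\<^bsub>A\<^esub> c [+A] \<ominus>\<^bsub>A\<^esub> d)"
  unfolding x(5) by (simp add: A.minus_add A.rng_l_minus A.rng_m_closed)
 then show ?case unfolding lev_Suc_iff using Suc.IH x by blast
qed (simp add: X_props)

lemma lev_mono: "m <= n ==> lev m <= lev n"
 by (induction rule: dec_induct) (use lev_Suc in blast)+

definition R0 :: "'a list set" where "R0 = generated_subrng A X"

lemma R0_eq: "R0 = (\<Union>n. lev n)"
proof
 have max: "\<exists>n. x \<in> lev n & y \<in> lev n" if "x \<in> lev a" "y \<in> lev b" for x y a b
  using that lev_mono[of a "max a b"] lev_mono[of b "max a b"] by (auto intro!: exI[of _ "max a b"])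
 have "subrng (\<Union>n. lev n) A"
  unfolding subrng_def
 proof (intro conjI ballI)
  show "additive_subgroup (\<Union>n. lev n) A"
  proof (rule A.add_subgroupI)
   show "(\<Union>n. lev n) <= carrier A" using lev_carrier by auto
   show "\<zero>\<^bsub>A\<^esub> \<in> (\<Union>n. lev n)" using lev_zero by auto
   show "x [+A] y \<in> (\<Union>n. lev n)" if "x \<in> (\<Union>n. lev n)" "y \<in> (\<Union>n. lev n)" for x y
   proof -
    obtain n where "x \<in> lev n" "y \<in> lev n" using max \<open>x \<in> _\<close> \<open>y \<in> _\<close> by (elim UN_E) metis
    then show ?thesis by (intro UN_I[of "Suc n"] lev_add) simp_all
   qed
   show "\<ominus>\<^bsub>A\<^esub> x \<in> (\<Union>n. lev n)" if "x \<in> (\<Union>n. lev n)" for x using that lev_neg by blast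
  qed
  show "x [*A] y \<in> (\<Union>n. lev n)" if "x \<in> (\<Union>n. lev n)" "y \<in> (\<Union>n. lev n)" for x y
  proof -
   obtain n where "x \<in> lev n" "y \<in> lev n" using max \<open>x \<in> _\<close> \<open>y \<in> _\<close> by (elim UN_E) metis
   then show ?thesis by (intro UN_I[of "Suc n"] lev_mult) simp_all
  qed
 qed
 moreover have "X <= (\<Union>n. lev n)" using level.simps(1)[of A X] by blast
 ultimately show "R0 <= (\<Union>n. lev n)" unfolding R0_def generated_subrng_def by blast
 have "lev n <= H" if H: "subrng H A" "X <= H" for H n
 proof (induction n)
  case (Suc n)
  have sub: "additive_subgroup H A" "!!x y. x \<in> H ==> y \<in> H ==> x [*A] y \<in> H" using H by (auto simp: subrng_def)
  note add = A.add_subgroupD(3)[OF sub(1)]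
  show ?case
  proof
   fix z assume "z \<in> lev (Suc n)"
   then obtain a b c d where "a \<in> lev n" "b \<in> lev n" "c \<in> lev n" "d \<in> lev n"
    "z = a [*A] b [+A] (c [+A] d)" unfolding lev_Suc_iff by blast
   moreover then have "a \<in> H" "b \<in> H" "c \<in> H" "d \<in> H" using Suc by auto
   ultimately show "z \<in> H" by (simp only:) (intro add sub(2))
  qed
 qed (simp add: H)
 then show "(\<Union>n. lev n) <= R0" unfolding R0_def generated_subrng_def by blast
qed

lemma R0_max: "finite F ==> F <= R0 ==> \<exists>n. F <= lev n"
proof (induction F rule: finite_induct)
 case (insert x F)
 then obtain m n where "F <= lev m" "x \<in> lev n" unfolding R0_eq by auto
 then show ?case using lev_mono[of m "max m n"] lev_mono[of n "max m n"]
  by (intro exI[of _ "max m n"]) auto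
qed auto

lemma R0_closed: "x \<in> R0 ==> y \<in> R0 ==> x [+A] y \<in> R0" "x \<in> R0 ==> y \<in> R0 ==> x [*A] y \<in> R0"
 "x \<in> R0 ==> \<ominus>\<^bsub>A\<^esub> x \<in> R0" "\<zero>\<^bsub>A\<^esub> \<in> R0"
proof -
 show "x [+A] y \<in> R0" if xy: "x \<in> R0" "y \<in> R0"
 proof -
  obtain n where "{x, y} <= lev n" using R0_max[of "{x, y}"] xy by auto
  then show ?thesis unfolding R0_eq by (intro UN_I[of "Suc n"] lev_add) simp_all
 qed
 show "x [*A] y \<in> R0" if xy: "x \<in> R0" "y \<in> R0"
 proof -
  obtain n where "{x, y} <= lev n" using R0_max[of "{x, y}"] xy by auto
  then show ?thesis unfolding R0_eq by (intro UN_I[of "Suc n"] lev_mult) simp_all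
 qed
 show "\<ominus>\<^bsub>A\<^esub> x \<in> R0" if "x \<in> R0" using that lev_neg unfolding R0_eq by auto
 show "\<zero>\<^bsub>A\<^esub> \<in> R0" using lev_zero unfolding R0_eq by auto
qed

lemma R0_carrier: "R0 <= carrier A"
 using lev_carrier by (auto simp: R0_eq)

text \<open>Sets covered by finitely many translates of \<open>X\<close> are closed under sums. They are also
  closed under products, as \<open>(e + x) (e' + x') = e e' + e x' + x e' + x x'\<close>. Here \<open>e X\<close> is covered because the elements with
  \<open>e X\<close> and \<open>X e\<close> covered form a subring that contains \<open>X\<close>.\<close>

lemma finite_cover_level:
 "\<exists>F. finite F & F <= R0 & (\<forall>x\<in>lev n. \<exists>f\<in>F. \<exists>z\<in>X. x = f [+A] z)"
proof -
 obtain F where F: "finite F" "F <= R0" "(X <#>\<^bsub>A\<^esub> X) \<union> (X <+>\<^bsub>A\<^esub> X) <= F <+>\<^bsub>A\<^esub> X"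
  using approx unfolding approximate_subring_def R0_def by blast
 have Xc: "x \<in> carrier A" if "x \<in> X" for x using X_props that by auto
 have Rc: "x \<in> carrier A" if "x \<in> R0" for x using R0_carrier that by auto
 have XR0: "X <= R0" unfolding R0_eq using level.simps(1)[of A X] by blast
 have covX: "\<exists>f\<in>F. \<exists>z\<in>X. x [+A] y = f [+A] z" "\<exists>f\<in>F. \<exists>z\<in>X. x [*A] y = f [+A] z"
  if "x \<in> X" "y \<in> X" for x y
 proof -
  have "x [+A] y \<in> X <+>\<^bsub>A\<^esub> X" "x [*A] y \<in> X <#>\<^bsub>A\<^esub> X"
   using that by (auto simp: set_add_iff set_mult_iff)
  then have "x [+A] y \<in> F <+>\<^bsub>A\<^esub> X" "x [*A] y \<in> F <+>\<^bsub>A\<^esub> X" using F(3) by auto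
  then show "\<exists>f\<in>F. \<exists>z\<in>X. x [+A] y = f [+A] z" "\<exists>f\<in>F. \<exists>z\<in>X. x [*A] y = f [+A] z"
   by (simp_all only: set_add_iff)
 qed
 define cov where "cov S \<longleftrightarrow> (\<exists>F. finite F & F <= R0 & (\<forall>x\<in>S. \<exists>f\<in>F. \<exists>z\<in>X. x = f [+A] z))" for S
 have tr: "\<exists>E. finite E & E <= R0 & (\<forall>x\<in>S. \<exists>f\<in>E. \<exists>z\<in>X. x = f [+A] z)" if "cov S" for S
  using that by (simp only: cov_def)
 have cov_sub: "cov S'" if S: "cov S" "S' <= S" for S S'
 proof -
  obtain E where E: "finite E" "E <= R0" "\<forall>x\<in>S. \<exists>f\<in>E. \<exists>z\<in>X. x = f [+A] z"
   using tr[OF S(1)] by (elim exE conjE)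
  then show ?thesis unfolding cov_def using S(2) by (intro exI[of _ E] conjI ballI) auto
 qed
 have cov_add: "cov {x [+A] y | x y. x \<in> S & y \<in> S'}" if S: "cov S" "cov S'" for S S'
 proof -
  obtain E where E: "finite E" "E <= R0" "\<forall>x\<in>S. \<exists>f\<in>E. \<exists>z\<in>X. x = f [+A] z" using tr[OF S(1)] by (elim exE conjE)
  obtain E' where E': "finite E'" "E' <= R0" "\<forall>x\<in>S'. \<exists>f\<in>E'. \<exists>z\<in>X. x = f [+A] z" using tr[OF S(2)] by (elim exE conjE)
  show ?thesis unfolding cov_def
  proof (intro exI[of _ "(%(e, e', f). e [+A] e' [+A] f) ` (E \<times> E' \<times> F)"] conjI ballI)
   show "finite ((%(e, e', f). e [+A] e' [+A] f) ` (E \<times> E' \<times> F))" using E E' F by auto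
   show "(%(e, e', f). e [+A] e' [+A] f) ` (E \<times> E' \<times> F) <= R0"
    using E(2) E'(2) F(2) by (auto intro!: R0_closed(1))
   fix w assume "w \<in> {x [+A] y | x y. x \<in> S & y \<in> S'}"
   then obtain x y where w: "x \<in> S" "y \<in> S'" "w = x [+A] y" by blast
   obtain e z where e: "e \<in> E" "z \<in> X" "x = e [+A] z" using E(3) w(1) by blast
   obtain e' z' where e': "e' \<in> E'" "z' \<in> X" "y = e' [+A] z'" using E'(3) w(2) by blast
   obtain f u where f: "f \<in> F" "u \<in> X" "z [+A] z' = f [+A] u" using covX(1)[OF e(2) e'(2)] by blast
   have c: "e \<in> carrier A" "z \<in> carrier A" "e' \<in> carrier A" "z' \<in> carrier A" "f \<in> carrier A" "u \<in> carrier A"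
    using e e' f E(2) E'(2) F(2) Xc Rc by blast+
   have "w = (e [+A] e') [+A] (z [+A] z')" unfolding w e e' using c by (simp add: A.a_ac)
   also have "\<dots> = (e [+A] e' [+A] f) [+A] u" unfolding f(3) using c by (simp add: A.a_ac)
   finally show "\<exists>g\<in>(%(e, e', f). e [+A] e' [+A] f) ` (E \<times> E' \<times> F). \<exists>z\<in>X. w = g [+A] z"
    using e(1) e'(1) f(1,2) by (intro bexI[of _ "e [+A] e' [+A] f"] bexI[of _ u]) force+
  qed
 qed
 have cov_fin: "cov S" if S: "finite S" "S <= R0" for S
  unfolding cov_def
 proof (intro exI[of _ S] conjI ballI S)
  fix x assume "x \<in> S"
  then have "x = x [+A] \<zero>\<^bsub>A\<^esub>" using S Rc by auto
  then show "\<exists>f\<in>S. \<exists>z\<in>X. x = f [+A] z" using \<open>x \<in> S\<close> X_props(2) by blast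
 qed
 have cov_X: "cov X"
  unfolding cov_def
 proof (intro exI[of _ "{\<zero>\<^bsub>A\<^esub>}"] conjI ballI)
  fix x assume "x \<in> X"
  then show "\<exists>f\<in>{\<zero>\<^bsub>A\<^esub>}. \<exists>z\<in>X. x = f [+A] z" using Xc by (auto intro!: bexI[of _ x])
 qed (use R0_closed in auto)
 have cov_Un: "cov (S \<union> S')" if S: "cov S" "cov S'" for S S'
 proof -
  obtain E where E: "finite E" "E <= R0" "\<forall>x\<in>S. \<exists>f\<in>E. \<exists>z\<in>X. x = f [+A] z"
   using tr[OF S(1)] by (elim exE conjE)
  obtain E' where E': "finite E'" "E' <= R0" "\<forall>x\<in>S'. \<exists>f\<in>E'. \<exists>z\<in>X. x = f [+A] z"
   using tr[OF S(2)] by (elim exE conjE)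
  show ?thesis unfolding cov_def
  proof (intro exI[of _ "E \<union> E'"] conjI ballI)
   show "\<exists>f\<in>E \<union> E'. \<exists>z\<in>X. x = f [+A] z" if "x \<in> S \<union> S'" for x
    using E(3)[rule_format, of x] E'(3)[rule_format, of x] that by auto
  qed (use E E' in auto)
 qed
 have cov_UN: "cov (\<Union>i\<in>I. S i)" if "finite I" "!!i. i \<in> I ==> cov (S i)" for I :: "'a list set" and S
  using that by (induction I rule: finite_induct) (auto intro: cov_Un cov_fin)
 have XX: "cov {x [*A] y | x y. x \<in> X & y \<in> X}"
  unfolding cov_def using F(1,2) covX(2) by (intro exI[of _ F] conjI ballI) auto
 define Z where "Z = {f \<in> R0. cov ((%x. f [*A] x) ` X) & cov ((%x. x [*A] f) ` X)}"
 have Z1: "cov ((%x. f [*A] x) ` X)" and Z2: "cov ((%x. x [*A] f) ` X)" if "f \<in> Z" for f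
  using that by (simp_all add: Z_def)
 have fin_mult: "cov ((%e. f [*A] e) ` E)" "cov ((%e. e [*A] f) ` E)"
  if "finite E" "E <= R0" "f \<in> R0" for f E
  using that by (auto intro!: cov_fin R0_closed(2))
 have Zl: "lev n <= Z" for n
 proof (induction n)
  case 0
  have "cov ((%x. f [*A] x) ` X)" "cov ((%x. x [*A] f) ` X)" if "f \<in> X" for f
   by (rule cov_sub[OF XX], use that in blast)+
  then show ?case using XR0 by (auto simp: Z_def)
 next
  case (Suc n)
  have mult: "f [*A] g \<in> Z" if fg: "f \<in> Z" "g \<in> Z" for f g
  proof -
   have fR: "f \<in> R0" "g \<in> R0" and c: "f \<in> carrier A" "g \<in> carrier A"
    using fg Rc by (auto simp: Z_def)
   obtain E where E: "finite E" "E <= R0" "\<forall>x\<in>(%x. g [*A] x) ` X. \<exists>e\<in>E. \<exists>z\<in>X. x = e [+A] z"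
    using tr[OF Z1[OF fg(2)]] by (elim exE conjE)
   have "cov {x [+A] y | x y. x \<in> (%e. f [*A] e) ` E & y \<in> (%x. f [*A] x) ` X}"
    by (rule cov_add[OF fin_mult(1)[OF E(1,2) fR(1)] Z1[OF fg(1)]])
   then have 1: "cov ((%x. f [*A] g [*A] x) ` X)"
   proof (rule cov_sub, intro subsetI)
    fix w assume "w \<in> (%x. f [*A] g [*A] x) ` X"
    then obtain x where x: "x \<in> X" "w = f [*A] g [*A] x" by blast
    obtain e z where e: "e \<in> E" "z \<in> X" "g [*A] x = e [+A] z" using E(3) x by blast
    have "w = f [*A] e [+A] f [*A] z"
     using x e c Xc E(2) Rc by (simp add: A.rng_m_assoc A.rng_r_distr subset_iff)
    then show "w \<in> {x [+A] y | x y. x \<in> (%e. f [*A] e) ` E & y \<in> (%x. f [*A] x) ` X}"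
     using e by blast
   qed
   obtain E where E: "finite E" "E <= R0" "\<forall>x\<in>(%x. x [*A] f) ` X. \<exists>e\<in>E. \<exists>z\<in>X. x = e [+A] z"
    using tr[OF Z2[OF fg(1)]] by (elim exE conjE)
   have "cov {x [+A] y | x y. x \<in> (%e. e [*A] g) ` E & y \<in> (%x. x [*A] g) ` X}"
    by (rule cov_add[OF fin_mult(2)[OF E(1,2) fR(2)] Z2[OF fg(2)]])
   then have 2: "cov ((%x. x [*A] (f [*A] g)) ` X)"
   proof (rule cov_sub, intro subsetI)
    fix w assume "w \<in> (%x. x [*A] (f [*A] g)) ` X"
    then obtain x where x: "x \<in> X" "w = x [*A] (f [*A] g)" by blast
    obtain e z where e: "e \<in> E" "z \<in> X" "x [*A] f = e [+A] z" using E(3) x by blast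
    have "w = (x [*A] f) [*A] g" using x c Xc by (simp add: A.rng_m_assoc)
    then have "w = e [*A] g [+A] z [*A] g"
     using e c Xc E(2) Rc by (simp add: A.rng_l_distr subset_iff)
    then show "w \<in> {x [+A] y | x y. x \<in> (%e. e [*A] g) ` E & y \<in> (%x. x [*A] g) ` X}"
     using e by blast
   qed
   show ?thesis using 1 2 fR R0_closed(2) by (simp add: Z_def)
  qed
  have add: "f [+A] g \<in> Z" if fg: "f \<in> Z" "g \<in> Z" for f g
  proof -
   have fR: "f \<in> R0" "g \<in> R0" and c: "f \<in> carrier A" "g \<in> carrier A"
    using fg Rc by (auto simp: Z_def)
   have "cov {x [+A] y | x y. x \<in> (%x. f [*A] x) ` X & y \<in> (%x. g [*A] x) ` X}"
    by (rule cov_add[OF Z1[OF fg(1)] Z1[OF fg(2)]])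
   then have 1: "cov ((%x. (f [+A] g) [*A] x) ` X)"
    by (rule cov_sub) (use c Xc in \<open>auto simp: A.rng_l_distr\<close>)
   have "cov {x [+A] y | x y. x \<in> (%x. x [*A] f) ` X & y \<in> (%x. x [*A] g) ` X}"
    by (rule cov_add[OF Z2[OF fg(1)] Z2[OF fg(2)]])
   then have 2: "cov ((%x. x [*A] (f [+A] g)) ` X)"
    by (rule cov_sub) (use c Xc in \<open>auto simp: A.rng_r_distr\<close>)
   show ?thesis using 1 2 fR R0_closed(1) by (simp add: Z_def)
  qed
  show ?case
  proof
   fix z assume "z \<in> lev (Suc n)"
   then obtain a b c d where "a \<in> lev n" "b \<in> lev n" "c \<in> lev n" "d \<in> lev n"
    "z = a [*A] b [+A] (c [+A] d)" unfolding lev_Suc_iff by blast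
   moreover then have "a \<in> Z" "b \<in> Z" "c \<in> Z" "d \<in> Z" using Suc by auto
   ultimately show "z \<in> Z" by (simp only:) (intro add mult)
  qed
 qed
 have covf: "cov ((%x. f [*A] x) ` X)" "cov ((%x. x [*A] f) ` X)" if "f \<in> R0" for f
  using that Zl unfolding R0_eq Z_def by blast+
 have "cov (lev n)"
 proof (induction n)
  case 0
  then show ?case using cov_X by simp
 next
  case (Suc n)
  obtain E where E: "finite E" "E <= R0" "\<forall>x\<in>lev n. \<exists>e\<in>E. \<exists>z\<in>X. x = e [+A] z"
   using tr[OF Suc] by (elim exE conjE)
  let ?P = "%S S'. {x [+A] y | x y. x \<in> S & y \<in> S'}"
  let ?EE = "(%(a, b). a [*A] b) ` (E \<times> E)"
  let ?EX = "\<Union>e\<in>E. (%x. e [*A] x) ` X" and ?XE = "\<Union>e\<in>E. (%x. x [*A] e) ` X"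
  let ?XX = "{x [*A] y | x y. x \<in> X & y \<in> X}"
  have "cov ?EE" using E by (intro cov_fin) (auto intro!: R0_closed(2))
  moreover have "cov ?EX" "cov ?XE" using E covf by (auto intro!: cov_UN)
  ultimately have "cov (?P (?P (?P ?EE ?EX) (?P ?XE ?XX)) (?P (lev n) (lev n)))"
   using XX Suc.IH by (rule_tac cov_add[OF cov_add[OF cov_add cov_add] cov_add])
  then show ?case
  proof (rule cov_sub, intro subsetI)
   fix w assume "w \<in> lev (Suc n)"
   then obtain a b c d where w: "a \<in> lev n" "b \<in> lev n" "c \<in> lev n" "d \<in> lev n"
    "w = a [*A] b [+A] (c [+A] d)" unfolding lev_Suc_iff by blast
   obtain e z where e: "e \<in> E" "z \<in> X" "a = e [+A] z" using E(3) w(1) by blast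
   obtain e' z' where e': "e' \<in> E" "z' \<in> X" "b = e' [+A] z'" using E(3) w(2) by blast
   have cc: "e \<in> carrier A" "z \<in> carrier A" "e' \<in> carrier A" "z' \<in> carrier A"
    using e e' E(2) Xc Rc by blast+
   have ab: "a [*A] b = (e [*A] e' [+A] e [*A] z') [+A] (z [*A] e' [+A] z [*A] z')"
    unfolding e(3) e'(3) using cc by (simp add: A.rng_l_distr A.rng_r_distr A.rng_m_closed A.a_ac)
   have P: "x [+A] y \<in> ?P S S'" if "x \<in> S" "y \<in> S'" for x y S S' using that by blast
   have "e [*A] e' \<in> ?EE" "e [*A] z' \<in> ?EX" "z [*A] e' \<in> ?XE" "z [*A] z' \<in> ?XX"
    using e e' by auto
   then show "w \<in> ?P (?P (?P ?EE ?EX) (?P ?XE ?XX)) (?P (lev n) (lev n))"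
    unfolding w(5) ab using w by (intro P)
  qed
 qed
 then show ?thesis by (simp add: cov_def)
qed

end

section \<open>The interpretation of the ring in the monster model\<close>

context abelian_group begin

lemma cancel_opposite:
  assumes "x \<in> carrier G" "u \<in> carrier G" "z \<in> carrier G" "z = (x \<oplus> \<ominus> x) \<oplus> u" shows "z = u"
  using assms by (simp add: r_neg)

text \<open>Rewriting with associativity and commutativity sorts the summands by size, and so separates a
  summand from its opposite. Together with those laws, these rules decide equations between short
  sums.\<close>

lemma cancel_gap:
  "x \<in> carrier G \<Longrightarrow> a \<in> carrier G \<Longrightarrow> x \<oplus> (a \<oplus> \<ominus> x) = a"
  "x \<in> carrier G \<Longrightarrow> a \<in> carrier G \<Longrightarrow> w \<in> carrier G \<Longrightarrow> x \<oplus> (a \<oplus> (\<ominus> x \<oplus> w)) = a \<oplus> w"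
  "x \<in> carrier G \<Longrightarrow> a \<in> carrier G \<Longrightarrow> b \<in> carrier G \<Longrightarrow> x \<oplus> (a \<oplus> (b \<oplus> \<ominus> x)) = a \<oplus> b"
  "x \<in> carrier G \<Longrightarrow> a \<in> carrier G \<Longrightarrow> b \<in> carrier G \<Longrightarrow> w \<in> carrier G \<Longrightarrow> x \<oplus> (a \<oplus> (b \<oplus> (\<ominus> x \<oplus> w))) = a \<oplus> (b \<oplus> w)"
  "x \<in> carrier G \<Longrightarrow> a \<in> carrier G \<Longrightarrow> b \<in> carrier G \<Longrightarrow> c \<in> carrier G \<Longrightarrow> x \<oplus> (a \<oplus> (b \<oplus> (c \<oplus> \<ominus> x))) = a \<oplus> (b \<oplus> c)"
  "x \<in> carrier G \<Longrightarrow> a \<in> carrier G \<Longrightarrow> b \<in> carrier G \<Longrightarrow> c \<in> carrier G \<Longrightarrow> w \<in> carrier G \<Longrightarrow> x \<oplus> (a \<oplus> (b \<oplus> (c \<oplus> (\<ominus> x \<oplus> w)))) = a \<oplus> (b \<oplus> (c \<oplus> w))"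
  "x \<in> carrier G \<Longrightarrow> a \<in> carrier G \<Longrightarrow> b \<in> carrier G \<Longrightarrow> c \<in> carrier G \<Longrightarrow> d \<in> carrier G \<Longrightarrow> x \<oplus> (a \<oplus> (b \<oplus> (c \<oplus> (d \<oplus> \<ominus> x)))) = a \<oplus> (b \<oplus> (c \<oplus> d))"
  "x \<in> carrier G \<Longrightarrow> a \<in> carrier G \<Longrightarrow> b \<in> carrier G \<Longrightarrow> c \<in> carrier G \<Longrightarrow> d \<in> carrier G \<Longrightarrow> w \<in> carrier G \<Longrightarrow> x \<oplus> (a \<oplus> (b \<oplus> (c \<oplus> (d \<oplus> (\<ominus> x \<oplus> w))))) = a \<oplus> (b \<oplus> (c \<oplus> (d \<oplus> w)))"
  "x \<in> carrier G \<Longrightarrow> a \<in> carrier G \<Longrightarrow> b \<in> carrier G \<Longrightarrow> c \<in> carrier G \<Longrightarrow> d \<in> carrier G \<Longrightarrow> e \<in> carrier G \<Longrightarrow> x \<oplus> (a \<oplus> (b \<oplus> (c \<oplus> (d \<oplus> (e \<oplus> \<ominus> x))))) = a \<oplus> (b \<oplus> (c \<oplus> (d \<oplus> e)))"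
  "x \<in> carrier G \<Longrightarrow> a \<in> carrier G \<Longrightarrow> b \<in> carrier G \<Longrightarrow> c \<in> carrier G \<Longrightarrow> d \<in> carrier G \<Longrightarrow> e \<in> carrier G \<Longrightarrow> w \<in> carrier G \<Longrightarrow> x \<oplus> (a \<oplus> (b \<oplus> (c \<oplus> (d \<oplus> (e \<oplus> (\<ominus> x \<oplus> w)))))) = a \<oplus> (b \<oplus> (c \<oplus> (d \<oplus> (e \<oplus> w))))"
  "x \<in> carrier G \<Longrightarrow> a \<in> carrier G \<Longrightarrow> b \<in> carrier G \<Longrightarrow> c \<in> carrier G \<Longrightarrow> d \<in> carrier G \<Longrightarrow> e \<in> carrier G \<Longrightarrow> f \<in> carrier G \<Longrightarrow> x \<oplus> (a \<oplus> (b \<oplus> (c \<oplus> (d \<oplus> (e \<oplus> (f \<oplus> \<ominus> x)))))) = a \<oplus> (b \<oplus> (c \<oplus> (d \<oplus> (e \<oplus> f))))"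
  "x \<in> carrier G \<Longrightarrow> a \<in> carrier G \<Longrightarrow> b \<in> carrier G \<Longrightarrow> c \<in> carrier G \<Longrightarrow> d \<in> carrier G \<Longrightarrow> e \<in> carrier G \<Longrightarrow> f \<in> carrier G \<Longrightarrow> w \<in> carrier G \<Longrightarrow> x \<oplus> (a \<oplus> (b \<oplus> (c \<oplus> (d \<oplus> (e \<oplus> (f \<oplus> (\<ominus> x \<oplus> w))))))) = a \<oplus> (b \<oplus> (c \<oplus> (d \<oplus> (e \<oplus> (f \<oplus> w)))))"
  "x \<in> carrier G \<Longrightarrow> a \<in> carrier G \<Longrightarrow> b \<in> carrier G \<Longrightarrow> c \<in> carrier G \<Longrightarrow> d \<in> carrier G \<Longrightarrow> e \<in> carrier G \<Longrightarrow> f \<in> carrier G \<Longrightarrow> g \<in> carrier G \<Longrightarrow> x \<oplus> (a \<oplus> (b \<oplus> (c \<oplus> (d \<oplus> (e \<oplus> (f \<oplus> (g \<oplus> \<ominus> x))))))) = a \<oplus> (b \<oplus> (c \<oplus> (d \<oplus> (e \<oplus> (f \<oplus> g)))))"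
  "x \<in> carrier G \<Longrightarrow> a \<in> carrier G \<Longrightarrow> b \<in> carrier G \<Longrightarrow> c \<in> carrier G \<Longrightarrow> d \<in> carrier G \<Longrightarrow> e \<in> carrier G \<Longrightarrow> f \<in> carrier G \<Longrightarrow> g \<in> carrier G \<Longrightarrow> w \<in> carrier G \<Longrightarrow> x \<oplus> (a \<oplus> (b \<oplus> (c \<oplus> (d \<oplus> (e \<oplus> (f \<oplus> (g \<oplus> (\<ominus> x \<oplus> w)))))))) = a \<oplus> (b \<oplus> (c \<oplus> (d \<oplus> (e \<oplus> (f \<oplus> (g \<oplus> w))))))"
  by (rule cancel_opposite[of x]; simp only: a_ac a_closed a_inv_closed)+

end

context rng begin

lemmas ring_norm = minus_eq minus_add a_ac cancel_gap r_neg r_neg1 r_neg2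
  rng_m_closed rng_m_assoc rng_l_distr rng_r_distr rng_l_minus rng_r_minus rng_l_null rng_r_null

end

declare level.simps(2) [simp del]

context def_ring begin

abbreviation Y :: "nat => 'a list set" where "Y n \<equiv> level_bar L M C k A X n"

lemma Y_dset: "dset (Y n)" and Y_T0: "Y n \<inter> T0 = lev n"
 using interp_dset[of "lev n"] zdef by (auto simp: level_bar_def zero_definable_def)

lemma Y_T: "Y n <= T"
 using dset_sub[OF Y_dset] .

lemma lev_T0: "lev n <= T0" and lev_Y: "lev n <= Y n"
 using Y_T0 by auto

lemma Y_mono: assumes "m <= n" shows "Y m <= Y n"
proof (rule dset_eqI[OF Y_dset Y_dset])
 show "Y m \<inter> T0 <= Y n"
  unfolding Y_T0 using lev_mono[OF assms] lev_Y[of n] by (rule order_trans)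
qed

lemma interp_tuples:
 assumes "definable_over L M n {} D" shows "interp_in L M C n D <= tuples n (universe C)"
proof -
 obtain q where q: "q \<in> formulas_over L n {}" "D = realizations M n {q}"
  using assms by (auto simp: definable_over_def)
 obtain \<phi> where \<phi>: "q = (\<phi>, [])" using q(1) by (auto simp: formulas_over_def)
 have "interp_in L M C n D = realizations C n {q}"
  unfolding q(2) \<phi> by (rule interp_eq) (use q \<phi> in simp)
 then show ?thesis by (auto simp: realizations_def)
qed

text \<open>The properties of the graph of an operation that make it the graph of a function from level \<open>n\<close>
  to level \<open>n + 1\<close> are first-order.\<close>

lemma op_interp:
 fixes f :: "'a list => 'a list => 'a list"
 assumes def: "!!n. definable_over L M (3 * k) {} ((%(x, y). x @ y @ f x y) ` (lev n \<times> lev n))"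
  and f: "!!n x y. x \<in> lev n ==> y \<in> lev n ==> f x y \<in> lev (Suc n)"
  and F: "!!x y. F x y = (THE z. \<exists>n. x @ y @ z \<in> interp_in L M C (3 * k) ((%(x, y). x @ y @ f x y) ` (lev n \<times> lev n)))"
 shows "!!n x y. x \<in> Y n ==> y \<in> Y n ==> F x y \<in> Y (Suc n)"
  and "!!n. dfn (%v. (v 0 \<in> Y n & v 1 \<in> Y n) & v 2 = F (v 0) (v 1))"
  and "!!n x y. x \<in> lev n ==> y \<in> lev n ==> F x y = f x y"
proof -
 define GI where "GI n = interp_in L M C (3 * k) ((%(x, y). x @ y @ f x y) ` (lev n \<times> lev n))" for n
 have dG: "dfn (%v. v 0 @ v 1 @ v 2 \<in> GI n)" for n
  unfolding GI_def by (rule interp_relation(1)[OF def])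
 have dGs: "dfn (%v. v a @ v b @ v c \<in> GI n)" for n a b c
  using dfn_subst[OF dG[of n], of "%i. if i = 0 then a else if i = 1 then b else c"] by simp
 have len: "length x = k" if "x \<in> T" for x using that by (auto simp: T_def tuples_def)
 have G0: "x @ y @ z \<in> GI n \<longleftrightarrow> x \<in> lev n & y \<in> lev n & z = f x y"
  if "x \<in> T0" "y \<in> T0" "z \<in> T0" for x y z n
 proof -
  have "x @ y @ z \<in> GI n \<longleftrightarrow> x @ y @ z \<in> (%(x, y). x @ y @ f x y) ` (lev n \<times> lev n)"
   unfolding GI_def by (rule interp_relation(2)[OF def that])
  also have "\<dots> \<longleftrightarrow> (\<exists>x'\<in>lev n. \<exists>y'\<in>lev n. x @ y @ z = x' @ y' @ f x' y')" by auto
  also have "\<dots> \<longleftrightarrow> x \<in> lev n & y \<in> lev n & z = f x y"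
  proof -
   have "x @ y @ z = x' @ y' @ f x' y' \<longleftrightarrow> x = x' & y = y' & z = f x' y'"
    if "x' \<in> lev n" "y' \<in> lev n" for x' y'
   proof -
    have "length x' = length x" "length y' = length y"
     using that lev_T0[of n] T0_sub_T len \<open>x \<in> T0\<close> \<open>y \<in> T0\<close> by (auto simp: subset_iff)
    then show ?thesis by simp
   qed
   then show ?thesis by blast
  qed
  finally show ?thesis .
 qed
 have ex: "\<exists>z\<in>T. x @ y @ z \<in> GI n" if xy: "x \<in> Y n" "y \<in> Y n" for x y n
 proof -
  have "x \<in> Y n & y \<in> Y n --> (\<exists>z\<in>T. x @ y @ z \<in> GI n)"
  proof (rule transfer2[where P = "%x y. x \<in> Y n & y \<in> Y n --> (\<exists>z\<in>T. x @ y @ z \<in> GI n)"])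
   have "dfn (%v. \<exists>z\<in>T. v 0 @ v 1 @ z \<in> GI n)"
    by (rule dfn_ex) (rule dGs)
   then show "dfn (%v. v 0 \<in> Y n & v 1 \<in> Y n --> (\<exists>z\<in>T. v 0 @ v 1 @ z \<in> GI n))"
    by (intro dfn_imp dfn_and dset_mem Y_dset)
   show "x \<in> Y n & y \<in> Y n --> (\<exists>z\<in>T. x @ y @ z \<in> GI n)" if "x \<in> T0" "y \<in> T0" for x y
   proof
    assume "x \<in> Y n & y \<in> Y n"
    then have l: "x \<in> lev n" "y \<in> lev n" using that Y_T0 by auto
    then have "f x y \<in> T0" using f lev_T0 by blast
    then show "\<exists>z\<in>T. x @ y @ z \<in> GI n" using G0[of x y "f x y" n] l that T0_sub_T by blast
   qed
   show "x \<in> T" "y \<in> T" using xy Y_T by auto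
  qed
  then show ?thesis using xy by blast
 qed
 have sub: "z \<in> Y (Suc n)" if xyz: "x \<in> T" "y \<in> T" "z \<in> T" "x @ y @ z \<in> GI n" for x y z n
 proof -
  have "x @ y @ z \<in> GI n --> z \<in> Y (Suc n)"
  proof (rule transfer3[where P = "%x y z. x @ y @ z \<in> GI n --> z \<in> Y (Suc n)"])
   show "dfn (%v. v 0 @ v 1 @ v 2 \<in> GI n --> v 2 \<in> Y (Suc n))"
    by (intro dfn_imp dset_mem Y_dset dG)
   show "x @ y @ z \<in> GI n --> z \<in> Y (Suc n)" if "x \<in> T0" "y \<in> T0" "z \<in> T0" for x y z
    using G0[OF that] f lev_Y by blast
  qed (use xyz in auto)
  then show ?thesis using xyz by blast
 qed
 have uniq: "z = z'" if xyz: "x \<in> T" "y \<in> T" "z \<in> T" "z' \<in> T" "x @ y @ z \<in> GI n" "x @ y @ z' \<in> GI m" for x y z z' n m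
 proof -
  let ?Q = "%v. v 0 @ v 1 @ v 2 \<in> GI n & v 0 @ v 1 @ v 3 \<in> GI m --> v 2 = v 3"
  let ?v = "%i::nat. if i = 0 then x else if i = 1 then y else if i = 2 then z else z'"
  have "?Q ?v"
  proof (rule transfer[where Q = ?Q])
   show "dfn ?Q" by (intro dfn_imp dfn_and dGs dfn_eq)
   show "?Q v" if "!!i. v i \<in> T0" for v using G0[of "v 0" "v 1"] that by metis
   show "?v i \<in> T" for i using xyz by simp
  qed
  then show ?thesis using xyz by simp
 qed
 have inT: "z \<in> T" if "x \<in> T" "y \<in> T" "x @ y @ z \<in> GI n" for x y z n
 proof -
  have "x @ y @ z \<in> tuples (3 * k) (universe C)"
   using interp_tuples[OF def[of n]] that unfolding GI_def by blast
  then show ?thesis using len[OF that(1)] len[OF that(2)] by (auto simp: T_def tuples_def)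
 qed
 have Fval: "F x y \<in> T & x @ y @ F x y \<in> GI n" if xy: "x \<in> Y n" "y \<in> Y n" for x y n
 proof -
  obtain z where z: "z \<in> T" "x @ y @ z \<in> GI n" using ex[OF xy] by blast
  have xyT: "x \<in> T" "y \<in> T" using xy Y_T by auto
  have "F x y = z" unfolding F GI_def[symmetric]
  proof (rule the_equality)
   show "\<exists>n. x @ y @ z \<in> GI n" using z by blast
   fix z' assume "\<exists>n. x @ y @ z' \<in> GI n"
   then obtain m where "x @ y @ z' \<in> GI m" by blast
   then show "z' = z" using uniq[of x y z' z m n] inT xyT z by blast
  qed
  then show ?thesis using z by simp
 qed
 show "F x y \<in> Y (Suc n)" if "x \<in> Y n" "y \<in> Y n" for n x y
  using Fval[OF that] sub[of x y "F x y" n] that Y_T by blast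
 show "dfn (%v. (v 0 \<in> Y n & v 1 \<in> Y n) & v 2 = F (v 0) (v 1))" for n
 proof (rule dfn_cong)
  show "dfn (%v. (v 0 \<in> Y n & v 1 \<in> Y n) & v 0 @ v 1 @ v 2 \<in> GI n)"
   by (intro dfn_and dset_mem Y_dset dG)
  fix v :: "nat => 'a list" assume v: "!!i. v i \<in> T"
  show "((v 0 \<in> Y n & v 1 \<in> Y n) & v 0 @ v 1 @ v 2 \<in> GI n) = ((v 0 \<in> Y n & v 1 \<in> Y n) & v 2 = F (v 0) (v 1))"
  proof (cases "v 0 \<in> Y n & v 1 \<in> Y n")
   case True
   then show ?thesis using Fval[of "v 0" n "v 1"] uniq[of "v 0" "v 1" "v 2" "F (v 0) (v 1)" n n] v by auto
  next
   case False
   then show ?thesis by blast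
  qed
 qed
 show "F x y = f x y" if xy: "x \<in> lev n" "y \<in> lev n" for n x y
 proof -
  have T0: "x \<in> T0" "y \<in> T0" "f x y \<in> T0" using xy f[OF xy] lev_T0 by auto
  then have "x @ y @ f x y \<in> GI n" using G0 xy by blast
  moreover have "F x y \<in> T & x @ y @ F x y \<in> GI n" using Fval xy lev_Y by blast
  ultimately show ?thesis using uniq[of x y "F x y" "f x y" n n] T0 T0_sub_T by blast
 qed
qed

definition R :: "'a list ring" where "R = ring_bar L M C k A X"

abbreviation add_R (infixl "[+]" 65) where "x [+] y \<equiv> x \<oplus>\<^bsub>R\<^esub> y"
abbreviation minus_R (infixl "[-]" 65) where "x [-] y \<equiv> x \<ominus>\<^bsub>R\<^esub> y"
abbreviation mult_R (infixl "[*]" 70) where "x [*] y \<equiv> x \<otimes>\<^bsub>R\<^esub> y"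

lemma R_carrier: "carrier R = (\<Union>n. Y n)"
 and R_zero: "\<zero>\<^bsub>R\<^esub> = \<zero>\<^bsub>A\<^esub>"
 by (simp_all add: R_def ring_bar_def)

lemma R_add_props:
 shows R_add_closed: "!!n x y. x \<in> Y n ==> y \<in> Y n ==> x [+] y \<in> Y (Suc n)"
  and R_add_dfn: "!!n. dfn (%v. (v 0 \<in> Y n & v 1 \<in> Y n) & v 2 = v 0 [+] v 1)"
  and R_add_lev: "!!n x y. x \<in> lev n ==> y \<in> lev n ==> x [+] y = x [+A] y"
proof -
 have def: "definable_over L M (3 * k) {} ((%(x, y). x @ y @ (x [+A] y)) ` (lev n \<times> lev n))" for n
  using zdef unfolding zero_definable_def add_graph_def by blast
 have F: "x [+] y = (THE z. \<exists>n. x @ y @ z \<in> interp_in L M C (3 * k) ((%(x, y). x @ y @ (x [+A] y)) ` (lev n \<times> lev n)))" for x y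
  by (simp add: R_def ring_bar_def add_graph_def)
 note * = op_interp[where f = "%x y. x [+A] y" and F = "%x y. x [+] y", OF def lev_add F]
 show "!!n x y. x \<in> Y n ==> y \<in> Y n ==> x [+] y \<in> Y (Suc n)" by (rule *(1))
 show "!!n. dfn (%v. (v 0 \<in> Y n & v 1 \<in> Y n) & v 2 = v 0 [+] v 1)" by (rule *(2))
 show "!!n x y. x \<in> lev n ==> y \<in> lev n ==> x [+] y = x [+A] y" by (rule *(3))
qed

lemma R_mult_props:
 shows R_mult_closed: "!!n x y. x \<in> Y n ==> y \<in> Y n ==> x [*] y \<in> Y (Suc n)"
  and R_mult_dfn: "!!n. dfn (%v. (v 0 \<in> Y n & v 1 \<in> Y n) & v 2 = v 0 [*] v 1)"
  and R_mult_lev: "!!n x y. x \<in> lev n ==> y \<in> lev n ==> x [*] y = x [*A] y"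
proof -
 have def: "definable_over L M (3 * k) {} ((%(x, y). x @ y @ (x [*A] y)) ` (lev n \<times> lev n))" for n
  using zdef unfolding zero_definable_def mult_graph_def by blast
 have F: "x [*] y = (THE z. \<exists>n. x @ y @ z \<in> interp_in L M C (3 * k) ((%(x, y). x @ y @ (x [*A] y)) ` (lev n \<times> lev n)))" for x y
  by (simp add: R_def ring_bar_def mult_graph_def)
 note * = op_interp[where f = "%x y. x [*A] y" and F = "%x y. x [*] y", OF def lev_mult F]
 show "!!n x y. x \<in> Y n ==> y \<in> Y n ==> x [*] y \<in> Y (Suc n)" by (rule *(1))
 show "!!n. dfn (%v. (v 0 \<in> Y n & v 1 \<in> Y n) & v 2 = v 0 [*] v 1)" by (rule *(2))
 show "!!n x y. x \<in> lev n ==> y \<in> lev n ==> x [*] y = x [*A] y" by (rule *(3))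
qed

lemma R0_T0: "R0 = carrier R \<inter> T0"
 unfolding R0_eq R_carrier using Y_T0 by auto

lemma R_add_R0: "x \<in> R0 ==> y \<in> R0 ==> x [+] y = x [+A] y"
 using R0_max[of "{x, y}"] R_add_lev by auto

lemma R_mult_R0: "x \<in> R0 ==> y \<in> R0 ==> x [*] y = x [*A] y"
 using R0_max[of "{x, y}"] R_mult_lev by auto

text \<open>A term whose value is defined when the guard \<open>G\<close> holds. The operations of the ring are definable only between levels, so
  the guard has to bound the values of the term.\<close>

definition tm :: "((nat => 'a list) => bool) => ((nat => 'a list) => 'a list) => bool" where
 "tm G t \<longleftrightarrow> dfn G & (\<exists>n. \<forall>v. (\<forall>i. v i \<in> T) --> G v --> t v \<in> Y n) \<and>
   dfn (%v. G (%i. v (Suc i)) & v 0 = t (%i. v (Suc i)))"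

lemma tm_bound: "tm G t ==> \<exists>n. \<forall>v. (\<forall>i. v i \<in> T) --> G v --> t v \<in> Y n"
 by (simp only: tm_def)

lemma tmI:
 "dfn G ==> \<forall>v. (\<forall>i. v i \<in> T) --> G v --> t v \<in> Y n ==>
   dfn (%v. G (%i. v (Suc i)) & v 0 = t (%i. v (Suc i))) ==> tm G t"
 unfolding tm_def by (intro conjI exI[of _ n])

lemma tm_var:
 assumes G: "dfn G" and le: "!!v. G v ==> v i \<in> Y n"
 shows "tm G (%v. v i)"
proof (rule tmI[OF G, of _ n])
 show "\<forall>v. (\<forall>i. v i \<in> T) --> G v --> v i \<in> Y n" using le by simp
 show "dfn (%v. G (%i. v (Suc i)) & v 0 = v (Suc i))"
  by (rule dfn_and[OF dfn_subst[OF G] dfn_eq])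
qed

lemma tm_const:
 assumes G: "dfn G" and c: "c \<in> R0" shows "tm G (%v. c)"
proof -
 obtain n where "c \<in> lev n" using c by (auto simp: R0_eq)
 then have n: "c \<in> Y n" "c \<in> T0" using lev_Y lev_T0 by auto
 have "dfn (%v. G (%i. v (Suc i)) & v 0 = c)"
  by (rule dfn_and[OF dfn_subst[OF G] dfn_const[OF n(2)]])
 then show ?thesis by (intro tmI[of _ _ n] G) (simp_all add: n)
qed

lemma tm_op:
 assumes cl: "!!n x y. x \<in> Y n ==> y \<in> Y n ==> F x y \<in> Y (Suc n)"
  and dF: "!!n. dfn (%v. (v 0 \<in> Y n & v 1 \<in> Y n) & v 2 = F (v 0) (v 1))"
  and s: "tm G s" and t: "tm G t"
 shows "tm G (%v. F (s v) (t v))"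
proof -
 obtain m where m: "\<forall>v. (\<forall>i. v i \<in> T) --> G v --> s v \<in> Y m"
  using tm_bound[OF s] by (elim exE)
 obtain n where n: "\<forall>v. (\<forall>i. v i \<in> T) --> G v --> t v \<in> Y n"
  using tm_bound[OF t] by (elim exE)
 have G: "dfn G" using s by (simp add: tm_def)
 define N where "N = max m n"
 have N: "s v \<in> Y N" "t v \<in> Y N" if "!!i. v i \<in> T" "G v" for v
  using m[rule_format, of v] n[rule_format, of v] that Y_mono[of m N] Y_mono[of n N] by (auto simp: N_def)
 have gs: "dfn (%v. G (%i. v (Suc (Suc (Suc i)))) & v (Suc 0) = s (%i. v (Suc (Suc (Suc i)))))"
  using dfn_subst[of "%v. G (%i. v (Suc i)) & v 0 = s (%i. v (Suc i))" "case_nat (Suc 0) (%i. Suc (Suc (Suc i)))"] s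
  by (simp add: tm_def)
 have gt: "dfn (%v. G (%i. v (Suc (Suc (Suc i)))) & v 0 = t (%i. v (Suc (Suc (Suc i)))))"
  using dfn_subst[of "%v. G (%i. v (Suc i)) & v 0 = t (%i. v (Suc i))" "case_nat 0 (%i. Suc (Suc (Suc i)))"] t
  by (simp add: tm_def)
 have gF: "dfn (%v. (v (Suc 0) \<in> Y N & v 0 \<in> Y N) & v (Suc (Suc 0)) = F (v (Suc 0)) (v 0))"
  using dfn_subst[OF dF[of N], of "%i. if i = 0 then Suc 0 else if i = 1 then 0 else Suc (Suc 0)"] by simp
 have "dfn (%v. \<exists>x\<in>T. \<exists>y\<in>T. ((G (%i. v (Suc i)) & x = s (%i. v (Suc i))) \<and>
   (G (%i. v (Suc i)) & y = t (%i. v (Suc i)))) & ((x \<in> Y N & y \<in> Y N) & v 0 = F x y))"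
  by (rule dfn_ex, rule dfn_ex) (rule dfn_and[OF dfn_and[OF gs gt] gF])
 then have "dfn (%v. G (%i. v (Suc i)) & v 0 = F (s (%i. v (Suc i))) (t (%i. v (Suc i))))"
 proof (rule dfn_cong)
  fix v :: "nat => 'a list" assume v: "!!i. v i \<in> T"
  have "s (%i. v (Suc i)) \<in> Y N & t (%i. v (Suc i)) \<in> Y N" if "G (%i. v (Suc i))"
   using N[of "%i. v (Suc i)"] v that by auto
  then show "(\<exists>x\<in>T. \<exists>y\<in>T. ((G (%i. v (Suc i)) & x = s (%i. v (Suc i))) \<and>
   (G (%i. v (Suc i)) & y = t (%i. v (Suc i)))) & ((x \<in> Y N & y \<in> Y N) & v 0 = F x y)) =
   (G (%i. v (Suc i)) & v 0 = F (s (%i. v (Suc i))) (t (%i. v (Suc i))))"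
   using Y_T[of N] by auto
 qed
 moreover have "\<forall>v. (\<forall>i. v i \<in> T) --> G v --> F (s v) (t v) \<in> Y (Suc N)"
  by (intro allI impI cl N) simp_all
 ultimately show ?thesis by (intro tmI[of _ _ "Suc N"] G)
qed

lemma tm_add: "tm G s ==> tm G t ==> tm G (%v. s v [+] t v)"
 by (rule tm_op[where F = "%x y. x [+] y"]) (assumption | rule R_add_dfn | rule R_add_closed)+

lemma tm_mult: "tm G s ==> tm G t ==> tm G (%v. s v [*] t v)"
 by (rule tm_op[where F = "%x y. x [*] y"]) (assumption | rule R_mult_dfn | rule R_mult_closed)+

lemma tm_T:
 assumes t: "tm G t" and v: "!!i. v i \<in> T" "G v" shows "t v \<in> T"
proof -
 obtain n where "\<forall>v. (\<forall>i. v i \<in> T) --> G v --> t v \<in> Y n"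
  using tm_bound[OF t] by (elim exE)
 then have "t v \<in> Y n" using v by simp
 then show ?thesis using Y_T by auto
qed

lemma tm_graph: "tm G t ==> dfn (%v. G (%i. v (Suc i)) & v 0 = t (%i. v (Suc i)))"
 by (simp add: tm_def)

lemma tm_eq_imp:
 assumes s: "tm G s" and t: "tm G t" shows "dfn (%v. G v --> s v = t v)"
proof -
 have "dfn (%v. \<exists>x\<in>T. (G v & x = s v) & (G v & x = t v))"
  by (rule dfn_ex) (rule dfn_and[OF tm_graph[OF s] tm_graph[OF t]])
 then have "dfn (%v. G v --> (\<exists>x\<in>T. (G v & x = s v) & (G v & x = t v)))"
  using s by (intro dfn_imp) (simp add: tm_def)
 then show ?thesis by (rule dfn_cong) (use tm_T[OF s] in auto)
qed

lemma tm_in_imp: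
 assumes t: "tm G t" and D: "dset D" shows "dfn (%v. G v --> t v \<in> D)"
proof -
 have "dfn (%v. \<exists>x\<in>T. (G v & x = t v) & x \<in> D)"
  by (rule dfn_ex) (rule dfn_and[OF tm_graph[OF t] dset_mem[OF D]])
 then have "dfn (%v. G v --> (\<exists>x\<in>T. (G v & x = t v) & x \<in> D))"
  using t by (intro dfn_imp) (simp add: tm_def)
 then show ?thesis by (rule dfn_cong) (use tm_T[OF t] in auto)
qed

lemma tm_dfn: "tm G t ==> dfn G" by (simp add: tm_def)

lemma tm_in:
 assumes t: "tm G t" and D: "dset D" shows "dfn (%v. G v & t v \<in> D)"
 using dfn_and[OF tm_dfn[OF t] tm_in_imp[OF t D]] by (rule dfn_cong) blast

lemma tm_eq:
 assumes s: "tm G s" and t: "tm G t" shows "dfn (%v. G v & s v = t v)"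
 using dfn_and[OF tm_dfn[OF t] tm_eq_imp[OF s t]] by (rule dfn_cong) blast

lemma tm_guard:
 assumes t: "tm G t" and H: "dfn H" "!!v. H v ==> G v" shows "tm H t"
proof -
 have "dfn (%v. H (%i. v (Suc i)) & (G (%i. v (Suc i)) & v 0 = t (%i. v (Suc i))))"
  by (rule dfn_and[OF dfn_subst[OF H(1)] tm_graph[OF t]])
 then have "dfn (%v. H (%i. v (Suc i)) & v 0 = t (%i. v (Suc i)))"
  by (rule dfn_cong) (use H(2) in auto)
 moreover obtain n where "\<forall>v. (\<forall>i. v i \<in> T) --> G v --> t v \<in> Y n"
  using tm_bound[OF t] by (elim exE)
 then have "\<forall>v. (\<forall>i. v i \<in> T) --> H v --> t v \<in> Y n" using H(2) by simp
 ultimately show ?thesis by (intro tmI[of _ _ n] H(1))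
qed

lemma common_level3: "x \<in> carrier R ==> y \<in> carrier R ==> z \<in> carrier R ==> \<exists>n. x \<in> Y n & y \<in> Y n & z \<in> Y n"
proof -
 assume "x \<in> carrier R" "y \<in> carrier R" "z \<in> carrier R"
 then obtain a b c where abc: "x \<in> Y a" "y \<in> Y b" "z \<in> Y c" unfolding R_carrier by blast
 let ?n = "max a (max b c)"
 have "Y a <= Y ?n" "Y b <= Y ?n" "Y c <= Y ?n" by (rule Y_mono, simp)+
 then show ?thesis using abc by blast
qed

lemma in_R0: "x \<in> T0 ==> x \<in> Y n ==> x \<in> R0"
 using Y_T0 by (auto simp: R0_eq)

lemma R0_Ac: "x \<in> R0 ==> x \<in> carrier A"
 using R0_carrier by auto

lemmas R0_simps = R_add_R0 R_mult_R0 R0_closed R0_Ac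

lemma guard3: "dfn (%v. (v 0 \<in> Y n & v 1 \<in> Y n) & v 2 \<in> Y n)"
 by (intro dfn_and dset_mem Y_dset)

lemma tm_var3:
 shows "tm (%v. (v 0 \<in> Y n & v 1 \<in> Y n) & v 2 \<in> Y n) (%v. v 0)"
  "tm (%v. (v 0 \<in> Y n & v 1 \<in> Y n) & v 2 \<in> Y n) (%v. v 1)"
  "tm (%v. (v 0 \<in> Y n & v 1 \<in> Y n) & v 2 \<in> Y n) (%v. v 2)"
 by (rule tm_var[OF guard3, of _ _ n], simp)+

text \<open>Ring laws in at most three variables pass from \<open>R0\<close> to the interpretation, one level at a time.\<close>

lemma law3:
 assumes s: "!!n. tm (%v. (v 0 \<in> Y n & v 1 \<in> Y n) & v 2 \<in> Y n) (%v. s (v 0) (v 1) (v 2))"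
  and t: "!!n. tm (%v. (v 0 \<in> Y n & v 1 \<in> Y n) & v 2 \<in> Y n) (%v. t (v 0) (v 1) (v 2))"
  and eq: "!!x y z. x \<in> R0 ==> y \<in> R0 ==> z \<in> R0 ==> s x y z = t x y z"
  and xyz: "x \<in> carrier R" "y \<in> carrier R" "z \<in> carrier R"
 shows "s x y z = t x y z"
proof -
 obtain n where n: "x \<in> Y n" "y \<in> Y n" "z \<in> Y n" using common_level3[OF xyz] by blast
 have "(x \<in> Y n & y \<in> Y n) & z \<in> Y n --> s x y z = t x y z"
 proof (rule transfer3[where P = "%x y z. (x \<in> Y n & y \<in> Y n) & z \<in> Y n --> s x y z = t x y z"])
  show "dfn (%v. (v 0 \<in> Y n & v 1 \<in> Y n) & v 2 \<in> Y n --> s (v 0) (v 1) (v 2) = t (v 0) (v 1) (v 2))"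
   by (rule tm_eq_imp[OF s t])
  show "(x \<in> Y n & y \<in> Y n) & z \<in> Y n --> s x y z = t x y z" if "x \<in> T0" "y \<in> T0" "z \<in> T0" for x y z
   using eq that in_R0 by blast
 qed (use n Y_T in auto)
 then show ?thesis using n by blast
qed

lemma zero_R0: "\<zero>\<^bsub>R\<^esub> \<in> R0"
 using R0_closed(4) by (simp add: R_zero)

lemma R0_sub_R: "R0 <= carrier R"
 by (auto simp: R0_T0)

lemma Y_negex: "x \<in> Y n ==> \<exists>y\<in>Y n. y [+] x = \<zero>\<^bsub>R\<^esub>"
proof -
 assume x: "x \<in> Y n"
 have "x \<in> Y n --> (\<exists>y\<in>T. (y \<in> Y n & x \<in> Y n) & y [+] x = \<zero>\<^bsub>R\<^esub>)"
 proof (rule transfer1[where P = "%x. x \<in> Y n --> (\<exists>y\<in>T. (y \<in> Y n & x \<in> Y n) & y [+] x = \<zero>\<^bsub>R\<^esub>)"])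
  have G: "dfn (%v. v 0 \<in> Y n & v (Suc 0) \<in> Y n)" by (intro dfn_and dset_mem Y_dset)
  have "dfn (%v. (v 0 \<in> Y n & v (Suc 0) \<in> Y n) & v 0 [+] v (Suc 0) = \<zero>\<^bsub>R\<^esub>)"
  proof (rule tm_eq[OF tm_add tm_const[OF G zero_R0]])
   show "tm (%v. v 0 \<in> Y n & v (Suc 0) \<in> Y n) (%v. v 0)" by (rule tm_var[OF G, of _ n]) simp
   show "tm (%v. v 0 \<in> Y n & v (Suc 0) \<in> Y n) (%v. v (Suc 0))" by (rule tm_var[OF G, of _ n]) simp
  qed
  then have "dfn (%v. \<exists>y\<in>T. (y \<in> Y n & v 0 \<in> Y n) & y [+] v 0 = \<zero>\<^bsub>R\<^esub>)" by (rule dfn_ex)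
  then show "dfn (%v. v 0 \<in> Y n --> (\<exists>y\<in>T. (y \<in> Y n & v 0 \<in> Y n) & y [+] v 0 = \<zero>\<^bsub>R\<^esub>))"
   by (intro dfn_imp dset_mem Y_dset)
  show "x \<in> Y n --> (\<exists>y\<in>T. (y \<in> Y n & x \<in> Y n) & y [+] x = \<zero>\<^bsub>R\<^esub>)" if "x \<in> T0" for x
  proof
   assume "x \<in> Y n"
   then have l: "x \<in> lev n" using that Y_T0 by auto
   then have "\<ominus>\<^bsub>A\<^esub> x \<in> lev n" "x \<in> carrier A" using lev_neg lev_carrier by auto
   moreover then have "\<ominus>\<^bsub>A\<^esub> x [+] x = \<zero>\<^bsub>R\<^esub>" using l R_add_lev[of "\<ominus>\<^bsub>A\<^esub> x" n x] by (simp add: R_zero A.l_neg)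
   ultimately show "\<exists>y\<in>T. (y \<in> Y n & x \<in> Y n) & y [+] x = \<zero>\<^bsub>R\<^esub>"
    using l lev_Y Y_T by blast
  qed
 qed (use x Y_T in auto)
 then show ?thesis using x by blast
qed

lemma rng_R: "rng R"
proof (rule rng.intro)
 have c: "x [+] y \<in> carrier R" "x [*] y \<in> carrier R" if xy: "x \<in> carrier R" "y \<in> carrier R" for x y
 proof -
  obtain n where n: "x \<in> Y n" "y \<in> Y n" using common_level3[OF xy xy(1)] by (elim exE conjE)
  show "x [+] y \<in> carrier R" unfolding R_carrier using R_add_closed[OF n] by (rule UN_I[OF UNIV_I])
  show "x [*] y \<in> carrier R" unfolding R_carrier using R_mult_closed[OF n] by (rule UN_I[OF UNIV_I])
 qed
 show "abelian_group R"
 proof (rule abelian_groupI)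
  show "\<zero>\<^bsub>R\<^esub> \<in> carrier R" using zero_R0 R0_sub_R by blast
  show "x [+] y [+] z = x [+] (y [+] z)" if "x \<in> carrier R" "y \<in> carrier R" "z \<in> carrier R" for x y z
   by (rule law3[OF _ _ _ that]) (intro tm_add tm_var3, intro tm_add tm_var3, simp add: R0_simps A.a_assoc)
  show "x [+] y = y [+] x" if "x \<in> carrier R" "y \<in> carrier R" for x y
   by (rule law3[where s = "%x y z. x [+] y" and t = "%x y z. y [+] x", OF _ _ _ that that(1)])
    (intro tm_add tm_var3, intro tm_add tm_var3, simp add: R0_simps A.a_comm)
  show "\<zero>\<^bsub>R\<^esub> [+] x = x" if "x \<in> carrier R" for x
   by (rule law3[where s = "%x y z. \<zero>\<^bsub>R\<^esub> [+] x" and t = "%x y z. x", OF _ _ _ that that that])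
    (intro tm_add tm_const guard3 zero_R0 tm_var3, intro tm_var3, simp add: R0_simps zero_R0 R_zero)
  show "\<exists>y\<in>carrier R. y [+] x = \<zero>\<^bsub>R\<^esub>" if "x \<in> carrier R" for x
   using that Y_negex unfolding R_carrier by blast
 qed (use c in auto)
 show "rng_axioms R"
 proof (rule rng_axioms.intro)
  show "x [*] y [*] z = x [*] (y [*] z)" if "x \<in> carrier R" "y \<in> carrier R" "z \<in> carrier R" for x y z
   by (rule law3[OF _ _ _ that]) (intro tm_mult tm_var3, intro tm_mult tm_var3, simp add: R0_simps A.rng_m_assoc)
  show "(x [+] y) [*] z = x [*] z [+] y [*] z" if "x \<in> carrier R" "y \<in> carrier R" "z \<in> carrier R" for x y z
   by (rule law3[OF _ _ _ that]) (intro tm_mult tm_add tm_var3, intro tm_mult tm_add tm_var3, simp add: R0_simps A.rng_l_distr)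
  show "z [*] (x [+] y) = z [*] x [+] z [*] y" if "x \<in> carrier R" "y \<in> carrier R" "z \<in> carrier R" for x y z
   by (rule law3[where s = "%x y z. z [*] (x [+] y)" and t = "%x y z. z [*] x [+] z [*] y", OF _ _ _ that])
    (intro tm_mult tm_add tm_var3, intro tm_mult tm_add tm_var3, simp add: R0_simps A.rng_r_distr)
 qed (use c in auto)
qed

sublocale R: rng R by (rule rng_R)

lemma Y_R: "x \<in> Y n ==> x \<in> carrier R"
 by (auto simp: R_carrier)

lemma R_T: "x \<in> carrier R ==> x \<in> T"
 using Y_T by (auto simp: R_carrier)

lemma Y_neg: assumes "x \<in> Y n" shows "\<ominus>\<^bsub>R\<^esub> x \<in> Y n"
proof -
 obtain y where y: "y \<in> Y n" "y [+] x = \<zero>\<^bsub>R\<^esub>" using Y_negex[OF assms] by blast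
 then have "\<ominus>\<^bsub>R\<^esub> x = y" using R.minus_equality[OF y(2)] Y_R assms by simp
 then show ?thesis using y by simp
qed

lemma R_neg_R0: assumes "x \<in> R0" shows "\<ominus>\<^bsub>R\<^esub> x = \<ominus>\<^bsub>A\<^esub> x"
proof -
 have "\<ominus>\<^bsub>A\<^esub> x [+] x = \<zero>\<^bsub>R\<^esub>" using assms by (simp add: R0_simps R_zero A.l_neg)
 then show ?thesis using R.minus_equality assms R0_sub_R R0_closed(3) by blast
qed

lemma tm_neg: assumes t: "tm G t" shows "tm G (%v. \<ominus>\<^bsub>R\<^esub> t v)"
proof -
 obtain n where n: "\<forall>v. (\<forall>i. v i \<in> T) --> G v --> t v \<in> Y n"
  using tm_bound[OF t] by (elim exE)
 let ?H = "%v. G (%i. v (Suc i)) & v 0 \<in> Y n"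
 have H: "dfn ?H" by (intro dfn_and dfn_subst[OF tm_dfn[OF t]] dset_mem Y_dset)
 have t': "tm (%v. G (%i. v (Suc i))) (%v. t (%i. v (Suc i)))"
 proof (rule tmI[of _ _ n])
  show "dfn (%v. G (%i. v (Suc i)))" by (rule dfn_subst[OF tm_dfn[OF t]])
  show "\<forall>v. (\<forall>i. v i \<in> T) --> G (%i. v (Suc i)) --> t (%i. v (Suc i)) \<in> Y n"
   using n by simp
  show "dfn (%v. G (%i. v (Suc (Suc i))) & v 0 = t (%i. v (Suc (Suc i))))"
   using dfn_subst[OF tm_graph[OF t], of "case_nat 0 (%i. Suc (Suc i))"] by simp
 qed
 have "dfn (%v. ?H v & v 0 [+] t (%i. v (Suc i)) = \<zero>\<^bsub>R\<^esub>)"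
 proof (rule tm_eq[OF tm_add[OF _ tm_guard[OF t' H]] tm_const[OF H zero_R0]])
  show "tm ?H (%v. v 0)" by (rule tm_var[OF H, of _ n]) simp
 qed simp
 then have "dfn (%v. G (%i. v (Suc i)) & v 0 = \<ominus>\<^bsub>R\<^esub> t (%i. v (Suc i)))"
 proof (rule dfn_cong)
  fix v :: "nat => 'a list" assume v: "!!i. v i \<in> T"
  have tv: "t (%i. v (Suc i)) \<in> Y n" if "G (%i. v (Suc i))" using n v that by simp
  show "(?H v & v 0 [+] t (%i. v (Suc i)) = \<zero>\<^bsub>R\<^esub>) =
    (G (%i. v (Suc i)) & v 0 = \<ominus>\<^bsub>R\<^esub> t (%i. v (Suc i)))"
  proof (cases "G (%i. v (Suc i))")
   case True
   note tY = tv[OF True] and tR = Y_R[OF tv[OF True]]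
   have "v 0 \<in> Y n & v 0 [+] t (%i. v (Suc i)) = \<zero>\<^bsub>R\<^esub> \<longleftrightarrow> v 0 = \<ominus>\<^bsub>R\<^esub> t (%i. v (Suc i))"
   proof
    assume *: "v 0 \<in> Y n & v 0 [+] t (%i. v (Suc i)) = \<zero>\<^bsub>R\<^esub>"
    show "v 0 = \<ominus>\<^bsub>R\<^esub> t (%i. v (Suc i))"
     by (rule R.minus_equality[OF conjunct2[OF *] tR Y_R[OF conjunct1[OF *]], symmetric])
   next
    assume "v 0 = \<ominus>\<^bsub>R\<^esub> t (%i. v (Suc i))"
    then show "v 0 \<in> Y n & v 0 [+] t (%i. v (Suc i)) = \<zero>\<^bsub>R\<^esub>"
     using Y_neg[OF tY] R.l_neg[OF tR] by simp
   qed
   then show ?thesis using True by simp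
  qed simp
 qed
 moreover have "\<forall>v. (\<forall>i. v i \<in> T) --> G v --> \<ominus>\<^bsub>R\<^esub> t v \<in> Y n" using n by (simp add: Y_neg)
 ultimately show ?thesis by (intro tmI[of _ _ n] tm_dfn[OF t])
qed

lemma tm_minus: "tm G s ==> tm G t ==> tm G (%v. s v [-] t v)"
 unfolding a_minus_def by (intro tm_add tm_neg)

lemmas tm_intros = tm_add tm_mult tm_minus tm_neg

lemma R_minus_R0: "x \<in> R0 ==> y \<in> R0 ==> x [-] y \<in> R0"
 unfolding a_minus_def by (simp add: R_neg_R0 R0_simps)

lemma Y_minus: "x \<in> Y n ==> y \<in> Y n ==> x [-] y \<in> Y (Suc n)"
 unfolding a_minus_def using Y_neg R_add_closed by blast

lemma dset_image2:
 assumes D: "dset D" "dset E" and t: "tm (%v. v 0 \<in> D & v 1 \<in> E) (%v. t (v 0) (v 1))"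
 shows "dset {t x y | x y. x \<in> D & y \<in> E}"
proof (rule dsetI[of "%z. \<exists>x\<in>T. \<exists>y\<in>T. (x \<in> D & y \<in> E) & z = t x y"])
 have "dfn (%v. (v (Suc 0) \<in> D & v 0 \<in> E) & v (Suc (Suc 0)) = t (v (Suc 0)) (v 0))"
  using dfn_subst[OF tm_graph[OF t], of "%i. if i = 0 then Suc (Suc 0) else if i = Suc 0 then Suc 0 else 0"]
  by simp
 then show "dfn (%v. \<exists>x\<in>T. \<exists>y\<in>T. (x \<in> D & y \<in> E) & v 0 = t x y)"
  by (intro dfn_ex)
 show "z \<in> {t x y | x y. x \<in> D & y \<in> E} \<longleftrightarrow> z \<in> T & (\<exists>x\<in>T. \<exists>y\<in>T. (x \<in> D & y \<in> E) & z = t x y)" for z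
 proof -
  have "t x y \<in> T" if "x \<in> D" "y \<in> E" for x y
  proof -
   have "(if i = (0 :: nat) then x else y) \<in> T" for i using that dset_sub[OF D(1)] dset_sub[OF D(2)] by auto
   from tm_T[OF t, of "%i. if i = 0 then x else y", OF this] show ?thesis using that by simp
  qed
  then show ?thesis using dset_sub[OF D(1)] dset_sub[OF D(2)] by blast
 qed
qed

lemma guard2: "dset D ==> dset E ==> dfn (%v. v i \<in> D & v j \<in> E)"
 by (intro dfn_and dset_mem)

lemma tm_var2:
 assumes "dset D" "dset E" "D <= Y n" "E <= Y n"
 shows "tm (%v. v 0 \<in> D & v 1 \<in> E) (%v. v 0)" "tm (%v. v 0 \<in> D & v 1 \<in> E) (%v. v 1)"
 using assms by (auto intro!: tm_var[OF guard2, of _ _ _ _ _ n])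

lemma dset_sum:
 assumes "dset D" "dset E" "D <= Y n" "E <= Y n" shows "dset (D <+>\<^bsub>R\<^esub> E)"
proof -
 have "D <+>\<^bsub>R\<^esub> E = {x [+] y | x y. x \<in> D & y \<in> E}"
  unfolding set_eq_iff set_add_iff by blast
 then show ?thesis using dset_image2[OF assms(1,2) tm_add[OF tm_var2[OF assms]]] by simp
qed

lemma dset_prod:
 assumes "dset D" "dset E" "D <= Y n" "E <= Y n" shows "dset (D <#>\<^bsub>R\<^esub> E)"
proof -
 have "D <#>\<^bsub>R\<^esub> E = {x [*] y | x y. x \<in> D & y \<in> E}"
  unfolding set_eq_iff set_mult_iff by blast
 then show ?thesis using dset_image2[OF assms(1,2) tm_mult[OF tm_var2[OF assms]]] by simp
qed

lemma sum_Y: "D <= Y n ==> E <= Y n ==> D <+>\<^bsub>R\<^esub> E <= Y (Suc n)"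
 by (auto simp: set_add_iff intro!: R_add_closed)

lemma prod_Y: "D <= Y n ==> E <= Y n ==> D <#>\<^bsub>R\<^esub> E <= Y (Suc n)"
 by (auto simp: set_mult_iff intro!: R_mult_closed)

end

section \<open>A descending chain of generic definable sets\<close>

context monster begin

text \<open>Any condition on finitely many truth values, such as one on the number of those that are true, is a Boolean
  combination.\<close>

lemma dfn_boolfun:
 fixes n :: nat
 assumes "!!j. j < n ==> dfn (P j)"
 shows "dfn (%v. \<Phi> (%j. j < n & P j v))"
 using assms
proof (induction n arbitrary: \<Phi>)
 case 0
 show ?case by (simp add: dfn_closed)
next
 case (Suc n)
 have 1: "dfn (%v. \<Phi> ((%j. j < n & P j v)(n := b)))" for b
  using Suc.IH[of "%\<beta>. \<Phi> (\<beta>(n := b))"] Suc.prems by simp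
 have "dfn (%v. (P n v & \<Phi> ((%j. j < n & P j v)(n := True))) \<or>
   (\<not> P n v & \<Phi> ((%j. j < n & P j v)(n := False))))"
  using Suc.prems[of n] by (intro dfn_or dfn_and dfn_not 1) simp_all
 then show ?case
 proof (rule dfn_cong)
  fix v :: "nat => 'a list"
  have "(%j. j < Suc n & P j v) = (%j. j < n & P j v)(n := P n v)"
   by (rule ext) (auto simp: less_Suc_eq fun_upd_def)
  then show "((P n v & \<Phi> ((%j. j < n & P j v)(n := True))) \<or>
   (\<not> P n v & \<Phi> ((%j. j < n & P j v)(n := False)))) = \<Phi> (%j. j < Suc n & P j v)"
   by (cases "P n v") simp_all
 qed
qed

lemma dfn_ex_slot:
 assumes "dfn P" shows "dfn (%v. \<exists>x\<in>T. P (v(m := x)))"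
proof (rule dfn_ex)
 have "(%i. v (Suc i))(m := v 0) = (%i. v (if i = m then 0 else Suc i))" for v :: "nat => 'a list"
  by auto
 then show "dfn (%v. P ((%i. v (Suc i))(m := v 0)))"
  using dfn_subst[OF assms, of "%i. if i = m then 0 else Suc i"] by simp
qed

lemma dfn_ex_slots:
 assumes "dfn P"
 shows "dfn (%v. \<exists>x. (\<forall>i. x i \<in> T) & P (%i. if 0 < i & i <= n then x i else v i))"
proof (induction n)
 case 0
 obtain d where "d \<in> T" using T0_nonempty T0_sub_T by blast
 then have ex: "\<exists>x :: nat => 'a list. \<forall>i. x i \<in> T" by (intro exI[of _ "%_. d"]) simp
 show ?case
 proof (rule dfn_cong[OF assms])
  fix v :: "nat => 'a list"
  have "(%i. if 0 < i & i <= 0 then x i else v i) = v" for x by (rule ext) auto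
  then show "P v = (\<exists>x. (\<forall>i. x i \<in> T) & P (%i. if 0 < i & i <= 0 then x i else v i))"
   using ex by simp
 qed
next
 case (Suc n)
 from dfn_ex_slot[OF this, of "Suc n"] show ?case
 proof (rule dfn_cong)
  fix v :: "nat => 'a list"
  show "(\<exists>y\<in>T. \<exists>x. (\<forall>i. x i \<in> T) & P (%i. if 0 < i & i <= n then x i else (v(Suc n := y)) i)) =
   (\<exists>x. (\<forall>i. x i \<in> T) & P (%i. if 0 < i & i <= Suc n then x i else v i))"
  proof
   assume "\<exists>y\<in>T. \<exists>x. (\<forall>i. x i \<in> T) & P (%i. if 0 < i & i <= n then x i else (v(Suc n := y)) i)"
   then obtain y x where yx: "y \<in> T" "\<forall>i. x i \<in> T" "P (%i. if 0 < i & i <= n then x i else (v(Suc n := y)) i)"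
    by (elim bexE exE conjE)
   have "(%i. if 0 < i & i <= Suc n then (x(Suc n := y)) i else v i) =
    (%i. if 0 < i & i <= n then x i else (v(Suc n := y)) i)" by (auto simp: le_Suc_eq)
   then show "\<exists>x. (\<forall>i. x i \<in> T) & P (%i. if 0 < i & i <= Suc n then x i else v i)"
    using yx by (intro exI[of _ "x(Suc n := y)"]) simp
  next
   assume "\<exists>x. (\<forall>i. x i \<in> T) & P (%i. if 0 < i & i <= Suc n then x i else v i)"
   then obtain x where x: "\<forall>i. x i \<in> T" "P (%i. if 0 < i & i <= Suc n then x i else v i)"
    by (elim exE conjE)
   have "(%i. if 0 < i & i <= Suc n then x i else v i) =
    (%i. if 0 < i & i <= n then x i else (v(Suc n := x (Suc n))) i)" by (auto simp: le_Suc_eq)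
   then show "\<exists>y\<in>T. \<exists>x. (\<forall>i. x i \<in> T) & P (%i. if 0 < i & i <= n then x i else (v(Suc n := y)) i)"
    using x by (intro bexI[of _ "x (Suc n)"] exI[of _ x] conjI) simp_all
  qed
 qed
qed

end

context abelian_group begin

lemma conv_indicator_card:
 "conv E (indicator S) u = real (card {j. j < length E & u \<oplus> E ! j \<in> S})"
proof -
 have "conv E (indicator S) u = (\<Sum>j<length E. indicator S (u \<oplus> E ! j))"
  by (simp add: conv_def sum_list_sum_nth atLeast0LessThan)
 also have "\<dots> = (\<Sum>j\<in>{..<length E} \<inter> {j. u \<oplus> E ! j \<in> S}. 1)"
  by (simp add: indicator_def of_bool_def sum.If_cases)
 also have "{..<length E} \<inter> {j. u \<oplus> E ! j \<in> S} = {j. j < length E & u \<oplus> E ! j \<in> S}" by auto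
 finally show ?thesis by simp
qed

end

context def_ring begin

abbreviation G0 :: "'a list ring" where "G0 \<equiv> R\<lparr>carrier := R0\<rparr>"

lemma R0_R [simp]: "x \<in> R0 ==> x \<in> carrier R"
 using R0_sub_R by auto

lemma R0_R_closed: "x \<in> R0 ==> y \<in> R0 ==> x [+] y \<in> R0" "x \<in> R0 ==> \<ominus>\<^bsub>R\<^esub> x \<in> R0"
 "x \<in> R0 ==> y \<in> R0 ==> x [*] y \<in> R0" "\<zero>\<^bsub>R\<^esub> \<in> R0"
 by (simp_all add: R_add_R0 R_neg_R0 R_mult_R0 R0_closed zero_R0)

lemma G0_group: "abelian_group G0"
proof (rule abelian_groupI)
 show "\<exists>y\<in>carrier G0. y \<oplus>\<^bsub>G0\<^esub> x = \<zero>\<^bsub>G0\<^esub>" if "x \<in> carrier G0" for x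
  using that by (intro bexI[of _ "\<ominus>\<^bsub>R\<^esub> x"]) (simp_all add: R.l_neg R0_R_closed)
qed (simp_all add: R0_R_closed R.a_ac)

lemma G0_neg: "x \<in> R0 ==> \<ominus>\<^bsub>G0\<^esub> x = \<ominus>\<^bsub>R\<^esub> x"
 using abelian_group.minus_equality[OF G0_group, of "\<ominus>\<^bsub>R\<^esub> x" x]
 by (simp add: R.l_neg R0_R_closed)

lemma G0_minus: "y \<in> R0 ==> x \<ominus>\<^bsub>G0\<^esub> y = x [-] y"
 by (simp add: a_minus_def G0_neg)

lemma dset_translate:
 assumes "f \<in> R0" "dset E" shows "dset {x \<in> T. x \<in> Y n & x [-] f \<in> E}"
proof (rule dset_collect)
 have G: "dfn (%v. v 0 \<in> Y n)" by (rule dset_mem[OF Y_dset])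
 show "dfn (%v. v 0 \<in> Y n & v 0 [-] f \<in> E)"
  by (rule tm_in[OF tm_minus[OF tm_var[OF G, of _ n] tm_const[OF G assms(1)]] assms(2)]) simp
qed

lemma dset_neg_preimage:
 assumes "dset E" shows "dset {x \<in> T. x \<in> Y n & \<ominus>\<^bsub>R\<^esub> x \<in> E}"
proof (rule dset_collect)
 have G: "dfn (%v. v 0 \<in> Y n)" by (rule dset_mem[OF Y_dset])
 show "dfn (%v. v 0 \<in> Y n & \<ominus>\<^bsub>R\<^esub> v 0 \<in> E)"
  by (rule tm_in[OF tm_neg[OF tm_var[OF G, of _ n]] assms]) simp
qed

text \<open>The formula behind \<open>up\<close> for the overlap of \<open>D\<close> with its translate by \<open>g\<close>, when the translations are \<open>x 0, ..., x (a - 1)\<close> on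
  the left and \<open>x a, ..., x (a + b - 1)\<close> on the right. The level \<open>N\<close> contains all relevant \<open>u\<close>.\<close>

definition up_matrix :: "nat => nat => 'a list set => 'a list set => nat => nat => 'a list => (nat => 'a list) => bool" where
 "up_matrix i N D Z a b g x \<longleftrightarrow> (\<forall>j<a + b. x j \<in> Y i) \<and>
   (\<forall>u\<in>T. u \<in> Y N --> card {j. j < a & (u [+] x j \<in> D & (u [+] x j) [-] g \<in> D)}
    <= card {j. j < b & u [+] x (a + j) \<in> Z})"

lemma dfn_up_matrix_body:
 assumes D: "dset D" and Z: "dset Z"
 shows "dfn (%v. (v (Suc 0) \<in> Y m & (\<forall>j<a + b. v (Suc (Suc j)) \<in> Y i)) & v 0 \<in> Y N \<and>
   \<not> card {j. j < a & (v 0 [+] v (Suc (Suc j)) \<in> D & (v 0 [+] v (Suc (Suc j))) [-] v (Suc 0) \<in> D)}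
    <= card {j. j < b & v 0 [+] v (Suc (Suc (a + j))) \<in> Z})"
proof -
 let ?G = "%j v. (v 0 \<in> Y N & v (Suc 0) \<in> Y m) & v (Suc (Suc j)) \<in> Y i"
 define P where "P j v \<longleftrightarrow> (if j < a then (?G j v & v 0 [+] v (Suc (Suc j)) \<in> D) \<and>
   (?G j v & (v 0 [+] v (Suc (Suc j))) [-] v (Suc 0) \<in> D)
   else ?G j v & v 0 [+] v (Suc (Suc j)) \<in> Z)" for j and v :: "nat => 'a list"
 have G: "dfn (?G j)" for j by (intro dfn_and dset_mem Y_dset)
 have v0: "tm (?G j) (%v. v 0)" for j by (rule tm_var[OF G, of _ _ N]) simp
 have v1: "tm (?G j) (%v. v (Suc 0))" for j by (rule tm_var[OF G, of _ _ m]) simp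
 have vj: "tm (?G j) (%v. v (Suc (Suc j)))" for j by (rule tm_var[OF G, of _ _ i]) simp
 have d1: "dfn (%v. ?G j v & v 0 [+] v (Suc (Suc j)) \<in> D)" for j
  by (rule tm_in[OF tm_add[OF v0 vj] D])
 have d2: "dfn (%v. ?G j v & (v 0 [+] v (Suc (Suc j))) [-] v (Suc 0) \<in> D)" for j
  by (rule tm_in[OF tm_minus[OF tm_add[OF v0 vj] v1] D])
 have d3: "dfn (%v. ?G j v & v 0 [+] v (Suc (Suc j)) \<in> Z)" for j
  by (rule tm_in[OF tm_add[OF v0 vj] Z])
 have dP: "dfn (P j)" for j
  unfolding P_def using dfn_and[OF d1[of j] d2[of j]] d3[of j] by (cases "j < a") simp_all
 have "dfn (%v. (%\<beta>. \<not> card {j. j < a & \<beta> j} <= card {j. j < b & \<beta> (a + j)}) (%j. j < a + b & P j v))"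
  by (rule dfn_boolfun) (rule dP)
 then have "dfn (%v. (v (Suc 0) \<in> Y m & (\<forall>j<a + b. v (Suc (Suc j)) \<in> Y i)) & v 0 \<in> Y N \<and>
   \<not> card {j. j < a & (j < a + b & P j v)} <= card {j. j < b & (a + j < a + b & P (a + j) v)})"
  by (intro dfn_and dset_mem Y_dset dfn_conj_many) simp_all
 then show ?thesis
 proof (rule dfn_cong)
  fix v :: "nat => 'a list"
  let ?A = "(v (Suc 0) \<in> Y m & (\<forall>j<a + b. v (Suc (Suc j)) \<in> Y i)) & v 0 \<in> Y N"
  have "{j. j < a & (j < a + b & P j v)} = {j. j < a & (v 0 [+] v (Suc (Suc j)) \<in> D & (v 0 [+] v (Suc (Suc j))) [-] v (Suc 0) \<in> D)}"
   "{j. j < b & (a + j < a + b & P (a + j) v)} = {j. j < b & v 0 [+] v (Suc (Suc (a + j))) \<in> Z}"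
   if ?A using that by (auto simp: P_def)
  then show "((v (Suc 0) \<in> Y m & (\<forall>j<a + b. v (Suc (Suc j)) \<in> Y i)) & v 0 \<in> Y N \<and>
   \<not> card {j. j < a & (j < a + b & P j v)} <= card {j. j < b & (a + j < a + b & P (a + j) v)}) =
   ((v (Suc 0) \<in> Y m & (\<forall>j<a + b. v (Suc (Suc j)) \<in> Y i)) & v 0 \<in> Y N \<and>
   \<not> card {j. j < a & (v 0 [+] v (Suc (Suc j)) \<in> D & (v 0 [+] v (Suc (Suc j))) [-] v (Suc 0) \<in> D)}
    <= card {j. j < b & v 0 [+] v (Suc (Suc (a + j))) \<in> Z})"
   by (cases ?A) auto
 qed
qed

lemma dfn_up_matrix:
 assumes D: "dset D" and Z: "dset Z"
 shows "dfn (%v. v 0 \<in> Y m & up_matrix i N D Z a b (v 0) (%j. v (Suc j)))"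
proof -
 let ?B = "%u v. (v 0 \<in> Y m & (\<forall>j<a + b. v (Suc j) \<in> Y i)) & u \<in> Y N \<and>
   \<not> card {j. j < a & (u [+] v (Suc j) \<in> D & (u [+] v (Suc j)) [-] v 0 \<in> D)}
    <= card {j. j < b & u [+] v (Suc (a + j)) \<in> Z}"
 have "dfn (%v. \<exists>u\<in>T. ?B u v)"
  by (rule dfn_ex) (rule dfn_up_matrix_body[OF assms])
 then have "dfn (%v. (v 0 \<in> Y m & (\<forall>j<a + b. v (Suc j) \<in> Y i)) & \<not> (\<exists>u\<in>T. ?B u v))"
  by (intro dfn_and dfn_not dset_mem Y_dset dfn_conj_many)
 then show ?thesis
  by (rule dfn_cong) (auto simp: up_matrix_def)
qed

definition up_set :: "nat => nat => 'a list set => 'a list set => real => 'a list set" where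
 "up_set i N D Z s = {g. \<exists>a\<le>i. \<exists>b\<le>i. 0 < a & real b <= s * real a \<and>
   (\<exists>x. (\<forall>j. x j \<in> T) & up_matrix i N D Z a b g x)}"

lemma up_matrix_cong: "(!!j. j < a + b ==> x j = x' j) ==> up_matrix i N D Z a b g x = up_matrix i N D Z a b g x'"
proof -
 assume eq: "!!j. j < a + b ==> x j = x' j"
 have "{j. j < a & (u [+] x j \<in> D & (u [+] x j) [-] g \<in> D)} =
  {j. j < a & (u [+] x' j \<in> D & (u [+] x' j) [-] g \<in> D)}"
  "{j. j < b & u [+] x (a + j) \<in> Z} = {j. j < b & u [+] x' (a + j) \<in> Z}" for u
  using eq by auto
 then show ?thesis using eq by (simp add: up_matrix_def)
qed

lemma up_set_dset:
 assumes D: "dset D" and Z: "dset Z" shows "dset (Y m \<inter> up_set i N D Z s)"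
proof -
 have 1: "dset {g \<in> T. \<exists>x. (\<forall>j. x j \<in> T) & (g \<in> Y m & up_matrix i N D Z a b g x)}" for a b
 proof (rule dset_collect)
  have eq: "(\<exists>x. (\<forall>j. x j \<in> T) & (v 0 \<in> Y m & up_matrix i N D Z a b (v 0) (%j. if j < a + b then x (Suc j) else v (Suc j)))) =
   (\<exists>x. (\<forall>j. x j \<in> T) & (v 0 \<in> Y m & up_matrix i N D Z a b (v 0) x))"
   if v: "!!i. v i \<in> T" for v :: "nat => 'a list"
  proof
   assume "\<exists>x. (\<forall>j. x j \<in> T) & (v 0 \<in> Y m & up_matrix i N D Z a b (v 0) (%j. if j < a + b then x (Suc j) else v (Suc j)))"
   then obtain x where x: "\<forall>j. x j \<in> T" "v 0 \<in> Y m"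
    "up_matrix i N D Z a b (v 0) (%j. if j < a + b then x (Suc j) else v (Suc j))" by (elim exE conjE)
   show "\<exists>x. (\<forall>j. x j \<in> T) & (v 0 \<in> Y m & up_matrix i N D Z a b (v 0) x)"
    by (rule exI[of _ "%j. if j < a + b then x (Suc j) else v (Suc j)"]) (use x v in simp)
  next
   assume "\<exists>x. (\<forall>j. x j \<in> T) & (v 0 \<in> Y m & up_matrix i N D Z a b (v 0) x)"
   then obtain x where x: "\<forall>j. x j \<in> T" "v 0 \<in> Y m" "up_matrix i N D Z a b (v 0) x" by (elim exE conjE)
   have "up_matrix i N D Z a b (v 0) (%j. if j < a + b then x j else v (Suc j))"
    using x(3) up_matrix_cong[of a b "%j. if j < a + b then x j else v (Suc j)" x] by simp
   then show "\<exists>x. (\<forall>j. x j \<in> T) & (v 0 \<in> Y m & up_matrix i N D Z a b (v 0) (%j. if j < a + b then x (Suc j) else v (Suc j)))"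
    using x by (intro exI[of _ "%j. x (j - 1)"]) (simp cong: if_cong)
  qed
  have "dfn (%v. \<exists>x. (\<forall>i. x i \<in> T) & ((if 0 < (0::nat) & 0 <= a + b then x 0 else v 0) \<in> Y m \<and>
   up_matrix i N D Z a b (if 0 < (0::nat) & 0 <= a + b then x 0 else v 0) (%j. if 0 < Suc j & Suc j <= a + b then x (Suc j) else v (Suc j))))"
   by (rule dfn_ex_slots[OF dfn_up_matrix[OF D Z]])
  then have "dfn (%v. \<exists>x. (\<forall>j. x j \<in> T) & (v 0 \<in> Y m & up_matrix i N D Z a b (v 0) (%j. if j < a + b then x (Suc j) else v (Suc j))))"
   by (simp add: Suc_le_eq)
  then show "dfn (%v. \<exists>x. (\<forall>j. x j \<in> T) & (v 0 \<in> Y m & up_matrix i N D Z a b (v 0) x))"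
   by (rule dfn_cong) (rule eq)
 qed
 have "Y m \<inter> up_set i N D Z s = \<Union>((%(a, b). {g \<in> T. \<exists>x. (\<forall>j. x j \<in> T) & (g \<in> Y m & up_matrix i N D Z a b g x)}) `
   {(a, b). (a <= i & b <= i) & 0 < a & real b <= s * real a})"
  using Y_T[of m] unfolding up_set_def by (fastforce simp: subset_iff)
 moreover have "finite {(a, b). (a <= i & b <= i) & 0 < a & real b <= s * real a}"
  by (rule finite_subset[of _ "{..i} \<times> {..i}"]) auto
 ultimately show ?thesis using 1 by (simp only:) (rule dset_Union, auto)
qed

definition generic :: "'a list set => bool" where
 "generic Z \<longleftrightarrow> (\<forall>n. \<exists>F. finite F & F <= R0 & (\<forall>x\<in>Y n. \<exists>f\<in>F. x [-] f \<in> Z))"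

definition base :: "'a list set => bool" where
 "base Z \<longleftrightarrow> dset Z & (\<exists>n. Z <= Y n) & \<zero>\<^bsub>R\<^esub> \<in> Z & (\<forall>x\<in>Z. \<ominus>\<^bsub>R\<^esub> x \<in> Z) & generic Z"

definition fourfold :: "'a list set => 'a list set" where
 "fourfold S = (S <+>\<^bsub>R\<^esub> S) <+>\<^bsub>R\<^esub> (S <+>\<^bsub>R\<^esub> S)"

lemma fourfold_iff: "z \<in> fourfold S \<longleftrightarrow> (\<exists>a\<in>S. \<exists>b\<in>S. \<exists>c\<in>S. \<exists>d\<in>S. z = a [+] b [+] (c [+] d))"
 unfolding fourfold_def set_add_iff Bex_def by blast

lemma fourfold_Y: "S <= Y n ==> fourfold S <= Y (Suc (Suc n))"
 unfolding fourfold_def by (intro sum_Y)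

lemma fourfold_dset: "dset S ==> S <= Y n ==> dset (fourfold S)"
 unfolding fourfold_def by (intro dset_sum[of _ _ "Suc n"] dset_sum[of _ _ n] sum_Y)

text \<open>The approximate group is \<open>Z \<inter> R0\<close>, and \<open>ex_good_kernel\<close> is applied to the subsets of it that are definable over \<open>M\<close>. A good kernel \<open>S\<close> is generic and
  \<open>8 S \<subseteq> 4 Z\<close>, both of which are transferred to the monster model.\<close>

lemma base_step:
 assumes Z: "base Z"
 shows "\<exists>S. base S & (\<forall>x\<in>fourfold S. \<forall>y\<in>fourfold S. x [-] y \<in> fourfold Z)"
proof -
 have Zd: "dset Z" "\<zero>\<^bsub>R\<^esub> \<in> Z" "!!x. x \<in> Z ==> \<ominus>\<^bsub>R\<^esub> x \<in> Z" "generic Z" using Z by (auto simp: base_def)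
 obtain n where n: "Z <= Y n" using Z by (auto simp: base_def)
 have ZR: "x \<in> carrier R" if "x \<in> Z" for x using n that Y_R by auto
 define Z0 where "Z0 = Z \<inter> T0"
 have Z0R: "x \<in> R0" if "x \<in> Z0" for x using that n in_R0 by (auto simp: Z0_def)
 obtain F where F: "finite F" "F <= R0" "\<forall>x\<in>Y (Suc n). \<exists>f\<in>F. x [-] f \<in> Z"
  using Zd(4) unfolding generic_def by (elim allE[of _ "Suc n"] exE conjE)
 obtain Fs where Fs: "set Fs = F" using finite_list[OF F(1)] by (elim exE)
 have R0Y: "R0 <= (\<Union>n. lev n)" by (simp add: R0_eq)
 have levR0: "lev m <= R0" for m by (auto simp: R0_eq)
 have R0T0: "x \<in> T0" if "x \<in> R0" for x using that by (simp add: R0_T0)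
 interpret AG: approx_group G0 Z0 Fs "%n. lev n"
 proof (intro approx_group.intro approx_group_axioms.intro G0_group)
  show "Z0 <= carrier G0" using Z0R by auto
  show "\<zero>\<^bsub>G0\<^esub> \<in> Z0" using Zd(2) R0_R_closed(4) R0T0 by (simp add: Z0_def)
  show "\<ominus>\<^bsub>G0\<^esub> x \<in> Z0" if "x \<in> Z0" for x
   using that Z0R[OF that] Zd(3) R0T0[OF R0_R_closed(2)] by (simp add: Z0_def G0_neg)
  show "set Fs <= carrier G0" using F Fs by simp
  show "\<exists>f\<in>set Fs. \<exists>z\<in>Z0. x \<oplus>\<^bsub>G0\<^esub> y = f \<oplus>\<^bsub>G0\<^esub> z" if xy: "x \<in> Z0" "y \<in> Z0" for x y
  proof -
   have r: "x \<in> R0" "y \<in> R0" using xy Z0R by auto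
   have "x [+] y \<in> Y (Suc n)" using xy n by (auto simp: Z0_def intro!: R_add_closed)
   then obtain f where f: "f \<in> F" "x [+] y [-] f \<in> Z" using F(3) by blast
   then have fr: "f \<in> R0" using F by auto
   have "x [+] y [-] f \<in> Z0" using f r fr R0T0[OF R_minus_R0[OF R0_R_closed(1)]] by (simp add: Z0_def)
   moreover have "x [+] y = f [+] (x [+] y [-] f)"
    using r[THEN R0_R] fr[THEN R0_R] by algebra
   ultimately show ?thesis using f(1) Fs by (intro bexI[of _ f] bexI[of _ "x [+] y [-] f"]) simp_all
  qed
  show "lev m <= carrier G0" for m using levR0 by simp
  show "lev m <= lev (Suc m)" for m by (rule lev_Suc)
  show "x \<oplus>\<^bsub>G0\<^esub> y \<in> lev (Suc m)" if "x \<in> lev m" "y \<in> lev m" for m x y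
   using that lev_add R_add_lev by simp
  show "\<ominus>\<^bsub>G0\<^esub> x \<in> lev m" if "x \<in> lev m" for m x
   using that lev_neg levR0 R_neg_R0 G0_neg by (simp add: subset_iff)
  show "\<zero>\<^bsub>G0\<^esub> \<in> lev m" for m using lev_zero by (simp add: R_zero)
  show "carrier G0 <= (\<Union>n. lev n)" using R0Y by simp
  show "\<exists>m. Z0 <= lev m" using n Y_T0[of n] by (auto simp: Z0_def)
 qed
 define DD' where "DD' = {D \<inter> T0 | D. dset D & (\<exists>m. D <= Y m)}"
 have overlap: "AG.self_overlap (D \<inter> T0) g = {x \<in> T. x \<in> Y m & x [-] g \<in> D} \<inter> D \<inter> T0"
  if "D <= Y m" "g \<in> R0" for D g m
  using that in_R0[of _ m] R0T0[OF R_minus_R0] T0_sub_T unfolding AG.self_overlap_def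
  by (auto simp: G0_minus)
 have inter: "AG.self_overlap B g \<in> DD'" if B: "B \<in> DD'" and g: "g \<in> carrier G0" for B g
 proof -
  obtain D m where D: "B = D \<inter> T0" "dset D" "D <= Y m" using B by (auto simp: DD'_def)
  have "g \<in> R0" using g by simp
  then show ?thesis unfolding D(1) overlap[OF D(3) \<open>g \<in> R0\<close>] DD'_def
   using dset_Int[OF dset_translate[OF \<open>g \<in> R0\<close> D(2)] D(2), of m] D(3) by blast
 qed
 have up_iff: "AG.up i (indicator (AG.self_overlap (D \<inter> T0) g)) s \<longleftrightarrow> g \<in> up_set i (Suc (max m i)) D Z s"
  if D: "dset D" "D <= Y m" and g: "g \<in> R0" for D m g i s
 proof -
  define N where "N = Suc (max m i)"
  have gT: "g \<in> T0" "g \<in> T" using g R0T0 T0_sub_T by auto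
  obtain l where l: "g \<in> Y l" using g lev_Y by (auto simp: R0_eq)
  have inov: "w \<in> AG.self_overlap (D \<inter> T0) g \<longleftrightarrow> w \<in> D & w [-] g \<in> D" if "w \<in> R0" for w
   using that g R0T0 R_minus_R0[OF that g] unfolding AG.self_overlap_def by (auto simp: G0_minus)
  have inZ0: "w \<in> Z0 \<longleftrightarrow> w \<in> Z" if "w \<in> R0" for w using that R0T0 by (simp add: Z0_def)
  have far: "u \<in> Y N" if "u \<in> carrier R" "e \<in> Y i" "u [+] e \<in> D" for u e
  proof -
   have "e \<in> Y (max m i)" "u [+] e \<in> Y (max m i)"
    using that D(2) Y_mono[of i "max m i"] Y_mono[of m "max m i"] by auto
   then have "(u [+] e) [-] e \<in> Y N" unfolding N_def by (rule Y_minus[rotated])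
   moreover have "(u [+] e) [-] e = u" using that(1) Y_R[OF that(2)] by algebra
   ultimately show ?thesis by simp
  qed
  have conv1: "AG.conv E (indicator (AG.self_overlap (D \<inter> T0) g)) u =
    real (card {j. j < length E & (u [+] E ! j \<in> D & (u [+] E ! j) [-] g \<in> D)})"
   if "set E <= R0" "u \<in> R0" for E u
  proof -
   have "u [+] E ! j \<in> R0" if "j < length E" for j
    using R0_R_closed(1)[OF \<open>u \<in> R0\<close>, of "E ! j"] \<open>set E <= R0\<close> that nth_mem by blast
   then show ?thesis unfolding AG.conv_indicator_card
    by (intro arg_cong[where f = real] arg_cong[where f = card]) (auto simp: inov)
  qed
  have conv2: "AG.conv E (indicator Z0) u = real (card {j. j < length E & u [+] E ! j \<in> Z})"
   if "set E <= R0" "u \<in> R0" for E u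
  proof -
   have "u [+] E ! j \<in> R0" if "j < length E" for j
    using R0_R_closed(1)[OF \<open>u \<in> R0\<close>, of "E ! j"] \<open>set E <= R0\<close> that nth_mem by blast
   then show ?thesis unfolding AG.conv_indicator_card
    by (intro arg_cong[where f = real] arg_cong[where f = card]) (auto simp: inZ0)
  qed
  show ?thesis unfolding N_def[symmetric]
  proof
   assume "AG.up i (indicator (AG.self_overlap (D \<inter> T0) g)) s"
   then obtain E E' where E: "E \<noteq> []" "length E <= i" "length E' <= i" "set E <= lev i" "set E' <= lev i"
    "real (length E') <= s * real (length E)"
    "\<forall>u\<in>carrier G0. AG.conv E (indicator (AG.self_overlap (D \<inter> T0) g)) u <= AG.conv E' (indicator Z0) u"
    unfolding AG.up_def by (elim exE conjE)
   have ER: "set E <= R0" "set E' <= R0" using E levR0 by blast+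
   define a b where "a = length E" and "b = length E'"
   define x where "x j = (if j < a + b then (E @ E') ! j else g)" for j
   have xl: "x j \<in> lev i" if "j < a + b" for j
   proof -
    have "(E @ E') ! j \<in> set (E @ E')" using that by (intro nth_mem) (simp add: a_def b_def)
    then show ?thesis using E(4,5) that by (auto simp: x_def)
   qed
   have xT0: "x j \<in> T0" for j using xl lev_T0 gT by (cases "j < a + b") (auto simp: x_def)
   have xE: "j < a ==> x j = E ! j" "j < b ==> x (a + j) = E' ! j" for j
    by (auto simp: x_def a_def b_def nth_append)
   have "up_matrix i N D Z a b g x"
    unfolding up_matrix_def
   proof (intro conjI allI impI ballI)
    show "x j \<in> Y i" if "j < a + b" for j using xl[OF that] lev_Y by auto
    fix u assume u: "u \<in> T" "u \<in> Y N"
    let ?Q = "%v :: nat => 'a list. (v (Suc 0) \<in> Y l & (\<forall>j<a + b. v (Suc (Suc j)) \<in> Y i)) & v 0 \<in> Y N \<and>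
   \<not> card {j. j < a & (v 0 [+] v (Suc (Suc j)) \<in> D & (v 0 [+] v (Suc (Suc j))) [-] v (Suc 0) \<in> D)}
    <= card {j. j < b & v 0 [+] v (Suc (Suc (a + j))) \<in> Z}"
    show "card {j. j < a & (u [+] x j \<in> D & (u [+] x j) [-] g \<in> D)}
     <= card {j. j < b & u [+] x (a + j) \<in> Z}"
    proof (rule ccontr)
     assume neg: "\<not> ?thesis"
     define v where "v = case_nat u (case_nat g x)"
     have vT: "v k \<in> T" for k using u gT xT0 T0_sub_T by (auto simp: v_def split: nat.split)
     have "?Q v" using neg u l xl lev_Y by (auto simp: v_def)
     from tarski_vaught[OF dfn_up_matrix_body[OF D(1) Zd(1)] vT this]
     obtain w where w: "\<forall>k. w k \<in> T0" "?Q w" "\<forall>k. v k \<in> T0 --> w k = v k"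
      by (elim exE conjE) (rule that, assumption, intro conjI, assumption+)
     have w1: "w (Suc 0) = g" "w (Suc (Suc j)) = x j" for j
      using w(3) gT xT0 by (simp_all add: v_def)
     have w0: "w 0 \<in> R0" using w(1,2) in_R0 by blast
     have "real (card {j. j < length E & (w 0 [+] E ! j \<in> D & (w 0 [+] E ! j) [-] g \<in> D)})
       <= real (card {j. j < length E' & w 0 [+] E' ! j \<in> Z})"
      using bspec[OF E(7), of "w 0"] w0 unfolding conv1[OF ER(1) w0] conv2[OF ER(2) w0] by simp
     moreover have "{j. j < length E & (w 0 [+] E ! j \<in> D & (w 0 [+] E ! j) [-] g \<in> D)} =
       {j. j < a & (w 0 [+] w (Suc (Suc j)) \<in> D & (w 0 [+] w (Suc (Suc j))) [-] w (Suc 0) \<in> D)}"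
      "{j. j < length E' & w 0 [+] E' ! j \<in> Z} = {j. j < b & w 0 [+] w (Suc (Suc (a + j))) \<in> Z}"
      unfolding w1 using xE by (auto simp: a_def b_def)
     ultimately show False using w(2) by simp
    qed
   qed
   moreover have "x j \<in> T" for j using xT0 T0_sub_T by auto
   ultimately show "g \<in> up_set i N D Z s"
    unfolding up_set_def using E(1,2,3,6) by (auto simp: a_def b_def)
  next
   assume "g \<in> up_set i N D Z s"
   then obtain a b x where abx: "a <= i" "b <= i" "0 < a" "real b <= s * real a" "\<forall>j. x j \<in> T"
    "up_matrix i N D Z a b g x" unfolding up_set_def by blast
   define v where "v = case_nat g x"
   have vT: "v k \<in> T" for k using gT abx(5) by (auto simp: v_def split: nat.split)
   have "v 0 \<in> Y l & up_matrix i N D Z a b (v 0) (%j. v (Suc j))" using l abx(6) by (simp add: v_def)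
   from tarski_vaught[OF dfn_up_matrix[OF D(1) Zd(1)] vT this]
   obtain w where w: "\<forall>k. w k \<in> T0" "w 0 \<in> Y l" "up_matrix i N D Z a b (w 0) (%j. w (Suc j))"
    "\<forall>k. v k \<in> T0 --> w k = v k"
      by (elim exE conjE) (rule that, assumption+)
   have w0: "w 0 = g" using w(4)[rule_format, of 0] gT by (simp add: v_def)
   define E where "E = map (%j. w (Suc j)) [0..<a]"
   define E' where "E' = map (%j. w (Suc (a + j))) [0..<b]"
   have wl: "w (Suc j) \<in> lev i" if "j < a + b" for j
   proof -
    have "w (Suc j) \<in> Y i" using w(3) that by (simp add: up_matrix_def)
    then show ?thesis using w(1) Y_T0[of i] by blast
   qed
   have El: "set E <= lev i" "set E' <= lev i" using wl by (auto simp: E_def E'_def)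
   then have ER: "set E <= R0" "set E' <= R0" using levR0 by blast+
   show "AG.up i (indicator (AG.self_overlap (D \<inter> T0) g)) s"
    unfolding AG.up_def
   proof (rule exI[of _ E], rule exI[of _ E'], intro conjI ballI)
    show "E \<noteq> []" using abx(3) by (simp add: E_def)
    show "length E <= i" "length E' <= i" using abx by (simp_all add: E_def E'_def)
    show "real (length E') <= s * real (length E)" using abx by (simp add: E_def E'_def)
    fix u assume "u \<in> carrier G0"
    then have u: "u \<in> R0" by simp
    show "AG.conv E (indicator (AG.self_overlap (D \<inter> T0) g)) u <= AG.conv E' (indicator Z0) u"
    proof (cases "u \<in> Y N")
     case True
     have "u \<in> T" using u R_T by auto
     then have "card {j. j < a & (u [+] w (Suc j) \<in> D & (u [+] w (Suc j)) [-] g \<in> D)}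
      <= card {j. j < b & u [+] w (Suc (a + j)) \<in> Z}"
      using w(3) True unfolding up_matrix_def w0 by blast
     moreover have "{j. j < length E & (u [+] E ! j \<in> D & (u [+] E ! j) [-] g \<in> D)} =
      {j. j < a & (u [+] w (Suc j) \<in> D & (u [+] w (Suc j)) [-] g \<in> D)}"
      "{j. j < length E' & u [+] E' ! j \<in> Z} = {j. j < b & u [+] w (Suc (a + j)) \<in> Z}"
      by (auto simp: E_def E'_def)
     ultimately show ?thesis unfolding conv1[OF ER(1) u] conv2[OF ER(2) u] by simp
    next
     case False
     have "u [+] E ! j \<notin> D" if "j < length E" for j
     proof
      assume "u [+] E ! j \<in> D"
      moreover have "E ! j \<in> Y i" using that El(1) lev_Y[of i] nth_mem by blast
      ultimately show False using far[of u "E ! j"] u False by simp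
     qed
     then have "{j. j < length E & (u [+] E ! j \<in> D & (u [+] E ! j) [-] g \<in> D)} = {}" by auto
     then show ?thesis unfolding conv1[OF ER(1) u] conv2[OF ER(2) u] by (simp only: card.empty)
    qed
   qed (use El in auto)
  qed
 qed
 have stab: "AG.stab i s B \<in> DD'" if B: "B \<in> DD'" and "i > 0" "s > 0" for B i s
 proof -
  obtain D m where D: "B = D \<inter> T0" "dset D" "D <= Y m" using B by (auto simp: DD'_def)
  let ?U = "up_set i (Suc (max m i)) D Z s"
  let ?V = "Y (Suc m) - (Y (Suc m) \<inter> ?U)"
  have dV: "dset ?V" by (intro dset_Diff Y_dset up_set_dset D Zd)
  let ?W = "{x \<in> T. x \<in> Y (Suc m) & \<ominus>\<^bsub>R\<^esub> x \<in> ?V}"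
  have dW: "dset (?V \<inter> ?W)" by (intro dset_Int dV dset_neg_preimage)
  have "AG.stab i s B = (?V \<inter> ?W) \<inter> T0"
  proof (intro equalityI subsetI)
   fix g assume g: "g \<in> AG.stab i s B"
   then have gR: "g \<in> R0" "\<ominus>\<^bsub>R\<^esub> g \<in> R0" by (auto simp: AG.stab_def R0_R_closed)
   have nup: "\<not> AG.up i (indicator (AG.self_overlap (D \<inter> T0) g)) s"
    "\<not> AG.up i (indicator (AG.self_overlap (D \<inter> T0) (\<ominus>\<^bsub>R\<^esub> g))) s"
    using g gR by (auto simp: AG.stab_def D(1) G0_neg)
   have "AG.self_overlap (D \<inter> T0) g \<noteq> {}"
   proof
    assume e: "AG.self_overlap (D \<inter> T0) g = {}"
    have "AG.up i (%u. 0) 0" using AG.up_zero by (rule AG.up_level) (use \<open>i > 0\<close> in simp)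
    then have "AG.up i (indicator {}) s" by (rule AG.up_mono) (use \<open>s > 0\<close> in auto)
    then show False using nup(1) e by simp
   qed
   then obtain y where y: "y \<in> D" "y [-] g \<in> D" using gR(1) overlap[OF D(3) gR(1)] by auto
   have "y [-] (y [-] g) \<in> Y (Suc m)" using y D(3) Y_minus by blast
   moreover have "y [-] (y [-] g) = g" using gR(1)[THEN R0_R] y(1) D(3) Y_R[of y m] by (simp add: subset_iff) algebra
   ultimately have gY: "g \<in> Y (Suc m)" by simp
   then have "\<ominus>\<^bsub>R\<^esub> g \<in> Y (Suc m)" by (rule Y_neg)
   then show "g \<in> (?V \<inter> ?W) \<inter> T0"
    using nup up_iff[OF D(2,3) gR(1)] up_iff[OF D(2,3) gR(2)] gY gR R0T0 T0_sub_T by auto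
  next
   fix g assume g: "g \<in> (?V \<inter> ?W) \<inter> T0"
   then have gR: "g \<in> R0" using in_R0 by auto
   then have gR': "\<ominus>\<^bsub>R\<^esub> g \<in> R0" by (rule R0_R_closed)
   show "g \<in> AG.stab i s B"
    using g gR gR' up_iff[OF D(2,3) gR] up_iff[OF D(2,3) gR'] by (auto simp: AG.stab_def D(1) G0_neg)
  qed
  then show ?thesis unfolding DD'_def using dW by blast
 qed
 have "Z0 \<in> DD'" unfolding DD'_def Z0_def using Zd(1) n by blast
 then obtain S0 where S0: "S0 \<in> DD'" "AG.good_kernel S0"
  using AG.ex_good_kernel[of DD'] inter stab by blast
 obtain S m where S: "S0 = S \<inter> T0" "dset S" "S <= Y m" using S0(1) by (auto simp: DD'_def)
 have gk: "\<zero>\<^bsub>R\<^esub> \<in> S0" "!!g. g \<in> S0 ==> \<ominus>\<^bsub>R\<^esub> g \<in> S0"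
  "!!gs. length gs = 8 ==> set gs <= S0 ==> \<exists>a\<in>Z0. \<exists>b\<in>Z0. \<exists>c\<in>Z0. \<exists>d\<in>Z0. AG.total gs = a [+] b [+] (c [+] d)"
  "\<exists>F. finite F & F <= Z0 & (\<forall>x\<in>Z0. \<exists>f\<in>F. x [-] f \<in> S0)"
 proof -
  have S0R: "S0 <= R0" using S0(2) by (simp add: AG.good_kernel_def)
  show "\<zero>\<^bsub>R\<^esub> \<in> S0" using S0(2) by (simp add: AG.good_kernel_def)
  show "\<ominus>\<^bsub>R\<^esub> g \<in> S0" if g: "g \<in> S0" for g
  proof -
   have gR: "g \<in> R0" using S0R g by blast
   have "\<ominus>\<^bsub>G0\<^esub> g \<in> S0" using S0(2) g by (simp add: AG.good_kernel_def)
   then show ?thesis unfolding G0_neg[OF gR] .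
  qed
  show "\<exists>a\<in>Z0. \<exists>b\<in>Z0. \<exists>c\<in>Z0. \<exists>d\<in>Z0. AG.total gs = a [+] b [+] (c [+] d)"
   if "length gs = 8" "set gs <= S0" for gs
   using S0(2) that by (simp add: AG.good_kernel_def)
  obtain F where "finite F" "F <= Z0" "\<forall>x\<in>Z0. \<exists>f\<in>F. x \<ominus>\<^bsub>G0\<^esub> f \<in> S0"
   using S0(2) unfolding AG.good_kernel_def by (elim exE conjE)
  moreover have "x \<ominus>\<^bsub>G0\<^esub> f = x [-] f" if "f \<in> Z0" for x f using G0_minus Z0R that by simp
  ultimately show "\<exists>F. finite F & F <= Z0 & (\<forall>x\<in>Z0. \<exists>f\<in>F. x [-] f \<in> S0)"
   by (intro exI[of _ F]) (auto simp: subset_iff)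
 qed
 have SR: "x \<in> carrier R" if "x \<in> S" for x using that S(3) Y_R by auto
 have Sneg: "\<ominus>\<^bsub>R\<^esub> x \<in> S" if "x \<in> S" for x
 proof -
  have "S <= {x \<in> T. x \<in> Y m & \<ominus>\<^bsub>R\<^esub> x \<in> S}"
   by (rule dset_eqI[OF S(2) dset_neg_preimage[OF S(2)]]) (use gk(2) S T0_sub_T in auto)
  then show ?thesis using that by auto
 qed
 have Zm: "dset (fourfold Z)" by (rule fourfold_dset[OF Zd(1) n])
 have eight: "((v 0 [+] v 1) [+] (v 2 [+] v 3)) [+] ((v 4 [+] v 5) [+] (v 6 [+] v 7)) \<in> fourfold Z"
  if v: "!!i. v i \<in> S" for v :: "nat => 'a list"
 proof -
  let ?G = "%v. \<forall>i<8. v i \<in> S"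
  let ?t = "%v. ((v 0 [+] v 1) [+] (v 2 [+] v 3)) [+] ((v 4 [+] v 5) [+] (v 6 [+] v (7::nat)))"
  have G: "dfn ?G" by (intro dfn_conj_many dset_mem S)
  have var: "tm ?G (%v. v i)" if "i < 8" for i :: nat
   by (rule tm_var[OF G, of _ m]) (use that S(3) in auto)
  have t: "tm ?G ?t" by (intro tm_add var) simp_all
  have "?G v --> ?t v \<in> fourfold Z"
  proof (rule transfer[OF tm_in_imp[OF t Zm]])
   show "v i \<in> T" for i using v dset_sub[OF S(2)] by auto
   fix w :: "nat => 'a list" assume w: "!!i. w i \<in> T0"
   show "?G w --> ?t w \<in> fourfold Z"
   proof
    assume G: "?G w"
    then have w0: "w i \<in> S0" if "i < 8" for i using that w S(1) by simp
    let ?gs = "[w 0, w 1, w 2, w 3, w 4, w 5, w 6, w 7]"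
    have "set ?gs <= S0" using w0 by simp
    from gk(3)[OF _ this] obtain a b c d where
     abcd: "a \<in> Z0" "b \<in> Z0" "c \<in> Z0" "d \<in> Z0" "AG.total ?gs = a [+] b [+] (c [+] d)" by auto
    have c: "w 0 \<in> carrier R" "w 1 \<in> carrier R" "w 2 \<in> carrier R" "w 3 \<in> carrier R"
     "w 4 \<in> carrier R" "w 5 \<in> carrier R" "w 6 \<in> carrier R" "w 7 \<in> carrier R"
     using G SR by simp_all
    have "AG.total ?gs = w 0 [+] (w 1 [+] (w 2 [+] (w 3 [+] (w 4 [+] (w 5 [+] (w 6 [+] (w 7 [+] \<zero>\<^bsub>R\<^esub>)))))))"
     by simp
    also have "\<dots> = ?t w" using c by (simp add: R.a_assoc)
    finally have "?t w = a [+] b [+] (c [+] d)" using abcd by simp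
    then show "?t w \<in> fourfold Z" unfolding fourfold_iff using abcd(1-4) by (auto simp: Z0_def)
   qed
  qed
  then show ?thesis using v by blast
 qed
 have "x [-] y \<in> fourfold Z" if xy: "x \<in> fourfold S" "y \<in> fourfold S" for x y
 proof -
  obtain a b c d where x: "a \<in> S" "b \<in> S" "c \<in> S" "d \<in> S" "x = a [+] b [+] (c [+] d)"
   using xy(1) unfolding fourfold_iff by (elim bexE)
  obtain a' b' c' d' where y: "a' \<in> S" "b' \<in> S" "c' \<in> S" "d' \<in> S" "y = a' [+] b' [+] (c' [+] d')"
   using xy(2) unfolding fourfold_iff by (elim bexE)
  have "x [-] y = ((a [+] b) [+] (c [+] d)) [+] ((\<ominus>\<^bsub>R\<^esub> a' [+] \<ominus>\<^bsub>R\<^esub> b') [+] (\<ominus>\<^bsub>R\<^esub> c' [+] \<ominus>\<^bsub>R\<^esub> d'))"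
   unfolding x(5) y(5) a_minus_def using y(1-4)[THEN SR] by (simp add: R.minus_add)
  also have "\<dots> \<in> fourfold Z"
   using eight[of "%i. if i = 0 then a else if i = 1 then b else if i = 2 then c else if i = 3 then d else
    if i = 4 then \<ominus>\<^bsub>R\<^esub> a' else if i = 5 then \<ominus>\<^bsub>R\<^esub> b' else if i = 6 then \<ominus>\<^bsub>R\<^esub> c' else \<ominus>\<^bsub>R\<^esub> d'"] x(1-4) y(1-4) Sneg
   by simp
  finally show ?thesis .
 qed
 moreover have "base S"
  unfolding base_def
 proof (intro conjI ballI)
  show "dset S" by (rule S)
  show "\<exists>n. S <= Y n" using S(3) by blast
  show "\<zero>\<^bsub>R\<^esub> \<in> S" using gk(1) S(1) by auto
  show "\<ominus>\<^bsub>R\<^esub> x \<in> S" if "x \<in> S" for x by (rule Sneg[OF that])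
  obtain F1 where F1: "finite F1" "F1 <= Z0" "\<forall>x\<in>Z0. \<exists>f\<in>F1. x [-] f \<in> S0" using gk(4) by (elim exE conjE)
  have F1R: "F1 <= R0" using F1(2) Z0R by auto
  have "Z <= \<Union>((%f. {x \<in> T. x \<in> Y n & x [-] f \<in> S}) ` F1)"
  proof (rule dset_eqI[OF Zd(1)])
   show "dset (\<Union>((%f. {x \<in> T. x \<in> Y n & x [-] f \<in> S}) ` F1))"
    by (rule dset_Union) (use F1(1) F1R dset_translate[OF _ S(2)] in auto)
   show "Z \<inter> T0 <= \<Union>((%f. {x \<in> T. x \<in> Y n & x [-] f \<in> S}) ` F1)"
   proof
    fix x assume x: "x \<in> Z \<inter> T0"
    then obtain f where "f \<in> F1" "x [-] f \<in> S0" using F1(3) by (auto simp: Z0_def)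
    then show "x \<in> \<Union>((%f. {x \<in> T. x \<in> Y n & x [-] f \<in> S}) ` F1)"
     using x n T0_sub_T S(1) by auto
   qed
  qed
  then have cZ: "\<exists>f\<in>F1. x [-] f \<in> S" if "x \<in> Z" for x using that by auto
  show "generic S" unfolding generic_def
  proof
   fix l
   obtain F2 where F2: "finite F2" "F2 <= R0" "\<forall>x\<in>Y l. \<exists>f\<in>F2. x [-] f \<in> Z"
    using Zd(4) unfolding generic_def by (elim allE[of _ l] exE conjE)
   show "\<exists>F. finite F & F <= R0 & (\<forall>x\<in>Y l. \<exists>f\<in>F. x [-] f \<in> S)"
   proof (intro exI[of _ "(%(f, h). f [+] h) ` (F2 \<times> F1)"] conjI ballI)
    show "finite ((%(f, h). f [+] h) ` (F2 \<times> F1))" using F1 F2 by simp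
    show "(%(f, h). f [+] h) ` (F2 \<times> F1) <= R0" using F1R F2(2) by (auto intro!: R0_R_closed(1))
    fix x assume x: "x \<in> Y l"
    obtain f where f: "f \<in> F2" "x [-] f \<in> Z" using F2(3) x by blast
    obtain h where h: "h \<in> F1" "x [-] f [-] h \<in> S" using cZ[OF f(2)] by blast
    have "x \<in> carrier R" "f \<in> carrier R" "h \<in> carrier R" using x Y_R f h F1R F2(2) by auto
    then have "x [-] f [-] h = x [-] (f [+] h)" by algebra
    then show "\<exists>f\<in>(%(f, h). f [+] h) ` (F2 \<times> F1). x [-] f \<in> S"
     using f h by (intro bexI[of _ "f [+] h"]) auto
   qed
  qed
 qed
 ultimately show ?thesis by (intro exI[of _ S]) simp
qed

lemma base_Y0: "base (Y 0)"
 unfolding base_def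
proof (intro conjI ballI)
 show "generic (Y 0)" unfolding generic_def
 proof
  fix n
  obtain F where F: "finite F" "F <= R0" "\<forall>x\<in>lev n. \<exists>f\<in>F. \<exists>z\<in>X. x = f [+A] z"
   using finite_cover_level[of n] by (elim exE conjE)
  have "Y n <= \<Union>((%f. {x \<in> T. x \<in> Y n & x [-] f \<in> Y 0}) ` F)"
  proof (rule dset_eqI[OF Y_dset])
   show "dset (\<Union>((%f. {x \<in> T. x \<in> Y n & x [-] f \<in> Y 0}) ` F))"
    by (rule dset_Union) (use F dset_translate[OF _ Y_dset] in auto)
   show "Y n \<inter> T0 <= \<Union>((%f. {x \<in> T. x \<in> Y n & x [-] f \<in> Y 0}) ` F)"
   proof
    fix x assume x: "x \<in> Y n \<inter> T0"
    then have "x \<in> lev n" using Y_T0 by auto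
    then obtain f z where f: "f \<in> F" "z \<in> X" "x = f [+A] z" using F(3) by blast
    have zl: "z \<in> lev 0" using f(2) by simp
    then have zR: "z \<in> R0" "z \<in> Y 0" using zl lev_Y[of 0] unfolding R0_eq by blast+
    have fR: "f \<in> R0" using f F by auto
    have "x = f [+] z" using f(3) R_add_R0[OF fR zR(1)] by simp
    then have "x [-] f = z" using fR[THEN R0_R] zR(1)[THEN R0_R] by (simp only:) algebra
    then show "x \<in> \<Union>((%f. {x \<in> T. x \<in> Y n & x [-] f \<in> Y 0}) ` F)"
     using x zR f(1) T0_sub_T by auto
   qed
  qed
  then show "\<exists>F. finite F & F <= R0 & (\<forall>x\<in>Y n. \<exists>f\<in>F. x [-] f \<in> Y 0)"
   using F by (intro exI[of _ F]) auto
 qed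
 show "\<zero>\<^bsub>R\<^esub> \<in> Y 0" using lev_zero[of 0] lev_Y[of 0] by (auto simp: R_zero)
qed (auto intro: Y_dset Y_neg)

lemma ex_base_chain:
 "\<exists>S. base (S 0) & S 0 = Y 0 & (\<forall>i. base (S (Suc i)) \<and>
   (\<forall>x\<in>fourfold (S (Suc i)). \<forall>y\<in>fourfold (S (Suc i)). x [-] y \<in> fourfold (S i)))"
proof -
 have "\<exists>f. \<forall>n. (base (f n) & (n = 0 --> f n = Y 0)) \<and>
   (\<forall>x\<in>fourfold (f (Suc n)). \<forall>y\<in>fourfold (f (Suc n)). x [-] y \<in> fourfold (f n))"
  by (rule dependent_nat_choice) (use base_Y0 base_step in auto)
 then obtain f where "\<forall>n. (base (f n) & (n = 0 --> f n = Y 0)) \<and>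
   (\<forall>x\<in>fourfold (f (Suc n)). \<forall>y\<in>fourfold (f (Suc n)). x [-] y \<in> fourfold (f n))" by (elim exE)
 then show ?thesis by (intro exI[of _ f]) (simp add: base_Y0)
qed

end

section \<open>The smallest type-definable subgroup of bounded index\<close>

context def_ring begin

lemma tequiv_sym: "tequiv a b ==> tequiv b a"
 by (simp add: tequiv_def)

lemma tequiv_mem: "tequiv a b ==> dset D ==> a \<in> D ==> b \<in> D"
 by (simp add: tequiv_def)

lemma tequiv_image:
 assumes t: "tm (%v. v 0 \<in> D) (%v. t (v 0))" and D: "dset D" and ab: "tequiv a b" "a \<in> D"
 shows "tequiv (t a) (t b)"
proof (rule tequivI)
 have b: "b \<in> D" using tequiv_mem[OF ab(1) D ab(2)] .
 have T: "a \<in> T" "b \<in> T" using ab by (simp_all add: tequiv_def)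
 show "t a \<in> T" using tm_T[OF t, of "%_. a"] T ab by simp
 show "t b \<in> T" using tm_T[OF t, of "%_. b"] T b by simp
 fix E assume E: "dset E" "t b \<in> E"
 have "dset {x \<in> T. x \<in> D & t x \<in> E}" by (rule dset_collect[OF tm_in[OF t E(1)]])
 moreover have "b \<in> {x \<in> T. x \<in> D & t x \<in> E}" using b T E by simp
 ultimately have "a \<in> {x \<in> T. x \<in> D & t x \<in> E}" using tequiv_mem[OF tequiv_sym[OF ab(1)]] by blast
 then show "t a \<in> E" by simp
qed

text \<open>The connected-component conditions: type-definable subgroups over \<open>M\<close> whose cosets contain each complete type over \<open>M\<close>. By \<open>CC_iff_bounded\<close> this is
  boundedness of the index, in a form suited to compactness.\<close>

definition CC :: "'a list set => bool" where
 "CC I \<longleftrightarrow> additive_subgroup I R & tdef I & (\<forall>a\<in>carrier R. \<forall>b. tequiv a b --> a [-] b \<in> I)"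

lemma CC_sub: "CC I ==> additive_subgroup I R"
 and CC_tdef: "CC I ==> tdef I"
 and CC_diff: "CC I ==> a \<in> carrier R ==> tequiv a b ==> a [-] b \<in> I"
 by (simp_all add: CC_def)

lemmas subD = R.add_subgroupD

lemma sub_minus: "additive_subgroup I R ==> x \<in> I ==> y \<in> I ==> x [-] y \<in> I"
 unfolding a_minus_def by (intro subD)

lemma tequiv_Y: "tequiv a b ==> a \<in> Y n ==> b \<in> Y n"
 using tequiv_mem Y_dset by blast

lemma tequiv_R: "tequiv a b ==> a \<in> carrier R ==> b \<in> carrier R"
 using tequiv_Y unfolding R_carrier by blast

text \<open>By compactness, since the levels exhaust the ring.\<close>

lemma tdef_level:
 assumes I: "tdef I" "I <= carrier R" shows "\<exists>n. I <= Y n"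
proof -
 define \<S> where "\<S> = {D - Y n | D n. dset D & I <= D}"
 obtain d where d: "d \<in> T" using T0_nonempty T0_sub_T by blast
 have fb: "fbase \<S>" unfolding fbase_def
 proof (intro conjI ballI)
  have "T - Y 0 \<in> \<S>" unfolding \<S>_def using dset_T tdef_sub[OF I(1)] by blast
  then show "\<S> \<noteq> {}" by blast
  show "dset D" if "D \<in> \<S>" for D using that dset_Diff Y_dset by (auto simp: \<S>_def)
  fix D E assume "D \<in> \<S>" "E \<in> \<S>"
  then obtain D' n E' m where 1: "D = D' - Y n" "dset D'" "I <= D'" "E = E' - Y m" "dset E'" "I <= E'"
   by (auto simp: \<S>_def)
  have "dset (D' \<inter> E')" "I <= D' \<inter> E'" using 1 dset_Int by auto
  then have "D' \<inter> E' - Y (max n m) \<in> \<S>" unfolding \<S>_def by blast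
  moreover have "D' \<inter> E' - Y (max n m) <= D \<inter> E" using 1 Y_mono[of n "max n m"] Y_mono[of m "max n m"] by auto
  ultimately show "\<exists>F\<in>\<S>. F <= D \<inter> E" by blast
 qed
 have "\<exists>D\<in>\<S>. \<forall>x\<in>D. False"
 proof (rule compactness1[OF fb, of "%_. d" "%x w. False"])
  show "False" if x: "x \<in> \<Inter>\<S>" for x
  proof -
   have "x \<in> D - Y n" if "dset D" "I <= D" for D n using x that unfolding \<S>_def by blast
   then have "x \<in> \<Inter>{D. dset D & I <= D}" "x \<notin> Y n" for n using dset_T tdef_sub[OF I(1)] by blast+
   then have "x \<in> I" "x \<notin> carrier R" using tdef_fbase(2)[OF I(1)] by (auto simp: R_carrier)
   then show False using I(2) by blast
  qed
 qed (simp_all add: d dfn_closed)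
 then obtain D where "D \<in> \<S>" "D = {}" by blast
 then show ?thesis unfolding \<S>_def by blast
qed

definition Nm :: "'a list set => nat => 'a list set set" where
 "Nm I m = {D. dset D & I <= D & D <= Y m}"

lemma Nm_fbase:
 assumes "tdef I" "I <= Y m" shows "fbase (Nm I m)" "\<Inter>(Nm I m) = I"
proof -
 show "fbase (Nm I m)" unfolding fbase_def
 proof (intro conjI ballI)
  show "Nm I m \<noteq> {}" using assms Y_dset by (auto simp: Nm_def)
  show "dset D" if "D \<in> Nm I m" for D using that by (simp add: Nm_def)
  show "\<exists>F\<in>Nm I m. F <= D \<inter> E" if "D \<in> Nm I m" "E \<in> Nm I m" for D E
   using that by (intro bexI[of _ "D \<inter> E"]) (auto simp: Nm_def dset_Int)
 qed
 have "x \<in> I" if x: "x \<in> \<Inter>(Nm I m)" for x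
 proof -
  have "x \<in> D" if "dset D" "I <= D" for D
  proof -
   have "D \<inter> Y m \<in> Nm I m" using that assms dset_Int Y_dset by (auto simp: Nm_def)
   then show ?thesis using x by blast
  qed
  then show ?thesis using tdef_fbase(2)[OF assms(1)] by blast
 qed
 then show "\<Inter>(Nm I m) = I" by (auto simp: Nm_def)
qed

lemma Nm_Int: "D \<in> Nm I m ==> E \<in> Nm I m ==> D \<inter> E \<in> Nm I m"
 by (auto simp: Nm_def dset_Int)

lemma Nm_dset: "D \<in> Nm I m ==> dset D" and Nm_Y: "D \<in> Nm I m ==> D <= Y m" and Nm_sub: "D \<in> Nm I m ==> I <= D"
 by (auto simp: Nm_def)

lemma Nm_tdef:
 assumes "tdef I" "I <= Y m" "!!D. D \<in> Nm I m ==> x \<in> D" shows "x \<in> I"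
 using Nm_fbase(2)[OF assms(1,2)] assms(3) by blast

lemma tmv:
 assumes "dset D" "dset E" "D <= Y n" "E <= Y m"
 shows "tm (%v. v 0 \<in> D & v (Suc 0) \<in> E) (%v. v 0)" "tm (%v. v 0 \<in> D & v (Suc 0) \<in> E) (%v. v (Suc 0))"
proof -
 have G: "dfn (%v. v 0 \<in> D & v (Suc 0) \<in> E)" by (rule guard2[OF assms(1,2)])
 show "tm (%v. v 0 \<in> D & v (Suc 0) \<in> E) (%v. v 0)" by (rule tm_var[OF G, of _ n]) (use assms in auto)
 show "tm (%v. v 0 \<in> D & v (Suc 0) \<in> E) (%v. v (Suc 0))" by (rule tm_var[OF G, of _ m]) (use assms in auto)
qed

lemma Nm_pair:
 assumes I: "tdef I" "I <= Y m"
  and Q: "dfn (%v. Q (v 0) (v (Suc 0)))"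
  and all: "!!x y. x \<in> I ==> y \<in> I ==> Q x y"
 shows "\<exists>E\<in>Nm I m. \<forall>x\<in>E. \<forall>y\<in>E. Q x y"
proof -
 obtain d where d: "d \<in> T" using T0_nonempty T0_sub_T by blast
 have "\<exists>D\<in>Nm I m. \<exists>E\<in>Nm I m. \<forall>x\<in>D. \<forall>y\<in>E. Q x y"
 proof (rule compactness2[OF Nm_fbase(1)[OF I] Nm_fbase(1)[OF I], of "%_. d" "%x y w. Q x y"])
  show "dfn (%v. Q (v 0) (v 1))" using Q by simp
 qed (use d all in \<open>simp_all add: Nm_fbase(2)[OF I]\<close>)
 then obtain D E where DE: "D \<in> Nm I m" "E \<in> Nm I m" "\<forall>x\<in>D. \<forall>y\<in>E. Q x y" by (elim bexE)
 show ?thesis by (rule bexI[OF _ Nm_Int[OF DE(1,2)]]) (use DE(3) in simp)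
qed

lemma Nm_minus:
 assumes I: "additive_subgroup I R" "tdef I" "I <= Y m" and D: "dset D" "I <= D"
 shows "\<exists>E\<in>Nm I m. \<forall>x\<in>E. \<forall>y\<in>E. x [-] y \<in> D"
proof -
 have "\<exists>E\<in>Nm I m. \<forall>x\<in>E. \<forall>y\<in>E. (x \<in> Y m & y \<in> Y m) --> x [-] y \<in> D"
 proof (rule Nm_pair[OF I(2,3)])
  show "dfn (%v. v 0 \<in> Y m & v (Suc 0) \<in> Y m --> v 0 [-] v (Suc 0) \<in> D)"
   by (rule tm_in_imp[OF tm_minus[OF tmv[OF Y_dset Y_dset order_refl order_refl]] D(1)])
  show "x \<in> Y m & y \<in> Y m --> x [-] y \<in> D" if "x \<in> I" "y \<in> I" for x y
   using sub_minus[OF I(1) that] D(2) by auto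
 qed
 then obtain E where E: "E \<in> Nm I m" "\<forall>x\<in>E. \<forall>y\<in>E. (x \<in> Y m & y \<in> Y m) --> x [-] y \<in> D" by (elim bexE)
 show ?thesis by (rule bexI[OF _ E(1)]) (use E(2) Nm_Y[OF E(1)] in blast)
qed

lemma Nm_mult2:
 assumes I: "tdef I" "I <= Y m" and D: "dset D" and all: "!!x y. x \<in> I ==> y \<in> I ==> x [*] y \<in> D"
 shows "\<exists>E\<in>Nm I m. \<forall>x\<in>E. \<forall>y\<in>E. x [*] y \<in> D"
proof -
 have "\<exists>E\<in>Nm I m. \<forall>x\<in>E. \<forall>y\<in>E. (x \<in> Y m & y \<in> Y m) --> x [*] y \<in> D"
 proof (rule Nm_pair[OF I])
  show "dfn (%v. v 0 \<in> Y m & v (Suc 0) \<in> Y m --> v 0 [*] v (Suc 0) \<in> D)"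
   by (rule tm_in_imp[OF tm_mult[OF tmv[OF Y_dset Y_dset order_refl order_refl]] D(1)])
 qed (use all in auto)
 then obtain E where E: "E \<in> Nm I m" "\<forall>x\<in>E. \<forall>y\<in>E. (x \<in> Y m & y \<in> Y m) --> x [*] y \<in> D" by (elim bexE)
 show ?thesis by (rule bexI[OF _ E(1)]) (use E(2) Nm_Y[OF E(1)] in blast)
qed

lemma Nm_single:
 assumes I: "tdef I" "I <= Y m" and D: "dset D" and r: "r \<in> Y n"
  and t: "tm (%v. v 0 \<in> Y m & v (Suc 0) \<in> Y n) (%v. t (v 0) (v (Suc 0)))"
  and all: "!!x. x \<in> I ==> t x r \<in> D"
 shows "\<exists>E\<in>Nm I m. \<forall>x\<in>E. t x r \<in> D"
proof -
 have "\<exists>E\<in>Nm I m. \<forall>x\<in>E. (x \<in> Y m & r \<in> Y n) --> t x r \<in> D"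
 proof (rule compactness1[OF Nm_fbase(1)[OF I], of "%_. r" "%x w. (x \<in> Y m & w 0 \<in> Y n) --> t x (w 0) \<in> D"])
  show "r \<in> T" using r Y_T by auto
  show "dfn (%v. v 0 \<in> Y m & v (Suc 0) \<in> Y n --> t (v 0) (v (Suc 0)) \<in> D)"
   by (rule tm_in_imp[OF t D])
 qed (use all in \<open>simp add: Nm_fbase(2)[OF I]\<close>)
 then obtain E where E: "E \<in> Nm I m" "\<forall>x\<in>E. (x \<in> Y m & r \<in> Y n) --> t x r \<in> D" by (elim bexE)
 show ?thesis by (rule bexI[OF _ E(1)]) (use E(2) Nm_Y[OF E(1)] r in blast)
qed

definition type_base :: "nat => 'a list => 'a list set set" where
 "type_base n b = {E. dset E & b \<in> E & E <= Y n}"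

lemma type_base_props:
 assumes "b \<in> Y n"
 shows "fbase (type_base n b)" "!!x. x \<in> \<Inter>(type_base n b) ==> tequiv x b"
proof -
 have Yn: "Y n \<in> type_base n b" using assms Y_dset by (simp add: type_base_def)
 show "fbase (type_base n b)" unfolding fbase_def
 proof (intro conjI ballI)
  show "type_base n b \<noteq> {}" using Yn by blast
  show "dset D" if "D \<in> type_base n b" for D using that by (simp add: type_base_def)
  show "\<exists>F\<in>type_base n b. F <= D \<inter> E" if "D \<in> type_base n b" "E \<in> type_base n b" for D E
   using that by (intro bexI[of _ "D \<inter> E"]) (auto simp: type_base_def dset_Int)
 qed
 fix x assume x: "x \<in> \<Inter>(type_base n b)"
 show "tequiv x b"
 proof (rule tequivI)
  show "x \<in> T" using x Yn Y_T by blast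
  show "b \<in> T" using assms Y_T by auto
  show "x \<in> D" if "dset D" "b \<in> D" for D
  proof -
   have "D \<inter> Y n \<in> type_base n b" using that assms dset_Int Y_dset by (simp add: type_base_def)
   then show ?thesis using x by blast
  qed
 qed
qed

text \<open>By compactness a coset of \<open>D\<close> represented in \<open>M\<close> contains a given point: the type of the point is realized
  approximately in \<open>M\<close>. Saturation reduces these cosets to finitely many.\<close>

lemma CC_generic:
 assumes I: "CC I" and D: "dset D" "I <= D"
 shows "\<exists>F. finite F & F <= R0 & (\<forall>x\<in>Y n. \<exists>f\<in>F. x [-] f \<in> D)"
proof -
 let ?Q = "%x a. (x \<in> Y n & a \<in> Y n) & x [-] a \<in> D"
 obtain d where d: "d \<in> T" using T0_nonempty T0_sub_T by blast
 note tt = tm_minus[OF tmv[OF Y_dset Y_dset order_refl order_refl]]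
 have near: "\<exists>e\<in>R0. ?Q b e" if b: "b \<in> Y n" for b
 proof -
  note tb = type_base_props[OF b]
  have "\<exists>E1\<in>type_base n b. \<exists>E2\<in>type_base n b. \<forall>x\<in>E1. \<forall>y\<in>E2. (x \<in> Y n & y \<in> Y n) --> x [-] y \<in> D"
  proof (rule compactness2[OF tb(1) tb(1), of "%_. d" "%x y w. (x \<in> Y n & y \<in> Y n) --> x [-] y \<in> D"])
   show "dfn (%v. v 0 \<in> Y n & v 1 \<in> Y n --> v 0 [-] v 1 \<in> D)"
    using tm_in_imp[OF tt D(1)] by simp
   fix x y assume "x \<in> \<Inter>(type_base n b)" "y \<in> \<Inter>(type_base n b)"
   then have "tequiv x b" "tequiv y b" using tb(2) by blast+
   then have "tequiv x y" by (auto simp: tequiv_def)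
   then show "x \<in> Y n & y \<in> Y n --> x [-] y \<in> D" using CC_diff[OF I, of x y] Y_R D(2) by blast
  qed (rule d)
  then obtain E1 E2 where E: "E1 \<in> type_base n b" "E2 \<in> type_base n b"
   "\<forall>x\<in>E1. \<forall>y\<in>E2. (x \<in> Y n & y \<in> Y n) --> x [-] y \<in> D" by (elim bexE)
  then obtain e where e: "e \<in> T0" "e \<in> E2" using dset_meets_T0[of E2 b] by (auto simp: type_base_def)
  then have "e \<in> R0" "e \<in> Y n" using E(2) in_R0 by (auto simp: type_base_def)
  then show ?thesis using E e b by (intro bexI[of _ e]) (auto simp: type_base_def)
 qed
 have "R0 <= lists (universe M)" using R0_T0 by (auto simp: T0_def tuples_def)
 then have "small R0" by (rule small_subset[OF small_lists[OF small_universe]])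
 moreover have "R0 <= T" using R0_T0 T0_sub_T by auto
 moreover have "dfn (%v. ?Q (v 0) (v 1))" using tm_in[OF tt D(1)] by simp
 ultimately have "\<exists>F. finite F & F <= R0 & (\<forall>x\<in>Y n. \<exists>a\<in>F. ?Q x a)"
  using near by (intro finite_subcover Y_dset)
 then obtain F where "finite F" "F <= R0" "\<forall>x\<in>Y n. \<exists>a\<in>F. ?Q x a" by (elim exE conjE)
 then show ?thesis by (intro exI[of _ F]) blast
qed

lemma diff_diff: "a \<in> carrier R ==> b \<in> carrier R ==> f \<in> carrier R ==>
  (a [-] f) [-] (b [-] f) = a [-] b"
 by (simp add: R.ring_norm)

lemma CC_Inter_chain:
 assumes ne: "\<G> \<noteq> {}" and d: "!!E. E \<in> \<G> ==> dset E" and z: "!!E. E \<in> \<G> ==> \<zero>\<^bsub>R\<^esub> \<in> E"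
  and lev: "\<Inter>\<G> <= carrier R"
  and minus: "!!E. E \<in> \<G> ==> \<exists>E'\<in>\<G>. \<forall>x\<in>E'. \<forall>y\<in>E'. x [-] y \<in> E"
  and gen: "!!E. E \<in> \<G> ==> generic E"
 shows "CC (\<Inter>\<G>)"
 unfolding CC_def
proof (intro conjI ballI allI impI)
 have m: "x [-] y \<in> \<Inter>\<G>" if "x \<in> \<Inter>\<G>" "y \<in> \<Inter>\<G>" for x y
  using minus that by blast
 show "additive_subgroup (\<Inter>\<G>) R"
 proof (rule R.add_subgroupI)
  show z': "\<zero>\<^bsub>R\<^esub> \<in> \<Inter>\<G>" using z by blast
  show neg: "\<ominus>\<^bsub>R\<^esub> x \<in> \<Inter>\<G>" if "x \<in> \<Inter>\<G>" for x
   using m[OF z' that] that lev by (auto simp: R.minus_eq)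
  show "x [+] y \<in> \<Inter>\<G>" if "x \<in> \<Inter>\<G>" "y \<in> \<Inter>\<G>" for x y
  proof -
   have "x \<in> carrier R" "y \<in> carrier R" using that lev by blast+
   then have "x [+] y = x [-] (\<ominus>\<^bsub>R\<^esub> y)" by algebra
   then show ?thesis using m[OF that(1) neg[OF that(2)]] by simp
  qed
 qed (rule lev)
 have "\<Inter>\<G> = T \<inter> \<Inter>\<G>" using ne dset_sub[OF d] by blast
 then show "tdef (\<Inter>\<G>)" unfolding tdef_def
  by (intro exI[of _ \<G>] conjI ballI) (rule d, assumption+)
 fix a b assume a: "a \<in> carrier R" "tequiv a b"
 then have b: "b \<in> carrier R" using tequiv_R by blast
 obtain n where n: "a \<in> Y n" using a by (auto simp: R_carrier)
 show "a [-] b \<in> \<Inter>\<G>"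
 proof
  fix E assume "E \<in> \<G>"
  then obtain E' where E': "E' \<in> \<G>" "\<forall>x\<in>E'. \<forall>y\<in>E'. x [-] y \<in> E" using minus by blast
  obtain F where F: "F <= R0" "\<forall>x\<in>Y n. \<exists>f\<in>F. x [-] f \<in> E'"
   using gen[OF E'(1)] unfolding generic_def by (elim allE[of _ n] exE conjE)
  obtain f where f: "f \<in> F" "a [-] f \<in> E'" using F(2) n by blast
  then have fR: "f \<in> R0" using F by blast
  have "a \<in> {x \<in> T. x \<in> Y n & x [-] f \<in> E'}" using n f Y_T by blast
  then have "b [-] f \<in> E'"
   using tequiv_mem[OF a(2) dset_translate[OF fR d[OF E'(1)]]] by blast
  then show "a [-] b \<in> E" using E'(2) f(2) diff_diff[OF a(1) b R0_R[OF fR]] by metis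
 qed
qed

text \<open>A bounded number of cosets covers the ring, so finitely many translates of a definable neighbourhood of \<open>I\<close> cover a level; by
  elementarity the translations can be taken in \<open>M\<close>, and membership in a translate is then part of the type.\<close>

lemma bounded_imp_CC:
 assumes I: "additive_subgroup I R" "tdef I"
  and B: "B <= carrier R" "small B" "!!x. x \<in> carrier R ==> \<exists>b\<in>B. x [-] b \<in> I"
 shows "CC I"
 unfolding CC_def
proof (intro conjI I ballI allI impI)
 fix a b assume a: "a \<in> carrier R" "tequiv a b"
 then have bR: "b \<in> carrier R" using tequiv_R by blast
 obtain m where m: "I <= Y m" using tdef_level[OF I(2) subD(1)[OF I(1)]] by blast
 obtain n where n: "a \<in> Y n" using a by (auto simp: R_carrier)
 have "a [-] b \<in> D" if D: "D \<in> Nm I m" for D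
 proof -
  obtain E where E: "E \<in> Nm I m" "\<forall>x\<in>E. \<forall>y\<in>E. x [-] y \<in> D"
   using Nm_minus[OF I m Nm_dset[OF D] Nm_sub[OF D]] by (elim bexE)
  define N where "N = Suc (max n m)"
  define B' where "B' = B \<inter> Y N"
  let ?Q = "%x c. (x \<in> Y N & c \<in> Y N) & x [-] c \<in> E"
  note tt = tm_minus[OF tmv[OF Y_dset[of N] Y_dset[of N] order_refl order_refl]]
  have nN: "Y n <= Y N" unfolding N_def by (rule Y_mono) simp
  have cov: "\<exists>c\<in>B'. ?Q x c" if x: "x \<in> Y n" for x
  proof -
   obtain c where c: "c \<in> B" "x [-] c \<in> I" using B(3) x Y_R by blast
   have "x \<in> Y (max n m)" "x [-] c \<in> Y (max n m)"
    using x c(2) m Y_mono[of n "max n m"] Y_mono[of m "max n m"] by auto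
   then have "x [-] (x [-] c) \<in> Y N" unfolding N_def by (rule Y_minus)
   moreover have "x [-] (x [-] c) = c" using Y_R[OF x] c(1) B(1) by (simp add: subset_iff) algebra
   ultimately have "c \<in> Y N" by simp
   then show ?thesis using c x nN Nm_sub[OF E(1)] by (intro bexI[of _ c]) (auto simp: B'_def)
  qed
  have "small B'" by (rule small_subset[OF B(2)]) (simp add: B'_def)
  moreover have "B' <= T" using Y_T by (auto simp: B'_def)
  moreover have "dfn (%v. ?Q (v 0) (v 1))" using tm_in[OF tt Nm_dset[OF E(1)]] by simp
  ultimately have "\<exists>F. finite F & F <= B' & (\<forall>x\<in>Y n. \<exists>c\<in>F. ?Q x c)"
   using cov by (intro finite_subcover Y_dset)
  then obtain F where F: "finite F" "F <= B'" "\<forall>x\<in>Y n. \<exists>c\<in>F. ?Q x c" by (elim exE conjE)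
  obtain cs where cs: "set cs = F" using finite_list[OF F(1)] by (elim exE)
  obtain d where d: "d \<in> T" using T0_nonempty T0_sub_T by blast
  define l where "l = length cs"
  define v where "v j = (if j < l then cs ! j else d)" for j
  let ?W = "%v :: nat => 'a list. \<forall>x\<in>T. x \<in> Y n --> \<not> (\<forall>j<l. \<not> ?Q x (v j))"
  have Wd: "dfn ?W"
  proof (rule dfn_all)
   have "dfn (%v. ?Q (v 0) (v (Suc j)))" for j
    using dfn_subst[OF tm_in[OF tt Nm_dset[OF E(1)]], of "%i. if i = 0 then 0 else Suc j"] by simp
   then show "dfn (%v. v 0 \<in> Y n --> \<not> (\<forall>j<l. \<not> ?Q (v 0) (v (Suc j))))"
    by (intro dfn_imp dfn_not dfn_conj_many dset_mem Y_dset)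
  qed
  have vT: "v j \<in> T" for j using d cs F(2) \<open>B' <= T\<close> nth_mem[of j cs] by (auto simp: v_def l_def)
  have "?W v"
  proof (intro ballI impI notI)
   fix x assume "x \<in> Y n" "\<forall>j<l. \<not> ?Q x (v j)"
   moreover then obtain c where "c \<in> F" "?Q x c" using F(3) by blast
   moreover then obtain j where "j < l" "v j = c" using cs by (auto simp: v_def l_def in_set_conv_nth)
   ultimately show False by blast
  qed
  from tarski_vaught[OF Wd vT this] obtain w where w: "\<forall>i. w i \<in> T0" "?W w" by (elim exE conjE)
  have "a \<in> T" using a by (simp add: tequiv_def)
  then obtain j where j: "j < l" "?Q a (w j)" using w(2) n by blast
  then have wj: "w j \<in> R0" using w(1) in_R0 by blast
  have "a \<in> {x \<in> T. x \<in> Y N & x [-] w j \<in> E}" using j \<open>a \<in> T\<close> by blast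
  then have "b [-] w j \<in> E"
   using tequiv_mem[OF a(2) dset_translate[OF wj Nm_dset[OF E(1)]]] by blast
  then show ?thesis using E(2) j(2) diff_diff[OF a(1) bR R0_R[OF wj]] by metis
 qed
 then show "a [-] b \<in> I" using Nm_tdef[OF I(2) m] by blast
qed

lemma tdef_preimage:
 assumes "tdef P" and t: "tm (%v. v 0 \<in> Y m) (%v. t (v 0))"
 shows "tdef {x \<in> Y m. t x \<in> P}"
proof -
 have "{x \<in> Y m. t x \<in> P} = T \<inter> \<Inter>{{x \<in> T. x \<in> Y m & t x \<in> D} | D. dset D & P <= D}" (is "?L = ?R")
 proof
  show "?L <= ?R" using Y_T by blast
  show "?R <= ?L"
  proof
   fix x assume "x \<in> ?R"
   then have x: "x \<in> Y m & t x \<in> D" if "dset D" "P <= D" for D using that by blast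
   have "x \<in> Y m" using x[OF dset_T tdef_sub[OF assms(1)]] by simp
   moreover have "t x \<in> \<Inter>{D. dset D & P <= D}" using x by blast
   ultimately show "x \<in> ?L" using tdef_fbase(2)[OF assms(1)] by simp
  qed
 qed
 moreover have "\<forall>E\<in>{{x \<in> T. x \<in> Y m & t x \<in> D} | D. dset D & P <= D}. dset E"
  using dset_collect[OF tm_in[OF t]] by blast
 ultimately show ?thesis unfolding tdef_def by blast
qed

definition H :: "'a list set" where "H = \<Inter>{I. CC I}"

lemma H_props: "CC H" "H <= fourfold (Y 0)" "!!I. CC I ==> H <= I"
proof -
 obtain S where S: "S 0 = Y 0" "!!i. base (S i)"
  "!!i. \<forall>x\<in>fourfold (S (Suc i)). \<forall>y\<in>fourfold (S (Suc i)). x [-] y \<in> fourfold (S i)"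
 proof -
  obtain S where S: "base (S 0)" "S 0 = Y 0" "\<forall>i. base (S (Suc i)) \<and>
   (\<forall>x\<in>fourfold (S (Suc i)). \<forall>y\<in>fourfold (S (Suc i)). x [-] y \<in> fourfold (S i))"
   using ex_base_chain by (elim exE conjE)
  have "base (S i)" for i using S by (cases i) auto
  then show ?thesis using that[of S] S by blast
 qed
 have in4: "x \<in> fourfold (S i)" if "x \<in> S i" for x i
 proof -
  have z: "\<zero>\<^bsub>R\<^esub> \<in> S i" and "x \<in> carrier R" using S(2)[of i] that Y_R by (auto simp: base_def)
  then have "x = x [+] \<zero>\<^bsub>R\<^esub> [+] (\<zero>\<^bsub>R\<^esub> [+] \<zero>\<^bsub>R\<^esub>)" by simp
  then show ?thesis unfolding fourfold_iff using that z by blast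
 qed
 have sub: "(\<Inter>(range (%i. fourfold (S i)))) <= fourfold (Y 0)" using S(1) by (metis INF_lower UNIV_I)
 have "CC (\<Inter>(range (%i. fourfold (S i))))"
 proof (rule CC_Inter_chain)
  show "\<Inter>(range (%i. fourfold (S i))) <= carrier R"
   using sub fourfold_Y[of "Y 0" 0] Y_R by blast
  fix E assume "E \<in> range (%i. fourfold (S i))"
  then obtain i where E: "E = fourfold (S i)" by blast
  obtain n where "S i <= Y n" "dset (S i)" using S(2)[of i] by (auto simp: base_def)
  then show "dset E" unfolding E by (intro fourfold_dset)
  show "\<zero>\<^bsub>R\<^esub> \<in> E" unfolding E using S(2)[of i] in4 by (simp add: base_def)
  show "\<exists>E'\<in>range (%i. fourfold (S i)). \<forall>x\<in>E'. \<forall>y\<in>E'. x [-] y \<in> E"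
   unfolding E by (rule bexI[of _ "fourfold (S (Suc i))"], rule S(3)) simp
  have "generic (S i)" using S(2)[of i] by (simp add: base_def)
  then show "generic E" unfolding generic_def E using in4[of _ i] by meson
 qed simp
 then have ne: "CC (\<Inter>(range (%i. fourfold (S i))))" .
 then show 4: "H <= fourfold (Y 0)" using sub unfolding H_def by blast
 show "H <= I" if "CC I" for I using that unfolding H_def by blast
 show "CC H" unfolding CC_def
 proof (intro conjI ballI allI impI)
  show "additive_subgroup H R"
  proof (rule R.add_subgroupI)
   show "H <= carrier R" using 4 fourfold_Y[of "Y 0" 0] Y_R by blast
   show "\<zero>\<^bsub>R\<^esub> \<in> H" unfolding H_def using subD(2)[OF CC_sub] by blast
   show "x [+] y \<in> H" if "x \<in> H" "y \<in> H" for x y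
    using that subD(3)[OF CC_sub] unfolding H_def by blast
   show "\<ominus>\<^bsub>R\<^esub> x \<in> H" if "x \<in> H" for x using that subD(4)[OF CC_sub] unfolding H_def by blast
  qed
  have "H = T \<inter> \<Inter>{I. CC I}" using tdef_sub[OF CC_tdef[OF ne]] ne unfolding H_def by blast
  then show "tdef H" using tdef_Inter[of "{I. CC I}"] CC_tdef by simp
  show "a [-] b \<in> H" if "a \<in> carrier R" "tequiv a b" for a b
   using CC_diff that unfolding H_def by blast
 qed
qed

lemmas H_sub = CC_sub[OF H_props(1)] and H_tdef = CC_tdef[OF H_props(1)]
lemmas H_R = subD(1)[OF H_sub] and H_zero = subD(2)[OF H_sub] and H_add = subD(3)[OF H_sub] and H_neg = subD(4)[OF H_sub]
lemmas H_minus = sub_minus[OF H_sub]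

lemma H_carrier [simp]: "x \<in> H ==> x \<in> carrier R"
 using H_R by auto

text \<open>The preimage of \<open>H\<close> under an endomorphism that is definable over \<open>M\<close> meets the conditions, so it contains \<open>H\<close>.\<close>

lemma H_absorb:
 assumes t: "!!m. tm (%v. v 0 \<in> Y m) (%v. t (v 0))"
  and cl: "!!x. x \<in> carrier R ==> t x \<in> carrier R"
  and add: "!!x y. x \<in> carrier R ==> y \<in> carrier R ==> t (x [+] y) = t x [+] t y"
  and neg: "!!x. x \<in> carrier R ==> t (\<ominus>\<^bsub>R\<^esub> x) = \<ominus>\<^bsub>R\<^esub> t x" and zero: "t \<zero>\<^bsub>R\<^esub> = \<zero>\<^bsub>R\<^esub>"
  and h: "h \<in> H"
 shows "t h \<in> H"
proof -
 obtain m where m: "H <= Y m" using tdef_level[OF H_tdef H_R] by blast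
 have "CC {x \<in> H. t x \<in> H}" unfolding CC_def
 proof (intro conjI ballI allI impI)
  show "additive_subgroup {x \<in> H. t x \<in> H} R"
   by (rule R.add_subgroupI) (auto simp: H_zero zero add neg intro: H_add H_neg)
  have "{x \<in> H. t x \<in> H} = H \<inter> {x \<in> Y m. t x \<in> H}" using m by blast
  then show "tdef {x \<in> H. t x \<in> H}" using tdef_Int[OF H_tdef tdef_preimage[OF H_tdef t]] by simp
  fix a b assume a: "a \<in> carrier R" "tequiv a b"
  then have b: "b \<in> carrier R" using tequiv_R by blast
  obtain n where n: "a \<in> Y n" using a by (auto simp: R_carrier)
  have "tequiv (t a) (t b)" by (rule tequiv_image[OF t Y_dset a(2) n])
  then have "t a [-] t b \<in> H" using CC_diff[OF H_props(1)] cl a(1) by blast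
  moreover have "t (a [-] b) = t a [-] t b" unfolding a_minus_def using a b by (simp add: add neg)
  ultimately show "a [-] b \<in> {x \<in> H. t x \<in> H}" using CC_diff[OF H_props(1) a] by simp
 qed
 then have "H <= {x \<in> H. t x \<in> H}" by (rule H_props(3))
 then show ?thesis using h by blast
qed

lemma R0_H: assumes "e \<in> R0" "h \<in> H" shows "e [*] h \<in> H" "h [*] e \<in> H"
proof -
 have v: "tm (%v. v 0 \<in> Y m) (%v. v 0)" for m by (rule tm_var[OF dset_mem[OF Y_dset], of _ m]) simp
 have c: "tm (%v. v 0 \<in> Y m) (%v. e)" for m by (rule tm_const[OF dset_mem[OF Y_dset] assms(1)])
 have e: "e \<in> carrier R" using assms by simp
 show "e [*] h \<in> H"
  by (rule H_absorb[OF tm_mult[OF c v] _ _ _ _ assms(2)])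
   (use e in \<open>simp_all add: R.rng_m_closed R.rng_r_distr R.rng_r_minus R.rng_r_null\<close>)
 show "h [*] e \<in> H"
  by (rule H_absorb[OF tm_mult[OF v c] _ _ _ _ assms(2)])
   (use e in \<open>simp_all add: R.rng_m_closed R.rng_l_distr R.rng_l_minus R.rng_l_null\<close>)
qed

end

section \<open>The smallest type-definable ideal of bounded index\<close>

context def_ring begin

text \<open>Equality of the types over \<open>M\<close> of two pairs.\<close>

definition same_pair_type :: "'a list => 'a list => 'a list => 'a list => bool" where
 "same_pair_type r h a b \<longleftrightarrow> (\<forall>P. dfn (%v. P (v 0) (v (Suc 0))) --> P r h --> P a b)"

lemma same_pair_typeD:
 assumes "same_pair_type r h a b" "dfn (%v. P (v 0) (v (Suc 0)))" "P r h" shows "P a b"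
 by (rule assms(1)[unfolded same_pair_type_def, THEN spec[of _ P], THEN mp, THEN mp, OF assms(2,3)])

lemma H_level: "\<exists>m. H <= Y m"
 using tdef_level[OF H_tdef H_R] .

lemma same_pair_type_props:
 assumes s: "same_pair_type r h a b" and r: "r \<in> Y n" and h: "h \<in> H"
 shows "a \<in> Y n" "b \<in> H" "r [*] h [-] a [*] b \<in> H"
proof -
 obtain m where m: "H <= Y m" using H_level by (elim exE)
 show aY: "a \<in> Y n"
  by (rule same_pair_typeD[OF s, of "%x y. x \<in> Y n"]) (rule dset_mem[OF Y_dset], rule r)
 have bD: "b \<in> D" if "dset D" "h \<in> D" for D
  by (rule same_pair_typeD[OF s, of "%x y. y \<in> D"]) (rule dset_mem[OF that(1)], rule that(2))
 show bH: "b \<in> H" by (rule Nm_tdef[OF H_tdef m]) (use bD Nm_dset Nm_sub h in blast)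
 have "tequiv (r [*] h) (a [*] b)"
 proof (rule tequiv_sym, rule tequivI)
  show "r [*] h \<in> T" "a [*] b \<in> T" using r h aY bH Y_R R_T R.rng_m_closed H_carrier by metis+
  fix D assume D: "dset D" "r [*] h \<in> D"
  have "(a \<in> Y n & b \<in> Y m) & a [*] b \<in> D"
   by (rule same_pair_typeD[OF s, of "%x y. (x \<in> Y n & y \<in> Y m) & x [*] y \<in> D"])
    (rule tm_in[OF tm_mult[OF tmv[OF Y_dset Y_dset order_refl order_refl]] D(1)], use r h m D in auto)
  then show "a [*] b \<in> D" by simp
 qed
 then show "r [*] h [-] a [*] b \<in> H"
  using CC_diff[OF H_props(1)] r h Y_R R.rng_m_closed H_carrier by metis
qed

text \<open>Every element of \<open>R\<close> maps \<open>H\<close> into \<open>H\<close>, and the type of \<open>(r, h)\<close> is finitely satisfiable in \<open>M\<close>. So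
  compactness provides a realization whose first component does the same with the given elements of \<open>H\<close>.\<close>

lemma coheir_pair:
 fixes w :: "nat => 'a list"
 assumes r: "r \<in> Y n" and h: "h \<in> H" and w: "!!i. w i \<in> H"
 shows "\<exists>a b. same_pair_type r h a b & (\<forall>i. a [*] w i \<in> H)"
proof -
 obtain m where m: "H <= Y m" using H_level by (elim exE)
 define q where "q P D l v \<longleftrightarrow> (P (v 0) (v (Suc 0)) & v 0 \<in> Y n) \<and>
   (\<forall>i<l. (v 0 \<in> Y n & v (Suc (Suc i)) \<in> Y m) --> v 0 [*] v (Suc (Suc i)) \<in> D)"
  for P D and l :: nat and v :: "nat => 'a list"
 define \<P> where "\<P> = {P. dfn (%v. P (v 0) (v (Suc 0))) & P r h}"
 define \<Q> where "\<Q> = {q P D l | P D l. P \<in> \<P> & D \<in> Nm H m}"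
 define w' where "w' i = w (i - 2)" for i
 have Ym: "Y m \<in> Nm H m" using m Y_dset by (simp add: Nm_def)
 have TP: "(%x y. True) \<in> \<P>" by (simp add: \<P>_def dfn_True)
 have "\<exists>x. (\<forall>i. x i \<in> T) & (\<forall>Q\<in>\<Q>. Q (%i. if i < 2 then x i else w' i))"
 proof (rule compactness)
  show "w' i \<in> T" for i using w[THEN H_carrier] R_T by (simp add: w'_def)
  show "\<Q> \<noteq> {}" using Ym TP unfolding \<Q>_def by blast
  show "dfn Q" if "Q \<in> \<Q>" for Q
  proof -
   note hyp = that
   obtain P D l where Q: "Q = q P D l" "P \<in> \<P>" "D \<in> Nm H m" using hyp unfolding \<Q>_def by blast
   have "dfn (%v. (v 0 \<in> Y n & v (Suc (Suc i)) \<in> Y m) --> v 0 [*] v (Suc (Suc i)) \<in> D)" for i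
    using dfn_subst[OF tm_in_imp[OF tm_mult[OF tmv[OF Y_dset[of n] Y_dset[of m] order_refl order_refl]] Nm_dset[OF Q(3)]],
      of "%k. if k = 0 then 0 else Suc (Suc i)"] by simp
   then show ?thesis unfolding Q(1) q_def using Q(2)
    by (intro dfn_and dfn_conj_many dset_mem Y_dset) (simp_all add: \<P>_def)
  qed
  show "\<exists>Q3\<in>\<Q>. \<forall>v. (\<forall>i. v i \<in> T) --> Q3 v --> Q1 v & Q2 v" if "Q1 \<in> \<Q>" "Q2 \<in> \<Q>" for Q1 Q2
  proof -
   note hyp = that
   obtain P1 D1 l1 where 1: "Q1 = q P1 D1 l1" "P1 \<in> \<P>" "D1 \<in> Nm H m" using hyp(1) unfolding \<Q>_def by blast
   obtain P2 D2 l2 where 2: "Q2 = q P2 D2 l2" "P2 \<in> \<P>" "D2 \<in> Nm H m" using hyp(2) unfolding \<Q>_def by blast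
   let ?P = "%x y. P1 x y & P2 x y"
   have "?P \<in> \<P>" using 1(2) 2(2) dfn_and by (simp add: \<P>_def)
   then have "q ?P (D1 \<inter> D2) (max l1 l2) \<in> \<Q>" unfolding \<Q>_def using Nm_Int[OF 1(3) 2(3)] by blast
   moreover have "q ?P (D1 \<inter> D2) (max l1 l2) v ==> q P1 D1 l1 v & q P2 D2 l2 v" for v
    unfolding q_def by simp
   ultimately show ?thesis unfolding 1(1) 2(1) by blast
  qed
  show "\<exists>x. (\<forall>i. x i \<in> T) & Q (%i. if i < 2 then x i else w' i)" if "Q \<in> \<Q>" for Q
  proof -
   note hyp = that
   obtain P D l where Q: "Q = q P D l" "P \<in> \<P>" "D \<in> Nm H m" using hyp unfolding \<Q>_def by blast
   have d: "dfn (%v. P (v 0) (v (Suc 0)) & v 0 \<in> Y n)"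
    using Q(2) by (intro dfn_and dset_mem Y_dset) (simp add: \<P>_def)
   let ?v = "%i::nat. if i = 0 then r else h"
   have vT: "?v i \<in> T" for i using r h Y_T R_T by auto
   have Pv: "P (?v 0) (?v (Suc 0)) & ?v 0 \<in> Y n" using Q(2) r by (simp add: \<P>_def)
   obtain u where u: "\<forall>i. u i \<in> T0" "P (u 0) (u (Suc 0)) & u 0 \<in> Y n"
    using tarski_vaught[OF d, of ?v, OF vT Pv]
    by (elim exE conjE) (rule that, assumption, intro conjI, assumption+)
   then have "u 0 \<in> R0" using in_R0 by blast
   then have "u 0 [*] w i \<in> D" for i using R0_H(1) w Nm_sub[OF Q(3)] by blast
   then have "q P D l (%i. if i < 2 then u i else w' i)" using u(2) by (simp add: q_def w'_def)
   then show ?thesis unfolding Q(1) using u(1) T0_sub_T by (intro exI[of _ u]) auto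
  qed
 qed
 then obtain x where x: "\<forall>Q\<in>\<Q>. Q (%i. if i < 2 then x i else w' i)" by (elim exE conjE)
 have qx: "q P D l (%i. if i < 2 then x i else w' i)" if "P \<in> \<P>" "D \<in> Nm H m" for P D l
  using x that unfolding \<Q>_def by blast
 have "same_pair_type r h (x 0) (x (Suc 0))" unfolding same_pair_type_def
 proof (intro allI impI)
  fix P assume "dfn (%v. P (v 0) (v (Suc 0)))" "P r h"
  then have "P \<in> \<P>" by (simp add: \<P>_def)
  from qx[OF this Ym, of 0] show "P (x 0) (x (Suc 0))" by (simp add: q_def)
 qed
 moreover have "x 0 [*] w i \<in> H" for i
 proof (rule Nm_tdef[OF H_tdef m])
  fix D assume "D \<in> Nm H m"
  from qx[OF TP this, of "Suc i"] show "x 0 [*] w i \<in> D"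
   using w m by (auto simp: q_def w'_def)
 qed
 ultimately show ?thesis by blast
qed

lemma coheir_sequence:
 fixes N :: nat
 assumes r: "r \<in> Y n" and h: "h \<in> H" and h0: "h0 \<in> H"
 shows "\<exists>a b. (\<forall>j<N. same_pair_type r h (a j) (b j) & a j [*] h0 \<in> H & (\<forall>i<j. a j [*] b i \<in> H))"
proof (induction N)
 case (Suc N)
 then obtain a b where ab: "\<forall>j<N. same_pair_type r h (a j) (b j) & a j [*] h0 \<in> H & (\<forall>i<j. a j [*] b i \<in> H)"
  by (elim exE)
 define w where "w i = (if i < N then b i else h0)" for i
 have "w i \<in> H" for i using ab same_pair_type_props(2)[OF _ r h] h0 by (auto simp: w_def)
 from coheir_pair[where w = w, OF r h this] obtain a' b' where
  a': "same_pair_type r h a' b'" "\<forall>i. a' [*] w i \<in> H" by (elim exE conjE)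
 have "a' [*] h0 \<in> H" using a'(2)[rule_format, of N] by (simp add: w_def)
 moreover have "a' [*] b i \<in> H" if "i < N" for i using a'(2)[rule_format, of i] that by (simp add: w_def)
 ultimately show ?case
  using ab a'(1) by (intro exI[of _ "a(N := a')"] exI[of _ "b(N := b')"]) (auto simp: less_Suc_eq)
qed simp

text \<open>Two of the products of \<open>r\<close> with the second components of a long coheir sequence lie in the same coset of a given definable neighbourhood of
  \<open>H\<close>, by pigeonhole. The element \<open>x\<close> is the second component of the earlier pair and \<open>(y, z)\<close> is the later pair.\<close>

lemma pair_in_fiber:
 assumes r: "r \<in> Y n" "r' \<in> Y n" and h: "h \<in> H" "h' \<in> H"
 shows "\<exists>x y z. x \<in> H & same_pair_type r' h' y z & y [*] h \<in> H & y [*] x \<in> H \<and>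
   r [*] z [-] r [*] x \<in> H"
proof -
 obtain m0 where m0: "H <= Y m0" using H_level by (elim exE)
 define m where "m = max m0 n"
 have m: "H <= Y m" "Y n <= Y m" using m0 Y_mono[of m0 m] Y_mono[of n m] by (auto simp: m_def)
 define \<P> where "\<P> = {P. dfn (%v. P (v 0) (v (Suc 0))) & P r' h'}"
 let ?G = "%v :: nat => 'a list. \<forall>i<5. v i \<in> Y m"
 have G: "dfn ?G" by (intro dfn_conj_many dset_mem Y_dset)
 have var: "tm ?G (%v. v i)" if "i < 5" for i :: nat
  by (rule tm_var[OF G, of _ m]) (use that in auto)
 define q where "q P D v \<longleftrightarrow> ((v 0 \<in> D & P (v 1) (v 2)) & (?G v & v 1 [*] v 4 \<in> D)) \<and>
   ((?G v & v 1 [*] v 0 \<in> D) & (?G v & v 3 [*] v 2 [-] v 3 [*] v 0 \<in> D))"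
  for P D and v :: "nat => 'a list"
 define \<Q> where "\<Q> = {q P D | P D. P \<in> \<P> & D \<in> Nm H m}"
 define w' where "w' i = (if i = 3 then r else h)" for i :: nat
 have Ym: "Y m \<in> Nm H m" using m Y_dset by (simp add: Nm_def)
 have TP: "(%x y. True) \<in> \<P>" by (simp add: \<P>_def dfn_True)
 have "\<exists>x. (\<forall>i. x i \<in> T) & (\<forall>Q\<in>\<Q>. Q (%i. if i < 3 then x i else w' i))"
 proof (rule compactness)
  show "w' i \<in> T" for i using r h R_T Y_R by (simp add: w'_def)
  show "\<Q> \<noteq> {}" using Ym TP unfolding \<Q>_def by blast
  show "dfn Q" if "Q \<in> \<Q>" for Q
  proof -
   note hyp = that
   obtain P D where Q: "Q = q P D" "P \<in> \<P>" "D \<in> Nm H m" using hyp unfolding \<Q>_def by blast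
   have "dfn (%v. P (v 0) (v (Suc 0)))" using Q(2) by (simp add: \<P>_def)
   from dfn_subst[OF this, of Suc] have P: "dfn (%v. P (v 1) (v 2))" by (simp add: numeral_2_eq_2)
   note D = Nm_dset[OF Q(3)]
   show ?thesis unfolding Q(1) q_def
    by (intro dfn_and dset_mem D P tm_in tm_minus tm_mult var) simp_all
  qed
  show "\<exists>Q3\<in>\<Q>. \<forall>v. (\<forall>i. v i \<in> T) --> Q3 v --> Q1 v & Q2 v" if "Q1 \<in> \<Q>" "Q2 \<in> \<Q>" for Q1 Q2
  proof -
   note hyp = that
   obtain P1 D1 where 1: "Q1 = q P1 D1" "P1 \<in> \<P>" "D1 \<in> Nm H m" using hyp(1) unfolding \<Q>_def by blast
   obtain P2 D2 where 2: "Q2 = q P2 D2" "P2 \<in> \<P>" "D2 \<in> Nm H m" using hyp(2) unfolding \<Q>_def by blast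
   let ?P = "%x y. P1 x y & P2 x y"
   have "?P \<in> \<P>" using 1(2) 2(2) dfn_and by (simp add: \<P>_def)
   then have "q ?P (D1 \<inter> D2) \<in> \<Q>" unfolding \<Q>_def using Nm_Int[OF 1(3) 2(3)] by blast
   moreover have "q ?P (D1 \<inter> D2) v ==> q P1 D1 v & q P2 D2 v" for v
    unfolding q_def by blast
   ultimately show ?thesis unfolding 1(1) 2(1) by blast
  qed
  show "\<exists>x. (\<forall>i. x i \<in> T) & Q (%i. if i < 3 then x i else w' i)" if "Q \<in> \<Q>" for Q
  proof -
   note hyp = that
   obtain P D where Q: "Q = q P D" "P \<in> \<P>" "D \<in> Nm H m" using hyp unfolding \<Q>_def by blast
   obtain E where E: "E \<in> Nm H m" "\<forall>x\<in>E. \<forall>y\<in>E. x [-] y \<in> D"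
    using Nm_minus[OF H_sub H_tdef m(1) Nm_dset[OF Q(3)] Nm_sub[OF Q(3)]] by (elim bexE)
   obtain F where F: "finite F" "F <= R0" "\<forall>x\<in>Y (Suc m). \<exists>f\<in>F. x [-] f \<in> E"
    using CC_generic[OF H_props(1) Nm_dset[OF E(1)] Nm_sub[OF E(1)], of "Suc m"] by (elim exE conjE)
   obtain a b where ab: "\<forall>j<Suc (card F). same_pair_type r' h' (a j) (b j) & a j [*] h \<in> H & (\<forall>i<j. a j [*] b i \<in> H)"
    using coheir_sequence[OF r(2) h(2) h(1), of "Suc (card F)"] by (elim exE)
   have bH: "b j \<in> H" and aY: "a j \<in> Y n" if "j < Suc (card F)" for j
    using ab that same_pair_type_props(1,2)[OF _ r(2) h(2)] by blast+
   have "\<forall>j<Suc (card F). \<exists>f\<in>F. r [*] b j [-] f \<in> E"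
   proof (intro allI impI)
    fix j assume "j < Suc (card F)"
    then have "b j \<in> Y m" "r \<in> Y m" using bH m r by auto
    then have "r [*] b j \<in> Y (Suc m)" using R_mult_closed by blast
    then show "\<exists>f\<in>F. r [*] b j [-] f \<in> E" using F(3) by blast
   qed
   then obtain c where c: "\<forall>j<Suc (card F). c j \<in> F & r [*] b j [-] c j \<in> E" by metis
   have "card (c ` {..<Suc (card F)}) <= card F" using c F(1) by (intro card_mono) auto
   then have "\<not> inj_on c {..<Suc (card F)}" by (intro pigeonhole) simp
   then obtain i j where ij: "i < j" "j < Suc (card F)" "c i = c j"
    unfolding inj_on_def by (metis lessThan_iff nat_neq_iff)
   have cc: "r [*] b j \<in> carrier R" "r [*] b i \<in> carrier R" "c j \<in> carrier R"
    using r Y_R bH ij c F(2) R.rng_m_closed by auto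
   have "r [*] b j [-] c j \<in> E" "r [*] b i [-] c j \<in> E"
    using c[rule_format, of j] c[rule_format, of i] ij by auto
   then have "(r [*] b j [-] c j) [-] (r [*] b i [-] c j) \<in> D" using E(2) by blast
   then have d: "r [*] b j [-] r [*] b i \<in> D" using diff_diff[OF cc] by simp
   let ?x = "%k::nat. if k = 0 then b i else if k = 1 then a j else b j"
   let ?e = "%k. if k < 3 then ?x k else w' k"
   have HD: "x \<in> D" if "x \<in> H" for x using Nm_sub[OF Q(3)] that by blast
   have "?e k \<in> Y m" for k
    using bH[of i] bH[of j] aY[of j] ij r h m by (auto simp: w'_def)
   moreover have "P (a j) (b j)" using ab ij same_pair_typeD[of r' h' "a j" "b j" P] Q(2) by (simp add: \<P>_def)
   moreover have "a j [*] h \<in> D" "a j [*] b i \<in> D" "b i \<in> D" using ab ij bH[of i] by (auto intro!: HD)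
   ultimately have "q P D ?e" unfolding q_def using d by (simp add: w'_def)
   moreover have "?x k \<in> T" for k using bH[of i] bH[of j] aY[of j] ij R_T Y_R by auto
   ultimately show ?thesis unfolding Q(1) by (intro exI[of _ ?x]) simp
  qed
 qed
 then obtain x where x: "\<forall>Q\<in>\<Q>. Q (%i. if i < 3 then x i else w' i)" by (elim exE conjE)
 have qx: "q P D (%i. if i < 3 then x i else w' i)" if "P \<in> \<P>" "D \<in> Nm H m" for P D
  using x that unfolding \<Q>_def by blast
 have "same_pair_type r' h' (x 1) (x 2)" unfolding same_pair_type_def
 proof (intro allI impI)
  fix P assume "dfn (%v. P (v 0) (v (Suc 0)))" "P r' h'"
  then have "P \<in> \<P>" by (simp add: \<P>_def)
  from qx[OF this Ym] show "P (x 1) (x 2)" by (simp add: q_def)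
 qed
 moreover have "x 0 \<in> H" "x 1 [*] h \<in> H" "x 1 [*] x 0 \<in> H" "r [*] x 2 [-] r [*] x 0 \<in> H"
  by (rule Nm_tdef[OF H_tdef m(1)], use qx[OF TP] in \<open>force simp: q_def w'_def\<close>)+
 ultimately show ?thesis by blast
qed

definition J :: "'a list set" where
 "J = {h [+] r [*] h' | h r h'. h \<in> H & r \<in> carrier R & h' \<in> H}"

lemma J_iff: "z \<in> J \<longleftrightarrow> (\<exists>h\<in>H. \<exists>r\<in>carrier R. \<exists>h'\<in>H. z = h [+] r [*] h')"
 unfolding J_def by blast

lemma H_J: "h \<in> H ==> h \<in> J"
 unfolding J_iff using H_zero by (intro bexI[of _ h] bexI[of _ "\<zero>\<^bsub>R\<^esub>"]) (simp_all add: R.rng_r_null)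

lemma RH_J: "r \<in> carrier R ==> h \<in> H ==> r [*] h \<in> J"
 unfolding J_iff using H_zero by (intro bexI[of _ "\<zero>\<^bsub>R\<^esub>"] bexI[of _ r] bexI[of _ h]) (simp_all add: R.rng_m_closed)

lemma J_R: "z \<in> J ==> z \<in> carrier R"
 unfolding J_iff using R.rng_m_closed by auto

lemma H_J_add: "h \<in> H ==> z \<in> J ==> h [+] z \<in> J"
proof -
 assume h: "h \<in> H" and "z \<in> J"
 then obtain g r g' where z: "g \<in> H" "r \<in> carrier R" "g' \<in> H" "z = g [+] r [*] g'" unfolding J_iff by (elim bexE)
 have "h [+] z = (h [+] g) [+] r [*] g'" unfolding z(4) using h z R.rng_m_closed by (simp add: R.a_assoc)
 then show ?thesis unfolding J_iff using H_add[OF h z(1)] z by blast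
qed

text \<open>Expanding \<open>(r + y) (h + z - x)\<close>, all terms other than \<open>r h\<close> and \<open>y z\<close> cancel modulo \<open>H\<close>, and \<open>y z\<close>
  equals \<open>r' h'\<close> modulo \<open>H\<close>, because the two have the same type over \<open>M\<close>.\<close>

lemma RH_add:
 assumes "r \<in> carrier R" "h \<in> H" "r' \<in> carrier R" "h' \<in> H"
 shows "r [*] h [+] r' [*] h' \<in> J"
proof -
 obtain n where n: "r \<in> Y n" "r' \<in> Y n" using common_level3[OF assms(1,3,3)] by blast
 obtain x y z where xyz: "x \<in> H" "same_pair_type r' h' y z" "y [*] h \<in> H" "y [*] x \<in> H"
   "r [*] z [-] r [*] x \<in> H" using pair_in_fiber[OF n assms(2,4)] by (elim exE conjE)
 note p = same_pair_type_props[OF xyz(2) n(2) assms(4)]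
 have c: "r \<in> carrier R" "h \<in> carrier R" "r' \<in> carrier R" "h' \<in> carrier R" "x \<in> carrier R"
  "y \<in> carrier R" "z \<in> carrier R" using assms xyz(1) p Y_R by auto
 let ?d = "((r' [*] h' [-] y [*] z) [-] (r [*] z [-] r [*] x)) [-] (y [*] h [-] y [*] x)"
 have d: "?d \<in> H" by (rule H_minus[OF H_minus[OF p(3) xyz(5)] H_minus[OF xyz(3,4)]])
 have s: "h [+] (z [-] x) \<in> H" using assms(2) p(2) xyz(1) by (intro H_add H_minus)
 have "r [*] h [+] r' [*] h' = ?d [+] (r [+] y) [*] (h [+] (z [-] x))"
  using c by (simp add: R.ring_norm)
 then show ?thesis using H_J_add[OF d RH_J[OF _ s]] c by simp
qed

lemma J_add: "x \<in> J ==> y \<in> J ==> x [+] y \<in> J"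
proof -
 assume "x \<in> J" "y \<in> J"
 then obtain a r a' b s b' where *: "a \<in> H" "r \<in> carrier R" "a' \<in> H" "x = a [+] r [*] a'"
  "b \<in> H" "s \<in> carrier R" "b' \<in> H" "y = b [+] s [*] b'" unfolding J_iff by (elim bexE)
 have "x [+] y = (a [+] b) [+] (r [*] a' [+] s [*] b')"
  unfolding *(4,8) using * by (simp add: R.a_ac R.rng_m_closed)
 then show ?thesis using H_J_add[OF H_add RH_add] * by metis
qed

lemma J_neg: "x \<in> J ==> \<ominus>\<^bsub>R\<^esub> x \<in> J"
proof -
 assume "x \<in> J"
 then obtain a r a' where *: "a \<in> H" "r \<in> carrier R" "a' \<in> H" "x = a [+] r [*] a'" unfolding J_iff by (elim bexE)
 have "\<ominus>\<^bsub>R\<^esub> x = \<ominus>\<^bsub>R\<^esub> a [+] (\<ominus>\<^bsub>R\<^esub> r) [*] a'"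
  unfolding *(4) using * by (simp add: R.minus_add R.rng_m_closed R.rng_l_minus)
 then show ?thesis unfolding J_iff using * H_neg by blast
qed

text \<open>The type of \<open>s\<close> has a realization \<open>x\<close> with \<open>h x \<in> H\<close>, again because it is finitely satisfiable in \<open>M\<close>, and \<open>s - x \<in> H\<close>. So no right multiples have to be
  added to \<open>J\<close>.\<close>

lemma HR_J:
 assumes h: "h \<in> H" and s: "s \<in> carrier R" shows "h [*] s \<in> J"
proof -
 obtain m where m: "H <= Y m" using H_level by (elim exE)
 obtain n where n: "s \<in> Y n" using s by (auto simp: R_carrier)
 define q where "q E D v \<longleftrightarrow> v 0 \<in> E & ((v 0 \<in> Y n & v (Suc 0) \<in> Y m) & v (Suc 0) [*] v 0 \<in> D)"
  for E D and v :: "nat => 'a list"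
 define \<Q> where "\<Q> = {q E D | E D. E \<in> type_base n s & D \<in> Nm H m}"
 note tb = type_base_props[OF n]
 have Yn: "Y n \<in> type_base n s" using n Y_dset by (simp add: type_base_def)
 have Ym: "Y m \<in> Nm H m" using m Y_dset by (simp add: Nm_def)
 have "\<exists>x. (\<forall>i. x i \<in> T) & (\<forall>Q\<in>\<Q>. Q (%i. if i < 1 then x i else h))"
 proof (rule compactness)
  show "h \<in> T" using h R_T by auto
  show "\<Q> \<noteq> {}" using Ym Yn unfolding \<Q>_def by blast
  show "dfn Q" if "Q \<in> \<Q>" for Q
  proof -
   note hyp = that
   obtain E D where Q: "Q = q E D" "E \<in> type_base n s" "D \<in> Nm H m" using hyp unfolding \<Q>_def by blast
   have "dset E" using Q(2) by (simp add: type_base_def)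
   note tt = tmv[OF Y_dset[of n] Y_dset[of m] order_refl order_refl]
   show ?thesis unfolding Q(1) q_def
    by (intro dfn_and[OF dset_mem[OF \<open>dset E\<close>]] tm_in[OF tm_mult[OF tt(2,1)] Nm_dset[OF Q(3)]])
  qed
  show "\<exists>Q3\<in>\<Q>. \<forall>v. (\<forall>i. v i \<in> T) --> Q3 v --> Q1 v & Q2 v" if "Q1 \<in> \<Q>" "Q2 \<in> \<Q>" for Q1 Q2
  proof -
   note hyp = that
   obtain E1 D1 where 1: "Q1 = q E1 D1" "E1 \<in> type_base n s" "D1 \<in> Nm H m" using hyp(1) unfolding \<Q>_def by blast
   obtain E2 D2 where 2: "Q2 = q E2 D2" "E2 \<in> type_base n s" "D2 \<in> Nm H m" using hyp(2) unfolding \<Q>_def by blast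
   have "E1 \<inter> E2 \<in> type_base n s" using 1(2) 2(2) by (auto simp: type_base_def dset_Int)
   then have "q (E1 \<inter> E2) (D1 \<inter> D2) \<in> \<Q>" unfolding \<Q>_def using Nm_Int[OF 1(3) 2(3)] by blast
   moreover have "q (E1 \<inter> E2) (D1 \<inter> D2) v ==> q E1 D1 v & q E2 D2 v" for v
    unfolding q_def by blast
   ultimately show ?thesis unfolding 1(1) 2(1) by blast
  qed
  show "\<exists>x. (\<forall>i. x i \<in> T) & Q (%i. if i < 1 then x i else h)" if "Q \<in> \<Q>" for Q
  proof -
   note hyp = that
   obtain E D where Q: "Q = q E D" "E \<in> type_base n s" "D \<in> Nm H m" using hyp unfolding \<Q>_def by blast
   obtain e where e: "e \<in> T0" "e \<in> E" using dset_meets_T0[of E s] Q(2) by (auto simp: type_base_def)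
   then have eY: "e \<in> Y n" using Q(2) by (auto simp: type_base_def)
   then have "h [*] e \<in> D" using R0_H(2)[OF in_R0 h] e(1) Nm_sub[OF Q(3)] by blast
   then have "Q (%i. if i < 1 then e else h)" unfolding Q(1) q_def using e eY h m by auto
   then show ?thesis using e(1) T0_sub_T by (intro exI[of _ "%_. e"]) auto
  qed
 qed
 then obtain x where x: "\<forall>Q\<in>\<Q>. Q (%i. if i < 1 then x i else h)" by (elim exE conjE)
 have qx: "q E D (%i. if i < 1 then x i else h)" if "E \<in> type_base n s" "D \<in> Nm H m" for E D
  using x that unfolding \<Q>_def by blast
 have "x 0 \<in> \<Inter>(type_base n s)" using qx[OF _ Ym] by (auto simp: q_def)
 then have eq: "tequiv s (x 0)" using tb(2) tequiv_sym by blast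
 have hx: "h [*] x 0 \<in> H"
  by (rule Nm_tdef[OF H_tdef m]) (use qx[OF Yn] in \<open>force simp: q_def\<close>)
 have sx: "s [-] x 0 \<in> H" by (rule CC_diff[OF H_props(1) s eq])
 have c: "h \<in> carrier R" "x 0 \<in> carrier R" using h tequiv_R[OF eq s] by auto
 have "h [*] s = h [*] x 0 [+] h [*] (s [-] x 0)" using c s by (simp add: R.ring_norm)
 then show ?thesis using H_J_add[OF hx RH_J[OF c(1) sx]] by simp
qed

lemma J_absorb_left: "r \<in> carrier R ==> z \<in> J ==> r [*] z \<in> J"
proof -
 assume r: "r \<in> carrier R" and "z \<in> J"
 then obtain a s b where z: "a \<in> H" "s \<in> carrier R" "b \<in> H" "z = a [+] s [*] b" unfolding J_iff by (elim bexE)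
 have "r [*] z = r [*] a [+] (r [*] s) [*] b"
  unfolding z(4) using r z by (simp add: R.rng_r_distr R.rng_m_assoc R.rng_m_closed)
 then show ?thesis using RH_add[OF r z(1) R.rng_m_closed[OF r z(2)] z(3)] by simp
qed

lemma J_absorb_right: "r \<in> carrier R ==> z \<in> J ==> z [*] r \<in> J"
proof -
 assume r: "r \<in> carrier R" and "z \<in> J"
 then obtain a s b where z: "a \<in> H" "s \<in> carrier R" "b \<in> H" "z = a [+] s [*] b" unfolding J_iff by (elim bexE)
 have "z [*] r = a [*] r [+] s [*] (b [*] r)"
  unfolding z(4) using r z by (simp add: R.rng_l_distr R.rng_m_assoc R.rng_m_closed)
 then show ?thesis using J_add[OF HR_J[OF z(1) r] J_absorb_left[OF z(2) HR_J[OF z(3) r]]] by simp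
qed

lemma J_sub: "additive_subgroup J R"
 by (rule R.add_subgroupI) (use J_R J_add J_neg H_J[OF H_zero] in auto)

lemma J_ideal: "two_sided_ideal J R"
 unfolding two_sided_ideal_def using J_sub J_absorb_left J_absorb_right by blast

text \<open>Every \<open>r\<close> differs from an element of \<open>R\<close> by an element of \<open>Xbar\<close>, and \<open>R\<close> absorbs into \<open>H\<close>. This bounds \<open>J\<close>, which
  makes it type-definable.\<close>

lemma J_thin: "z \<in> J \<longleftrightarrow> (\<exists>h\<in>H. \<exists>x\<in>Y 0. \<exists>h'\<in>H. z = h [+] x [*] h')"
proof
 assume "z \<in> J"
 then obtain a r b where z: "a \<in> H" "r \<in> carrier R" "b \<in> H" "z = a [+] r [*] b" unfolding J_iff by (elim bexE)
 obtain n where n: "r \<in> Y n" using z by (auto simp: R_carrier)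
 have "generic (Y 0)" using base_Y0 by (simp add: base_def)
 then obtain f where f: "f \<in> R0" "r [-] f \<in> Y 0" using n unfolding generic_def by blast
 have "z = (a [+] f [*] b) [+] (r [-] f) [*] b"
  unfolding z(4) using z(2) f(1)[THEN R0_R] H_carrier[OF z(1)] H_carrier[OF z(3)] by (simp add: R.ring_norm)
 moreover have "a [+] f [*] b \<in> H" using H_add[OF z(1) R0_H(1)[OF f(1) z(3)]] .
 ultimately show "\<exists>h\<in>H. \<exists>x\<in>Y 0. \<exists>h'\<in>H. z = h [+] x [*] h'" using f(2) z(3) by blast
next
 assume "\<exists>h\<in>H. \<exists>x\<in>Y 0. \<exists>h'\<in>H. z = h [+] x [*] h'"
 then show "z \<in> J" unfolding J_iff using Y_R by blast
qed

lemma J_tdef: "tdef J"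
proof -
 obtain m where m: "H <= Y m" using H_level by (elim exE)
 define SD where "SD D = D <+>\<^bsub>R\<^esub> (Y 0 <#>\<^bsub>R\<^esub> D)" for D
 have SD_iff: "z \<in> SD D \<longleftrightarrow> (\<exists>h\<in>D. \<exists>x\<in>Y 0. \<exists>h'\<in>D. z = h [+] x [*] h')" for z D
  unfolding SD_def set_add_iff Bex_def set_mult_iff by blast
 have Y0m: "Y 0 <= Y m" by (rule Y_mono) simp
 have dSD: "dset (SD D)" if D: "D \<in> Nm H m" for D
 proof -
  have p: "Y 0 <#>\<^bsub>R\<^esub> D <= Y (Suc m)" by (rule prod_Y[OF Y0m Nm_Y[OF D]])
  have D': "D <= Y (Suc m)" using Nm_Y[OF D] Y_mono[of m "Suc m"] by auto
  show ?thesis unfolding SD_def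
   by (rule dset_sum[OF Nm_dset[OF D] dset_prod[OF Y_dset Nm_dset[OF D] Y0m Nm_Y[OF D]] D' p])
 qed
 have Ym: "Y m \<in> Nm H m" using m Y_dset by (simp add: Nm_def)
 have "J = T \<inter> \<Inter>(SD ` Nm H m)"
 proof
  show "J <= T \<inter> \<Inter>(SD ` Nm H m)"
  proof
   fix z assume z: "z \<in> J"
   then obtain h x h' where *: "h \<in> H" "x \<in> Y 0" "h' \<in> H" "z = h [+] x [*] h'" unfolding J_thin by (elim bexE)
   have "z \<in> SD D" if "D \<in> Nm H m" for D unfolding SD_iff using * Nm_sub[OF that] by blast
   then show "z \<in> T \<inter> \<Inter>(SD ` Nm H m)" using J_R[OF z] R_T by blast
  qed
  show "T \<inter> \<Inter>(SD ` Nm H m) <= J"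
  proof (rule ccontr)
   assume "\<not> ?thesis"
   then obtain z where z: "z \<in> T" "!!D. D \<in> Nm H m ==> z \<in> SD D" "z \<notin> J" by blast
   let ?G = "%v. (v 0 \<in> Y m & v 1 \<in> Y m) & v 2 \<in> Y m"
   let ?Q = "%h x h' (w :: nat => 'a list). \<not> (((h \<in> Y m & x \<in> Y m) & h' \<in> Y m) & w 0 = h [+] x [*] h')"
   have "\<exists>D\<in>Nm H m. \<exists>E\<in>{Y 0}. \<exists>F\<in>Nm H m. \<forall>h\<in>D. \<forall>x\<in>E. \<forall>h'\<in>F. ?Q h x h' (%_. z)"
   proof (rule compactness3[OF Nm_fbase(1)[OF H_tdef m] fbase_single[OF Y_dset] Nm_fbase(1)[OF H_tdef m]])
    have "dfn (%v. ?G (%i. v (Suc i)) & v 0 = v (Suc 0) [+] v (Suc 1) [*] v (Suc 2))"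
     using tm_graph[OF tm_add[OF tm_var3(1) tm_mult[OF tm_var3(2,3)]], of m] by simp
    from dfn_subst[OF this, of "%i. if i = 0 then 3 else i - 1"]
    have "dfn (%v. ?G v & v 3 = v 0 [+] v 1 [*] v 2)" by simp
    from dfn_not[OF this]
    show "dfn (%v. ?Q (v 0) (v 1) (v 2) (%i. v (Suc (Suc (Suc i)))))" by (simp add: numeral_3_eq_3)
    show "?Q h x h' (%_. z)" if "h \<in> \<Inter>(Nm H m)" "x \<in> \<Inter>{Y 0}" "h' \<in> \<Inter>(Nm H m)" for h x h'
    proof -
     have "h \<in> H" "x \<in> Y 0" "h' \<in> H" using that Nm_fbase(2)[OF H_tdef m] by auto
     then have "z \<noteq> h [+] x [*] h'" using z(3) unfolding J_thin by blast
     then show ?thesis by simp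
    qed
   qed (rule z(1))
   then obtain D F where DF: "D \<in> Nm H m" "F \<in> Nm H m" "\<forall>h\<in>D. \<forall>x\<in>Y 0. \<forall>h'\<in>F. ?Q h x h' (%_. z)" by auto
   obtain h x h' where "h \<in> D \<inter> F" "x \<in> Y 0" "h' \<in> D \<inter> F" "z = h [+] x [*] h'"
    using z(2)[OF Nm_Int[OF DF(1,2)]] unfolding SD_iff by (elim bexE)
   then show False using DF Nm_Y[OF DF(1)] Nm_Y[OF DF(2)] Y0m by blast
  qed
 qed
 moreover have "\<forall>D\<in>SD ` Nm H m. dset D" using dSD by blast
 ultimately show ?thesis unfolding tdef_def by blast
qed

lemma J_CC: "CC J"
 unfolding CC_def using J_sub J_tdef CC_diff[OF H_props(1)] H_J by blast

lemma CC_iff_bounded: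
 assumes I: "additive_subgroup I R" "tdef I"
 shows "CC I \<longleftrightarrow> bounded_index \<kappa> R I"
proof -
 interpret I: abelian_subgroup I R
  by (rule abelian_subgroupI3[OF I(1) R.abelian_group_axioms])
 have cos: "I +>\<^bsub>R\<^esub> a = I +>\<^bsub>R\<^esub> b" if "a \<in> carrier R" "b \<in> carrier R" "a [-] b \<in> I" for a b
 proof -
  have "a = (a [-] b) [+] b" using that(1,2) by (simp add: R.ring_norm)
  then have "a \<in> I +>\<^bsub>R\<^esub> b" using that(3) by (auto simp: a_r_coset_def')
  then show ?thesis using I.a_repr_independence' that by blast
 qed
 have cosets: "a_rcosets\<^bsub>R\<^esub> I = (%a. I +>\<^bsub>R\<^esub> a) ` carrier R" by (auto simp: A_RCOSETS_def')
 define rep where "rep c = (SOME a. a \<in> carrier R & c = I +>\<^bsub>R\<^esub> a)" for c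
 have rep: "rep c \<in> carrier R" "c = I +>\<^bsub>R\<^esub> rep c" if "c \<in> a_rcosets\<^bsub>R\<^esub> I" for c
 proof -
  have "\<exists>a. a \<in> carrier R & c = I +>\<^bsub>R\<^esub> a" using that unfolding cosets by blast
  from someI_ex[OF this] show "rep c \<in> carrier R" "c = I +>\<^bsub>R\<^esub> rep c" unfolding rep_def by blast+
 qed
 have bi: "bounded_index \<kappa> R I \<longleftrightarrow> small (a_rcosets\<^bsub>R\<^esub> I)" by (simp add: bounded_index_def small_def)
 show ?thesis unfolding bi
 proof
  assume CC: "CC I"
  define f where "f c = {D. dset D & rep c \<in> D}" for c
  have "inj_on f (a_rcosets\<^bsub>R\<^esub> I)"
  proof (rule inj_onI)
   fix c d assume c: "c \<in> a_rcosets\<^bsub>R\<^esub> I" and d: "d \<in> a_rcosets\<^bsub>R\<^esub> I" and eq: "f c = f d"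
   have "tequiv (rep c) (rep d)"
    by (rule tequivI) (use rep(1)[OF c] rep(1)[OF d] R_T eq in \<open>auto simp: f_def set_eq_iff\<close>)
   then have "rep c [-] rep d \<in> I" using CC_diff[OF CC rep(1)[OF c]] by blast
   then show "c = d" using cos[OF rep(1)[OF c] rep(1)[OF d]] rep(2)[OF c] rep(2)[OF d] by simp
  qed
  moreover have "f ` (a_rcosets\<^bsub>R\<^esub> I) <= Pow {D. dset D}" by (auto simp: f_def)
  moreover have "small (Pow {D. dset D})" by (rule small_Pow[OF small_dsets])
  ultimately show "small (a_rcosets\<^bsub>R\<^esub> I)"
   using small_subset[of "Pow {D. dset D}" "f ` (a_rcosets\<^bsub>R\<^esub> I)"] small_image[of "f ` (a_rcosets\<^bsub>R\<^esub> I)" "the_inv_into (a_rcosets\<^bsub>R\<^esub> I) f"]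
   by (simp add: the_inv_into_onto)
 next
  assume s: "small (a_rcosets\<^bsub>R\<^esub> I)"
  show "CC I"
  proof (rule bounded_imp_CC[OF I])
   show "rep ` (a_rcosets\<^bsub>R\<^esub> I) <= carrier R" using rep by blast
   show "small (rep ` (a_rcosets\<^bsub>R\<^esub> I))" by (rule small_image[OF s])
   show "\<exists>b\<in>rep ` (a_rcosets\<^bsub>R\<^esub> I). x [-] b \<in> I" if x: "x \<in> carrier R" for x
   proof -
    let ?c = "I +>\<^bsub>R\<^esub> x"
    have c: "?c \<in> a_rcosets\<^bsub>R\<^esub> I" using x unfolding cosets by blast
    define d where "d = rep ?c"
    have dR: "d \<in> carrier R" and "x \<in> I +>\<^bsub>R\<^esub> d"
     unfolding d_def using rep[OF c] I.a_rcos_self[OF x] by simp_all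
    then obtain i where i: "i \<in> I" "x = i [+] d" by (auto simp: a_r_coset_def')
    have iR: "i \<in> carrier R" using subD(1)[OF I(1)] i(1) by blast
    have "x [-] d = i" unfolding i(2) using dR iR by (simp add: R.ring_norm)
    then have "x [-] rep ?c \<in> I" using i(1) by (simp add: d_def)
    then show ?thesis using c by blast
   qed
  qed
 qed
qed

lemma J_tdef_bounded_ideal: "is_tdef_bounded_ideal L M \<kappa> C k R J"
 unfolding is_tdef_bounded_ideal_def tdef_iff
 using J_ideal J_tdef J_CC CC_iff_bounded[OF J_sub J_tdef] by blast

lemma J_least: assumes "is_tdef_bounded_ideal L M \<kappa> C k R I" shows "J <= I"
proof
 have I: "two_sided_ideal I R" "tdef I" "bounded_index \<kappa> R I"
  using assms unfolding is_tdef_bounded_ideal_def tdef_iff by blast+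
 then have s: "additive_subgroup I R" and ab: "!!a x. a \<in> I ==> x \<in> carrier R ==> x [*] a \<in> I"
  by (auto simp: two_sided_ideal_def)
 then have HI: "H <= I" using H_props(3) CC_iff_bounded[OF s I(2)] I(3) by blast
 fix z assume "z \<in> J"
 then obtain h r h' where "h \<in> H" "r \<in> carrier R" "h' \<in> H" "z = h [+] r [*] h'" unfolding J_iff by (elim bexE)
 then show "z \<in> I" using HI ab subD(3)[OF s] by blast
qed

lemma ideal00_eq: "ideal00 L M \<kappa> C k R = J"
 unfolding ideal00_def using J_tdef_bounded_ideal J_least by blast

lemma J_small: "J <= fourfold (Y 0) <+>\<^bsub>R\<^esub> (Y 0 <#>\<^bsub>R\<^esub> fourfold (Y 0))"
 unfolding subset_iff J_thin set_add_iff Bex_def set_mult_iff using H_props(2) by blast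

end

section \<open>The logic topology on the quotient\<close>

context def_ring begin

definition jl :: nat where "jl = (SOME m. J <= Y m)"

lemma J_jl: "J <= Y jl"
proof -
 have "\<exists>m. J <= Y m" by (rule tdef_level[OF J_tdef subD(1)[OF J_sub]])
 then show ?thesis unfolding jl_def by (rule someI_ex)
qed

text \<open>The definable sets \<open>D \<supseteq> J\<close> inside a fixed level form a base of neighbourhoods of \<open>0\<close> for a ring topology on
  \<open>Rbar\<close> in which \<open>R\<close> is dense and \<open>J\<close> is the closure of \<open>0\<close>. All topological properties of
  the quotient are derived from this.\<close>

abbreviation nb :: "'a list set set" where "nb \<equiv> Nm J jl"

lemma Y_nb: "Y jl \<in> nb"
 using J_jl Y_dset by (simp add: Nm_def)

lemma nb_R: "D \<in> nb ==> d \<in> D ==> d \<in> carrier R"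
 using Nm_Y Y_R by blast

lemma nb_zero: "D \<in> nb ==> \<zero>\<^bsub>R\<^esub> \<in> D"
 using Nm_sub subD(2)[OF J_sub] by blast

lemma nb_minus: "D \<in> nb ==> \<exists>E\<in>nb. E <= D & (\<forall>x\<in>E. \<forall>y\<in>E. x [-] y \<in> D)"
proof -
 assume D: "D \<in> nb"
 obtain E where E: "E \<in> nb" "\<forall>x\<in>E. \<forall>y\<in>E. x [-] y \<in> D"
  using Nm_minus[OF J_sub J_tdef J_jl Nm_dset[OF D] Nm_sub[OF D]] by (elim bexE)
 show ?thesis by (rule bexI[OF _ Nm_Int[OF E(1) D]]) (use E(2) in simp)
qed

lemma nb_plus: "D \<in> nb ==> \<exists>E\<in>nb. E <= D & (\<forall>x\<in>E. \<forall>y\<in>E. x [+] y \<in> D)"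
proof -
 assume D: "D \<in> nb"
 obtain E where E: "E \<in> nb" "E <= D" "\<forall>x\<in>E. \<forall>y\<in>E. x [-] y \<in> D"
  using nb_minus[OF D] by (elim bexE conjE)
 obtain F where F: "F \<in> nb" "F <= E" "\<forall>x\<in>F. \<forall>y\<in>F. x [-] y \<in> E"
  using nb_minus[OF E(1)] by (elim bexE conjE)
 have "x [+] y \<in> D" if xy: "x \<in> F" "y \<in> F" for x y
 proof -
  have c: "x \<in> carrier R" "y \<in> carrier R" using xy nb_R[OF F(1)] by auto
  have "\<zero>\<^bsub>R\<^esub> [-] y \<in> E" "x \<in> E" using F xy nb_zero[OF F(1)] by auto
  then have "x [-] (\<zero>\<^bsub>R\<^esub> [-] y) \<in> D" using E(3) by blast
  moreover have "x [-] (\<zero>\<^bsub>R\<^esub> [-] y) = x [+] y" using c by (simp add: R.ring_norm)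
  ultimately show ?thesis by simp
 qed
 then show ?thesis using F(1,2) E(2) by blast
qed

lemma nb_mult: "D \<in> nb ==> \<exists>E\<in>nb. \<forall>x\<in>E. \<forall>y\<in>E. x [*] y \<in> D"
proof -
 assume D: "D \<in> nb"
 show ?thesis
  by (rule Nm_mult2[OF J_tdef J_jl Nm_dset[OF D]]) (use J_absorb_left[OF J_R] Nm_sub[OF D] in blast)
qed

lemma nb_absorb_left: assumes D: "D \<in> nb" and a: "a \<in> carrier R" shows "\<exists>E\<in>nb. \<forall>x\<in>E. a [*] x \<in> D"
proof -
 obtain n where n: "a \<in> Y n" using a by (auto simp: R_carrier)
 note t = tmv[OF Y_dset[of jl] Y_dset[of n] order_refl order_refl]
 show ?thesis
  by (rule Nm_single[OF J_tdef J_jl Nm_dset[OF D] n tm_mult[OF t(2,1)]])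
   (use J_absorb_left[OF a] Nm_sub[OF D] in blast)
qed

lemma nb_absorb_right: assumes D: "D \<in> nb" and a: "a \<in> carrier R" shows "\<exists>E\<in>nb. \<forall>x\<in>E. x [*] a \<in> D"
proof -
 obtain n where n: "a \<in> Y n" using a by (auto simp: R_carrier)
 note t = tmv[OF Y_dset[of jl] Y_dset[of n] order_refl order_refl]
 show ?thesis
  by (rule Nm_single[OF J_tdef J_jl Nm_dset[OF D] n tm_mult[OF t(1,2)]])
   (use J_absorb_right[OF a] Nm_sub[OF D] in blast)
qed

lemma nb_dense: assumes D: "D \<in> nb" and a: "a \<in> carrier R" shows "\<exists>e\<in>R0. a [-] e \<in> D & e [-] a \<in> D"
proof -
 obtain n where n: "a \<in> Y n" using a by (auto simp: R_carrier)
 obtain E where E: "E \<in> nb" "E <= D" "\<forall>x\<in>E. \<forall>y\<in>E. x [-] y \<in> D"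
  using nb_minus[OF D] by (elim bexE conjE)
 obtain F where "F <= R0" "\<forall>x\<in>Y n. \<exists>f\<in>F. x [-] f \<in> E"
  using CC_generic[OF J_CC Nm_dset[OF E(1)] Nm_sub[OF E(1)], of n] by (elim exE conjE)
 then obtain e where e: "e \<in> R0" "a [-] e \<in> E" using n by blast
 have "\<zero>\<^bsub>R\<^esub> [-] (a [-] e) \<in> D" using E(3) e(2) nb_zero[OF E(1)] by blast
 moreover have "\<zero>\<^bsub>R\<^esub> [-] (a [-] e) = e [-] a" using a e(1)[THEN R0_R] by (simp add: R.ring_norm)
 ultimately show ?thesis using e E(2) by auto
qed

lemma nb_sep: "a \<notin> J ==> \<exists>D\<in>nb. a \<notin> D"
 using Nm_tdef[OF J_tdef J_jl] by blast

lemma nb_add_cont: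
 assumes D: "D \<in> nb" and ab: "a \<in> carrier R" "b \<in> carrier R"
 shows "\<exists>E\<in>nb. \<forall>x\<in>carrier R. \<forall>y\<in>carrier R. x [-] a \<in> E --> y [-] b \<in> E -->
  (x [+] y) [-] (a [+] b) \<in> D"
proof -
 obtain E where E: "E \<in> nb" "\<forall>x\<in>E. \<forall>y\<in>E. x [+] y \<in> D" using nb_plus[OF D] by (elim bexE conjE)
 have "(x [+] y) [-] (a [+] b) = (x [-] a) [+] (y [-] b)"
  if "x \<in> carrier R" "y \<in> carrier R" for x y using that ab by (simp add: R.ring_norm)
 then show ?thesis using E by (intro bexI[OF _ E(1)]) simp
qed

lemma nb_mult_cont:
 assumes D: "D \<in> nb" and ab: "a \<in> carrier R" "b \<in> carrier R"
 shows "\<exists>E\<in>nb. \<forall>x\<in>carrier R. \<forall>y\<in>carrier R. x [-] a \<in> E --> y [-] b \<in> E -->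
  (x [*] y) [-] (a [*] b) \<in> D"
proof -
 obtain D2 where D2: "D2 \<in> nb" "\<forall>x\<in>D2. \<forall>y\<in>D2. x [+] y \<in> D" using nb_plus[OF D] by (elim bexE conjE)
 obtain D3 where D3: "D3 \<in> nb" "\<forall>x\<in>D3. \<forall>y\<in>D3. x [+] y \<in> D2" using nb_plus[OF D2(1)] by (elim bexE conjE)
 obtain E1 where E1: "E1 \<in> nb" "\<forall>x\<in>E1. \<forall>y\<in>E1. x [*] y \<in> D3" using nb_mult[OF D3(1)] by (elim bexE)
 obtain E2 where E2: "E2 \<in> nb" "\<forall>x\<in>E2. a [*] x \<in> D3" using nb_absorb_left[OF D3(1) ab(1)] by (elim bexE)
 obtain E3 where E3: "E3 \<in> nb" "\<forall>x\<in>E3. x [*] b \<in> D2" using nb_absorb_right[OF D2(1) ab(2)] by (elim bexE)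
 let ?E = "(E1 \<inter> E2) \<inter> E3"
 have "(x [*] y) [-] (a [*] b) \<in> D"
  if xy: "x \<in> carrier R" "y \<in> carrier R" "x [-] a \<in> ?E" "y [-] b \<in> ?E" for x y
 proof -
  have "(x [-] a) [*] (y [-] b) \<in> D3" "a [*] (y [-] b) \<in> D3" "(x [-] a) [*] b \<in> D2"
   using E1(2) E2(2) E3(2) xy(3,4) by auto
  then have "((x [-] a) [*] (y [-] b) [+] a [*] (y [-] b)) [+] (x [-] a) [*] b \<in> D"
   using D2(2) D3(2) by blast
  moreover have "((x [-] a) [*] (y [-] b) [+] a [*] (y [-] b)) [+] (x [-] a) [*] b
    = (x [*] y) [-] (a [*] b)" using xy(1,2) ab by (simp add: R.ring_norm)
  ultimately show ?thesis by simp
 qed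
 then show ?thesis using Nm_Int[OF Nm_Int[OF E1(1) E2(1)] E3(1)] by blast
qed

abbreviation q :: "'a list => 'a list set" where "q a \<equiv> J +>\<^bsub>R\<^esub> a"

lemma J_abelian: "abelian_subgroup J R"
 by (rule abelian_subgroupI3[OF J_sub R.abelian_group_axioms])

lemma q_mem: "x \<in> q a \<longleftrightarrow> (\<exists>j\<in>J. x = j [+] a)"
 by (auto simp: a_r_coset_def')

lemma q_eq:
 assumes ab: "a \<in> carrier R" "b \<in> carrier R" shows "q a = q b \<longleftrightarrow> a [-] b \<in> J"
proof
 assume "q a = q b"
 then have "a \<in> q b" using abelian_subgroup.a_rcos_self[OF J_abelian ab(1)] by simp
 then obtain j where j: "j \<in> J" "a = j [+] b" unfolding q_mem by (elim bexE)
 have "a [-] b = j" unfolding j(2) using ab(2) J_R[OF j(1)] by (simp add: R.ring_norm)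
 then show "a [-] b \<in> J" using j(1) by simp
next
 assume d: "a [-] b \<in> J"
 have "a = (a [-] b) [+] b" using ab by (simp add: R.ring_norm)
 then have "a \<in> q b" unfolding q_mem using d by (rule bexI)
 then show "q a = q b" using abelian_subgroup.a_repr_independence'[OF J_abelian _ ab(2)] by simp
qed

abbreviation TR :: "'a list set ring" where "TR \<equiv> R Quot J"

lemma TR_carrier: "carrier TR = q ` carrier R"
 by (auto simp: FactRing_def A_RCOSETS_def')

lemma TR_add: "a \<in> carrier R ==> b \<in> carrier R ==> q a \<oplus>\<^bsub>TR\<^esub> q b = q (a [+] b)"
 by (simp add: FactRing_def abelian_subgroup.a_rcos_sum[OF J_abelian])

lemma TR_mult:
 assumes a: "a \<in> carrier R" and b: "b \<in> carrier R" shows "q a \<otimes>\<^bsub>TR\<^esub> q b = q (a [*] b)"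
proof -
 have "q (x [*] y) = q (a [*] b)" if "x \<in> q a" "y \<in> q b" for x y
 proof -
  note hyp = that
  obtain i j where ij: "i \<in> J" "x = i [+] a" "j \<in> J" "y = j [+] b" using hyp unfolding q_mem by (elim bexE)
  note c = a b J_R[OF ij(1)] J_R[OF ij(3)]
  have "(x [*] y) [-] (a [*] b) = i [*] (j [+] b) [+] a [*] j" unfolding ij(2,4) using c by (simp add: R.ring_norm)
  moreover have "i [*] (j [+] b) [+] a [*] j \<in> J"
   by (rule J_add[OF J_absorb_right[OF R.a_closed[OF J_R[OF ij(3)] b] ij(1)] J_absorb_left[OF a ij(3)]])
  ultimately show ?thesis using c ij by (subst q_eq) (simp_all add: R.rng_m_closed)
 qed
 moreover have "a \<in> q a" "b \<in> q b" using a b abelian_subgroup.a_rcos_self[OF J_abelian] by auto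
 ultimately have "(\<Union>x\<in>q a. \<Union>y\<in>q b. q (x [*] y)) = q (a [*] b)" by blast
 then show ?thesis by (simp add: FactRing_def rcoset_mult_def)
qed

lemma TR_zero: "\<zero>\<^bsub>TR\<^esub> = q \<zero>\<^bsub>R\<^esub>"
proof -
 have "q \<zero>\<^bsub>R\<^esub> = J" using J_R by (force simp: set_eq_iff q_mem)
 then show ?thesis by (simp add: FactRing_def)
qed

lemma rng_TR: "rng TR"
proof (rule rng.intro)
 note TR = TR_carrier TR_add TR_mult TR_zero R.rng_m_closed
 show "abelian_group TR"
 proof (rule abelian_groupI)
  show "x \<oplus>\<^bsub>TR\<^esub> y \<in> carrier TR" if "x \<in> carrier TR" "y \<in> carrier TR" for x y
   using that by (auto simp: TR)
  show "\<zero>\<^bsub>TR\<^esub> \<in> carrier TR" by (simp add: TR)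
  show "x \<oplus>\<^bsub>TR\<^esub> y \<oplus>\<^bsub>TR\<^esub> z = x \<oplus>\<^bsub>TR\<^esub> (y \<oplus>\<^bsub>TR\<^esub> z)" if "x \<in> carrier TR" "y \<in> carrier TR" "z \<in> carrier TR" for x y z
   using that by (auto simp: TR R.a_assoc)
  show "x \<oplus>\<^bsub>TR\<^esub> y = y \<oplus>\<^bsub>TR\<^esub> x" if "x \<in> carrier TR" "y \<in> carrier TR" for x y
   using that by (auto simp: TR R.a_comm)
  show "\<zero>\<^bsub>TR\<^esub> \<oplus>\<^bsub>TR\<^esub> x = x" if "x \<in> carrier TR" for x
   using that by (auto simp: TR)
  show "\<exists>y\<in>carrier TR. y \<oplus>\<^bsub>TR\<^esub> x = \<zero>\<^bsub>TR\<^esub>" if "x \<in> carrier TR" for x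
  proof -
   note hyp = that
   obtain a where a: "a \<in> carrier R" "x = q a" using hyp by (auto simp: TR)
   then show ?thesis by (intro bexI[of _ "q (\<ominus>\<^bsub>R\<^esub> a)"]) (simp_all add: TR R.l_neg)
  qed
 qed
 show "rng_axioms TR"
  by (rule rng_axioms.intro)
   (auto simp: TR R.rng_m_assoc R.rng_l_distr R.rng_r_distr)
qed

lemma TR_neg: "a \<in> carrier R ==> \<ominus>\<^bsub>TR\<^esub> q a = q (\<ominus>\<^bsub>R\<^esub> a)"
proof -
 assume a: "a \<in> carrier R"
 interpret TR: rng TR by (rule rng_TR)
 show ?thesis
  by (rule TR.minus_equality) (use a in \<open>simp_all add: TR_add TR_zero TR_carrier R.l_neg\<close>)
qed

definition opn :: "'a list set set => bool" where
 "opn V \<longleftrightarrow> V <= carrier TR & (\<forall>a\<in>carrier R. q a \<in> V --> (\<exists>D\<in>nb. \<forall>x\<in>carrier R. x [-] a \<in> D --> q x \<in> V))"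

lemma tdef_of_nbhds:
 assumes "P <= T" "!!a. a \<in> T ==> a \<notin> P ==> \<exists>W. dset W & a \<in> W & W \<inter> P = {}"
 shows "tdef P"
proof -
 have "P = T \<inter> \<Inter>{D. dset D & P <= D}"
 proof
  show "P <= T \<inter> \<Inter>{D. dset D & P <= D}" using assms(1) by blast
  show "T \<inter> \<Inter>{D. dset D & P <= D} <= P"
  proof
   fix a assume a: "a \<in> T \<inter> \<Inter>{D. dset D & P <= D}"
   show "a \<in> P"
   proof (rule ccontr)
    assume "a \<notin> P"
    then obtain W where W: "dset W" "a \<in> W" "W \<inter> P = {}" using assms(2)[of a] a by blast
    have "dset (T - W)" "P <= T - W" using W assms(1) dset_compl by auto
    then show False using a W(2) by blast
   qed
  qed
 qed
 then show ?thesis unfolding tdef_def by (intro exI[of _ "{D. dset D & P <= D}"]) blast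
qed

lemma diff_mem:
 assumes "\<forall>x\<in>E. \<forall>y\<in>E. x [-] y \<in> D" "x [-] e \<in> E" "a [-] e \<in> E"
  and "x \<in> carrier R" "a \<in> carrier R" "e \<in> carrier R"
 shows "x [-] a \<in> D"
 using assms(1-3) diff_diff[OF assms(4-6)] by metis

text \<open>A set of cosets whose complement is type-definable over some parameters is the image of a set
  that is invariant over \<open>M\<close>, as elements of the same type over \<open>M\<close> lie in the same coset of \<open>J\<close>. So the complement is type-definable over \<open>M\<close>, and compactness
  provides the neighbourhoods. Conversely, a neighbourhood of \<open>a\<close> contains a definable set
  \<open>e + E\<close> around \<open>a\<close> with \<open>e \<in> R\<close>, by density.\<close>

lemma opn_iff:
 assumes V: "V <= carrier TR"
 shows "(\<forall>m. type_definable L \<kappa> C k ({a \<in> carrier R. q a \<in> carrier TR - V} \<inter> Y m)) \<longleftrightarrow> opn V"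
proof
 assume td: "\<forall>m. type_definable L \<kappa> C k ({a \<in> carrier R. q a \<in> carrier TR - V} \<inter> Y m)"
 show "opn V" unfolding opn_def
 proof (intro conjI V ballI impI)
  fix a assume a: "a \<in> carrier R" "q a \<in> V"
  obtain n where n: "a \<in> Y n" using a by (auto simp: R_carrier)
  define N where "N = Suc (max n jl)"
  define P where "P = {a \<in> carrier R. q a \<in> carrier TR - V} \<inter> Y N"
  have "tdef P"
  proof (rule tdef_of_invariant)
   show "type_definable L \<kappa> C k P" unfolding P_def using td by blast
   fix c c' assume c: "c \<in> P" "tequiv c c'"
   then have cR: "c \<in> carrier R" "q c \<notin> V" "c \<in> Y N" by (auto simp: P_def)
   then have c': "c' \<in> Y N" using tequiv_Y c(2) by blast
   then have "q c = q c'" using q_eq[OF cR(1) Y_R] CC_diff[OF J_CC cR(1) c(2)] by blast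
   then show "c' \<in> P" using cR c' Y_R by (auto simp: P_def TR_carrier)
  qed
  note P = tdef_fbase[OF this]
  have "\<exists>D\<in>nb. \<exists>E\<in>{D. dset D & P <= D}. \<forall>x\<in>D. \<forall>y\<in>E. \<not> ((x \<in> Y jl & a \<in> Y n) & y = a [+] x)"
  proof (rule compactness2[OF Nm_fbase(1)[OF J_tdef J_jl] P(1), of "%_. a"
     "%x y w. \<not> ((x \<in> Y jl & w 0 \<in> Y n) & y = w 0 [+] x)"])
   show "a \<in> T" using R_T[OF a(1)] .
   note t = tmv[OF Y_dset[of jl] Y_dset[of n] order_refl order_refl]
   from dfn_not[OF dfn_subst[OF tm_graph[OF tm_add[OF t(2,1)]], of "%i. if i = 0 then Suc 0 else if i = Suc 0 then 0 else Suc (Suc 0)"]]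
   show "dfn (%v. \<not> ((v 0 \<in> Y jl & v (Suc (Suc 0)) \<in> Y n) & v 1 = v (Suc (Suc 0)) [+] v 0))" by simp
   fix x y assume "x \<in> \<Inter>nb" "y \<in> \<Inter>{D. dset D & P <= D}"
   then have x: "x \<in> J" and y: "y \<in> P" using Nm_fbase(2)[OF J_tdef J_jl] P(2) by auto
   have xR: "x \<in> carrier R" using J_R[OF x] .
   have "(a [+] x) [-] a = x" using a(1) xR by (simp add: R.ring_norm)
   then have "q (a [+] x) = q a" using q_eq[of "a [+] x" a] a(1) xR x by simp
   then show "\<not> ((x \<in> Y jl & a \<in> Y n) & y = a [+] x)" using y a(2) by (auto simp: P_def)
  qed
  then obtain D E where DE: "D \<in> nb" "P <= E" "\<forall>x\<in>D. \<forall>y\<in>E. \<not> ((x \<in> Y jl & a \<in> Y n) & y = a [+] x)" by blast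
  show "\<exists>D\<in>nb. \<forall>x\<in>carrier R. x [-] a \<in> D --> q x \<in> V"
  proof (intro bexI[OF _ DE(1)] ballI impI)
   fix x assume x: "x \<in> carrier R" "x [-] a \<in> D"
   have eq: "x = a [+] (x [-] a)" using a(1) x(1) by (simp add: R.ring_norm)
   have l: "x [-] a \<in> Y jl" using Nm_Y[OF DE(1)] x(2) by blast
   then have "x \<notin> P" using DE n x(2) eq by blast
   moreover have "a [+] (x [-] a) \<in> Y N" unfolding N_def
    by (rule R_add_closed) (use n l Y_mono[of n "max n jl"] Y_mono[of jl "max n jl"] in auto)
   ultimately show "q x \<in> V" using x(1) eq by (auto simp: P_def TR_carrier)
  qed
 qed
next
 assume o: "opn V"
 show "\<forall>m. type_definable L \<kappa> C k ({a \<in> carrier R. q a \<in> carrier TR - V} \<inter> Y m)"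
 proof (intro allI tdef_imp_type_definable tdef_of_nbhds)
  fix m
  show "{a \<in> carrier R. q a \<in> carrier TR - V} \<inter> Y m <= T" using Y_T by blast
  fix a assume a: "a \<in> T" "a \<notin> {a \<in> carrier R. q a \<in> carrier TR - V} \<inter> Y m"
  show "\<exists>W. dset W & a \<in> W & W \<inter> ({a \<in> carrier R. q a \<in> carrier TR - V} \<inter> Y m) = {}"
  proof (cases "a \<in> Y m")
   case False
   then show ?thesis using a(1) dset_compl[OF Y_dset[of m]] by (intro exI[of _ "T - Y m"]) auto
  next
   case True
   then have aR: "a \<in> carrier R" by (rule Y_R)
   then have "q a \<in> V" using a True by (auto simp: TR_carrier)
   then obtain D where D: "D \<in> nb" "\<forall>x\<in>carrier R. x [-] a \<in> D --> q x \<in> V" using o aR unfolding opn_def by blast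
   obtain E where E: "E \<in> nb" "\<forall>x\<in>E. \<forall>y\<in>E. x [-] y \<in> D" using nb_minus[OF D(1)] by (elim bexE conjE)
   obtain e where e: "e \<in> R0" "a [-] e \<in> E" using nb_dense[OF E(1) aR] by (elim bexE conjE)
   have "q x \<in> V" if "x \<in> Y m" "x [-] e \<in> E" for x
    using D(2) diff_mem[OF E(2) that(2) e(2) Y_R[OF that(1)] aR R0_R[OF e(1)]] Y_R[OF that(1)] by blast
   moreover have "dset {x \<in> T. x \<in> Y m & x [-] e \<in> E}" by (rule dset_translate[OF e(1) Nm_dset[OF E(1)]])
   ultimately show ?thesis using True a(1) e(2) by (intro exI[of _ "{x \<in> T. x \<in> Y m & x [-] e \<in> E}"]) auto
  qed
 qed
qed

lemma istopology_opn: "istopology opn"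
 unfolding istopology_def
proof (intro conjI allI impI)
 fix U V assume UV: "opn U" "opn V"
 show "opn (U \<inter> V)" unfolding opn_def
 proof (intro conjI ballI impI)
  show "U \<inter> V <= carrier TR" using UV by (auto simp: opn_def)
  fix a assume a: "a \<in> carrier R" "q a \<in> U \<inter> V"
  obtain D where D: "D \<in> nb" "\<forall>x\<in>carrier R. x [-] a \<in> D --> q x \<in> U" using UV(1) a unfolding opn_def by blast
  obtain E where E: "E \<in> nb" "\<forall>x\<in>carrier R. x [-] a \<in> E --> q x \<in> V" using UV(2) a unfolding opn_def by blast
  show "\<exists>D\<in>nb. \<forall>x\<in>carrier R. x [-] a \<in> D --> q x \<in> U \<inter> V"
   by (rule bexI[OF _ Nm_Int[OF D(1) E(1)]]) (use D(2) E(2) in simp)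
 qed
next
 fix \<K> assume K: "\<forall>V\<in>\<K>. opn V"
 show "opn (\<Union>\<K>)" unfolding opn_def
 proof (intro conjI ballI impI)
  show "\<Union>\<K> <= carrier TR" using K by (auto simp: opn_def)
  fix a assume a: "a \<in> carrier R" "q a \<in> \<Union>\<K>"
  then obtain V where V: "V \<in> \<K>" "q a \<in> V" by blast
  then obtain D where "D \<in> nb" "\<forall>x\<in>carrier R. x [-] a \<in> D --> q x \<in> V" using K a(1) unfolding opn_def by blast
  then show "\<exists>D\<in>nb. \<forall>x\<in>carrier R. x [-] a \<in> D --> q x \<in> \<Union>\<K>" using V(1) by blast
 qed
qed

definition \<tau> :: "'a list set topology" where "\<tau> = topology opn"

lemma logic_topology_eq: "logic_topology L \<kappa> C k (level_bar L M C k A X) R J = \<tau>"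
proof -
 have "(%V. V <= carrier TR & (\<forall>m. type_definable L \<kappa> C k ({a \<in> carrier R. q a \<in> carrier TR - V} \<inter> Y m))) = opn"
 proof (rule ext)
  fix V show "(V <= carrier TR & (\<forall>m. type_definable L \<kappa> C k ({a \<in> carrier R. q a \<in> carrier TR - V} \<inter> Y m))) = opn V"
   using opn_iff[of V] by (cases "V <= carrier TR") (simp_all add: opn_def)
 qed
 then show ?thesis unfolding logic_topology_def \<tau>_def by (rule arg_cong)
qed

lemma openin_\<tau>: "openin \<tau> = opn"
 unfolding \<tau>_def by (rule topology_inverse'[OF istopology_opn])

lemma topspace_\<tau>: "topspace \<tau> = carrier TR"
proof -
 have "opn (carrier TR)" unfolding opn_def TR_carrier using Y_nb by blast
 then show ?thesis unfolding topspace_def openin_\<tau> by (auto simp: opn_def)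
qed

lemma \<tau>_nbhd:
 assumes "openin \<tau> V" "a \<in> carrier R" "q a \<in> V"
 shows "\<exists>D\<in>nb. \<forall>x\<in>carrier R. x [-] a \<in> D --> q x \<in> V"
 using assms unfolding openin_\<tau> opn_def by blast

lemma ball:
 assumes a: "a \<in> carrier R" and D: "D \<in> nb"
 shows "\<exists>V. openin \<tau> V & q a \<in> V & (\<forall>x\<in>carrier R. q x \<in> V --> x [-] a \<in> D)"
proof -
 define B where "B = {c \<in> carrier R. \<exists>E\<in>nb. \<forall>e\<in>E. (c [+] e) [-] a \<in> D}"
 have step: "\<exists>E\<in>nb. \<forall>x\<in>carrier R. x [-] c \<in> E --> x \<in> B" if c: "c \<in> B" for c
 proof -
  obtain E where E: "E \<in> nb" "\<forall>e\<in>E. (c [+] e) [-] a \<in> D" and cR: "c \<in> carrier R" using c unfolding B_def by blast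
  obtain F where F: "F \<in> nb" "\<forall>x\<in>F. \<forall>y\<in>F. x [+] y \<in> E" using nb_plus[OF E(1)] by (elim bexE conjE)
  have "x \<in> B" if x: "x \<in> carrier R" "x [-] c \<in> F" for x
  proof -
   have "(x [+] e) [-] a \<in> D" if e: "e \<in> F" for e
   proof -
    have "(x [-] c) [+] e \<in> E" using F(2) x(2) e by blast
    then have "(c [+] ((x [-] c) [+] e)) [-] a \<in> D" using E(2) by blast
    moreover have "(c [+] ((x [-] c) [+] e)) [-] a = (x [+] e) [-] a"
     using a cR x(1) nb_R[OF F(1) e] by (simp add: R.ring_norm)
    ultimately show ?thesis by simp
   qed
   then show ?thesis unfolding B_def using x(1) F(1) by blast
  qed
  then show ?thesis using F(1) by blast
 qed
 have sat: "x \<in> B" if x: "x \<in> carrier R" and cB: "c \<in> B" and eq: "q x = q c" for x c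
 proof -
  have "x [-] c \<in> J" using q_eq[of x c] x cB eq by (auto simp: B_def)
  moreover obtain E where "E \<in> nb" "\<forall>x\<in>carrier R. x [-] c \<in> E --> x \<in> B" using step[OF cB] by (elim bexE)
  ultimately show ?thesis using Nm_sub x by blast
 qed
 have "opn (q ` B)" unfolding opn_def
 proof (intro conjI ballI impI)
  show "q ` B <= carrier TR" by (auto simp: B_def TR_carrier)
  fix c assume c: "c \<in> carrier R" "q c \<in> q ` B"
  then obtain b where "b \<in> B" "q c = q b" by blast
  then have "c \<in> B" using sat c(1) by blast
  from step[OF this] show "\<exists>D\<in>nb. \<forall>x\<in>carrier R. x [-] c \<in> D --> q x \<in> q ` B" by blast
 qed
 moreover have "a \<in> B"
 proof -
  have "(a [+] e) [-] a \<in> D" if "e \<in> D" for e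
  proof -
   have "(a [+] e) [-] a = e" using a nb_R[OF D that] by (simp add: R.ring_norm)
   then show ?thesis using that by simp
  qed
  then show ?thesis unfolding B_def using a D by blast
 qed
 moreover have "x [-] a \<in> D" if x: "x \<in> carrier R" "q x \<in> q ` B" for x
 proof -
  obtain b where "b \<in> B" "q x = q b" using x(2) by blast
  then have "x \<in> B" using sat x(1) by blast
  then obtain E where E: "E \<in> nb" "\<forall>e\<in>E. (x [+] e) [-] a \<in> D" unfolding B_def by blast
  then have "(x [+] \<zero>\<^bsub>R\<^esub>) [-] a \<in> D" using nb_zero[OF E(1)] by blast
  then show ?thesis using x(1) by simp
 qed
 ultimately show ?thesis unfolding openin_\<tau> by blast
qed

text \<open>The definable set \<open>W\<close> is a translate of a neighbourhood of \<open>J\<close> by an element of \<open>R\<close> close to \<open>a\<close>.\<close>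

lemma sandwich:
 assumes U: "openin \<tau> U" and a: "a \<in> carrier R" "q a \<in> U"
 shows "\<exists>V W. openin \<tau> V & q a \<in> V & dset W & W <= carrier R \<and>
  (\<forall>x\<in>carrier R. q x \<in> V --> x \<in> W) & q ` W <= U"
proof -
 obtain D where D: "D \<in> nb" "\<forall>x\<in>carrier R. x [-] a \<in> D --> q x \<in> U" using \<tau>_nbhd[OF U a] by (elim bexE)
 obtain E where E: "E \<in> nb" "\<forall>x\<in>E. \<forall>y\<in>E. x [-] y \<in> D" using nb_minus[OF D(1)] by (elim bexE conjE)
 obtain F where F: "F \<in> nb" "F <= E" "\<forall>x\<in>F. \<forall>y\<in>F. x [+] y \<in> E" using nb_plus[OF E(1)] by (elim bexE conjE)
 obtain e where e: "e \<in> R0" "a [-] e \<in> F" using nb_dense[OF F(1) a(1)] by (elim bexE conjE)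
 obtain V where V: "openin \<tau> V" "q a \<in> V" "\<forall>x\<in>carrier R. q x \<in> V --> x [-] a \<in> F" using ball[OF a(1) F(1)] by (elim exE conjE)
 have eR: "e \<in> carrier R" using e(1) by simp
 obtain n where n: "e \<in> Y n" using eR by (auto simp: R_carrier)
 define N where "N = Suc (max n jl)"
 define W where "W = {x \<in> T. x \<in> Y N & x [-] e \<in> E}"
 have "x \<in> W" if x: "x \<in> carrier R" "q x \<in> V" for x
 proof -
  have "(x [-] a) [+] (a [-] e) \<in> E" using F(3) V(3) x e(2) by blast
  moreover have "(x [-] a) [+] (a [-] e) = x [-] e" using x(1) a(1) eR by (simp add: R.ring_norm)
  ultimately have xe: "x [-] e \<in> E" by simp
  then have "x [-] e \<in> Y jl" using Nm_Y[OF E(1)] by blast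
  then have "e [+] (x [-] e) \<in> Y N" unfolding N_def
   by (intro R_add_closed) (use n Y_mono[of n "max n jl"] Y_mono[of jl "max n jl"] in auto)
  moreover have "e [+] (x [-] e) = x" using x(1) eR by (simp add: R.ring_norm)
  ultimately show ?thesis using xe R_T[OF x(1)] by (simp add: W_def)
 qed
 moreover have "q x \<in> U" if "x \<in> W" for x
 proof -
  have x: "x \<in> carrier R" "x [-] e \<in> E" using that Y_R by (auto simp: W_def)
  then show ?thesis using D(2) diff_mem[OF E(2) x(2) _ x(1) a(1) eR] e(2) F(2) by blast
 qed
 moreover have "dset W" unfolding W_def by (rule dset_translate[OF e(1) Nm_dset[OF E(1)]])
 moreover have "W <= carrier R" using Y_R by (auto simp: W_def)
 ultimately show ?thesis using V(1,2) by (intro exI[of _ V] exI[of _ W]) auto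
qed

lemma dset_compact:
 assumes W: "!!W. W \<in> \<W> ==> dset W" and D: "dset D" "D <= \<Union>\<W>"
 shows "\<exists>\<F>. finite \<F> & \<F> <= \<W> & D <= \<Union>\<F>"
proof -
 define \<S> where "\<S> = {T - \<Union>\<F> | \<F>. finite \<F> & \<F> <= \<W>}"
 obtain d where d: "d \<in> T" using T0_nonempty T0_sub_T by blast
 have fb: "fbase \<S>" unfolding fbase_def
 proof (intro conjI ballI)
  have "T - \<Union>{} \<in> \<S>" unfolding \<S>_def by blast
  then show "\<S> \<noteq> {}" by blast
  show "dset E" if "E \<in> \<S>" for E using that W by (auto simp: \<S>_def intro!: dset_compl dset_Union)
  fix E F assume "E \<in> \<S>" "F \<in> \<S>"
  then obtain \<F> \<F>' where *: "E = T - \<Union>\<F>" "finite \<F>" "\<F> <= \<W>" "F = T - \<Union>\<F>'" "finite \<F>'" "\<F>' <= \<W>"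
   unfolding \<S>_def by blast
  then have "T - \<Union>(\<F> \<union> \<F>') \<in> \<S>" unfolding \<S>_def using finite_UnI by blast
  then show "\<exists>G\<in>\<S>. G <= E \<inter> F" by (rule bexI[rotated]) (use * in auto)
 qed
 have "\<exists>E\<in>\<S>. \<forall>x\<in>E. x \<notin> D"
 proof (rule compactness1[OF fb, of "%_. d" "%x w. x \<notin> D"])
  show "dfn (%v. v 0 \<notin> D)" by (rule dfn_not[OF dset_mem[OF D(1)]])
  fix x assume x: "x \<in> \<Inter>\<S>"
  have "x \<notin> W" if "W \<in> \<W>" for W
  proof -
   have "T - \<Union>{W} \<in> \<S>" unfolding \<S>_def using that by blast
   then show ?thesis using x by blast
  qed
  then show "x \<notin> D" using D(2) by blast
 qed (rule d)
 then obtain E where "E \<in> \<S>" "\<forall>x\<in>E. x \<notin> D" by (elim bexE)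
 then obtain \<F> where "finite \<F>" "\<F> <= \<W>" "\<forall>x\<in>T - \<Union>\<F>. x \<notin> D" unfolding \<S>_def by blast
 then show ?thesis using dset_sub[OF D(1)] by (intro exI[of _ \<F>]) blast
qed

lemma compact_level: "compactin \<tau> (q ` Y m)"
 unfolding compactin_def
proof (intro conjI allI impI)
 show "q ` Y m <= topspace \<tau>" using Y_R by (auto simp: topspace_\<tau> TR_carrier)
 fix \<U> assume "(\<forall>U\<in>\<U>. openin \<tau> U) & q ` Y m <= \<Union>\<U>"
 then have U: "!!U. U \<in> \<U> ==> openin \<tau> U" "q ` Y m <= \<Union>\<U>" by auto
 define \<W> where "\<W> = {W. dset W & (\<exists>U\<in>\<U>. q ` W <= U)}"
 have cov: "Y m <= \<Union>\<W>"
 proof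
  fix a assume a: "a \<in> Y m"
  then obtain U' where U': "U' \<in> \<U>" "q a \<in> U'" using U(2) by blast
  obtain V W where VW: "q a \<in> V" "dset W" "\<forall>x\<in>carrier R. q x \<in> V --> x \<in> W" "q ` W <= U'"
   using sandwich[OF U(1)[OF U'(1)] Y_R[OF a] U'(2)] by (elim exE conjE)
  then show "a \<in> \<Union>\<W>" unfolding \<W>_def using U'(1) Y_R[OF a] by blast
 qed
 have "\<exists>\<F>. finite \<F> & \<F> <= \<W> & Y m <= \<Union>\<F>"
  by (rule dset_compact[OF _ Y_dset cov]) (simp add: \<W>_def)
 then obtain \<F> where F: "finite \<F>" "\<F> <= \<W>" "Y m <= \<Union>\<F>" by (elim exE conjE)
 have "\<forall>W\<in>\<F>. \<exists>U. U \<in> \<U> & q ` W <= U" using F(2) unfolding \<W>_def by blast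
 from bchoice[OF this] obtain c where c: "\<forall>W\<in>\<F>. c W \<in> \<U> & q ` W <= c W"
   by (elim exE)
 have "q ` Y m <= \<Union>(c ` \<F>)" using F(3) c by blast
 then show "\<exists>\<F>. finite \<F> & \<F> <= \<U> & q ` Y m <= \<Union>\<F>" using F(1) c by (intro exI[of _ "c ` \<F>"]) auto
qed

lemma Hausdorff_\<tau>: "Hausdorff_space \<tau>"
 unfolding Hausdorff_space_def topspace_\<tau> TR_carrier
proof (intro allI impI)
 fix x y assume "x \<in> q ` carrier R & y \<in> q ` carrier R & x \<noteq> y"
 then obtain a b where ab: "a \<in> carrier R" "b \<in> carrier R" "x = q a" "y = q b" "q a \<noteq> q b" by blast
 then have "b [-] a \<notin> J" using q_eq by metis
 then obtain D where D: "D \<in> nb" "b [-] a \<notin> D" using nb_sep by blast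
 obtain E where E: "E \<in> nb" "\<forall>x\<in>E. \<forall>y\<in>E. x [-] y \<in> D" using nb_minus[OF D(1)] by (elim bexE conjE)
 obtain V where V: "openin \<tau> V" "q a \<in> V" "\<forall>x\<in>carrier R. q x \<in> V --> x [-] a \<in> E" using ball[OF ab(1) E(1)] by (elim exE conjE)
 obtain W where W: "openin \<tau> W" "q b \<in> W" "\<forall>x\<in>carrier R. q x \<in> W --> x [-] b \<in> E" using ball[OF ab(2) E(1)] by (elim exE conjE)
 have "disjnt V W" unfolding disjnt_iff
 proof (intro allI notI)
  fix z assume z: "z \<in> V & z \<in> W"
  then have "z \<in> carrier TR" using V(1) by (auto simp: openin_\<tau> opn_def)
  then obtain c where c: "c \<in> carrier R" "z = q c" by (auto simp: TR_carrier)
  then have "(c [-] a) [-] (c [-] b) \<in> D" using E(2) V(3) W(3) z by blast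
  moreover have "(c [-] a) [-] (c [-] b) = b [-] a" using c(1) ab by (simp add: R.ring_norm)
  ultimately show False using D(2) by simp
 qed
 then show "\<exists>U V. openin \<tau> U & openin \<tau> V & x \<in> U & y \<in> V & disjnt U V"
  using V(1,2) W(1,2) unfolding ab(3,4) by (intro exI[of _ V] exI[of _ W] conjI) auto
qed

lemma locally_compact_\<tau>: "locally_compact_space \<tau>"
 unfolding locally_compact_space_def topspace_\<tau> TR_carrier
proof (intro ballI)
 fix x assume "x \<in> q ` carrier R"
 then obtain a where a: "a \<in> carrier R" "x = q a" by blast
 obtain n where n: "a \<in> Y n" using a by (auto simp: R_carrier)
 define N where "N = Suc (max n jl)"
 obtain V where V: "openin \<tau> V" "q a \<in> V" "\<forall>x\<in>carrier R. q x \<in> V --> x [-] a \<in> Y jl" using ball[OF a(1) Y_nb] by (elim exE conjE)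
 have "V <= q ` Y N"
 proof
  fix z assume z: "z \<in> V"
  then have "z \<in> carrier TR" using V(1) by (auto simp: openin_\<tau> opn_def)
  then obtain c where c: "c \<in> carrier R" "z = q c" by (auto simp: TR_carrier)
  have "a [+] (c [-] a) \<in> Y N" unfolding N_def
   by (rule R_add_closed) (use n c z V(3) Y_mono[of n "max n jl"] Y_mono[of jl "max n jl"] in auto)
  moreover have "a [+] (c [-] a) = c" using a(1) c(1) by (simp add: R.ring_norm)
  ultimately show "z \<in> q ` Y N" using c(2) by simp
 qed
 then show "\<exists>U K. openin \<tau> U & compactin \<tau> K & x \<in> U & U <= K"
  using V(1,2) compact_level[of N] unfolding a(2) by (intro exI[of _ V] exI[of _ "q ` Y N"] conjI) auto
qed

lemma continuous_\<tau>_op: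
 assumes cl: "!!x y. x \<in> carrier R ==> y \<in> carrier R ==> F x y \<in> carrier R"
  and cont: "!!D a b. D \<in> nb ==> a \<in> carrier R ==> b \<in> carrier R ==>
   \<exists>E\<in>nb. \<forall>x\<in>carrier R. \<forall>y\<in>carrier R. x [-] a \<in> E --> y [-] b \<in> E --> F x y [-] F a b \<in> D"
  and G: "!!x y. x \<in> carrier R ==> y \<in> carrier R ==> G (q x, q y) = q (F x y)"
 shows "continuous_map (prod_topology \<tau> \<tau>) \<tau> G"
 unfolding continuous_map_def
proof (intro conjI allI impI)
 show "G \<in> topspace (prod_topology \<tau> \<tau>) \<rightarrow> topspace \<tau>"
  using cl by (auto simp: topspace_\<tau> TR_carrier G)
 fix U assume U: "openin \<tau> U"
 show "openin (prod_topology \<tau> \<tau>) {x \<in> topspace (prod_topology \<tau> \<tau>). G x \<in> U}"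
  unfolding openin_prod_topology_alt
 proof (intro allI impI)
  fix x y assume xy: "(x, y) \<in> {x \<in> topspace (prod_topology \<tau> \<tau>). G x \<in> U}"
  then obtain a b where ab: "a \<in> carrier R" "x = q a" "b \<in> carrier R" "y = q b" by (auto simp: topspace_\<tau> TR_carrier)
  then have qF: "q (F a b) \<in> U" using xy G by simp
  obtain D where D: "D \<in> nb" "\<forall>x\<in>carrier R. x [-] F a b \<in> D --> q x \<in> U"
   using \<tau>_nbhd[OF U cl[OF ab(1,3)] qF] by (elim bexE)
  obtain E where E: "E \<in> nb" "\<forall>x\<in>carrier R. \<forall>y\<in>carrier R. x [-] a \<in> E --> y [-] b \<in> E --> F x y [-] F a b \<in> D"
   using cont[OF D(1) ab(1,3)] by (elim bexE)
  obtain V where V: "openin \<tau> V" "q a \<in> V" "\<forall>x\<in>carrier R. q x \<in> V --> x [-] a \<in> E" using ball[OF ab(1) E(1)] by (elim exE conjE)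
  obtain W where W: "openin \<tau> W" "q b \<in> W" "\<forall>x\<in>carrier R. q x \<in> W --> x [-] b \<in> E" using ball[OF ab(3) E(1)] by (elim exE conjE)
  have "V \<times> W <= {x \<in> topspace (prod_topology \<tau> \<tau>). G x \<in> U}"
  proof
   fix z assume "z \<in> V \<times> W"
   then obtain v w where z: "z = (v, w)" "v \<in> V" "w \<in> W" by blast
   then have vw: "v \<in> carrier TR" "w \<in> carrier TR" using V(1) W(1) by (auto simp: openin_\<tau> opn_def)
   then obtain c d where cd: "c \<in> carrier R" "v = q c" "d \<in> carrier R" "w = q d" by (auto simp: TR_carrier)
   have "F c d [-] F a b \<in> D" using E(2) V(3) W(3) z cd by blast
   then have "q (F c d) \<in> U" using D(2) cl[OF cd(1,3)] by blast
   then show "z \<in> {x \<in> topspace (prod_topology \<tau> \<tau>). G x \<in> U}" using vw z cd G by (simp add: topspace_\<tau>)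
  qed
  then show "\<exists>V W. openin \<tau> V & openin \<tau> W & x \<in> V & y \<in> W & V \<times> W <= {x \<in> topspace (prod_topology \<tau> \<tau>). G x \<in> U}"
   using V(1,2) W(1,2) unfolding ab(2,4) by (intro exI[of _ V] exI[of _ W] conjI)
 qed
qed

lemma continuous_\<tau>_neg: "continuous_map \<tau> \<tau> (%x. \<ominus>\<^bsub>TR\<^esub> x)"
 unfolding continuous_map_def
proof (intro conjI allI impI)
 show "(%x. \<ominus>\<^bsub>TR\<^esub> x) \<in> topspace \<tau> \<rightarrow> topspace \<tau>" by (auto simp: topspace_\<tau> TR_carrier TR_neg)
 fix U assume U: "openin \<tau> U"
 show "openin \<tau> {x \<in> topspace \<tau>. \<ominus>\<^bsub>TR\<^esub> x \<in> U}" unfolding openin_\<tau> opn_def topspace_\<tau>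
 proof (intro conjI ballI impI)
  fix a assume a: "a \<in> carrier R" "q a \<in> {x \<in> carrier TR. \<ominus>\<^bsub>TR\<^esub> x \<in> U}"
  then have "q (\<ominus>\<^bsub>R\<^esub> a) \<in> U" by (simp add: TR_neg)
  then obtain D where D: "D \<in> nb" "\<forall>x\<in>carrier R. x [-] (\<ominus>\<^bsub>R\<^esub> a) \<in> D --> q x \<in> U"
   using \<tau>_nbhd[OF U R.a_inv_closed[OF a(1)]] by blast
  obtain E where E: "E \<in> nb" "\<forall>x\<in>E. \<forall>y\<in>E. x [-] y \<in> D" using nb_minus[OF D(1)] by (elim bexE conjE)
  have "q x \<in> {x \<in> carrier TR. \<ominus>\<^bsub>TR\<^esub> x \<in> U}" if x: "x \<in> carrier R" "x [-] a \<in> E" for x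
  proof -
   have "\<zero>\<^bsub>R\<^esub> [-] (x [-] a) \<in> D" using E(2) x(2) nb_zero[OF E(1)] by blast
   moreover have "\<zero>\<^bsub>R\<^esub> [-] (x [-] a) = \<ominus>\<^bsub>R\<^esub> x [-] (\<ominus>\<^bsub>R\<^esub> a)" using x(1) a(1) by (simp add: R.ring_norm)
   ultimately have "q (\<ominus>\<^bsub>R\<^esub> x) \<in> U" using D(2) x(1) by simp
   then show ?thesis using x(1) by (simp add: TR_neg TR_carrier)
  qed
  then show "\<exists>D\<in>nb. \<forall>x\<in>carrier R. x [-] a \<in> D --> q x \<in> {x \<in> carrier TR. \<ominus>\<^bsub>TR\<^esub> x \<in> U}" using E(1) by blast
 qed simp
qed

lemma locally_compact_TR: "locally_compact_ring TR \<tau>"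
 unfolding locally_compact_ring_def
proof (intro conjI rng_TR topspace_\<tau> continuous_\<tau>_neg Hausdorff_\<tau> locally_compact_\<tau>)
 show "continuous_map (prod_topology \<tau> \<tau>) \<tau> (%(x, y). x \<oplus>\<^bsub>TR\<^esub> y)"
  by (rule continuous_\<tau>_op[OF _ nb_add_cont]) (simp_all add: TR_add)
 show "continuous_map (prod_topology \<tau> \<tau>) \<tau> (%(x, y). x \<otimes>\<^bsub>TR\<^esub> y)"
  by (rule continuous_\<tau>_op[OF _ nb_mult_cont]) (simp_all add: TR_mult R.rng_m_closed)
qed

lemma q_model: "definable_lc_model L M k A X TR \<tau> q"
 unfolding definable_lc_model_def Let_def R0_def[symmetric]
proof (intro conjI locally_compact_TR)
 show "q \<in> rng_hom (A\<lparr>carrier := R0\<rparr>) TR"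
  by (auto simp: rng_hom_def TR_carrier TR_add TR_mult R_add_R0 R_mult_R0)
 have XY: "X <= Y 0" using lev_Y[of 0] by simp
 have c: "\<tau> closure_of (q ` X) <= q ` Y 0"
  by (rule closure_of_minimal[OF image_mono[OF XY] compactin_imp_closedin[OF Hausdorff_\<tau> compact_level]])
 show "compactin \<tau> (\<tau> closure_of (q ` X))"
  by (rule closed_compactin[OF compact_level c closedin_closure_of])
 obtain V where V: "openin \<tau> V" "q \<zero>\<^bsub>R\<^esub> \<in> V" "\<forall>x\<in>carrier R. q x \<in> V --> x [-] \<zero>\<^bsub>R\<^esub> \<in> Y jl"
  using ball[OF R.zero_closed Y_nb] by (elim exE conjE)
 have "{a \<in> R0. q a \<in> V} <= lev jl"
 proof
  fix a assume a: "a \<in> {a \<in> R0. q a \<in> V}"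
  then have "a [-] \<zero>\<^bsub>R\<^esub> \<in> Y jl" using V(3) by simp
  moreover have "a [-] \<zero>\<^bsub>R\<^esub> = a" using a R0_R[of a] by (simp add: R.ring_norm)
  ultimately show "a \<in> lev jl" using a Y_T0[of jl] R0_T0 by auto
 qed
 moreover have "V <= carrier TR" using V(1) by (simp add: openin_\<tau> opn_def)
 ultimately show "\<exists>U V m. openin \<tau> V & \<zero>\<^bsub>TR\<^esub> \<in> V & V <= U & U <= carrier TR & {a \<in> R0. q a \<in> U} <= lev m"
  using V(1,2) by (intro exI[of _ V] exI[of _ jl] conjI) (simp_all add: TR_zero)
 show "\<forall>U K. openin \<tau> U & compactin \<tau> K & K <= U -->
   (\<exists>Ya\<subseteq>R0. definable_over L M k (universe M) Ya & {a \<in> R0. q a \<in> K} <= Ya & Ya <= {a \<in> R0. q a \<in> U})"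
 proof (intro allI impI)
  fix U K assume UK: "openin \<tau> U & compactin \<tau> K & K <= U"
  define \<V> where "\<V> = {V. openin \<tau> V & (\<exists>W. dset W & W <= carrier R & (\<forall>x\<in>carrier R. q x \<in> V --> x \<in> W) & q ` W <= U)}"
  have KT: "K <= carrier TR" using UK compactin_subset_topspace topspace_\<tau> by blast
  have "K <= \<Union>\<V>"
  proof
   fix z assume z: "z \<in> K"
   then obtain a where a: "a \<in> carrier R" "z = q a" using KT by (auto simp: TR_carrier)
   have "q a \<in> U" using UK z a by blast
   then obtain V W where "openin \<tau> V" "q a \<in> V" "dset W" "W <= carrier R" "\<forall>x\<in>carrier R. q x \<in> V --> x \<in> W" "q ` W <= U"
    using sandwich[of U a] UK a(1) by (elim exE conjE) blast
   then show "z \<in> \<Union>\<V>" unfolding \<V>_def a(2) by blast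
  qed
  moreover have "\<forall>V\<in>\<V>. openin \<tau> V" by (simp add: \<V>_def)
  ultimately obtain \<F> where F: "finite \<F>" "\<F> <= \<V>" "K <= \<Union>\<F>"
   using UK unfolding compactin_def by meson
  have "\<forall>V\<in>\<F>. \<exists>W. dset W & W <= carrier R & (\<forall>x\<in>carrier R. q x \<in> V --> x \<in> W) & q ` W <= U"
   using F(2) unfolding \<V>_def by blast
  from bchoice[OF this] obtain c where c: "\<forall>V\<in>\<F>. dset (c V) & c V <= carrier R & (\<forall>x\<in>carrier R. q x \<in> V --> x \<in> c V) & q ` c V <= U"
   by (elim exE)
  define W where "W = \<Union>(c ` \<F>)"
  have "dset W" unfolding W_def by (rule dset_Union) (use F(1) c in auto)
  moreover have "W <= carrier R" "q ` W <= U" unfolding W_def using c by auto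
  moreover have "{a \<in> R0. q a \<in> K} <= W"
  proof
   fix a assume a: "a \<in> {a \<in> R0. q a \<in> K}"
   then obtain V where V: "V \<in> \<F>" "q a \<in> V" using F(3) by blast
   have "\<forall>x\<in>carrier R. q x \<in> V --> x \<in> c V" using bspec[OF c V(1)] by (elim conjE)
   moreover have "a \<in> carrier R" using a by simp
   ultimately show "a \<in> W" unfolding W_def using V by blast
  qed
  ultimately show "\<exists>Ya\<subseteq>R0. definable_over L M k (universe M) Ya & {a \<in> R0. q a \<in> K} <= Ya & Ya <= {a \<in> R0. q a \<in> U}"
   using definable_dset[of W] R0_T0 by (intro exI[of _ "W \<inter> T0"]) auto
 qed
qed

text \<open>\<open>D\<close> is definable over \<open>M\<close> and its points in \<open>M\<close> lie in \<open>D'\<close>. Sums and products preserve this by elementarity, as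
  the summands and factors of a point in \<open>M\<close> can be found in \<open>M\<close>.\<close>

definition interprets :: "'a list set => 'a list set => bool" where
 "interprets D D' \<longleftrightarrow> dset D & (\<exists>n. D <= Y n) & D \<inter> T0 <= D'"

lemma interprets_op:
 assumes D: "interprets D D'" and E: "interprets E E'"
  and cl: "!!n x y. x \<in> Y n ==> y \<in> Y n ==> F x y \<in> Y (Suc n)"
  and tm: "!!G s t. tm G s ==> tm G t ==> tm G (%v. F (s v) (t v))"
  and F': "!!x y. x \<in> R0 ==> y \<in> R0 ==> F x y = F' x y"
  and B: "!!z. z \<in> B \<longleftrightarrow> (\<exists>x\<in>D. \<exists>y\<in>E. z = F x y)"
  and B': "!!z. z \<in> B' \<longleftrightarrow> (\<exists>x\<in>D'. \<exists>y\<in>E'. z = F' x y)"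
 shows "interprets B B'"
proof -
 obtain n m where nm: "D <= Y n" "E <= Y m" and d: "dset D" "dset E" and sub: "D \<inter> T0 <= D'" "E \<inter> T0 <= E'"
  using D E unfolding interprets_def by blast
 define N where "N = max n m"
 have N: "D <= Y N" "E <= Y N" using nm Y_mono[of n N] Y_mono[of m N] by (auto simp: N_def)
 note t = tm[OF tmv[OF d N]]
 have "B = {F x y | x y. x \<in> D & y \<in> E}" unfolding set_eq_iff B by blast
 then have "dset B" using dset_image2[OF d, of F] t by simp
 moreover have "B <= Y (Suc N)"
 proof
  fix z assume "z \<in> B"
  then obtain x y where "x \<in> D" "y \<in> E" "z = F x y" unfolding B by (elim bexE)
  then show "z \<in> Y (Suc N)" using cl[of x N y] N by blast
 qed
 moreover have "B \<inter> T0 <= B'"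
 proof
  fix z assume z: "z \<in> B \<inter> T0"
  then obtain x y where xy: "x \<in> D" "y \<in> E" "z = F x y" unfolding Int_iff B by (elim bexE conjE)
  let ?v = "%i :: nat. if i = 0 then z else if i = Suc 0 then x else y"
  have vT: "?v i \<in> T" for i using z xy T0_sub_T dset_sub[OF d(1)] dset_sub[OF d(2)] by auto
  have Pv: "(?v (Suc 0) \<in> D & ?v (Suc (Suc 0)) \<in> E) & ?v 0 = F (?v (Suc 0)) (?v (Suc (Suc 0)))" using xy by simp
  obtain w where w: "\<forall>i. w i \<in> T0" "(w (Suc 0) \<in> D & w (Suc (Suc 0)) \<in> E) & w 0 = F (w (Suc 0)) (w (Suc (Suc 0)))"
   "\<forall>i. ?v i \<in> T0 --> w i = ?v i"
   using tarski_vaught[OF tm_graph[OF t], of ?v, OF vT Pv] by (elim exE conjE) (rule that, assumption, intro conjI, assumption+)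
  have "w 0 = z" using w(3)[rule_format, of 0] z by simp
  moreover have "w (Suc 0) \<in> R0" "w (Suc (Suc 0)) \<in> R0" using w(1,2) N in_R0 by blast+
  ultimately have "z = F' (w (Suc 0)) (w (Suc (Suc 0)))" using w(2) F' by simp
  then show "z \<in> B'" unfolding B' using w(1,2) sub by blast
 qed
 ultimately show ?thesis unfolding interprets_def by blast
qed

lemma interprets_add:
 assumes "interprets D D'" "interprets E E'"
 shows "interprets (D <+>\<^bsub>R\<^esub> E) (D' <+>\<^bsub>A\<^esub> E')"
 by (rule interprets_op[where F = "%x y. x [+] y" and F' = "%x y. x [+A] y", OF assms])
  (assumption | rule R_add_closed tm_add R_add_R0 set_add_iff)+

lemma interprets_mult:
 assumes "interprets D D'" "interprets E E'"
 shows "interprets (D <#>\<^bsub>R\<^esub> E) (D' <#>\<^bsub>A\<^esub> E')"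
 by (rule interprets_op[where F = "%x y. x [*] y" and F' = "%x y. x [*A] y", OF assms])
  (assumption | rule R_mult_closed tm_mult R_mult_R0 set_mult_iff)+

abbreviation PR :: "'a list set" where "PR \<equiv> four_plus_mult_four R (Y 0)"

lemma PR_interprets: "interprets PR (four_plus_mult_four A X)"
proof -
 have "interprets (Y 0) X" unfolding interprets_def using Y_dset Y_T0[of 0] by auto
 then show ?thesis unfolding four_plus_mult_four_def four_def by (intro interprets_add interprets_mult)
qed

lemma J_PR: "J <= PR"
proof
 fix z assume "z \<in> J"
 then have "z \<in> fourfold (Y 0) <+>\<^bsub>R\<^esub> (Y 0 <#>\<^bsub>R\<^esub> fourfold (Y 0))" using J_small by blast
 moreover have "fourfold (Y 0) = four R (Y 0)"
 proof -
  have "a [+] b [+] (c [+] d) = a [+] b [+] c [+] d" if "a \<in> Y 0" "b \<in> Y 0" "c \<in> Y 0" "d \<in> Y 0" for a b c d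
   using that[THEN Y_R] by (simp add: R.a_assoc)
  then have eq: "(\<exists>a\<in>Y 0. \<exists>b\<in>Y 0. \<exists>c\<in>Y 0. \<exists>d\<in>Y 0. z = a [+] b [+] (c [+] d)) \<longleftrightarrow>
    (\<exists>a\<in>Y 0. \<exists>b\<in>Y 0. \<exists>c\<in>Y 0. \<exists>d\<in>Y 0. z = a [+] b [+] c [+] d)" for z by (intro bex_cong refl) simp_all
  have four: "z \<in> four R (Y 0) \<longleftrightarrow> (\<exists>a\<in>Y 0. \<exists>b\<in>Y 0. \<exists>c\<in>Y 0. \<exists>d\<in>Y 0. z = a [+] b [+] c [+] d)" for z
   unfolding four_def set_add_iff Bex_def by blast
  show ?thesis by (intro equalityI subsetI) (simp_all only: fourfold_iff eq four)
 qed
 ultimately show "z \<in> PR" by (simp add: four_plus_mult_four_def)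
qed

lemma coset_nbhd:
 assumes a: "a \<in> carrier R" "q a <= PR"
 shows "\<exists>D\<in>nb. \<forall>x\<in>D. x [+] a \<in> PR"
proof -
 obtain n where n: "a \<in> Y n" using a by (auto simp: R_carrier)
 have d: "dset PR" using PR_interprets by (simp add: interprets_def)
 note t = tmv[OF Y_dset[of jl] Y_dset[of n] order_refl order_refl]
 have m: "x [+] a \<in> PR" if "x \<in> J" for x
  using that a(2) unfolding subset_iff q_mem by blast
 show ?thesis by (rule Nm_single[OF J_tdef J_jl d n tm_add[OF t]]) (rule m)
qed

definition UR :: "'a list set set" where
 "UR = {q a | a. a \<in> carrier R & q a <= PR}"

lemma UR_open: "openin \<tau> UR"
 unfolding openin_\<tau> opn_def
proof (intro conjI ballI impI)
 show "UR <= carrier TR" by (auto simp: UR_def TR_carrier)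
 fix a assume a: "a \<in> carrier R" "q a \<in> UR"
 then have qa: "q a <= PR" by (auto simp: UR_def)
 obtain D where D: "D \<in> nb" "\<forall>x\<in>D. x [+] a \<in> PR" using coset_nbhd[OF a(1) qa] by (elim bexE)
 obtain E where E: "E \<in> nb" "\<forall>x\<in>E. \<forall>y\<in>E. x [+] y \<in> D" using nb_plus[OF D(1)] by (elim bexE conjE)
 have "q x \<in> UR" if x: "x \<in> carrier R" "x [-] a \<in> E" for x
 proof -
  have "z \<in> PR" if "z \<in> q x" for z
  proof -
   note hyp = that
   obtain j where j: "j \<in> J" "z = j [+] x" using hyp unfolding q_mem by (elim bexE)
   have "(j [+] (x [-] a)) [+] a \<in> PR" using D(2) E j(1) x(2) Nm_sub[OF E(1)] by blast
   moreover have "(j [+] (x [-] a)) [+] a = z" unfolding j(2) using J_R[OF j(1)] x(1) a(1) by (simp add: R.ring_norm)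
   ultimately show ?thesis by simp
  qed
  then show ?thesis unfolding UR_def using x(1) by blast
 qed
 then show "\<exists>D\<in>nb. \<forall>x\<in>carrier R. x [-] a \<in> D --> q x \<in> UR" using E(1) by blast
qed

lemma UR_zero: "\<zero>\<^bsub>TR\<^esub> \<in> UR"
proof -
 have "q \<zero>\<^bsub>R\<^esub> = J" using TR_zero by (simp add: FactRing_def)
 then show ?thesis unfolding TR_zero UR_def using J_PR R.zero_closed by blast
qed

lemma UR_preimage: "{a \<in> R0. q a \<in> UR} <= four_plus_mult_four A X"
proof
 fix a assume a: "a \<in> {a \<in> R0. q a \<in> UR}"
 then have "a \<in> q a" using abelian_subgroup.a_rcos_self[OF J_abelian] by simp
 then have "a \<in> PR" using a by (auto simp: UR_def)
 moreover have "a \<in> T0" using a R0_T0 by auto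
 ultimately show "a \<in> four_plus_mult_four A X" using PR_interprets by (auto simp: interprets_def)
qed

end

section \<open>Universality\<close>

lemma closure_separation:
 assumes "Hausdorff_space \<tau>" "locally_compact_space \<tau>" "openin \<tau> W" "x \<in> W"
 shows "\<exists>V K. openin \<tau> V & compactin \<tau> K & x \<in> V & V <= K & K <= W"
 using assms locally_compact_space_neighbourhood_base[of \<tau>] unfolding neighbourhood_base_of by blast

lemma continuous_prodD:
 assumes "continuous_map (prod_topology \<tau> \<tau>) \<tau> (%(x, y). F x y)"
  and "x \<in> topspace \<tau>" "y \<in> topspace \<tau>" "openin \<tau> W" "F x y \<in> W"
 shows "\<exists>U V. openin \<tau> U & openin \<tau> V & x \<in> U & y \<in> V & (\<forall>u\<in>U. \<forall>v\<in>V. F u v \<in> W)"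
proof -
 let ?P = "{z \<in> topspace (prod_topology \<tau> \<tau>). (%(x, y). F x y) z \<in> W}"
 have "openin (prod_topology \<tau> \<tau>) ?P" by (rule openin_continuous_map_preimage[OF assms(1,4)])
 moreover have "(x, y) \<in> ?P" using assms by simp
 ultimately obtain U V where UV: "openin \<tau> U" "openin \<tau> V" "x \<in> U" "y \<in> V" "U \<times> V <= ?P"
  unfolding openin_prod_topology_alt by meson
 have "F u v \<in> W" if "u \<in> U" "v \<in> V" for u v
  using subsetD[OF UV(5), of "(u, v)"] that by simp
 then have "\<forall>u\<in>U. \<forall>v\<in>V. F u v \<in> W" by (intro ballI)
 then show ?thesis using UV(1-4) by (intro exI conjI)
qed

text \<open>The tube lemma for a compact set and a point, in the form in which it makes multiplication by a compact set small near zero.\<close>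

lemma compact_tube:
 assumes K: "compactin \<tau> K" and zT: "openin \<tau> W0" "z \<in> W0"
  and loc: "!!c. c \<in> K ==> \<exists>A B. openin \<tau> A & openin \<tau> B & c \<in> A & z \<in> B & (\<forall>x\<in>A. \<forall>y\<in>B. Q x y)"
 shows "\<exists>B. openin \<tau> B & z \<in> B & (\<forall>x\<in>K. \<forall>y\<in>B. Q x y)"
proof -
 define \<A> where "\<A> = {A. openin \<tau> A & (\<exists>B. openin \<tau> B & z \<in> B & (\<forall>x\<in>A. \<forall>y\<in>B. Q x y))}"
 have "K <= \<Union>\<A>"
 proof
  fix c assume "c \<in> K"
  from loc[OF this] obtain A B where AB: "openin \<tau> A" "openin \<tau> B" "c \<in> A" "z \<in> B" "\<forall>x\<in>A. \<forall>y\<in>B. Q x y"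
   by (elim exE conjE)
  have "A \<in> \<A>" unfolding \<A>_def using AB(1,2,4,5) by (intro CollectI conjI exI[of _ B])
  then show "c \<in> \<Union>\<A>" using AB(3) by (rule UnionI)
 qed
 moreover have "\<forall>A\<in>\<A>. openin \<tau> A" by (simp add: \<A>_def)
 ultimately obtain \<F> where F: "finite \<F>" "\<F> <= \<A>" "K <= \<Union>\<F>" using K unfolding compactin_def by meson
 have "\<forall>A\<in>\<F>. \<exists>B. openin \<tau> B & z \<in> B & (\<forall>x\<in>A. \<forall>y\<in>B. Q x y)"
 proof
  fix A assume "A \<in> \<F>"
  then have "A \<in> \<A>" using F(2) by (rule subsetD[rotated])
  then show "\<exists>B. openin \<tau> B & z \<in> B & (\<forall>x\<in>A. \<forall>y\<in>B. Q x y)" by (simp add: \<A>_def)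
 qed
 from bchoice[OF this] obtain b where b: "\<forall>A\<in>\<F>. openin \<tau> (b A) & z \<in> b A & (\<forall>x\<in>A. \<forall>y\<in>b A. Q x y)"
   by (elim exE)
 have "openin \<tau> (\<Inter>(insert W0 (b ` \<F>)))" by (rule openin_Inter) (use F(1) b zT in auto)
 moreover have "z \<in> \<Inter>(insert W0 (b ` \<F>))" using b zT by auto
 moreover have "\<forall>x\<in>K. \<forall>y\<in>\<Inter>(insert W0 (b ` \<F>)). Q x y"
 proof (intro ballI)
  fix x y assume xy: "x \<in> K" "y \<in> \<Inter>(insert W0 (b ` \<F>))"
  then obtain A where A: "A \<in> \<F>" "x \<in> A" using F(3) by blast
  then have "y \<in> b A" using xy(2) by blast
  moreover have "\<forall>x\<in>A. \<forall>y\<in>b A. Q x y" using bspec[OF b A(1)] by (elim conjE)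
  ultimately show "Q x y" using A(2) by simp
 qed
 ultimately show ?thesis by (intro exI[of _ "\<Inter>(insert W0 (b ` \<F>))"] conjI)
qed

locale lc_model = def_ring L M C \<kappa> k A X
 for L :: "('f, 'p) language" and M C :: "('f, 'p, 'a) struct" and \<kappa> :: "'k rel" and k A X +
 fixes S :: "'s ring" and \<sigma> :: "'s topology" and f :: "'a list => 's"
 assumes model: "definable_lc_model L M k A X S \<sigma> f"
begin

lemma lc_ring: "locally_compact_ring S \<sigma>"
 and f_hom: "f \<in> rng_hom (A\<lparr>carrier := R0\<rparr>) S"
 and f_compact: "compactin \<sigma> (\<sigma> closure_of (f ` X))"
 and f_thin: "\<exists>U V m. openin \<sigma> V & \<zero>\<^bsub>S\<^esub> \<in> V & V <= U & U <= carrier S & {a \<in> R0. f a \<in> U} <= lev m"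
 and f_definable: "\<forall>U K. openin \<sigma> U & compactin \<sigma> K & K <= U -->
  (\<exists>Y\<subseteq>R0. definable_over L M k (universe M) Y & {a \<in> R0. f a \<in> K} <= Y & Y <= {a \<in> R0. f a \<in> U})"
 using model unfolding definable_lc_model_def Let_def R0_def[symmetric] by - (elim conjE, assumption)+

sublocale S: rng S
 using lc_ring unfolding locally_compact_ring_def by (elim conjE)

lemma topspace_\<sigma>: "topspace \<sigma> = carrier S" and Hausdorff_\<sigma>: "Hausdorff_space \<sigma>"
 and lc_\<sigma>: "locally_compact_space \<sigma>"
 and add_\<sigma>: "continuous_map (prod_topology \<sigma> \<sigma>) \<sigma> (%(x, y). x \<oplus>\<^bsub>S\<^esub> y)"
 and mult_\<sigma>: "continuous_map (prod_topology \<sigma> \<sigma>) \<sigma> (%(x, y). x \<otimes>\<^bsub>S\<^esub> y)"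
 and neg_\<sigma>: "continuous_map \<sigma> \<sigma> (%x. \<ominus>\<^bsub>S\<^esub> x)"
 using lc_ring unfolding locally_compact_ring_def by - (elim conjE, assumption)+

lemma open_S: "openin \<sigma> W ==> x \<in> W ==> x \<in> carrier S"
 using openin_subset topspace_\<sigma> by blast

lemma f_S: "x \<in> R0 ==> f x \<in> carrier S"
 and f_add: "x \<in> R0 ==> y \<in> R0 ==> f (x [+] y) = f x \<oplus>\<^bsub>S\<^esub> f y"
 and f_mult: "x \<in> R0 ==> y \<in> R0 ==> f (x [*] y) = f x \<otimes>\<^bsub>S\<^esub> f y"
 using f_hom by (auto simp: rng_hom_def R_add_R0 R_mult_R0)

lemma f_zero: "f \<zero>\<^bsub>R\<^esub> = \<zero>\<^bsub>S\<^esub>"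
proof -
 have "f (\<zero>\<^bsub>R\<^esub> [+] \<zero>\<^bsub>R\<^esub>) = f \<zero>\<^bsub>R\<^esub> \<oplus>\<^bsub>S\<^esub> f \<zero>\<^bsub>R\<^esub>" by (rule f_add[OF zero_R0 zero_R0])
 then have e: "f \<zero>\<^bsub>R\<^esub> \<oplus>\<^bsub>S\<^esub> f \<zero>\<^bsub>R\<^esub> = f \<zero>\<^bsub>R\<^esub>" by simp
 have "f \<zero>\<^bsub>R\<^esub> = (f \<zero>\<^bsub>R\<^esub> \<oplus>\<^bsub>S\<^esub> f \<zero>\<^bsub>R\<^esub>) \<ominus>\<^bsub>S\<^esub> f \<zero>\<^bsub>R\<^esub>" using f_S[OF zero_R0] by (simp add: S.ring_norm)
 also have "\<dots> = \<zero>\<^bsub>S\<^esub>" unfolding e using f_S[OF zero_R0] by (simp add: S.ring_norm)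
 finally show ?thesis .
qed

lemma f_minus: assumes "x \<in> R0" "y \<in> R0" shows "f (x [-] y) = f x \<ominus>\<^bsub>S\<^esub> f y"
proof -
 have c: "x \<in> carrier R" "y \<in> carrier R" using assms by auto
 have "f x = f ((x [-] y) [+] y)" by (rule arg_cong[of _ _ f]) (use c in \<open>simp add: R.ring_norm\<close>)
 also have "\<dots> = f (x [-] y) \<oplus>\<^bsub>S\<^esub> f y" by (rule f_add[OF R_minus_R0[OF assms] assms(2)])
 finally have *: "f x = f (x [-] y) \<oplus>\<^bsub>S\<^esub> f y" .
 show ?thesis unfolding * using f_S[OF R_minus_R0[OF assms]] f_S[OF assms(2)] by (simp add: S.ring_norm)
qed

lemma minus_\<sigma>: "continuous_map (prod_topology \<sigma> \<sigma>) \<sigma> (%(x, y). x \<ominus>\<^bsub>S\<^esub> y)"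
proof -
 have "continuous_map (prod_topology \<sigma> \<sigma>) (prod_topology \<sigma> \<sigma>) (%z. (fst z, \<ominus>\<^bsub>S\<^esub> snd z))"
  by (rule continuous_map_pairedI[OF continuous_map_fst continuous_map_compose[OF continuous_map_snd neg_\<sigma>, unfolded comp_def]])
 from continuous_map_compose[OF this add_\<sigma>]
 show ?thesis by (simp add: comp_def case_prod_unfold a_minus_def)
qed

lemma zero_nbhd:
 assumes "openin \<sigma> W" "\<zero>\<^bsub>S\<^esub> \<in> W"
 shows "\<exists>V. openin \<sigma> V & \<zero>\<^bsub>S\<^esub> \<in> V & V <= W & (\<forall>u\<in>V. \<forall>v\<in>V. u \<ominus>\<^bsub>S\<^esub> v \<in> W)"
proof -
 have z: "\<zero>\<^bsub>S\<^esub> \<in> topspace \<sigma>" by (simp add: topspace_\<sigma>)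
 have z0: "\<zero>\<^bsub>S\<^esub> \<ominus>\<^bsub>S\<^esub> \<zero>\<^bsub>S\<^esub> \<in> W" using assms(2) by (simp add: S.minus_eq S.r_neg)
 obtain U V where UV: "openin \<sigma> U" "openin \<sigma> V" "\<zero>\<^bsub>S\<^esub> \<in> U" "\<zero>\<^bsub>S\<^esub> \<in> V" "\<forall>u\<in>U. \<forall>v\<in>V. u \<ominus>\<^bsub>S\<^esub> v \<in> W"
  using continuous_prodD[OF minus_\<sigma> z z assms(1) z0] by (elim exE conjE)
 have "openin \<sigma> ((U \<inter> V) \<inter> W)" by (intro openin_Int UV assms)
 then show ?thesis using UV assms(2) by (intro exI[of _ "(U \<inter> V) \<inter> W"]) auto
qed

lemma translate_nbhd:
 assumes W: "openin \<sigma> W" and s: "s \<in> W"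
 shows "\<exists>U V. openin \<sigma> U & openin \<sigma> V & s \<in> U & \<zero>\<^bsub>S\<^esub> \<in> V & (\<forall>u\<in>U. \<forall>v\<in>V. u \<oplus>\<^bsub>S\<^esub> v \<in> W)"
 by (rule continuous_prodD[OF add_\<sigma> _ _ W]) (use open_S[OF W s] s in \<open>simp_all add: topspace_\<sigma>\<close>)

definition m0 :: nat where
 "m0 = (SOME m. \<exists>V. openin \<sigma> V & \<zero>\<^bsub>S\<^esub> \<in> V & {a \<in> R0. f a \<in> V} <= lev m)"

lemma m0: "\<exists>V. openin \<sigma> V & \<zero>\<^bsub>S\<^esub> \<in> V & {a \<in> R0. f a \<in> V} <= lev m0"
proof -
 have "\<exists>m. \<exists>V. openin \<sigma> V & \<zero>\<^bsub>S\<^esub> \<in> V & {a \<in> R0. f a \<in> V} <= lev m" using f_thin by blast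
 then show ?thesis unfolding m0_def by (rule someI_ex)
qed

text \<open>The definable sets that contain the preimage of a neighbourhood of \<open>0\<close>. Their intersection is the extension of the kernel of \<open>f\<close> to
  the monster model.\<close>

definition \<E> :: "'a list set set" where
 "\<E> = {E. dset E & E <= Y m0 & (\<exists>V. openin \<sigma> V & \<zero>\<^bsub>S\<^esub> \<in> V & (\<forall>x\<in>R0. f x \<in> V --> x \<in> E))}"

text \<open>A compact neighbourhood inside \<open>W\<close> and the definability of the model provide the definable set.\<close>

lemma shrink:
 assumes W: "openin \<sigma> W" "\<zero>\<^bsub>S\<^esub> \<in> W"
 shows "\<exists>E\<in>\<E>. \<forall>x\<in>E \<inter> T0. x \<in> R0 & f x \<in> W"
proof -
 obtain U where U: "openin \<sigma> U" "\<zero>\<^bsub>S\<^esub> \<in> U" "{a \<in> R0. f a \<in> U} <= lev m0" using m0 by (elim exE conjE)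
 have UW: "openin \<sigma> (W \<inter> U)" "\<zero>\<^bsub>S\<^esub> \<in> W \<inter> U" using U W by (auto intro: openin_Int)
 obtain V K where VK: "openin \<sigma> V" "compactin \<sigma> K" "\<zero>\<^bsub>S\<^esub> \<in> V" "V <= K" "K <= W \<inter> U"
  using closure_separation[OF Hausdorff_\<sigma> lc_\<sigma> UW] by (elim exE conjE)
 obtain B where B: "definable_over L M k (universe M) B" "{a \<in> R0. f a \<in> K} <= B" "B <= {a \<in> R0. f a \<in> W \<inter> U}"
  using f_definable[rule_format, OF conjI[OF UW(1) conjI[OF VK(2,5)]]]
  by (elim exE conjE) (rule that, assumption+)
 obtain E where E: "dset E" "E \<inter> T0 = B" using dset_of_definable[OF B(1)] by (elim exE conjE)
 have "E <= Y m0"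
  by (rule dset_eqI[OF E(1) Y_dset]) (use E(2) B(3) U(3) lev_Y[of m0] in blast)
 moreover have "x \<in> E" if "x \<in> R0" "f x \<in> V" for x using that VK(4) B(2) E(2) by blast
 ultimately have "E \<in> \<E>" unfolding \<E>_def using E(1) VK(1,3) by blast
 moreover have "\<forall>x\<in>E \<inter> T0. x \<in> R0 & f x \<in> W" using E(2) B(3) by blast
 ultimately show ?thesis by (intro bexI[of _ E])
qed

lemma f_level_compact: "\<exists>K. compactin \<sigma> K & f ` lev n <= K"
proof -
 let ?K = "\<sigma> closure_of (f ` X)"
 have X0: "X <= R0"
 proof
  fix x assume "x \<in> X"
  then have "x \<in> lev 0" by simp
  then show "x \<in> R0" unfolding R0_eq by (rule UN_I[OF UNIV_I])
 qed
 then have fX: "f ` X <= ?K" using f_S topspace_\<sigma> by (intro closure_of_subset) auto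
 obtain F where F: "finite F" "F <= R0" "\<forall>x\<in>lev n. \<exists>e\<in>F. \<exists>z\<in>X. x = e [+A] z"
  using finite_cover_level[of n] by (elim exE conjE)
 have "compactin \<sigma> ((%s. f e \<oplus>\<^bsub>S\<^esub> s) ` ?K)" if "e \<in> F" for e
 proof (rule image_compactin[OF f_compact])
  have "f e \<in> topspace \<sigma>" using f_S F(2) that topspace_\<sigma> by blast
  then have "continuous_map \<sigma> (prod_topology \<sigma> \<sigma>) (%s. (f e, s))"
   by (intro continuous_map_pairedI continuous_map_id[unfolded id_def]) simp_all
  from continuous_map_compose[OF this add_\<sigma>]
  show "continuous_map \<sigma> \<sigma> (%s. f e \<oplus>\<^bsub>S\<^esub> s)" by (simp add: comp_def)
 qed
 then have "compactin \<sigma> (\<Union>((%e. (%s. f e \<oplus>\<^bsub>S\<^esub> s) ` ?K) ` F))" by (intro compactin_Union) (use F(1) in auto)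
 moreover have "f ` lev n <= \<Union>((%e. (%s. f e \<oplus>\<^bsub>S\<^esub> s) ` ?K) ` F)"
 proof
  fix s assume "s \<in> f ` lev n"
  then obtain x where x: "x \<in> lev n" "s = f x" by blast
  obtain e z where ez: "e \<in> F" "z \<in> X" "x = e [+A] z" using F(3) x(1) by blast
  have r: "e \<in> R0" "z \<in> R0" using ez F(2) X0 by auto
  then have "s = f e \<oplus>\<^bsub>S\<^esub> f z" using x(2) ez(3) f_add[OF r] by (simp add: R_add_R0)
  moreover have "f z \<in> ?K" using fX ez(2) by blast
  ultimately show "s \<in> \<Union>((%e. (%s. f e \<oplus>\<^bsub>S\<^esub> s) ` ?K) ` F)" using ez(1) by blast
 qed
 ultimately show ?thesis by blast
qed

lemma generic_of_levels:
 assumes E: "dset E" and cov: "!!n. \<exists>F. finite F & F <= R0 & (\<forall>x\<in>lev n. \<exists>e\<in>F. x [-] e \<in> E)"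
 shows "generic E"
 unfolding generic_def
proof
 fix n
 obtain F where F: "finite F" "F <= R0" "\<forall>x\<in>lev n. \<exists>e\<in>F. x [-] e \<in> E" using cov[of n] by (elim exE conjE)
 have "Y n <= \<Union>((%e. {x \<in> T. x \<in> Y n & x [-] e \<in> E}) ` F)"
 proof (rule dset_eqI[OF Y_dset])
  show "dset (\<Union>((%e. {x \<in> T. x \<in> Y n & x [-] e \<in> E}) ` F))"
   by (rule dset_Union) (use F(1,2) dset_translate[OF _ E] in auto)
  show "Y n \<inter> T0 <= \<Union>((%e. {x \<in> T. x \<in> Y n & x [-] e \<in> E}) ` F)"
  proof
   fix x assume x: "x \<in> Y n \<inter> T0"
   then have "x \<in> lev n" using Y_T0 by blast
   then obtain e where "e \<in> F" "x [-] e \<in> E" using F(3) by blast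
   then show "x \<in> \<Union>((%e. {x \<in> T. x \<in> Y n & x [-] e \<in> E}) ` F)" using x T0_sub_T by blast
  qed
 qed
 then show "\<exists>F. finite F & F <= R0 & (\<forall>x\<in>Y n. \<exists>e\<in>F. x [-] e \<in> E)"
  using F(1,2) by (intro exI[of _ F]) auto
qed

text \<open>The image of a level is relatively compact, so it is covered by finitely many translates of any neighbourhood of \<open>0\<close>.\<close>

lemma \<E>_generic: assumes E: "E \<in> \<E>" shows "generic E"
proof (rule generic_of_levels)
 show "dset E" using E by (simp add: \<E>_def)
 fix n
 obtain V where V: "openin \<sigma> V" "\<zero>\<^bsub>S\<^esub> \<in> V" "\<forall>x\<in>R0. f x \<in> V --> x \<in> E" using E unfolding \<E>_def by blast
 obtain V2 where V2: "openin \<sigma> V2" "\<zero>\<^bsub>S\<^esub> \<in> V2" "\<forall>u\<in>V2. \<forall>v\<in>V2. u \<ominus>\<^bsub>S\<^esub> v \<in> V"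
  using zero_nbhd[OF V(1,2)] by (elim exE conjE)
 obtain K where K: "compactin \<sigma> K" "f ` lev n <= K" using f_level_compact[of n] by (elim exE conjE)
 have KS: "K <= carrier S" using compactin_subset_topspace[OF K(1)] topspace_\<sigma> by simp
 define B where "B c = {s \<in> topspace \<sigma>. s \<ominus>\<^bsub>S\<^esub> c \<in> V2}" for c
 have Bo: "openin \<sigma> (B c)" if "c \<in> K" for c unfolding B_def
 proof (rule openin_continuous_map_preimage[OF _ V2(1)])
  have "c \<in> topspace \<sigma>" using KS that topspace_\<sigma> by blast
  then have "continuous_map \<sigma> (prod_topology \<sigma> \<sigma>) (%s. (s, c))"
   by (intro continuous_map_pairedI continuous_map_id[unfolded id_def]) simp_all
  from continuous_map_compose[OF this minus_\<sigma>]
  show "continuous_map \<sigma> \<sigma> (%s. s \<ominus>\<^bsub>S\<^esub> c)" by (simp add: comp_def)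
 qed
 have Bc: "c \<in> B c" if "c \<in> K" for c
 proof -
  have "c \<in> carrier S" using KS that by blast
  then have "c \<ominus>\<^bsub>S\<^esub> c = \<zero>\<^bsub>S\<^esub>" by (simp add: S.ring_norm)
  then show ?thesis using \<open>c \<in> carrier S\<close> V2(2) by (simp add: B_def topspace_\<sigma>)
 qed
 have "\<forall>U\<in>B ` K. openin \<sigma> U" "K <= \<Union>(B ` K)" using Bo Bc by auto
 then obtain \<F> where \<F>: "finite \<F>" "\<F> <= B ` K" "K <= \<Union>\<F>" using K(1) unfolding compactin_def by meson
 obtain Kf where Kf: "Kf <= K" "finite Kf" "\<F> = B ` Kf" using finite_subset_image[OF \<F>(1,2)] by blast
 define x where "x c = (SOME x. x \<in> lev n & f x \<in> B c)" for c
 let ?Kf = "{c \<in> Kf. \<exists>x\<in>lev n. f x \<in> B c}"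
 have x: "x c \<in> lev n & f (x c) \<in> B c" if "c \<in> ?Kf" for c
 proof -
  have "\<exists>x. x \<in> lev n & f x \<in> B c" using that by blast
  then show ?thesis unfolding x_def by (rule someI_ex)
 qed
 have levR0: "lev n <= R0" by (auto simp: R0_eq)
 show "\<exists>F. finite F & F <= R0 & (\<forall>x\<in>lev n. \<exists>e\<in>F. x [-] e \<in> E)"
 proof (intro exI[of _ "x ` ?Kf"] conjI ballI)
  show "finite (x ` ?Kf)" using Kf(2) by simp
  show "x ` ?Kf <= R0" using x levR0 by blast
  fix y assume y: "y \<in> lev n"
  then have "f y \<in> \<Union>(B ` Kf)" using K(2) \<F>(3) Kf(3) by blast
  then obtain c where c: "c \<in> Kf" "f y \<in> B c" by blast
  then have c': "c \<in> ?Kf" using y by blast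
  have r: "y \<in> R0" "x c \<in> R0" using y x[OF c'] levR0 by auto
  have cc: "f y \<in> carrier S" "f (x c) \<in> carrier S" "c \<in> carrier S" using f_S r c(1) Kf(1) KS by auto
  have "(f y \<ominus>\<^bsub>S\<^esub> c) \<ominus>\<^bsub>S\<^esub> (f (x c) \<ominus>\<^bsub>S\<^esub> c) \<in> V" using V2(3) c(2) x[OF c'] by (simp add: B_def)
  moreover have "(f y \<ominus>\<^bsub>S\<^esub> c) \<ominus>\<^bsub>S\<^esub> (f (x c) \<ominus>\<^bsub>S\<^esub> c) = f y \<ominus>\<^bsub>S\<^esub> f (x c)" using cc by (simp add: S.ring_norm)
  ultimately have "f (y [-] x c) \<in> V" using f_minus[OF r] by simp
  then have "y [-] x c \<in> E" using V(3) R_minus_R0[OF r] by blast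
  then show "\<exists>e\<in>x ` ?Kf. y [-] e \<in> E" using c' by blast
 qed
qed

lemma \<E>_ne: "Y m0 \<in> \<E>"
proof -
 obtain U where "openin \<sigma> U" "\<zero>\<^bsub>S\<^esub> \<in> U" "{a \<in> R0. f a \<in> U} <= lev m0" using m0 by (elim exE conjE)
 then show ?thesis unfolding \<E>_def using Y_dset lev_Y[of m0] by blast
qed

lemma \<E>_dset: "E \<in> \<E> ==> dset E" and \<E>_Y: "E \<in> \<E> ==> E <= Y m0"
 by (auto simp: \<E>_def)

lemma \<E>_minus: assumes E: "E \<in> \<E>" shows "\<exists>E'\<in>\<E>. \<forall>x\<in>E'. \<forall>y\<in>E'. x [-] y \<in> E"
proof -
 obtain V where V: "openin \<sigma> V" "\<zero>\<^bsub>S\<^esub> \<in> V" "\<forall>x\<in>R0. f x \<in> V --> x \<in> E" using E unfolding \<E>_def by blast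
 obtain V2 where V2: "openin \<sigma> V2" "\<zero>\<^bsub>S\<^esub> \<in> V2" "\<forall>u\<in>V2. \<forall>v\<in>V2. u \<ominus>\<^bsub>S\<^esub> v \<in> V"
  using zero_nbhd[OF V(1,2)] by (elim exE conjE)
 obtain E' where E': "E' \<in> \<E>" "\<forall>x\<in>E' \<inter> T0. x \<in> R0 & f x \<in> V2" using shrink[OF V2(1,2)] by (elim bexE)
 have "x [-] y \<in> E" if xy: "x \<in> E'" "y \<in> E'" for x y
 proof -
  have "(x \<in> E' & y \<in> E') --> x [-] y \<in> E"
  proof (rule transfer2[where P = "%x y. (x \<in> E' & y \<in> E') --> x [-] y \<in> E"])
   show "dfn (%v. v 0 \<in> E' & v 1 \<in> E' --> v 0 [-] v 1 \<in> E)"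
    using tm_in_imp[OF tm_minus[OF tmv[OF \<E>_dset[OF E'(1)] \<E>_dset[OF E'(1)] \<E>_Y[OF E'(1)] \<E>_Y[OF E'(1)]]] \<E>_dset[OF E]] by simp
   fix x y assume T0: "x \<in> T0" "y \<in> T0"
   show "x \<in> E' & y \<in> E' --> x [-] y \<in> E"
   proof
    assume "x \<in> E' & y \<in> E'"
    then have *: "x \<in> R0" "y \<in> R0" "f x \<in> V2" "f y \<in> V2" using E'(2) T0 by auto
    then have "f (x [-] y) \<in> V" using V2(3) f_minus by simp
    then show "x [-] y \<in> E" using V(3) R_minus_R0[OF *(1,2)] by blast
   qed
  qed (use xy dset_sub[OF \<E>_dset[OF E'(1)]] in auto)
  then show ?thesis using xy by blast
 qed
 then show ?thesis using E'(1) by blast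
qed

lemma \<E>_CC: "CC (\<Inter>\<E>)"
proof (rule CC_Inter_chain)
 show "\<E> \<noteq> {}" using \<E>_ne by blast
 show "\<Inter>\<E> <= carrier R" using \<E>_ne Y_R by blast
 fix E assume E: "E \<in> \<E>"
 show "dset E" by (rule \<E>_dset[OF E])
 show "\<zero>\<^bsub>R\<^esub> \<in> E" using E f_zero zero_R0 unfolding \<E>_def by auto
 show "\<exists>E'\<in>\<E>. \<forall>x\<in>E'. \<forall>y\<in>E'. x [-] y \<in> E" by (rule \<E>_minus[OF E])
 show "generic E" by (rule \<E>_generic[OF E])
qed

lemma \<E>_op:
 assumes E: "E \<in> \<E>" and r: "r \<in> Y n"
  and cl: "!!x y. x \<in> R0 ==> y \<in> R0 ==> F x y \<in> R0"
  and hom: "!!x y. x \<in> R0 ==> y \<in> R0 ==> f (F x y) = G (f x) (f y)"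
  and tm: "!!P s t. tm P s ==> tm P t ==> tm P (%v. F (s v) (t v))"
  and cont: "continuous_map (prod_topology \<sigma> \<sigma>) \<sigma> (%(x, y). G x y)"
  and zero: "!!s. s \<in> carrier S ==> G s \<zero>\<^bsub>S\<^esub> = \<zero>\<^bsub>S\<^esub>"
 shows "\<exists>E'\<in>\<E>. \<forall>x\<in>E'. F r x \<in> E"
proof -
 obtain V where V: "openin \<sigma> V" "\<zero>\<^bsub>S\<^esub> \<in> V" "\<forall>x\<in>R0. f x \<in> V --> x \<in> E" using E unfolding \<E>_def by blast
 obtain K where K: "compactin \<sigma> K" "f ` lev n <= K" using f_level_compact[of n] by (elim exE conjE)
 have KS: "K <= carrier S" using compactin_subset_topspace[OF K(1)] topspace_\<sigma> by simp
 have "\<exists>B. openin \<sigma> B & \<zero>\<^bsub>S\<^esub> \<in> B & (\<forall>x\<in>K. \<forall>y\<in>B. G x y \<in> V)"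
 proof (rule compact_tube[OF K(1) V(1,2)])
  fix c assume "c \<in> K"
  then have c: "c \<in> carrier S" using KS by blast
  show "\<exists>A B. openin \<sigma> A & openin \<sigma> B & c \<in> A & \<zero>\<^bsub>S\<^esub> \<in> B & (\<forall>x\<in>A. \<forall>y\<in>B. G x y \<in> V)"
   by (rule continuous_prodD[OF cont _ _ V(1)]) (use c zero V(2) topspace_\<sigma> in auto)
 qed
 then obtain B where B: "openin \<sigma> B" "\<zero>\<^bsub>S\<^esub> \<in> B" "\<forall>x\<in>K. \<forall>y\<in>B. G x y \<in> V" by (elim exE conjE)
 obtain E' where E': "E' \<in> \<E>" "\<forall>x\<in>E' \<inter> T0. x \<in> R0 & f x \<in> B" using shrink[OF B(1,2)] by (elim bexE)
 have "F r x \<in> E" if x: "x \<in> E'" for x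
 proof -
  have "(r \<in> Y n & x \<in> E') --> F r x \<in> E"
  proof (rule transfer2[where P = "%r x. (r \<in> Y n & x \<in> E') --> F r x \<in> E"])
   show "dfn (%v. v 0 \<in> Y n & v 1 \<in> E' --> F (v 0) (v 1) \<in> E)"
    using tm_in_imp[OF tm[OF tmv[OF Y_dset[of n] \<E>_dset[OF E'(1)] order_refl \<E>_Y[OF E'(1)]]] \<E>_dset[OF E]] by simp
   fix r x assume T0: "r \<in> T0" "x \<in> T0"
   show "r \<in> Y n & x \<in> E' --> F r x \<in> E"
   proof
    assume rx: "r \<in> Y n & x \<in> E'"
    then have *: "r \<in> lev n" "r \<in> R0" "x \<in> R0" "f x \<in> B" using E'(2) T0 Y_T0 in_R0 by auto
    then have "G (f r) (f x) \<in> V" using B(3) K(2) by blast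
    then show "F r x \<in> E" using V(3) cl[OF *(2,3)] hom[OF *(2,3)] by simp
   qed
  qed (use x r Y_T dset_sub[OF \<E>_dset[OF E'(1)]] in auto)
  then show ?thesis using x r by blast
 qed
 then show ?thesis using E'(1) by blast
qed

lemma R0_mult: "x \<in> R0 ==> y \<in> R0 ==> x [*] y \<in> R0"
 by (simp add: R_mult_R0 R0_closed)

lemma swap_\<sigma>: "continuous_map (prod_topology \<sigma> \<sigma>) \<sigma> (%(x, y). y \<otimes>\<^bsub>S\<^esub> x)"
proof -
 have "continuous_map (prod_topology \<sigma> \<sigma>) (prod_topology \<sigma> \<sigma>) (%z. (snd z, fst z))"
  by (rule continuous_map_pairedI[OF continuous_map_snd continuous_map_fst])
 from continuous_map_compose[OF this mult_\<sigma>] show ?thesis by (simp add: comp_def case_prod_unfold)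
qed

text \<open>The intersection is an ideal: an element \<open>r\<close> of a level has image in a compact set \<open>K\<close> if it lies in \<open>R\<close>, and multiplication by \<open>K\<close> is uniformly
  continuous at \<open>0\<close>. This extends to all \<open>r\<close> in the level by elementarity.\<close>

lemma J_sub_\<E>: "J <= \<Inter>\<E>"
proof (rule J_least)
 have "r [*] x \<in> E & x [*] r \<in> E" if x: "x \<in> \<Inter>\<E>" and r: "r \<in> carrier R" and E: "E \<in> \<E>" for x r E
 proof -
  obtain n where n: "r \<in> Y n" using r by (auto simp: R_carrier)
  have "\<exists>E'\<in>\<E>. \<forall>x\<in>E'. r [*] x \<in> E"
   by (rule \<E>_op[OF E n, where F = "%x y. x [*] y" and G = "%x y. x \<otimes>\<^bsub>S\<^esub> y"])
    (assumption | rule R0_mult f_mult tm_mult mult_\<sigma> S.rng_r_null)+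
  then obtain E1 where E1: "E1 \<in> \<E>" "\<forall>x\<in>E1. r [*] x \<in> E" by (elim bexE)
  have "\<exists>E'\<in>\<E>. \<forall>x\<in>E'. x [*] r \<in> E"
   by (rule \<E>_op[OF E n, where F = "%x y. y [*] x" and G = "%x y. y \<otimes>\<^bsub>S\<^esub> x"])
    (assumption | rule R0_mult f_mult tm_mult swap_\<sigma> S.rng_l_null)+
  then obtain E2 where E2: "E2 \<in> \<E>" "\<forall>x\<in>E2. x [*] r \<in> E" by (elim bexE)
  show ?thesis using E1 E2 x by blast
 qed
 then have "two_sided_ideal (\<Inter>\<E>) R" unfolding two_sided_ideal_def using CC_sub[OF \<E>_CC] by blast
 then show "is_tdef_bounded_ideal L M \<kappa> C k R (\<Inter>\<E>)"
  unfolding is_tdef_bounded_ideal_def tdef_iff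
  using CC_tdef[OF \<E>_CC] CC_iff_bounded[OF CC_sub[OF \<E>_CC] CC_tdef[OF \<E>_CC]] \<E>_CC by blast
qed

lemma uniform:
 assumes W: "openin \<sigma> W" "\<zero>\<^bsub>S\<^esub> \<in> W"
 shows "\<exists>D\<in>nb. \<forall>x\<in>R0. x \<in> D --> f x \<in> W"
proof -
 obtain E where E: "E \<in> \<E>" "\<forall>x\<in>E \<inter> T0. x \<in> R0 & f x \<in> W" using shrink[OF W] by (elim bexE)
 have "E \<inter> Y jl \<in> nb" using E(1) J_sub_\<E> J_jl \<E>_dset Y_dset by (auto simp: Nm_def dset_Int)
 moreover have "\<forall>x\<in>R0. x \<in> E \<inter> Y jl --> f x \<in> W" using E(2) R0_T0 by blast
 ultimately show ?thesis by blast
qed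

text \<open>\<open>s\<close> is the limit of \<open>f\<close> at \<open>a\<close> along \<open>R\<close>.\<close>

definition tends :: "'a list => 's => bool" where
 "tends a s \<longleftrightarrow> s \<in> carrier S & (\<forall>W. openin \<sigma> W & s \<in> W --> (\<exists>D\<in>nb. \<forall>x\<in>R0. x [-] a \<in> D --> f x \<in> W))"

lemma tendsD: "tends a s ==> openin \<sigma> W ==> s \<in> W ==> \<exists>D\<in>nb. \<forall>x\<in>R0. x [-] a \<in> D --> f x \<in> W"
 unfolding tends_def by blast

lemma separate:
 assumes "s \<in> carrier S" "t \<in> carrier S" "s \<noteq> t"
 shows "\<exists>U V. openin \<sigma> U & openin \<sigma> V & s \<in> U & t \<in> V & U \<inter> V = {}"
 using Hausdorff_\<sigma> assms unfolding Hausdorff_space_def topspace_\<sigma> disjnt_def by blast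

lemma tends_unique:
 assumes a: "a \<in> carrier R" and s: "tends a s" and t: "tends a t" shows "s = t"
proof (rule ccontr)
 assume "s \<noteq> t"
 have c: "s \<in> carrier S" "t \<in> carrier S" using s t by (simp_all add: tends_def)
 obtain U V where UV: "openin \<sigma> U" "openin \<sigma> V" "s \<in> U" "t \<in> V" "U \<inter> V = {}"
  using separate[OF c \<open>s \<noteq> t\<close>] by (elim exE conjE)
 obtain D where D: "D \<in> nb" "\<forall>x\<in>R0. x [-] a \<in> D --> f x \<in> U" using tendsD[OF s UV(1,3)] by (elim bexE)
 obtain E where E: "E \<in> nb" "\<forall>x\<in>R0. x [-] a \<in> E --> f x \<in> V" using tendsD[OF t UV(2,4)] by (elim bexE)
 obtain x where "x \<in> R0" "x [-] a \<in> D \<inter> E" using nb_dense[OF Nm_Int[OF D(1) E(1)] a] by (elim bexE conjE)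
 then show False using D(2) E(2) UV(5) by blast
qed

lemma nb_finite: "finite \<F> ==> \<F> <= nb ==> \<exists>D\<in>nb. \<forall>E\<in>\<F>. D <= E"
proof (induction \<F> rule: finite_induct)
 case empty
 then show ?case using Y_nb by blast
next
 case (insert E \<F>)
 then obtain D where D: "D \<in> nb" "\<forall>E\<in>\<F>. D <= E" by blast
 have E: "E \<in> nb" using insert.prems by simp
 show ?case by (rule bexI[OF _ Nm_Int[OF D(1) E]]) (use D(2) in auto)
qed

text \<open>A cluster point exists by compactness of the closure of the image of a level. By uniform continuity it is a limit.\<close>

lemma tends_ex:
 assumes a: "a \<in> carrier R" shows "\<exists>s. tends a s"
proof -
 obtain n where n: "a \<in> Y n" using a by (auto simp: R_carrier)
 define N where "N = Suc (max n jl)"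
 have lev: "x \<in> lev N" if x: "x \<in> R0" "x [-] a \<in> Y jl" for x
 proof -
  have "a [+] (x [-] a) \<in> Y N" unfolding N_def
   by (rule R_add_closed) (use n x(2) Y_mono[of n "max n jl"] Y_mono[of jl "max n jl"] in auto)
  moreover have "a [+] (x [-] a) = x" using a x(1)[THEN R0_R] by (simp add: R.ring_norm)
  ultimately show ?thesis using Y_T0[of N] x(1) R0_T0 by auto
 qed
 obtain K where K: "compactin \<sigma> K" "f ` lev N <= K" using f_level_compact[of N] by (elim exE conjE)
 define \<W> where "\<W> = {W. openin \<sigma> W & (\<exists>D\<in>nb. \<forall>x\<in>R0. x [-] a \<in> D --> f x \<notin> W)}"
 have "\<not> K <= \<Union>\<W>"
 proof
  assume "K <= \<Union>\<W>"
  moreover have "\<forall>W\<in>\<W>. openin \<sigma> W" by (simp add: \<W>_def)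
  ultimately obtain \<F> where \<F>: "finite \<F>" "\<F> <= \<W>" "K <= \<Union>\<F>" using K(1) unfolding compactin_def by meson
  have "\<forall>W\<in>\<F>. \<exists>D. D \<in> nb & (\<forall>x\<in>R0. x [-] a \<in> D --> f x \<notin> W)" using \<F>(2) unfolding \<W>_def by blast
  from bchoice[OF this] obtain d where d: "\<forall>W\<in>\<F>. d W \<in> nb & (\<forall>x\<in>R0. x [-] a \<in> d W --> f x \<notin> W)"
   by (elim exE)
  obtain D where D: "D \<in> nb" "\<forall>E\<in>d ` \<F>. D <= E" using nb_finite[of "d ` \<F>"] \<F>(1) d by blast
  obtain x where x: "x \<in> R0" "x [-] a \<in> D" using nb_dense[OF D(1) a] by (elim bexE conjE)
  have "f x \<in> K" using lev[OF x(1)] x(2) Nm_Y[OF D(1)] K(2) by blast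
  then obtain W where W: "W \<in> \<F>" "f x \<in> W" using \<F>(3) by blast
  then have "x [-] a \<in> d W" using D(2) x(2) by blast
  then show False using d W x(1) by blast
 qed
 then obtain s where s: "s \<in> K" "s \<notin> \<Union>\<W>" by blast
 have near: "\<exists>x\<in>R0. x [-] a \<in> D & f x \<in> W" if "openin \<sigma> W" "s \<in> W" "D \<in> nb" for W D
  using s(2) that unfolding \<W>_def by blast
 have sS: "s \<in> carrier S" using s(1) compactin_subset_topspace[OF K(1)] topspace_\<sigma> by auto
 have "tends a s" unfolding tends_def
 proof (intro conjI sS allI impI)
  fix W assume W: "openin \<sigma> W & s \<in> W"
  obtain U V where UV: "openin \<sigma> U" "openin \<sigma> V" "s \<in> U" "\<zero>\<^bsub>S\<^esub> \<in> V" "\<forall>u\<in>U. \<forall>v\<in>V. u \<oplus>\<^bsub>S\<^esub> v \<in> W"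
   using translate_nbhd[OF conjunct1[OF W] conjunct2[OF W]] by (elim exE conjE)
  obtain D where D: "D \<in> nb" "\<forall>x\<in>R0. x \<in> D --> f x \<in> V" using uniform[OF UV(2,4)] by (elim bexE)
  obtain E where E: "E \<in> nb" "\<forall>x\<in>E. \<forall>y\<in>E. x [-] y \<in> D" using nb_minus[OF D(1)] by (elim bexE conjE)
  obtain y where y: "y \<in> R0" "y [-] a \<in> E" "f y \<in> U" using near[OF UV(1,3) E(1)] by (elim bexE conjE)
  have "f x \<in> W" if x: "x \<in> R0" "x [-] a \<in> E" for x
  proof -
   have "x [-] y \<in> D" using E(2) x(2) y(2) diff_diff[OF R0_R[OF x(1)] R0_R[OF y(1)] a] by metis
   then have "f (x [-] y) \<in> V" using D(2) R_minus_R0[OF x(1) y(1)] by blast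
   then have "f y \<oplus>\<^bsub>S\<^esub> f (x [-] y) \<in> W" using UV(5) y(3) by blast
   moreover have "f y \<oplus>\<^bsub>S\<^esub> f (x [-] y) = f x"
    unfolding f_minus[OF x(1) y(1)] using f_S[OF x(1)] f_S[OF y(1)] by (simp add: S.ring_norm)
   ultimately show ?thesis by simp
  qed
  then show "\<exists>D\<in>nb. \<forall>x\<in>R0. x [-] a \<in> D --> f x \<in> W" using E(1) by blast
 qed
 then show ?thesis by blast
qed

lemma tends_cong:
 assumes ab: "a \<in> carrier R" "b \<in> carrier R" "q a = q b" and s: "tends a s" shows "tends b s"
 unfolding tends_def
proof (intro conjI allI impI)
 show "s \<in> carrier S" using s by (simp add: tends_def)
 fix W assume W: "openin \<sigma> W & s \<in> W"
 obtain D where D: "D \<in> nb" "\<forall>x\<in>R0. x [-] a \<in> D --> f x \<in> W" using tendsD[OF s] W by blast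
 obtain E where E: "E \<in> nb" "\<forall>x\<in>E. \<forall>y\<in>E. x [+] y \<in> D" using nb_plus[OF D(1)] by (elim bexE conjE)
 have ba: "b [-] a \<in> E" using q_eq[OF ab(2,1)] ab(3) Nm_sub[OF E(1)] by auto
 have "f x \<in> W" if x: "x \<in> R0" "x [-] b \<in> E" for x
 proof -
  have "(x [-] b) [+] (b [-] a) \<in> D" using E(2) x(2) ba by blast
  moreover have "(x [-] b) [+] (b [-] a) = x [-] a" using ab(1,2) x(1)[THEN R0_R] by (simp add: R.ring_norm)
  ultimately show ?thesis using D(2) x(1) by simp
 qed
 then show "\<exists>D\<in>nb. \<forall>x\<in>R0. x [-] b \<in> D --> f x \<in> W" using E(1) by blast
qed

definition g :: "'a list set => 's" where
 "g = restrict (%c. SOME s. \<exists>a\<in>carrier R. c = q a & tends a s) (carrier TR)"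

lemma g_tends: assumes a: "a \<in> carrier R" shows "tends a (g (q a))"
proof -
 have ex: "\<exists>s. \<exists>b\<in>carrier R. q a = q b & tends b s" using tends_ex[OF a] a by blast
 have "g (q a) = (SOME s. \<exists>b\<in>carrier R. q a = q b & tends b s)" using a by (simp add: g_def TR_carrier)
 then have "\<exists>b\<in>carrier R. q a = q b & tends b (g (q a))" using someI_ex[OF ex] by simp
 then obtain b where b: "b \<in> carrier R" "q a = q b" "tends b (g (q a))" by (elim bexE conjE)
 show ?thesis by (rule tends_cong[OF b(1) a b(2)[symmetric] b(3)])
qed

lemma g_q: assumes a: "a \<in> R0" shows "g (q a) = f a"
proof (rule tends_unique[OF R0_R[OF a] g_tends[OF R0_R[OF a]]])
 show "tends a (f a)" unfolding tends_def
 proof (intro conjI f_S[OF a] allI impI)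
  fix W assume W: "openin \<sigma> W & f a \<in> W"
  obtain U V where UV: "openin \<sigma> V" "f a \<in> U" "\<zero>\<^bsub>S\<^esub> \<in> V" "\<forall>u\<in>U. \<forall>v\<in>V. u \<oplus>\<^bsub>S\<^esub> v \<in> W"
   using translate_nbhd[OF conjunct1[OF W] conjunct2[OF W]] by (elim exE conjE)
  obtain D where D: "D \<in> nb" "\<forall>x\<in>R0. x \<in> D --> f x \<in> V" using uniform[OF UV(1,3)] by (elim bexE)
  have "f x \<in> W" if x: "x \<in> R0" "x [-] a \<in> D" for x
  proof -
   have "f a \<oplus>\<^bsub>S\<^esub> f (x [-] a) \<in> W" using UV(2,4) D(2) R_minus_R0[OF x(1) a] x(2) by blast
   moreover have "f a \<oplus>\<^bsub>S\<^esub> f (x [-] a) = f x"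
    unfolding f_minus[OF x(1) a] using f_S[OF x(1)] f_S[OF a] by (simp add: S.ring_norm)
   ultimately show ?thesis by simp
  qed
  then show "\<exists>D\<in>nb. \<forall>x\<in>R0. x [-] a \<in> D --> f x \<in> W" using D(1) by blast
 qed
qed

lemma g_op:
 assumes ab: "a \<in> carrier R" "b \<in> carrier R"
  and cl: "!!x y. x \<in> carrier R ==> y \<in> carrier R ==> F x y \<in> carrier R"
  and cl0: "!!x y. x \<in> R0 ==> y \<in> R0 ==> F x y \<in> R0"
  and cont: "!!D a b. D \<in> nb ==> a \<in> carrier R ==> b \<in> carrier R ==>
   \<exists>E\<in>nb. \<forall>x\<in>carrier R. \<forall>y\<in>carrier R. x [-] a \<in> E --> y [-] b \<in> E --> F x y [-] F a b \<in> D"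
  and hom: "!!x y. x \<in> R0 ==> y \<in> R0 ==> f (F x y) = G (f x) (f y)"
  and clS: "!!x y. x \<in> carrier S ==> y \<in> carrier S ==> G x y \<in> carrier S"
  and contS: "continuous_map (prod_topology \<sigma> \<sigma>) \<sigma> (%(x, y). G x y)"
 shows "g (q (F a b)) = G (g (q a)) (g (q b))"
proof (rule ccontr)
 assume ne: "g (q (F a b)) \<noteq> G (g (q a)) (g (q b))"
 note ta = g_tends[OF ab(1)] and tb = g_tends[OF ab(2)] and tF = g_tends[OF cl[OF ab]]
 have c: "g (q a) \<in> carrier S" "g (q b) \<in> carrier S" "g (q (F a b)) \<in> carrier S" using ta tb tF by (simp_all add: tends_def)
 obtain U V where UV: "openin \<sigma> U" "openin \<sigma> V" "g (q (F a b)) \<in> U" "G (g (q a)) (g (q b)) \<in> V" "U \<inter> V = {}"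
  using separate[OF c(3) clS[OF c(1,2)] ne] by (elim exE conjE)
 obtain P Q where PQ: "openin \<sigma> P" "openin \<sigma> Q" "g (q a) \<in> P" "g (q b) \<in> Q" "\<forall>u\<in>P. \<forall>v\<in>Q. G u v \<in> V"
  using continuous_prodD[OF contS c(1,2)[folded topspace_\<sigma>] UV(2,4)] by (elim exE conjE)
 obtain D where D: "D \<in> nb" "\<forall>x\<in>R0. x [-] F a b \<in> D --> f x \<in> U" using tendsD[OF tF UV(1,3)] by (elim bexE)
 obtain E where E: "E \<in> nb" "\<forall>x\<in>carrier R. \<forall>y\<in>carrier R. x [-] a \<in> E --> y [-] b \<in> E --> F x y [-] F a b \<in> D"
  using cont[OF D(1) ab] by (elim bexE)
 obtain D1 where D1: "D1 \<in> nb" "\<forall>x\<in>R0. x [-] a \<in> D1 --> f x \<in> P" using tendsD[OF ta PQ(1,3)] by (elim bexE)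
 obtain D2 where D2: "D2 \<in> nb" "\<forall>x\<in>R0. x [-] b \<in> D2 --> f x \<in> Q" using tendsD[OF tb PQ(2,4)] by (elim bexE)
 obtain x where x: "x \<in> R0" "x [-] a \<in> E \<inter> D1" using nb_dense[OF Nm_Int[OF E(1) D1(1)] ab(1)] by (elim bexE conjE)
 obtain y where y: "y \<in> R0" "y [-] b \<in> E \<inter> D2" using nb_dense[OF Nm_Int[OF E(1) D2(1)] ab(2)] by (elim bexE conjE)
 have "F x y [-] F a b \<in> D" using E(2) x y R0_R by blast
 then have "f (F x y) \<in> U" using D(2) cl0[OF x(1) y(1)] by blast
 moreover have "G (f x) (f y) \<in> V" using PQ(5) D1(2) D2(2) x y by blast
 ultimately show False using hom[OF x(1) y(1)] UV(5) by auto
qed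

lemma g_hom: "g \<in> rng_hom TR S"
proof -
 have "g (q a \<oplus>\<^bsub>TR\<^esub> q b) = g (q a) \<oplus>\<^bsub>S\<^esub> g (q b)" if ab: "a \<in> carrier R" "b \<in> carrier R" for a b
  unfolding TR_add[OF ab] by (rule g_op[OF ab _ _ nb_add_cont _ _ add_\<sigma>]) (simp_all add: f_add R0_R_closed)
 moreover have "g (q a \<otimes>\<^bsub>TR\<^esub> q b) = g (q a) \<otimes>\<^bsub>S\<^esub> g (q b)" if ab: "a \<in> carrier R" "b \<in> carrier R" for a b
  unfolding TR_mult[OF ab] by (rule g_op[OF ab _ _ nb_mult_cont _ _ mult_\<sigma>]) (simp_all add: f_mult R0_mult R.rng_m_closed S.rng_m_closed)
 moreover have "g (q a) \<in> carrier S" if "a \<in> carrier R" for a using g_tends[OF that] by (simp add: tends_def)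
 ultimately show ?thesis by (auto simp: rng_hom_def TR_carrier)
qed

lemma g_continuous: "continuous_map \<tau> \<sigma> g"
 unfolding continuous_map_def
proof (intro conjI allI impI)
 show "g \<in> topspace \<tau> \<rightarrow> topspace \<sigma>" using g_hom by (simp add: rng_hom_def topspace_\<tau> topspace_\<sigma>)
 fix W assume W: "openin \<sigma> W"
 show "openin \<tau> {c \<in> topspace \<tau>. g c \<in> W}" unfolding openin_\<tau> opn_def topspace_\<tau>
 proof (intro conjI ballI impI)
  fix a assume a: "a \<in> carrier R" "q a \<in> {c \<in> carrier TR. g c \<in> W}"
  then have gW: "g (q a) \<in> W" by simp
  obtain V K where VK: "openin \<sigma> V" "compactin \<sigma> K" "g (q a) \<in> V" "V <= K" "K <= W"
   using closure_separation[OF Hausdorff_\<sigma> lc_\<sigma> W gW] by (elim exE conjE)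
  have Ko: "openin \<sigma> (topspace \<sigma> - K)" using compactin_imp_closedin[OF Hausdorff_\<sigma> VK(2)] by (simp add: closedin_def)
  obtain D where D: "D \<in> nb" "\<forall>x\<in>R0. x [-] a \<in> D --> f x \<in> V" using tendsD[OF g_tends[OF a(1)] VK(1,3)] by (elim bexE)
  obtain E where E: "E \<in> nb" "\<forall>x\<in>E. \<forall>y\<in>E. x [+] y \<in> D" using nb_plus[OF D(1)] by (elim bexE conjE)
  have "g (q c) \<in> K" if c: "c \<in> carrier R" "c [-] a \<in> E" for c
  proof (rule ccontr)
   assume "g (q c) \<notin> K"
   then have gc: "g (q c) \<in> topspace \<sigma> - K" using g_tends[OF c(1)] by (simp add: tends_def topspace_\<sigma>)
   obtain D' where D': "D' \<in> nb" "\<forall>x\<in>R0. x [-] c \<in> D' --> f x \<in> topspace \<sigma> - K"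
    using tendsD[OF g_tends[OF c(1)] Ko gc] by (elim bexE)
   obtain x where x: "x \<in> R0" "x [-] c \<in> D' \<inter> E" using nb_dense[OF Nm_Int[OF D'(1) E(1)] c(1)] by (elim bexE conjE)
   have "(x [-] c) [+] (c [-] a) \<in> D" using E(2) x(2) c(2) by blast
   moreover have "(x [-] c) [+] (c [-] a) = x [-] a" using a(1) c(1) x(1)[THEN R0_R] by (simp add: R.ring_norm)
   ultimately have "f x \<in> V" using D(2) x(1) by simp
   then show False using D'(2) x VK(4) by blast
  qed
  then have "\<forall>x\<in>carrier R. x [-] a \<in> E --> q x \<in> {c \<in> carrier TR. g c \<in> W}" using VK(5) by (auto simp: TR_carrier)
  then show "\<exists>D\<in>nb. \<forall>x\<in>carrier R. x [-] a \<in> D --> q x \<in> {c \<in> carrier TR. g c \<in> W}" using E(1) by blast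
 qed simp
qed

lemma continuous_unique:
 assumes g: "continuous_map \<tau> \<sigma> g1" "continuous_map \<tau> \<sigma> g2" "!!a. a \<in> R0 ==> g1 (q a) = g2 (q a)"
  and a: "a \<in> carrier R"
 shows "g1 (q a) = g2 (q a)"
proof (rule ccontr)
 assume ne: "g1 (q a) \<noteq> g2 (q a)"
 have qa: "q a \<in> topspace \<tau>" using a by (simp add: topspace_\<tau> TR_carrier)
 have c: "g1 (q a) \<in> carrier S" "g2 (q a) \<in> carrier S"
  using continuous_map_image_subset_topspace[OF g(1)] continuous_map_image_subset_topspace[OF g(2)] qa topspace_\<sigma> by blast+
 obtain U V where UV: "openin \<sigma> U" "openin \<sigma> V" "g1 (q a) \<in> U" "g2 (q a) \<in> V" "U \<inter> V = {}"
  using separate[OF c ne] by (elim exE conjE)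
 note o1 = openin_continuous_map_preimage[OF g(1) UV(1)] and o2 = openin_continuous_map_preimage[OF g(2) UV(2)]
 obtain D where D: "D \<in> nb" "\<forall>x\<in>carrier R. x [-] a \<in> D --> q x \<in> {c \<in> topspace \<tau>. g1 c \<in> U}"
  using \<tau>_nbhd[OF o1 a] qa UV(3) by blast
 obtain E where E: "E \<in> nb" "\<forall>x\<in>carrier R. x [-] a \<in> E --> q x \<in> {c \<in> topspace \<tau>. g2 c \<in> V}"
  using \<tau>_nbhd[OF o2 a] qa UV(4) by blast
 obtain x where x: "x \<in> R0" "x [-] a \<in> D \<inter> E" using nb_dense[OF Nm_Int[OF D(1) E(1)] a] by (elim bexE conjE)
 then have "g1 (q x) \<in> U" "g2 (q x) \<in> V" using D(2) E(2) R0_R by blast+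
 then show False using g(3)[OF x(1)] UV(5) by auto
qed

lemma factor_unique:
 "\<exists>!g. g \<in> extensional (carrier TR) & g \<in> rng_hom TR S & continuous_map \<tau> \<sigma> g & (\<forall>a\<in>R0. f a = g (q a))"
proof (rule ex1I[of _ g])
 show "g \<in> extensional (carrier TR) & g \<in> rng_hom TR S & continuous_map \<tau> \<sigma> g & (\<forall>a\<in>R0. f a = g (q a))"
  using g_hom g_continuous g_q by (simp add: g_def)
 fix g' assume g': "g' \<in> extensional (carrier TR) & g' \<in> rng_hom TR S & continuous_map \<tau> \<sigma> g' & (\<forall>a\<in>R0. f a = g' (q a))"
 show "g' = g"
 proof (rule extensionalityI[of _ "carrier TR"])
  show "g' \<in> extensional (carrier TR)" using g' by blast
  show "g \<in> extensional (carrier TR)" by (simp add: g_def)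
  fix c assume "c \<in> carrier TR"
  then obtain a where a: "a \<in> carrier R" "c = q a" by (auto simp: TR_carrier)
  show "g' c = g c" unfolding a(2) by (rule continuous_unique[OF _ g_continuous _ a(1)]) (use g' g_q in auto)
 qed
qed

end

context def_ring begin

lemma q_universal: "universal_definable_lc_model TYPE('s) L M k A X TR \<tau> q"
 unfolding universal_definable_lc_model_def R0_def[symmetric]
proof (intro conjI q_model allI impI)
 fix S :: "'s ring" and \<sigma> f
 assume "definable_lc_model L M k A X S \<sigma> f"
 then interpret m: lc_model L M C \<kappa> k A X S \<sigma> f by unfold_locales
 show "\<exists>!g. g \<in> extensional (carrier TR) & g \<in> rng_hom TR S & continuous_map \<tau> \<sigma> g & (\<forall>a\<in>R0. f a = g (q a))"
  by (rule m.factor_unique)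
qed

end

theorem corollary4p11:
  fixes L :: "('f, 'p) language"
    and M C :: "('f, 'p, 'a) struct"
    and \<kappa> :: "'k rel"
    and k :: nat
    and A :: "'a list ring"
    and X :: "'a list set"
  assumes "monster_model L M \<kappa> C"
    and "rng A"
    and "approximate_subring A X"
    and "zero_definable L M k A X"
  shows
    "let R = generated_subrng A X;
         Rbar = ring_bar L M C k A X;
         Xbar = interp_in L M C k X;
         I = ideal00 L M \<kappa> C k Rbar;
         T = Rbar Quot I;
         \<tau> = logic_topology L \<kappa> C k (level_bar L M C k A X) Rbar I;
         h = (\<lambda>a. I +>\<^bsub>Rbar\<^esub> a);
         U = {I +>\<^bsub>Rbar\<^esub> a | a. a \<in> carrier Rbar \<and>
                I +>\<^bsub>Rbar\<^esub> a \<subseteq> four_plus_mult_four Rbar Xbar}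
     in is_tdef_bounded_ideal L M \<kappa> C k Rbar I \<and>
        (\<exists>(S :: 'a list set ring) \<sigma> f. definable_lc_model L M k A X S \<sigma> f) \<and>
        universal_definable_lc_model TYPE('s) L M k A X T \<tau> h \<and>
        openin \<tau> U \<and> \<zero>\<^bsub>T\<^esub> \<in> U \<and>
        {a \<in> R. h a \<in> U} \<subseteq> four_plus_mult_four A X"
proof -
  interpret def_ring L M C \<kappa> k A X
    by (intro def_ring.intro monster.intro def_ring_axioms.intro assms)
  have X: "interp_in L M C k X = level_bar L M C k A X 0" by (simp add: level_bar_def)
  show ?thesis
    unfolding Let_def X R_def[symmetric] ideal00_eq logic_topology_eq R0_def[symmetric] UR_def[symmetric]
    using J_tdef_bounded_ideal q_model q_universal UR_open UR_zero UR_preimage by blast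
qed

end
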